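(* Let $\{v_n\}_{n\in\mathbb{Z}}$ and $\{w_n\}_{n\in\mathbb{Z}}$ be two i.i.d. sequences of real random variables, independent from each other, whose distributions have finite support, and with $\mathbb{E}(\log|w_1|)>-\infty$. Consider the random Jacobi operator on $\ell^2(\mathbb{Z})$ $$[H_\omega\psi]_n=-(w_{n+1}(\omega)\psi_{n+1}+w_n(\omega)\psi_{n-1})+v_n(\omega)\psi_n .$$ Let $E_0\in\mathbb{R}$ be such that $L^+(E_0)>0$. Then there is an open interval $\mathscr{I}\ni E_0$ such that on $\mathscr{I}$ the Lyapunov exponent $L^+$ is positive, the integrated density of states $N$ is weak-Hölder continuous, and almost surely the operator $H_\omega$ satisfies dynamical localization in $\mathscr{I}$ (provided $\mathscr{I}$ intersects the almost sure spectrum of $H_\omega$).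
   Context: For $E\in\mathbb{R}$, the transfer matrices of $H_\omega\psi=E\psi$ are $g_n^E=\begin{bmatrix}\frac{v_n-E}{w_{n+1}} & -\frac{w_n}{w_{n+1}}\\ 1&0\end{bmatrix}$, and $L^+(E)$ denotes the almost sure limit of $\frac1n\log\|g^E_{n-1}\cdots g^E_1g^E_0\|$. With $P_n:\ell^2(\mathbb{Z})\to\mathbb{R}^n$ the coordinate projection onto the sites $\{0,\dots,n-1\}$ and $H^{(n)}_\omega=P_nH_\omega P_n^*$, the integrated density of states is the almost sure limit $N(E)=\lim_n\frac1n\#\big((-\infty,E]\cap\mathrm{Spec}\,H^{(n)}_\omega\big)$. $N$ is weak-Hölder continuous on $\mathscr{I}$ if there are $C<\infty$, $\alpha>0$, $\sigma\in(0,1]$ with $|N(E)-N(E')|\le C\exp\big(-\alpha(\log\frac1{|E-E'|})^\sigma\big)$ for $E,E'\in\mathscr{I}$. $H_\omega$ satisfies dynamical localization in $\mathscr{I}$ if for every compact subinterval $\mathscr{J}\subset\mathscr{I}$ there are $C<\infty$, $\gamma,\sigma>0$ such that for all $j,k\in\mathbb{Z}$, $\mathbb{E}\big(\sup_{t\in\mathbb{R}}|\langle e_j,e^{-itH_\omega}\mathbf{1}_{\mathscr{J}}(H_\omega)e_k\rangle|\big)\le Ce^{-\gamma|j-k|^\sigma}$, where $\{e_j\}$ is the canonical basis and $\mathbf{1}_{\mathscr{J}}(H_\omega)$ the spectral projection. *)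

theory Defs
  imports "HOL-Probability.Probability"
begin

definition jacobi_op ::
  "(int \<Rightarrow> 'a \<Rightarrow> real) \<Rightarrow> (int \<Rightarrow> 'a \<Rightarrow> real) \<Rightarrow> 'a \<Rightarrow> (int \<Rightarrow> real) \<Rightarrow> (int \<Rightarrow> real)" where
  "jacobi_op v w \<omega> \<psi> = (\<lambda>n. - (w (n + 1) \<omega> * \<psi> (n + 1) + w n \<omega> * \<psi> (n - 1)) + v n \<omega> * \<psi> n)"

definition l2 :: "(int \<Rightarrow> real) set" where
  "l2 = {\<psi>. (\<lambda>n. (\<psi> n)\<^sup>2) summable_on UNIV}"

definition l2_inner :: "(int \<Rightarrow> real) \<Rightarrow> (int \<Rightarrow> real) \<Rightarrow> real" where
  "l2_inner \<phi> \<psi> = (\<Sum>\<^sub>\<infinity>n. \<phi> n * \<psi> n)"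

definition basis_vec :: "int \<Rightarrow> int \<Rightarrow> real" where
  "basis_vec j = (\<lambda>n. if n = j then 1 else 0)"

text \<open>Spectrum of an operator H on l^2(Z): E is in the spectrum iff H - E is not a bijection
  of l^2(Z) onto itself (for the bounded operators considered here this is the usual notion;
  the bounded inverse theorem makes boundedness of the inverse automatic).\<close>

definition l2_spectrum :: "((int \<Rightarrow> real) \<Rightarrow> (int \<Rightarrow> real)) \<Rightarrow> real set" where
  "l2_spectrum H = {E. \<not> (\<forall>\<psi>\<in>l2. \<exists>!\<phi>. \<phi> \<in> l2 \<and> (\<lambda>n. H \<phi> n - E * \<phi> n) = \<psi>)}"

text \<open>Spectral measure of H for a (finitely supported) vector phi: the finite, compactly supported
  Borel measure on R whose moments are <phi, H^m phi>.  For a bounded self-adjoint operator it exists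
  (spectral theorem) and is unique (compact support + moments, Weierstrass).\<close>

definition spectral_measure ::
  "((int \<Rightarrow> real) \<Rightarrow> (int \<Rightarrow> real)) \<Rightarrow> (int \<Rightarrow> real) \<Rightarrow> real measure" where
  "spectral_measure H \<phi> = (THE \<mu>. finite_measure \<mu> \<and> sets \<mu> = sets borel \<and>
      (\<exists>R. emeasure \<mu> (- {-R..R}) = 0) \<and>
      (\<forall>m::nat. (\<integral>x. x ^ m \<partial>\<mu>) = l2_inner \<phi> ((H ^^ m) \<phi>)))"

text \<open>The matrix element < e_j, f(H) e_k > for a bounded Borel function f :: real => complex,
  obtained from the spectral measures by polarisation (H is real symmetric, e_j, e_k real).\<close>

definition fcalc_elem ::
  "((int \<Rightarrow> real) \<Rightarrow> (int \<Rightarrow> real)) \<Rightarrow> (real \<Rightarrow> complex) \<Rightarrow> int \<Rightarrow> int \<Rightarrow> complex" where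
  "fcalc_elem H f j k =
     ((\<integral>x. f x \<partial>(spectral_measure H (\<lambda>n. basis_vec j n + basis_vec k n)))
    - (\<integral>x. f x \<partial>(spectral_measure H (\<lambda>n. basis_vec j n - basis_vec k n)))) / 4"

definition evol_proj_elem ::
  "((int \<Rightarrow> real) \<Rightarrow> (int \<Rightarrow> real)) \<Rightarrow> real set \<Rightarrow> real \<Rightarrow> int \<Rightarrow> int \<Rightarrow> complex" where
  "evol_proj_elem H J t j k = fcalc_elem H (\<lambda>x. indicator J x * cis (- t * x)) j k"

definition transfer_mat ::
  "(int \<Rightarrow> 'a \<Rightarrow> real) \<Rightarrow> (int \<Rightarrow> 'a \<Rightarrow> real) \<Rightarrow> real \<Rightarrow> 'a \<Rightarrow> int \<Rightarrow> real^2^2" where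
  "transfer_mat v w E \<omega> n =
     vector [vector [(v n \<omega> - E) / w (n + 1) \<omega>, - w n \<omega> / w (n + 1) \<omega>], vector [1, 0]]"

fun transfer_prod ::
  "(int \<Rightarrow> 'a \<Rightarrow> real) \<Rightarrow> (int \<Rightarrow> 'a \<Rightarrow> real) \<Rightarrow> real \<Rightarrow> 'a \<Rightarrow> nat \<Rightarrow> real^2^2" where
  "transfer_prod v w E \<omega> 0 = mat 1"
| "transfer_prod v w E \<omega> (Suc n) = transfer_mat v w E \<omega> (int n) ** transfer_prod v w E \<omega> n"

definition lyapunov_exp ::
  "'a measure \<Rightarrow> (int \<Rightarrow> 'a \<Rightarrow> real) \<Rightarrow> (int \<Rightarrow> 'a \<Rightarrow> real) \<Rightarrow> real \<Rightarrow> real" where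
  "lyapunov_exp M v w E = (THE L. AE \<omega> in M.
      (\<lambda>n. ln (onorm (\<lambda>x. transfer_prod v w E \<omega> n *v x)) / real n) \<longlonglongrightarrow> L)"

text \<open>Matrix entries of H^(n) = P_n H P_n^* on the sites 0..n-1.\<close>

definition restr_entry ::
  "(int \<Rightarrow> 'a \<Rightarrow> real) \<Rightarrow> (int \<Rightarrow> 'a \<Rightarrow> real) \<Rightarrow> 'a \<Rightarrow> nat \<Rightarrow> nat \<Rightarrow> real" where
  "restr_entry v w \<omega> i j =
     (if i = j then v (int i) \<omega>
      else if j = i + 1 then - w (int j) \<omega>
      else if i = j + 1 then - w (int i) \<omega>
      else 0)"

definition restr_spectrum ::
  "(int \<Rightarrow> 'a \<Rightarrow> real) \<Rightarrow> (int \<Rightarrow> 'a \<Rightarrow> real) \<Rightarrow> 'a \<Rightarrow> nat \<Rightarrow> real set" where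
  "restr_spectrum v w \<omega> n = {E. \<exists>\<psi> :: nat \<Rightarrow> real. (\<exists>i<n. \<psi> i \<noteq> 0) \<and>
      (\<forall>i<n. (\<Sum>j<n. restr_entry v w \<omega> i j * \<psi> j) = E * \<psi> i)}"

definition ids ::
  "'a measure \<Rightarrow> (int \<Rightarrow> 'a \<Rightarrow> real) \<Rightarrow> (int \<Rightarrow> 'a \<Rightarrow> real) \<Rightarrow> real \<Rightarrow> real" where
  "ids M v w E = (THE N. AE \<omega> in M.
      (\<lambda>n. real (card ({..E} \<inter> restr_spectrum v w \<omega> n)) / real n) \<longlonglongrightarrow> N)"

definition as_spectrum ::
  "'a measure \<Rightarrow> (int \<Rightarrow> 'a \<Rightarrow> real) \<Rightarrow> (int \<Rightarrow> 'a \<Rightarrow> real) \<Rightarrow> real set" where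
  "as_spectrum M v w = (THE \<Sigma>. AE \<omega> in M. l2_spectrum (jacobi_op v w \<omega>) = \<Sigma>)"

definition weak_hoelder_on :: "(real \<Rightarrow> real) \<Rightarrow> real set \<Rightarrow> bool" where
  "weak_hoelder_on N I \<longleftrightarrow> (\<exists>C \<alpha> \<sigma>. \<alpha> > 0 \<and> 0 < \<sigma> \<and> \<sigma> \<le> 1 \<and>
      (\<forall>E\<in>I. \<forall>E'\<in>I. E \<noteq> E' \<longrightarrow>
         \<bar>N E - N E'\<bar> \<le> C * exp (- \<alpha> * (ln (1 / \<bar>E - E'\<bar>)) powr \<sigma>)))"

definition dynamical_localization ::
  "'a measure \<Rightarrow> (int \<Rightarrow> 'a \<Rightarrow> real) \<Rightarrow> (int \<Rightarrow> 'a \<Rightarrow> real) \<Rightarrow> real set \<Rightarrow> bool" where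
  "dynamical_localization M v w I \<longleftrightarrow>
     (\<forall>a b. a \<le> b \<longrightarrow> {a..b} \<subseteq> I \<longrightarrow>
       (\<exists>C \<gamma> \<sigma>. \<gamma> > 0 \<and> \<sigma> > 0 \<and>
          (\<forall>j k. (\<integral>\<^sup>+ \<omega>. ennreal (SUP t. cmod (evol_proj_elem (jacobi_op v w \<omega>) {a..b} t j k)) \<partial>M)
                   \<le> ennreal (C * exp (- \<gamma> * real_of_int \<bar>j - k\<bar> powr \<sigma>)))))"

end

(* The transfer products act on pairs (u_n, w_n u_{n-1}) by unimodular matrices driven by i.i.d. letters
   (v_n, w_{n+1}).  If v is not constant, or |w| is not constant and v is not constantly E_0, then two letters
   differ by a translation of a coordinate on the projective line, and the frames obtained by applying powers
   of a letter cover the line.  No function is then almost invariant, so averaging over the letters contracts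
   L^2 of the plane and of the line.  Hence directions and norms spread, E ln |g_n ... g_1 x| grows linearly,
   and E |g_n ... g_1 x|^(-s) decays exponentially for some s > 0, which persists for all energies near E_0.
   In the remaining cases the products are explicit: the exponent vanishes, or E_0 lies in a spectral gap.

   An eigenfunction of a finite box that is large at a site compared to a window around it produces a vector
   that is not expanded on either side ("trapped"), an event of exponentially small probability.  For the
   integrated density of states this bounds the number of eigenvalues of a box in a short interval by the
   number of trapped sites.  For localization, being trapped is a polynomial condition in the energy, so the
   energies at which a site is trapped form few intervals; hence two distant sites are unlikely to be trapped
   at a common energy, and each box eigenfunction is small at one of them.  The bound passes to the whole line
   because spectral measures are weak limits of box spectral measures. *)
theory Submission
  imports Defs "HOL-Computational_Algebra.Fundamental_Theorem_Algebra"
begin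

section \<open>Averages over words\<close>

text \<open>Finitely supported disorder has no density, so averaging over a single potential value
  does not smooth the eigenvalues. What replaces this is the unimodular action: it preserves
  Lebesgue measure on the plane and counting measure on the projective line, and an L^2 contraction
  for these infinite invariant measures bounds atoms and bounded orbits with explicit constants. As
  there are finitely many letters, every probability is a finite weighted sum over words; the given
  probability space enters only through the law of the words read off from it. The scales in the
  two-site argument are unequal. The longer window, of size m, makes the set of its bad energies so
  short that each is close to one of at most 4m roots, which depend on that window only. The other
  window has size about \<beta>m with \<beta> small, so that its products hardly change when the
  energy is moved to such a root; there only a fixed-energy event remains, independent of the first
  window.\<close>

locale alphabet =
  fixes S :: "'l set" and p :: "'l => real"
  assumes fin_S: "finite S" and p_pos: "\<And>a. a \<in> S ==> p a > 0" and sum_p: "sum p S = 1"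
begin

definition words :: "nat => 'l list set" where
  "words n = {u. set u \<subseteq> S \<and> length u = n}"

text \<open>Expectation over n independent letters, built by conditioning on the first one.
  Splitting a word into independent blocks (\<open>mean_append\<close>) and martingale arguments
  become inductions, without any measure space.\<close>

primrec mean :: "nat => ('l list => real) => real" where
  "mean 0 f = f []"
| "mean (Suc n) f = (\<Sum>a\<in>S. p a * mean n (\<lambda>u. f (a # u)))"

definition prob :: "nat => ('l list => bool) => real" where
  "prob n P = mean n (\<lambda>u. of_bool (P u))"

definition weight :: "'l list => real" where
  "weight u = prod_list (map p u)"

lemma finite_words: "finite (words n)" unfolding words_def by (rule finite_lists_length_eq[OF fin_S])

lemma words_0: "words 0 = {[]}" by (auto simp: words_def)

lemma words_Suc: "words (Suc n) = (\<lambda>(a, u). a # u) ` (S \<times> words n)"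
  by (auto simp: words_def image_iff length_Suc_conv)

lemma append_in_words: "u \<in> words m ==> w \<in> words n ==> u @ w \<in> words (m + n)" by (auto simp: words_def)

lemma weight_pos: "u \<in> words n ==> weight u > 0"
  unfolding weight_def words_def by (induction u arbitrary: n) (auto simp: p_pos)

lemma mean_eq_sum: "mean n f = (\<Sum>u\<in>words n. weight u * f u)"
proof (induction n arbitrary: f)
  case 0
  then show ?case by (simp add: words_0 weight_def)
next
  case (Suc n)
  have "(\<Sum>u\<in>words (Suc n). weight u * f u)
      = (\<Sum>(a, u)\<in>S \<times> words n. weight (a # u) * f (a # u))"
    unfolding words_Suc by (subst sum.reindex) (auto simp: inj_on_def case_prod_unfold intro!: sum.cong)
  also have "\<dots> = (\<Sum>a\<in>S. \<Sum>u\<in>words n. weight (a # u) * f (a # u))" by (rule sum.cartesian_product[symmetric])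
  also have "\<dots> = (\<Sum>a\<in>S. p a * (\<Sum>u\<in>words n. weight u * f (a # u)))"
    by (simp add: weight_def sum_distrib_left mult.assoc)
  finally show ?case by (simp add: Suc)
qed

lemma mean_cong: "(\<And>u. u \<in> words n ==> f u = g u) ==> mean n f = mean n g"
  unfolding mean_eq_sum by (rule sum.cong) auto

lemma mean_mono: "(\<And>u. u \<in> words n ==> f u <= g u) ==> mean n f <= mean n g"
  unfolding mean_eq_sum by (rule sum_mono) (auto intro!: mult_left_mono dest: weight_pos)

lemma mean_add: "mean n (\<lambda>u. f u + g u) = mean n f + mean n g"
  unfolding mean_eq_sum by (simp add: algebra_simps sum.distrib)

lemma mean_diff: "mean n (\<lambda>u. f u - g u) = mean n f - mean n g"
  unfolding mean_eq_sum by (simp add: algebra_simps sum_subtractf)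

lemma mean_cmult: "mean n (\<lambda>u. c * f u) = c * mean n f"
  unfolding mean_eq_sum by (simp add: algebra_simps sum_distrib_left)

lemma mean_multc: "mean n (\<lambda>u. f u * c) = mean n f * c"
  unfolding mean_eq_sum by (simp add: algebra_simps sum_distrib_left)

lemma mean_const: "mean n (\<lambda>u. c) = c" by (induction n) (simp_all add: sum_p flip: sum_distrib_right)

lemma mean_nonneg: "(\<And>u. u \<in> words n ==> 0 <= f u) ==> 0 <= mean n f"
  using mean_mono[of n "\<lambda>_. 0" f] by (simp add: mean_const)

lemma mean_le_const: "(\<And>u. u \<in> words n ==> f u <= c) ==> mean n f <= c"
  using mean_mono[of n f "\<lambda>_. c"] by (simp add: mean_const)

lemma abs_mean_le: "\<bar>mean n f\<bar> <= mean n (\<lambda>u. \<bar>f u\<bar>)" unfolding mean_eq_sum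
  by (rule order_trans[OF sum_abs]) (auto intro!: sum_mono simp: abs_mult dest: weight_pos)

lemma mean_append: "mean (m + n) f = mean m (\<lambda>u. mean n (\<lambda>w. f (u @ w)))"
  by (induction m arbitrary: f) simp_all

lemma sum_weight: "(\<Sum>u\<in>words n. weight u) = 1" using mean_const[of n 1] by (simp add: mean_eq_sum)

lemma prob_nonneg: "0 <= prob n P" unfolding prob_def by (rule mean_nonneg) simp

lemma prob_le_1: "prob n P <= 1" unfolding prob_def by (rule mean_le_const) simp

lemma prob_mono: "(\<And>u. u \<in> words n ==> P u ==> Q u) ==> prob n P <= prob n Q"
  unfolding prob_def by (rule mean_mono) (auto simp: of_bool_def)

lemma prob_union_le: "prob n (\<lambda>u. P u \<or> Q u) <= prob n P + prob n Q"
  unfolding prob_def mean_add[symmetric] by (rule mean_mono) auto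

lemma prob_Bex_le: "finite I ==> prob n (\<lambda>u. \<exists>i\<in>I. P i u) <= (\<Sum>i\<in>I. prob n (P i))"
proof (induction I rule: finite_induct)
  case empty
  then show ?case by (simp add: prob_def mean_const)
next
  case (insert i I)
  have "prob n (\<lambda>u. \<exists>i\<in>insert i I. P i u) <= prob n (P i) + prob n (\<lambda>u. \<exists>i\<in>I. P i u)"
    using prob_union_le[of n "P i" "\<lambda>u. \<exists>i\<in>I. P i u"] by simp
  with insert show ?case by simp
qed

lemma prob_not: "prob n (\<lambda>u. \<not> P u) = 1 - prob n P"
proof -
  have "prob n (\<lambda>u. \<not> P u) = mean n (\<lambda>u. 1 - of_bool (P u))" unfolding prob_def by (rule mean_cong) auto
  then show ?thesis by (simp add: mean_diff mean_const prob_def)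
qed

lemma markov:
  assumes "c > 0" "\<And>u. u \<in> words n ==> 0 <= f u" "\<And>u. u \<in> words n ==> P u ==> c <= f u"
  shows "prob n P <= mean n f / c"
proof -
  have "prob n P <= mean n (\<lambda>u. (1 / c) * f u)"
    unfolding prob_def by (rule mean_mono) (use assms in \<open>auto simp: field_simps of_bool_def\<close>)
  then show ?thesis by (simp only: mean_cmult) simp
qed

text \<open>Turns control of the mean of y into control of an exponential moment. It serves both the
  deviation inequality and the decay of negative moments of the norm.\<close>

lemma exp_le_quadratic:
  fixes y :: real
  assumes "\<bar>y\<bar> <= 1"
  shows "exp y <= 1 + y + y\<^sup>2"
proof (cases "y >= 0")
  case True
  then show ?thesis using exp_bound[of y] assms by simp
next
  case False
  define z where "z = - y"
  have z: "0 <= z" "z <= 1" using False assms by (auto simp: z_def)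
  \<comment> \<open>For y = -z the claim is 1 <= (1 - z + z^2) exp z, and the product with the
    quadratic Taylor polynomial of exp is already at least 1.\<close>
  have "1 <= 1 + z\<^sup>2 / 2 + z^3 / 2 + z^4 / 2" using z by simp
  also have "\<dots> = (1 - z + z\<^sup>2) * (1 + z + z\<^sup>2 / 2)"
    by (simp add: power2_eq_square power3_eq_cube power4_eq_xxxx algebra_simps add_divide_distrib diff_divide_distrib)
  also have "\<dots> <= (1 - z + z\<^sup>2) * exp z"
    using exp_lower_Taylor_quadratic[of z] z by (intro mult_left_mono) (auto simp: add.assoc)
  finally have "exp (- z) <= 1 - z + z\<^sup>2" by (simp add: exp_minus field_simps)
  then show ?thesis by (simp add: z_def)
qed

text \<open>Azuma's inequality for functions on words: the averages over the remaining letters form a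
  martingale whose increments are controlled by the hypothesis.\<close>
lemma mean_exp_martingale:
  assumes "\<And>u a b. set u \<subseteq> S ==> length u < n ==> a \<in> S ==> b \<in> S ==>
      \<bar>mean (n - Suc (length u)) (\<lambda>w. f (u @ a # w)) - mean (n - Suc (length u)) (\<lambda>w. f (u @ b # w))\<bar> <= C"
    and "\<bar>t\<bar> * C <= 1"
  shows "mean n (\<lambda>u. exp (t * (f u - mean n f))) <= exp (t\<^sup>2 * C\<^sup>2 * n)" using assms
proof (induction n arbitrary: f)
  case 0
  then show ?case by simp
next
  case (Suc n)
  define g where "g a = mean n (\<lambda>u. f (a # u))" for a
  \<comment> \<open>D is the first martingale increment. Its mean vanishes (\<open>D0\<close>), so
    only the quadratic term of the exponential bound survives; the induction hypothesis handles the
    remaining letters.\<close>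
  define D where "D a = g a - mean (Suc n) f" for a
  have IH: "mean n (\<lambda>u. exp (t * (f (a # u) - g a))) <= exp (t\<^sup>2 * C\<^sup>2 * n)" if "a \<in> S" for a unfolding g_def
  proof (rule Suc.IH)
    fix u b c assume "set u \<subseteq> S" "length u < n" "b \<in> S" "c \<in> S"
    then show "\<bar>mean (n - Suc (length u)) (\<lambda>w. f (a # u @ b # w)) -
        mean (n - Suc (length u)) (\<lambda>w. f (a # u @ c # w))\<bar> <= C"
      using Suc.prems(1)[of "a # u" b c] that by simp
  qed (use Suc.prems in auto)
  have m: "mean (Suc n) f = (\<Sum>b\<in>S. p b * g b)" unfolding g_def by (rule mean.simps(2))
  have D_eq: "D a = (\<Sum>b\<in>S. p b * (g a - g b))" for a
    by (simp add: D_def m right_diff_distrib sum_subtractf sum_p del: mean.simps flip: sum_distrib_right)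
  have D_le: "\<bar>D a\<bar> <= C" if a: "a \<in> S" for a
  proof -
    have "\<bar>D a\<bar> <= (\<Sum>b\<in>S. \<bar>p b * (g a - g b)\<bar>)" unfolding D_eq by (rule sum_abs)
    also have "\<dots> <= (\<Sum>b\<in>S. p b * C)"
    proof (rule sum_mono)
      fix b assume b: "b \<in> S"
      have "\<bar>g a - g b\<bar> <= C" using Suc.prems(1)[of "[]" a b] a b by (simp add: g_def)
      then show "\<bar>p b * (g a - g b)\<bar> <= p b * C" using p_pos[OF b] by (simp add: abs_mult)
    qed
    also have "\<dots> = C" by (simp add: sum_p flip: sum_distrib_right)
    finally show ?thesis .
  qed
  have D0: "(\<Sum>a\<in>S. p a * D a) = 0"
    by (simp add: D_def m right_diff_distrib sum_subtractf sum_p del: mean.simps flip: sum_distrib_right)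
  have "mean (Suc n) (\<lambda>u. exp (t * (f u - mean (Suc n) f)))
      = (\<Sum>a\<in>S. p a * (exp (t * D a) * mean n (\<lambda>u. exp (t * (f (a # u) - g a)))))"
  proof -
    have "exp (t * (f (a # u) - mean (Suc n) f)) = exp (t * D a) * exp (t * (f (a # u) - g a))" for a u
      unfolding D_def exp_add[symmetric] by (simp only: algebra_simps) simp
    then show ?thesis
      unfolding mean.simps(2)[of n "\<lambda>u. exp (t * (f u - mean (Suc n) f))"] by (simp only: mean_cmult)
  qed
  also have "\<dots> <= (\<Sum>a\<in>S. p a * ((1 + t * D a + t\<^sup>2 * C\<^sup>2) * exp (t\<^sup>2 * C\<^sup>2 * n)))"
  proof (intro sum_mono mult_left_mono mult_mono)
    fix a assume a: "a \<in> S"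
    have "\<bar>t * D a\<bar> <= \<bar>t\<bar> * C" using D_le[OF a] by (simp add: abs_mult mult_left_mono)
    then have 1: "\<bar>t * D a\<bar> <= 1" using Suc.prems(2) by linarith
    have "(D a)\<^sup>2 <= C\<^sup>2" using D_le[OF a] by (simp add: abs_le_square_iff[symmetric])
    then have "(t * D a)\<^sup>2 <= t\<^sup>2 * C\<^sup>2" by (simp add: power_mult_distrib mult_left_mono)
    with exp_le_quadratic[OF 1] show 2: "exp (t * D a) <= 1 + t * D a + t\<^sup>2 * C\<^sup>2" by linarith
    show "mean n (\<lambda>u. exp (t * (f (a # u) - g a))) <= exp (t\<^sup>2 * C\<^sup>2 * n)" using IH[OF a] .
    show "0 <= mean n (\<lambda>u. exp (t * (f (a # u) - g a)))" by (rule mean_nonneg) simp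
    show "0 <= 1 + t * D a + t\<^sup>2 * C\<^sup>2" using 2 exp_ge_zero order_trans by blast
    show "0 <= p a" using p_pos[OF a] by simp
  qed
  also have "\<dots> = (\<Sum>a\<in>S. p a * (1 + t * D a + t\<^sup>2 * C\<^sup>2)) * exp (t\<^sup>2 * C\<^sup>2 * n)"
    by (simp add: sum_distrib_right mult.assoc)
  also have "(\<Sum>a\<in>S. p a * (1 + t * D a + t\<^sup>2 * C\<^sup>2)) = 1 + t * (\<Sum>a\<in>S. p a * D a) + t\<^sup>2 * C\<^sup>2"
    by (simp add: algebra_simps sum.distrib sum_distrib_left sum_p flip: sum_distrib_right)
  also have "\<dots> = 1 + t\<^sup>2 * C\<^sup>2" by (simp add: D0)
  also have "(1 + t\<^sup>2 * C\<^sup>2) * exp (t\<^sup>2 * C\<^sup>2 * n) <= exp (t\<^sup>2 * C\<^sup>2) * exp (t\<^sup>2 * C\<^sup>2 * n)"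
    by (intro mult_right_mono exp_ge_add_one_self) simp
  also have "\<dots> = exp (t\<^sup>2 * C\<^sup>2 * Suc n)" by (simp add: algebra_simps flip: exp_add)
  finally show ?case .
qed

lemma prob_deviation_le:
  assumes "\<And>u a b. set u \<subseteq> S ==> length u < n ==> a \<in> S ==> b \<in> S ==>
      \<bar>mean (n - Suc (length u)) (\<lambda>w. f (u @ a # w)) - mean (n - Suc (length u)) (\<lambda>w. f (u @ b # w))\<bar> <= C"
    and "C > 0" "0 < \<epsilon>" "\<epsilon> <= C"
  shows "prob n (\<lambda>u. \<bar>f u - mean n f\<bar> >= \<epsilon> * n) <= 2 * exp (- (\<epsilon>\<^sup>2 / (4 * C\<^sup>2)) * n)"
proof -
  \<comment> \<open>This t minimises t^2 C^2 - t \<epsilon>; the assumption \<epsilon> <= C gives t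
    C <= 1/2, inside the range of the martingale bound.\<close>
  define t where "t = \<epsilon> / (2 * C\<^sup>2)"
  have t: "t > 0" "t * C <= 1" using assms(2-4) by (auto simp: t_def power2_eq_square field_simps)
  have eq: "t\<^sup>2 * C\<^sup>2 * n - t * \<epsilon> * n = - (\<epsilon>\<^sup>2 / (4 * C\<^sup>2)) * n"
    using \<open>C > 0\<close> by (simp add: t_def field_simps power2_eq_square)
  have A: "prob n (\<lambda>u. s * (f u - mean n f) >= \<epsilon> * n) <= exp (- (\<epsilon>\<^sup>2 / (4 * C\<^sup>2)) * n)"
    if s: "\<bar>s\<bar> = 1" for s :: real
  proof -
    have "mean n (\<lambda>u. exp ((t * s) * (f u - mean n f))) <= exp ((t * s)\<^sup>2 * C\<^sup>2 * n)"
      using t s by (intro mean_exp_martingale assms(1)) (auto simp: abs_mult)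
    also have "(t * s)\<^sup>2 = t\<^sup>2" using s by (metis abs_mult mult.right_neutral power2_abs)
    finally have 1: "mean n (\<lambda>u. exp ((t * s) * (f u - mean n f))) <= exp (t\<^sup>2 * C\<^sup>2 * n)" .
    have "prob n (\<lambda>u. s * (f u - mean n f) >= \<epsilon> * n)
        <= mean n (\<lambda>u. exp ((t * s) * (f u - mean n f))) / exp (t * (\<epsilon> * n))"
      using t by (intro markov) (auto simp: mult.assoc)
    also have "\<dots> <= exp (t\<^sup>2 * C\<^sup>2 * n) / exp (t * (\<epsilon> * n))" by (intro divide_right_mono 1) simp
    also have "\<dots> = exp (t\<^sup>2 * C\<^sup>2 * n - t * \<epsilon> * n)" by (simp add: exp_diff mult.assoc)
    finally show ?thesis unfolding eq .
  qed
  have "prob n (\<lambda>u. \<bar>f u - mean n f\<bar> >= \<epsilon> * n)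
     <= prob n (\<lambda>u. 1 * (f u - mean n f) >= \<epsilon> * n \<or> (-1) * (f u - mean n f) >= \<epsilon> * n)" by (rule prob_mono) auto
  also have "\<dots> <= prob n (\<lambda>u. 1 * (f u - mean n f) >= \<epsilon> * n) + prob n (\<lambda>u. (-1) * (f u - mean n f) >= \<epsilon> * n)"
    by (rule prob_union_le)
  also have "\<dots> <= 2 * exp (- (\<epsilon>\<^sup>2 / (4 * C\<^sup>2)) * n)" using A[of 1] A[of "-1"] by simp
  finally show ?thesis .
qed

end

section \<open>Transfer steps\<close>

definition wedge :: "real \<times> real => real \<times> real => real" where
  "wedge x y = fst x * snd y - snd x * fst y"

text \<open>Acting on the vectors \<open>(u\<^sub>n, w\<^sub>n u\<^sub>n\<^sub>-\<^sub>1)\<close> instead of \<open>(u\<^sub>n, u\<^sub>n\<^sub>-\<^sub>1)\<close> makes the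
  transfer matrices unimodular and independent.\<close>
definition tstep :: "real => real \<times> real => real \<times> real => real \<times> real" where
  "tstep E a x = (((fst a - E) * fst x - snd x) / snd a, snd a * fst x)"

definition tstep_inv :: "real => real \<times> real => real \<times> real => real \<times> real" where
  "tstep_inv E a y = (snd y / snd a, (fst a - E) * snd y / snd a - snd a * fst y)"

primrec tact :: "real => (real \<times> real) list => real \<times> real => real \<times> real" where
  "tact E [] x = x"
| "tact E (a # u) x = tact E u (tstep E a x)"

lemma tstep_inv_tstep: "snd a \<noteq> 0 ==> tstep_inv E a (tstep E a x) = x"
  by (cases x) (simp add: tstep_def tstep_inv_def)

lemma tstep_tstep_inv: "snd a \<noteq> 0 ==> tstep E a (tstep_inv E a x) = x"
  by (cases x) (simp add: tstep_def tstep_inv_def field_simps)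

lemma wedge_tstep: "snd a \<noteq> 0 ==> wedge (tstep E a x) (tstep E a y) = wedge x y"
  by (simp add: tstep_def wedge_def field_simps)

lemma tstep_linear: "tstep E a (c *\<^sub>R x + d *\<^sub>R y) = c *\<^sub>R tstep E a x + d *\<^sub>R tstep E a y"
  by (simp add: tstep_def prod_eq_iff add_divide_distrib diff_divide_distrib algebra_simps)

lemma tact_linear: "tact E u (c *\<^sub>R x + d *\<^sub>R y) = c *\<^sub>R tact E u x + d *\<^sub>R tact E u y"
  by (induction u arbitrary: x y) (simp_all add: tstep_linear)

lemma tact_scale: "tact E u (c *\<^sub>R x) = c *\<^sub>R tact E u x" using tact_linear[of E u c x 0 0] by simp

lemma tact_append: "tact E (u @ w) x = tact E w (tact E u x)" by (induction u arbitrary: x) simp_all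

lemma norm_prod_sq: "(norm (x :: real \<times> real))\<^sup>2 = (fst x)\<^sup>2 + (snd x)\<^sup>2" by (cases x) (simp add: norm_Pair)

lemma abs_fst_le: "\<bar>fst (x :: real \<times> real)\<bar> <= norm x" by (cases x) (simp add: norm_Pair real_le_rsqrt)

lemma abs_snd_le: "\<bar>snd (x :: real \<times> real)\<bar> <= norm x" by (cases x) (simp add: norm_Pair real_le_rsqrt)

lemma norm_le_abs_add: "norm (x :: real \<times> real) <= \<bar>fst x\<bar> + \<bar>snd x\<bar>"
  by (cases x) (simp add: norm_Pair sqrt_sum_squares_le_sum_abs)

lemma abs_wedge_le: "\<bar>wedge x y\<bar> <= norm x * norm y"
proof -
  have "(wedge x y)\<^sup>2 <= (norm x)\<^sup>2 * (norm y)\<^sup>2" using zero_le_power2[of "fst x * fst y + snd x * snd y"]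
    unfolding norm_prod_sq wedge_def by (simp add: power2_eq_square algebra_simps)
  then have "(wedge x y)\<^sup>2 <= (norm x * norm y)\<^sup>2" by (simp add: power_mult_distrib)
  then show ?thesis by (metis abs_le_square_iff abs_of_nonneg mult_nonneg_nonneg norm_ge_zero)
qed

text \<open>In the orthonormal frame of x and its quarter turn, the second coordinate of y is
  \<open>wedge x y\<close>. Unit vectors with small wedge are thus proportional up to a small error,
  which is how closeness of directions is exploited.\<close>

lemma wedge_decomp:
  assumes "norm x = 1" "norm (y :: real \<times> real) = 1"
  obtains c where "\<bar>c\<bar> <= 1" "y = c *\<^sub>R x + wedge x y *\<^sub>R (- snd x, fst x)"
proof
  define c where "c = fst x * fst y + snd x * snd y"
  have sq: "(fst x)\<^sup>2 + (snd x)\<^sup>2 = 1" "(fst y)\<^sup>2 + (snd y)\<^sup>2 = 1"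
    using assms norm_prod_sq[of x] norm_prod_sq[of y] by auto
  have "c\<^sup>2 + (wedge x y)\<^sup>2 = ((fst x)\<^sup>2 + (snd x)\<^sup>2) * ((fst y)\<^sup>2 + (snd y)\<^sup>2)"
    unfolding c_def wedge_def by algebra
  then have "c\<^sup>2 + (wedge x y)\<^sup>2 = 1" using sq by simp
  then have "c\<^sup>2 <= 1" using zero_le_power2[of "wedge x y"] by linarith
  then show "\<bar>c\<bar> <= 1" by (simp add: abs_square_le_1)
  have "fst y = ((fst x)\<^sup>2 + (snd x)\<^sup>2) * fst y" "snd y = ((fst x)\<^sup>2 + (snd x)\<^sup>2) * snd y" using sq by auto
  then show "y = c *\<^sub>R x + wedge x y *\<^sub>R (- snd x, fst x)"
    by (auto simp: prod_eq_iff c_def wedge_def power2_eq_square algebra_simps)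
qed

section \<open>A spectral gap for measure preserving actions\<close>

text \<open>Jensen's inequality with a remainder: the variance is at least the contribution of the
  two words a and b, and two values at distance d cannot both be closer than d/2 to the
  mean.\<close>

lemma (in alphabet) mean_square_le:
  assumes "a \<in> words n" "b \<in> words n" "a \<noteq> b" "0 <= c" "c <= weight a" "c <= weight b"
  shows "(mean n f)\<^sup>2 <= mean n (\<lambda>u. (f u)\<^sup>2) - c / 2 * (f a - f b)\<^sup>2"
proof -
  define m where "m = mean n f"
  have "mean n (\<lambda>u. (f u - m)\<^sup>2) = mean n (\<lambda>u. (f u)\<^sup>2 - (2 * m) * f u + m\<^sup>2)"
    by (simp add: power2_diff algebra_simps)
  also have "\<dots> = mean n (\<lambda>u. (f u)\<^sup>2) - (2 * m) * m + m\<^sup>2"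
    unfolding mean_add mean_diff mean_cmult mean_const m_def ..
  finally have var: "mean n (\<lambda>u. (f u - m)\<^sup>2) = mean n (\<lambda>u. (f u)\<^sup>2) - m\<^sup>2" by (simp add: power2_eq_square)
  have "(\<Sum>u\<in>{a, b}. weight u * (f u - m)\<^sup>2) <= mean n (\<lambda>u. (f u - m)\<^sup>2)"
    unfolding mean_eq_sum by (rule sum_mono2) (use assms in \<open>auto simp: finite_words dest!: weight_pos\<close>)
  moreover have "c * (f a - m)\<^sup>2 + c * (f b - m)\<^sup>2 <= (\<Sum>u\<in>{a, b}. weight u * (f u - m)\<^sup>2)"
    using assms by (auto intro!: add_mono mult_right_mono)
  moreover have "c / 2 * (f a - f b)\<^sup>2 <= c * (f a - m)\<^sup>2 + c * (f b - m)\<^sup>2"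
  proof -
    have "(f a - f b)\<^sup>2 <= 2 * (f a - m)\<^sup>2 + 2 * (f b - m)\<^sup>2"
      using zero_le_power2[of "(f a - m) + (f b - m)"] by (simp add: power2_eq_square algebra_simps)
    then show ?thesis using mult_left_mono[OF _ assms(4)] by (fastforce simp: field_simps)
  qed
  ultimately show ?thesis using var by (simp add: m_def)
qed

lemma integrable_square_diff:
  fixes f h :: "'x => real"
  assumes [measurable]: "f \<in> borel_measurable N" "h \<in> borel_measurable N"
    and "integrable N (\<lambda>x. (f x)\<^sup>2)" "integrable N (\<lambda>x. (h x)\<^sup>2)"
  shows "integrable N (\<lambda>x. (f x - h x)\<^sup>2)"
proof (rule Bochner_Integration.integrable_bound)
  show "integrable N (\<lambda>x. 2 * (f x)\<^sup>2 + 2 * (h x)\<^sup>2)" using assms(3,4) by simp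
  have "(f x - h x)\<^sup>2 <= 2 * (f x)\<^sup>2 + 2 * (h x)\<^sup>2" for x
    using zero_le_power2[of "f x + h x"] by (simp add: power2_eq_square algebra_simps)
  then show "AE x in N. norm ((f x - h x)\<^sup>2) <= norm (2 * (f x)\<^sup>2 + 2 * (h x)\<^sup>2)" by (auto simp: abs_of_nonneg)
qed simp

text \<open>If the quadratic norm of the averaged function were almost as large as that of \<open>f\<close>, the
  measure with density \<open>f\<^sup>2\<close> would be almost invariant, hence almost invariant under translations of
  the coordinate \<open>\<sigma>\<close> in each of the \<open>q\<close> frames.  Then \<open>{\<bar>\<sigma>\<bar> < r}\<close> has at most about
  \<open>1 / (q + 1)\<close> of the mass in each frame, but these sets cover the space.\<close>
lemma (in alphabet) mean_operator_contraction:
  fixes N :: "'x measure" and g :: "'l => 'x => 'x" and f \<sigma> :: "'x => real"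
  assumes g_meas: "\<And>b. b \<in> S ==> g b \<in> N \<rightarrow>\<^sub>M N" and g_inv: "\<And>b. b \<in> S ==> distr N N (g b) = N"
    and f_meas: "f \<in> borel_measurable N" and f_int: "integrable N (\<lambda>x. (f x)\<^sup>2)"
    and a: "a \<in> S" and a': "a' \<in> S" and neq: "a \<noteq> a'"
    and gi_meas: "gi \<in> N \<rightarrow>\<^sub>M N" and gi: "\<And>x. gi (g a x) = x"
    and \<sigma>_meas: "\<sigma> \<in> borel_measurable N" and Dom: "Measurable.pred N Dom"
    and Dom_eq: "\<And>z. Dom (g a z) \<longleftrightarrow> Dom (g a' z)"
    and shift: "\<And>z. Dom (g a z) ==> \<sigma> (g a z) = \<sigma> (g a' z) + c"
    and cover: "AE x in N. \<exists>i<q. Dom ((gi ^^ i) x) \<and> \<bar>\<sigma> ((gi ^^ i) x)\<bar> < r"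
    and "c > 0" "2 * r = real M * c" "M > 0" "q > 0"
    and "0 <= \<pi>" "\<pi> <= p a" "\<pi> <= p a'" "\<delta> = 1 / (6 * real (q\<^sup>2 * M * (q + 1)))"
  shows "integrable N (\<lambda>x. (mean q (\<lambda>u. f (fold g u x)))\<^sup>2)"
    and "(\<integral>x. (mean q (\<lambda>u. f (fold g u x)))\<^sup>2 \<partial>N) <= (1 - \<pi> ^ q / 2 * \<delta>\<^sup>2) * (\<integral>x. (f x)\<^sup>2 \<partial>N)"
proof -
  define Q where "Q = (\<integral>x. (f x)\<^sup>2 \<partial>N)"
  have fold_meas: "fold g u \<in> N \<rightarrow>\<^sub>M N" if "set u \<subseteq> S" for u
    using that by (induction u) (auto intro: measurable_comp g_meas)
  have fold_inv: "distr N N (fold g u) = N" if "set u \<subseteq> S" for u using that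
  proof (induction u)
    case (Cons b u)
    then have "distr N N (fold g (b # u)) = distr (distr N N (g b)) N (fold g u)"
      by (subst distr_distr) (auto intro: fold_meas g_meas)
    with Cons show ?case by (simp add: g_inv comp_def)
  qed (simp add: distr_id2 id_def)
  note f_meas[measurable] \<sigma>_meas[measurable] Dom[measurable] gi_meas[measurable]
  define F where "F u x = f (fold g u x)" for u x
  have Fm: "F u \<in> borel_measurable N" if "u \<in> words q" for u
    unfolding F_def using fold_meas[of u] that by (auto simp: words_def intro: measurable_compose f_meas)
  have Fint: "integrable N (\<lambda>x. (F u x)\<^sup>2)" and Fval: "(\<integral>x. (F u x)\<^sup>2 \<partial>N) = Q" if "u \<in> words q" for u
  proof -
    have u: "set u \<subseteq> S" using that by (simp add: words_def)
    have "integrable (distr N N (fold g u)) (\<lambda>x. (f x)\<^sup>2)" using f_int fold_inv[OF u] by simp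
    then show "integrable N (\<lambda>x. (F u x)\<^sup>2)"
      by (subst (asm) integrable_distr_eq) (auto simp: F_def fold_meas[OF u])
    have "(\<integral>x. (f x)\<^sup>2 \<partial>(distr N N (fold g u))) = (\<integral>x. (F u x)\<^sup>2 \<partial>N)"
      by (subst integral_distr) (auto simp: F_def fold_meas[OF u])
    then show "(\<integral>x. (F u x)\<^sup>2 \<partial>N) = Q" using fold_inv[OF u] by (simp add: Q_def)
  qed
  \<comment> \<open>\<open>w i\<close> is the word of q letters a with one letter replaced by a',
    followed by i further letters a. Undoing these i letters exposes the images of one and the same
    point under a and under a', whose coordinates differ by c.\<close>
  define w where "w i = replicate (q - Suc i) a @ a' # replicate i a" for i
  define w0 where "w0 = replicate q a"
  have \<pi>_pow: "\<pi> ^ q >= 0" using \<open>0 <= \<pi>\<close> by simp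
  have w0: "w0 \<in> words q" using a by (auto simp: w0_def words_def)
  have w: "w i \<in> words q" if "i < q" for i using a a' that by (auto simp: w_def words_def)
  have w_neq: "w0 \<noteq> w i" if "i < q" for i
  proof
    assume "w0 = w i"
    then have "a' \<in> set w0" by (simp add: w_def)
    then show False using neq by (simp add: w0_def)
  qed
  have wt_repl: "weight (replicate k a) = p a ^ k" for k by (induction k) (auto simp: weight_def)
  have wt0: "\<pi> ^ q <= weight w0" unfolding w0_def wt_repl using assms by (intro power_mono) auto
  have wt: "\<pi> ^ q <= weight (w i)" if "i < q" for i
  proof -
    have "weight (w i) = p a ^ (q - Suc i) * (p a' * p a ^ i)" using wt_repl by (simp add: w_def weight_def)
    moreover have "\<pi> ^ (q - Suc i) * (\<pi> * \<pi> ^ i) <= p a ^ (q - Suc i) * (p a' * p a ^ i)"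
      using assms by (intro mult_mono power_mono) auto
    moreover have "\<pi> ^ (q - Suc i) * (\<pi> * \<pi> ^ i) = \<pi> ^ q" using that by (simp flip: power_Suc power_add)
    ultimately show ?thesis by simp
  qed
  have mean_meas: "(\<lambda>x. mean q (\<lambda>u. F u x)) \<in> borel_measurable N"
    unfolding mean_eq_sum using Fm by (auto intro!: borel_measurable_sum borel_measurable_times)
  have sq_meas: "(\<lambda>x. mean q (\<lambda>u. (F u x)\<^sup>2)) = (\<lambda>x. \<Sum>u\<in>words q. weight u * (F u x)\<^sup>2)"
    by (simp add: mean_eq_sum)
  have sq_int: "integrable N (\<lambda>x. mean q (\<lambda>u. (F u x)\<^sup>2))"
    unfolding sq_meas using Fint by (intro Bochner_Integration.integrable_sum) auto
  have sq_val: "(\<integral>x. mean q (\<lambda>u. (F u x)\<^sup>2) \<partial>N) = Q"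
    unfolding sq_meas using Fint by (simp add: Fval sum_weight flip: sum_distrib_right)
  have ptw: "(mean q (\<lambda>u. F u x))\<^sup>2 <= mean q (\<lambda>u. (F u x)\<^sup>2) - \<pi> ^ q / 2 * (F w0 x - F (w i) x)\<^sup>2"
    if "i < q" for i x
    using mean_square_le[OF w0 w[OF that] w_neq[OF that] _ wt0 wt[OF that], of "\<lambda>u. F u x"] assms by simp
  have ptw': "(mean q (\<lambda>u. F u x))\<^sup>2 <= mean q (\<lambda>u. (F u x)\<^sup>2)" for x
    using ptw[OF \<open>q > 0\<close>, of x] \<pi>_pow zero_le_power2[of "F w0 x - F (w 0) x"]
    by (smt (verit) divide_nonneg_pos mult_nonneg_nonneg)
  have int: "integrable N (\<lambda>x. (mean q (\<lambda>u. F u x))\<^sup>2)"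
    by (rule Bochner_Integration.integrable_bound[OF sq_int])
       (use mean_meas ptw' in \<open>auto simp: abs_of_nonneg intro!: order_trans[OF ptw']\<close>)
  then show "integrable N (\<lambda>x. (mean q (\<lambda>u. f (fold g u x)))\<^sup>2)" by (simp add: F_def)
  have Q0: "Q >= 0" unfolding Q_def by simp
  have q: "real q >= 1" "real M >= 1" using assms by auto
  have \<delta>: "\<delta> > 0" unfolding \<open>\<delta> = _\<close> using \<open>M > 0\<close> \<open>q > 0\<close> by (simp del: of_nat_mult of_nat_add)
  show "(\<integral>x. (mean q (\<lambda>u. f (fold g u x)))\<^sup>2 \<partial>N) <= (1 - \<pi> ^ q / 2 * \<delta>\<^sup>2) * (\<integral>x. (f x)\<^sup>2 \<partial>N)"
  proof (rule ccontr)
    assume "\<not> ?thesis"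
    then have big: "(1 - \<pi> ^ q / 2 * \<delta>\<^sup>2) * Q < (\<integral>x. (mean q (\<lambda>u. F u x))\<^sup>2 \<partial>N)" by (simp add: Q_def F_def)
    have dint: "integrable N (\<lambda>x. (F w0 x - F (w i) x)\<^sup>2)" if "i < q" for i
      using that by (intro integrable_square_diff Fm Fint w0 w)
    \<comment> \<open>If the contraction failed, the variance remainder would force f composed with
      the two words to be close in L^2.\<close>
    have close: "(\<integral>x. (F w0 x - F (w i) x)\<^sup>2 \<partial>N) < \<delta>\<^sup>2 * Q" if i: "i < q" for i
    proof (rule ccontr)
      assume "\<not> ?thesis"
      then have far: "\<delta>\<^sup>2 * Q <= (\<integral>x. (F w0 x - F (w i) x)\<^sup>2 \<partial>N)" by simp
      have "(\<integral>x. (mean q (\<lambda>u. F u x))\<^sup>2 \<partial>N)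
          <= (\<integral>x. mean q (\<lambda>u. (F u x)\<^sup>2) - \<pi> ^ q / 2 * (F w0 x - F (w i) x)\<^sup>2 \<partial>N)"
        using int sq_int dint[OF i] ptw[OF i] by (intro integral_mono) auto
      also have "\<dots> = Q - \<pi> ^ q / 2 * (\<integral>x. (F w0 x - F (w i) x)\<^sup>2 \<partial>N)"
        using sq_int dint[OF i] by (simp add: sq_val)
      also have "\<dots> <= Q - \<pi> ^ q / 2 * (\<delta>\<^sup>2 * Q)" using far \<pi>_pow by (intro diff_left_mono mult_left_mono) auto
      finally show False using big by (simp add: algebra_simps)
    qed
    have Qpos: "Q > 0"
      proof -
      have "0 <= (\<integral>x. (F w0 x - F (w 0) x)\<^sup>2 \<partial>N)" by (rule Bochner_Integration.integral_nonneg) simp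
      also note close[OF \<open>q > 0\<close>]
      finally show ?thesis using Q0 by (cases "Q = 0") auto
    qed
    define B where "B i P x \<longleftrightarrow> Dom ((gi ^^ i) x) \<and> P (\<sigma> ((gi ^^ i) x))" for i P x
    \<comment> \<open>\<nu> is the measure with density f^2. As every word preserves N, the mass of
      a set can be computed along any word (\<open>\<nu>_word\<close>).\<close>
    define \<nu> where "\<nu> A = (\<integral>x. indicator {x. A x} x * (f x)\<^sup>2 \<partial>N)" for A
    have Bm: "Measurable.pred N (B i P)" if [measurable]: "Measurable.pred borel P" for i P
      unfolding B_def by measurable
    have ind_int: "integrable N (\<lambda>x. indicator {x. A x} x * h x)"
      if [measurable]: "Measurable.pred N A" and h: "integrable N h" for A and h :: "'x => real"
      using integrable_real_mult_indicator[of "{x\<in>space N. A x}" N h] h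
      by (subst Bochner_Integration.integrable_cong[OF refl, of _ _ "\<lambda>x. h x * indicator {x\<in>space N. A x} x"])
         (auto simp: indicator_def)
    have \<nu>_word: "\<nu> A = (\<integral>x. indicator {x. A (fold g u x)} x * (F u x)\<^sup>2 \<partial>N)"
      if [measurable]: "Measurable.pred N A" and u: "u \<in> words q" for A u
    proof -
      have u': "set u \<subseteq> S" using u by (simp add: words_def)
      have "\<nu> A = (\<integral>x. indicator {x. A x} x * (f x)\<^sup>2 \<partial>(distr N N (fold g u)))"
        using fold_inv[OF u'] by (simp add: \<nu>_def)
      also have "\<dots> = (\<integral>x. indicator {x. A x} (fold g u x) * (f (fold g u x))\<^sup>2 \<partial>N)"
        by (subst integral_distr) (auto simp: fold_meas[OF u'])
      finally show ?thesis by (simp add: F_def indicator_def)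
    qed
    \<comment> \<open>The pullback of the set along \<open>w0\<close> equals the pullback of its
      translate along \<open>w i\<close>, so the two masses differ only through F, and that
      difference is controlled by \<open>close\<close>.\<close>
    have step: "\<nu> (B i P) <= \<nu> (B i (\<lambda>s. P (s + c))) + 3 * \<delta> * Q"
      if i: "i < q" and Pm[measurable]: "Measurable.pred borel P" for i P
    proof -
      have gi_pow: "(gi ^^ k) ((g a ^^ k) x) = x" for k x
        by (induction k arbitrary: x) (auto simp: gi funpow_swap1)
      have fold_repl: "fold g (replicate k a) x = (g a ^^ k) x" for k x
        by (induction k arbitrary: x) (auto simp: funpow_swap1)
      have same: "B i P (fold g w0 x) \<longleftrightarrow> B i (\<lambda>s. P (s + c)) (fold g (w i) x)" for x
      proof -
        define z where "z = (g a ^^ (q - Suc i)) x"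
        have "w0 = replicate (q - Suc i) a @ a # replicate i a"
          using i unfolding w0_def by (simp add: replicate_append_same flip: replicate_Suc replicate_add)
        then have "fold g w0 x = (g a ^^ i) (g a z)" by (simp add: fold_repl z_def)
        moreover have "fold g (w i) x = (g a ^^ i) (g a' z)" by (simp add: w_def fold_repl z_def)
        ultimately show ?thesis using shift[of z] Dom_eq[of z] by (auto simp: B_def gi_pow)
      qed
      define I where "I x = (indicator {x. B i P (fold g w0 x)} x :: real)" for x
      have Im: "Measurable.pred N (\<lambda>x. B i P (fold g w0 x))"
        using Bm[OF Pm] fold_meas[of w0] w0 by (auto simp: words_def intro: measurable_compose)
      have P'm: "Measurable.pred borel (\<lambda>s. P (s + c))" by measurable
      have 1: "\<nu> (B i P) = (\<integral>x. I x * (F w0 x)\<^sup>2 \<partial>N)" using \<nu>_word[OF Bm[OF Pm] w0] by (simp add: I_def)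
      have 2: "\<nu> (B i (\<lambda>s. P (s + c))) = (\<integral>x. I x * (F (w i) x)\<^sup>2 \<partial>N)"
        using \<nu>_word[OF Bm[OF P'm] w[OF i]] by (simp add: I_def same)
      have i1: "integrable N (\<lambda>x. I x * (F w0 x)\<^sup>2)" unfolding I_def by (rule ind_int[OF Im Fint[OF w0]])
      have i2: "integrable N (\<lambda>x. I x * (F (w i) x)\<^sup>2)" unfolding I_def by (rule ind_int[OF Im Fint[OF w[OF i]]])
      have "\<nu> (B i P) - \<nu> (B i (\<lambda>s. P (s + c))) = (\<integral>x. I x * (F w0 x)\<^sup>2 - I x * (F (w i) x)\<^sup>2 \<partial>N)"
        unfolding 1 2 using i1 i2 by simp
      also have "\<dots> <= (\<integral>x. (1 / (2 * \<delta>)) * (F w0 x - F (w i) x)\<^sup>2 + \<delta> * (F w0 x)\<^sup>2 + \<delta> * (F (w i) x)\<^sup>2 \<partial>N)"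
      proof (rule integral_mono)
        show "integrable N (\<lambda>x. I x * (F w0 x)\<^sup>2 - I x * (F (w i) x)\<^sup>2)" using i1 i2 by simp
        show "integrable N (\<lambda>x. (1 / (2 * \<delta>)) * (F w0 x - F (w i) x)\<^sup>2 + \<delta> * (F w0 x)\<^sup>2 + \<delta> * (F (w i) x)\<^sup>2)"
          using dint[OF i] Fint[OF w0] Fint[OF w[OF i]] by simp
        fix x
        define y z where "y = F w0 x" and "z = F (w i) x"
        \<comment> \<open>Weighted arithmetic-geometric mean inequality for (y - z)(y + z). The
          weight \<delta> balances the small L^2 distance \<delta>^2 Q against the full mass
          Q.\<close>
        have "0 <= ((y - z) - \<delta> * (y + z))\<^sup>2" by simp
        then have "2 * \<delta> * (y\<^sup>2 - z\<^sup>2) <= (y - z)\<^sup>2 + \<delta>\<^sup>2 * (y + z)\<^sup>2"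
          by (simp add: power2_eq_square algebra_simps)
        also have "\<dots> <= (y - z)\<^sup>2 + \<delta>\<^sup>2 * (2 * y\<^sup>2 + 2 * z\<^sup>2)"
          using zero_le_power2[of "y - z"] by (intro add_left_mono mult_left_mono) (auto simp: power2_eq_square algebra_simps)
        finally have "y\<^sup>2 - z\<^sup>2 <= ((y - z)\<^sup>2 + \<delta>\<^sup>2 * (2 * y\<^sup>2 + 2 * z\<^sup>2)) / (2 * \<delta>)"
          using \<delta> by (simp add: pos_le_divide_eq mult.commute)
        also have "\<dots> = (1 / (2 * \<delta>)) * (y - z)\<^sup>2 + \<delta> * y\<^sup>2 + \<delta> * z\<^sup>2"
          using \<delta> by (simp add: field_simps power2_eq_square)
        finally have le: "y\<^sup>2 - z\<^sup>2 <= (1 / (2 * \<delta>)) * (y - z)\<^sup>2 + \<delta> * y\<^sup>2 + \<delta> * z\<^sup>2" .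
        have "0 <= (1 / (2 * \<delta>)) * (y - z)\<^sup>2 + \<delta> * y\<^sup>2 + \<delta> * z\<^sup>2" using \<delta> by simp
        with le show "I x * (F w0 x)\<^sup>2 - I x * (F (w i) x)\<^sup>2
            <= (1 / (2 * \<delta>)) * (F w0 x - F (w i) x)\<^sup>2 + \<delta> * (F w0 x)\<^sup>2 + \<delta> * (F (w i) x)\<^sup>2"
          by (simp add: I_def indicator_def y_def z_def)
      qed
      also have "\<dots> = (1 / (2 * \<delta>)) * (\<integral>x. (F w0 x - F (w i) x)\<^sup>2 \<partial>N) + \<delta> * Q + \<delta> * Q"
        using dint[OF i] Fint[OF w0] Fint[OF w[OF i]] by (simp add: Fval w0 w i)
      also have "\<dots> <= (1 / (2 * \<delta>)) * (\<delta>\<^sup>2 * Q) + \<delta> * Q + \<delta> * Q"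
        using close[OF i] \<delta> by (intro add_mono mult_left_mono) auto
      also have "\<dots> <= 3 * \<delta> * Q" using \<delta> Q0 by (simp add: power2_eq_square field_simps)
      finally show ?thesis by simp
    qed
    have steps: "\<nu> (B i P) <= \<nu> (B i (\<lambda>s. P (s + real k * c))) + real k * (3 * \<delta> * Q)"
      if i: "i < q" and Pm[measurable]: "Measurable.pred borel P" for i P k
    proof (induction k)
      case (Suc k)
      have "Measurable.pred borel (\<lambda>s. P (s + real k * c))" by measurable
      from step[OF i this] Suc show ?case by (simp add: algebra_simps)
    qed simp
    \<comment> \<open>The window around 0 and its translates by multiples of 2r. Half-open intervals
      are disjoint yet contain the open window of the covering assumption; 2r = Mc makes each
      translate reachable by M shifts.\<close>
    define P where "P n s \<longleftrightarrow> r - 2 * r * real n > s \<and> s >= - r - 2 * r * real n" for n :: nat and s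
    have Pm: "Measurable.pred borel (P n)" for n unfolding P_def by measurable
    have rpos: "r > 0" using \<open>2 * r = real M * c\<close> \<open>c > 0\<close> \<open>M > 0\<close>
      by (metis mult_pos_pos of_nat_0_less_iff zero_less_mult_pos zero_less_numeral)
    have P_shift: "(\<lambda>s. P 0 (s + real (n * M) * c)) = P n" for n
    proof -
      have "real (n * M) * c = 2 * r * real n" using \<open>2 * r = real M * c\<close> by (simp add: mult_ac)
      then show ?thesis unfolding P_def fun_eq_iff by (simp only:) auto
    qed
    have P_disj: "P n s ==> P m s ==> n = m" for n m s
    proof (rule ccontr)
      assume A: "P n s" "P m s" "n \<noteq> m"
      have False if "P n s" "P m s" "n < m" for n m
      proof -
        have "r * 1 <= r * (real m - real n)" using rpos that by (intro mult_left_mono) auto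
        then have "2 * r * real n + 2 * r <= 2 * r * real m" by (simp add: algebra_simps)
        then show False using that by (simp add: P_def)
      qed
      with A show False by (metis nat_neq_iff)
    qed
    have small: "\<nu> (B i (P 0)) <= Q / (q + 1) + q * M * (3 * \<delta> * Q)" if i: "i < q" for i
    proof -
      have "(q + 1) * (\<nu> (B i (P 0)) - q * M * (3 * \<delta> * Q)) = (\<Sum>n\<le>q. \<nu> (B i (P 0)) - q * M * (3 * \<delta> * Q))"
        by simp
      also have "\<dots> <= (\<Sum>n\<le>q. \<nu> (B i (P n)))"
      proof (rule sum_mono)
        fix n assume "n \<in> {..q}"
        then have "real (n * M) * (3 * \<delta> * Q) <= q * M * (3 * \<delta> * Q)"
          using \<delta> Q0 by (intro mult_right_mono) (auto simp: mult_right_mono)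
        then show "\<nu> (B i (P 0)) - q * M * (3 * \<delta> * Q) <= \<nu> (B i (P n))"
          using steps[OF i Pm[of 0], of "n * M"] unfolding P_shift by linarith
      qed
      also have "\<dots> = (\<integral>x. (\<Sum>n\<le>q. indicator {x. B i (P n) x} x * (f x)\<^sup>2) \<partial>N)"
        unfolding \<nu>_def by (rule Bochner_Integration.integral_sum[symmetric]) (rule ind_int[OF Bm[OF Pm] f_int])
      also have "\<dots> <= Q" unfolding Q_def
      proof (rule integral_mono)
        show "integrable N (\<lambda>x. \<Sum>n\<le>q. indicator {x. B i (P n) x} x * (f x)\<^sup>2)"
          by (intro Bochner_Integration.integrable_sum ind_int[OF Bm[OF Pm] f_int])
        fix x
        have "(\<Sum>n\<le>q. indicator {x. B i (P n) x} x :: real) = card {n\<in>{..q}. B i (P n) x}"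
          by (simp add: indicator_def sum.If_cases Int_def)
        also have "\<dots> <= 1"
        proof -
          have "n = m" if "B i (P n) x" "B i (P m) x" for n m using that P_disj unfolding B_def by blast
          then have "card {n\<in>{..q}. B i (P n) x} <= 1" by (subst One_nat_def, subst card_le_Suc0_iff_eq) auto
          then show ?thesis by simp
        qed
        finally show "(\<Sum>n\<le>q. indicator {x. B i (P n) x} x * (f x)\<^sup>2) <= (f x)\<^sup>2"
          by (simp add: mult_left_le_one_le sum_nonneg flip: sum_distrib_right)
      qed (rule f_int)
      finally show ?thesis by (simp add: field_simps)
    qed
    have "Q <= (\<integral>x. (\<Sum>i<q. indicator {x. B i (P 0) x} x * (f x)\<^sup>2) \<partial>N)" unfolding Q_def
    proof (rule integral_mono_AE[OF f_int])
      show "integrable N (\<lambda>x. \<Sum>i<q. indicator {x. B i (P 0) x} x * (f x)\<^sup>2)"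
        by (intro Bochner_Integration.integrable_sum ind_int[OF Bm[OF Pm] f_int])
      show "AE x in N. (f x)\<^sup>2 <= (\<Sum>i<q. indicator {x. B i (P 0) x} x * (f x)\<^sup>2)" using cover
      proof eventually_elim
        case (elim x)
        then obtain i where "i < q" "Dom ((gi ^^ i) x)" "\<bar>\<sigma> ((gi ^^ i) x)\<bar> < r" by blast
        then have i: "i < q" "B i (P 0) x" by (auto simp: B_def P_def)
        have "(\<Sum>j\<in>{i}. indicator {x. B j (P 0) x} x * (f x)\<^sup>2) <= (\<Sum>j<q. indicator {x. B j (P 0) x} x * (f x)\<^sup>2)"
          using i by (intro sum_mono2) auto
        then show ?case using i by simp
      qed
    qed
    also have "\<dots> = (\<Sum>i<q. \<nu> (B i (P 0)))"
      unfolding \<nu>_def by (rule Bochner_Integration.integral_sum) (rule ind_int[OF Bm[OF Pm] f_int])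
    also have "\<dots> <= (\<Sum>i<q. Q / (q + 1) + q * M * (3 * \<delta> * Q))" by (intro sum_mono small) auto
    also have "\<dots> = Q * (q / (q + 1) + 3 * (real q)\<^sup>2 * M * \<delta>)" by (simp add: algebra_simps power2_eq_square)
    \<comment> \<open>Origin of \<delta>: q frames, each losing 3\<delta>Q at each of up to qM
      shifts, may use up only half of the deficit 1/(q + 1).\<close>
    also have "3 * (real q)\<^sup>2 * M * \<delta> = 1 / (2 * (q + 1))"
    proof -
      have "3 * X * (1 / (6 * (X * Y))) = 1 / (2 * Y)" if "X \<noteq> 0" "Y \<noteq> 0" for X Y :: real
        using that by (simp add: field_simps)
      then have "3 * ((real q)\<^sup>2 * M) * (1 / (6 * (((real q)\<^sup>2 * M) * (real q + 1)))) = 1 / (2 * (real q + 1))"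
        by this (use q in auto)
      then show ?thesis
        unfolding \<open>\<delta> = _\<close> by (simp only: of_nat_mult of_nat_power of_nat_add of_nat_1 mult.assoc)
    qed
    finally have Q_le: "Q <= Q * (q / (q + 1) + 1 / (2 * (q + 1)))" .
    have less_1: "q / (q + 1) + 1 / (2 * (q + 1)) < (1 :: real)"
      using q by (simp add: divide_simps, simp add: algebra_simps)
    then have "Q * (q / (q + 1) + 1 / (2 * (q + 1))) < Q * 1" using Qpos less_1 by (intro mult_strict_left_mono) auto
    then show False using Q_le by simp
  qed
qed

section \<open>Invariant measures of the transfer steps on the plane and on the projective
  line\<close>

locale jacobi_letters = alphabet S p for S :: "(real \<times> real) set" and p +
  assumes snd_nz: "\<And>a. a \<in> S ==> snd a \<noteq> 0"

lemma tact_eq_fold: "tact E u x = fold (tstep E) u x" by (induction u arbitrary: x) simp_all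

lemma tstep_eq_0_iff: "snd a \<noteq> 0 ==> tstep E a x = 0 \<longleftrightarrow> x = 0" by (auto simp: tstep_def prod_eq_iff)

lemma tstep_inv_eq_0_iff: "snd a \<noteq> 0 ==> tstep_inv E a x = 0 \<longleftrightarrow> x = 0" by (auto simp: tstep_inv_def prod_eq_iff)

lemma tstep_scale: "tstep E a (c *\<^sub>R x) = c *\<^sub>R tstep E a x" using tstep_linear[of E a c x 0 0] by simp

lemma tstep_inv_scale: "tstep_inv E a (c *\<^sub>R x) = c *\<^sub>R tstep_inv E a x"
  by (simp add: tstep_inv_def prod_eq_iff algebra_simps)

lemma borel_measurable_fst_snd_real [measurable]:
  "(fst :: real \<times> real => real) \<in> borel_measurable borel" "(snd :: real \<times> real => real) \<in> borel_measurable borel"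
  by (auto intro!: borel_measurable_continuous_onI continuous_intros)

lemma tstep_measurable[measurable]: "tstep E a \<in> borel_measurable borel"
  unfolding tstep_def by (intro borel_measurable_Pair) measurable

lemma tstep_inv_measurable[measurable]: "tstep_inv E a \<in> borel_measurable borel"
  unfolding tstep_inv_def by (intro borel_measurable_Pair) measurable

text \<open>The step has determinant 1. By Fubini the substitution in the second variable
  contributes the factor |w| and the one in the first variable its inverse.\<close>

lemma distr_lborel_tstep:
  assumes nz: "snd a \<noteq> 0"
  shows "distr lborel lborel (tstep E a) = (lborel :: (real \<times> real) measure)"
proof (rule measure_eqI)
  fix A :: "(real \<times> real) set"
  assume "A \<in> sets (distr lborel lborel (tstep E a))"
  then have A[measurable]: "A \<in> sets borel" by simp
  define h where "h x = (indicator A x :: ennreal)" for x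
  have h[measurable]: "h \<in> borel_measurable borel" unfolding h_def by simp
  have h'[measurable]: "h \<in> borel_measurable (lborel \<Otimes>\<^sub>M lborel)" by (simp add: lborel_prod)
  define v w where "v = fst a - E" and "w = snd a"
  have w: "w \<noteq> 0" using nz by (simp add: w_def)
  have inner: "(\<integral>\<^sup>+ y. h ((v * x - y) / w, w * x) \<partial>lborel) = ennreal \<bar>w\<bar> * (\<integral>\<^sup>+ s. h (s, w * x) \<partial>lborel)" for x
  proof -
    have "(\<integral>\<^sup>+ s. h (s, w * x) \<partial>lborel) = \<bar>- 1 / w\<bar> * (\<integral>\<^sup>+ y. h (v * x / w + (- 1 / w) * y, w * x) \<partial>lborel)"
      by (rule nn_integral_real_affine) (use w in \<open>auto intro!: measurable_compose[OF _ h]\<close>)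
    also have "(\<lambda>y. h (v * x / w + (- 1 / w) * y, w * x)) = (\<lambda>y. h ((v * x - y) / w, w * x))"
      by (simp add: diff_divide_distrib)
    finally show ?thesis using w by (simp add: mult.assoc[symmetric] flip: ennreal_mult)
  qed
  have G: "(\<lambda>x. \<integral>\<^sup>+ s. h (s, x) \<partial>lborel) \<in> borel_measurable lborel"
    by (rule lborel.borel_measurable_nn_integral) simp
  have "emeasure (distr lborel lborel (tstep E a)) A = (\<integral>\<^sup>+ x. h x \<partial>distr lborel lborel (tstep E a))"
    unfolding h_def by simp
  also have "\<dots> = (\<integral>\<^sup>+ z. h (tstep E a z) \<partial>lborel)" by (rule nn_integral_distr) auto
  also have "\<dots> = (\<integral>\<^sup>+ z. h (tstep E a z) \<partial>(lborel \<Otimes>\<^sub>M lborel))" by (simp add: lborel_prod)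
  also have "\<dots> = (\<integral>\<^sup>+ x. \<integral>\<^sup>+ y. h (tstep E a (x, y)) \<partial>lborel \<partial>lborel)"
    by (rule lborel.nn_integral_fst[symmetric]) (simp add: lborel_prod)
  also have "\<dots> = (\<integral>\<^sup>+ x. ennreal \<bar>w\<bar> * (\<integral>\<^sup>+ s. h (s, 0 + w * x) \<partial>lborel) \<partial>lborel)"
    using inner by (simp add: tstep_def v_def w_def)
  also have "\<dots> = ennreal \<bar>w\<bar> * (\<integral>\<^sup>+ x. (\<integral>\<^sup>+ s. h (s, 0 + w * x) \<partial>lborel) \<partial>lborel)"
    by (rule nn_integral_cmult) (rule measurable_compose[OF _ G], simp)
  also have "\<dots> = (\<integral>\<^sup>+ x. (\<integral>\<^sup>+ s. h (s, x) \<partial>lborel) \<partial>lborel)"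
    by (rule nn_integral_real_affine[symmetric]) (use G w in auto)
  also have "\<dots> = (\<integral>\<^sup>+ z. h z \<partial>(lborel \<Otimes>\<^sub>M lborel))" by (rule lborel_pair.nn_integral_snd) simp
  also have "\<dots> = emeasure lborel A" by (simp add: lborel_prod h_def)
  finally show "emeasure (distr lborel lborel (tstep E a)) A = emeasure lborel A" .
qed simp

text \<open>The projective line, as the set of slopes with \<open>None\<close> for the vertical direction.\<close>
definition slope_vec :: "real option => real \<times> real" where
  "slope_vec d = (case d of None => (0, 1) | Some s => (1, s))"

definition slope :: "real \<times> real => real option" where
  "slope x = (if fst x = 0 then None else Some (snd x / fst x))"

lemma slope_vec_nz: "slope_vec d \<noteq> 0" by (cases d) (auto simp: slope_vec_def prod_eq_iff)

lemma slope_slope_vec: "slope (slope_vec d) = d" by (cases d) (auto simp: slope_vec_def slope_def)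

lemma slope_scale: "c \<noteq> 0 ==> slope (c *\<^sub>R x) = slope x" by (auto simp: slope_def)

lemma slope_vec_slope:
  assumes "x \<noteq> 0"
  obtains c where "c \<noteq> 0" "slope_vec (slope x) = c *\<^sub>R x"
proof (cases "fst x = 0")
  case True
  with assms that[of "1 / snd x"] show ?thesis by (auto simp: slope_def slope_vec_def prod_eq_iff)
next
  case False
  with that[of "1 / fst x"] show ?thesis by (auto simp: slope_def slope_vec_def prod_eq_iff)
qed

lemma slope_eqI: "x \<noteq> 0 ==> y \<noteq> 0 ==> wedge x y = 0 ==> slope x = slope y"
  by (auto simp: slope_def wedge_def field_simps prod_eq_iff)

definition pstep :: "real => real \<times> real => real option => real option" where
  "pstep E a d = slope (tstep E a (slope_vec d))"

definition pstep_inv :: "real => real \<times> real => real option => real option" where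
  "pstep_inv E a d = slope (tstep_inv E a (slope_vec d))"

lemma pstep_slope: "snd a \<noteq> 0 ==> x \<noteq> 0 ==> pstep E a (slope x) = slope (tstep E a x)"
  unfolding pstep_def by (rule slope_vec_slope[of x]) (auto simp: tstep_scale slope_scale)

lemma pstep_inv_slope: "snd a \<noteq> 0 ==> x \<noteq> 0 ==> pstep_inv E a (slope x) = slope (tstep_inv E a x)"
  unfolding pstep_inv_def by (rule slope_vec_slope[of x]) (auto simp: tstep_inv_scale slope_scale)

lemma pstep_inv_pstep: "snd a \<noteq> 0 ==> pstep_inv E a (pstep E a d) = d"
  by (simp add: pstep_def pstep_inv_slope slope_vec_nz tstep_eq_0_iff tstep_inv_tstep slope_slope_vec)

lemma pstep_pstep_inv: "snd a \<noteq> 0 ==> pstep E a (pstep_inv E a d) = d"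
  by (simp add: pstep_inv_def pstep_slope slope_vec_nz tstep_inv_eq_0_iff tstep_tstep_inv slope_slope_vec)

lemma fold_pstep_slope:
  "\<forall>a\<in>set u. snd a \<noteq> 0 ==> x \<noteq> 0 ==> fold (pstep E) u (slope x) = slope (tact E u x)"
  by (induction u arbitrary: x) (auto simp: pstep_slope tstep_eq_0_iff)

lemma tact_eq_0_iff: "\<forall>a\<in>set u. snd a \<noteq> 0 ==> tact E u x = 0 \<longleftrightarrow> x = 0"
  by (induction u arbitrary: x) (auto simp: tstep_eq_0_iff)

lemma wedge_tact: "\<forall>a\<in>set u. snd a \<noteq> 0 ==> wedge (tact E u x) (tact E u y) = wedge x y"
  by (induction u arbitrary: x y) (auto simp: wedge_tstep)

text \<open>\<sigma> is a coordinate on directions, defined on Dom, in which exchanging the letter a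
  for a' is the translation by c. The frames are \<sigma> composed with powers of the inverse step
  of a; a single one misses the directions where \<sigma> is large, but q of them cover everything
  by windows of half-width r. Making 2r a multiple of c lets shifts tile the axis by
  windows.\<close>

locale shifted_frames = jacobi_letters +
  fixes E :: real and a a' :: "real \<times> real" and \<sigma> :: "real \<times> real => real" and Dom :: "real \<times> real => bool"
    and c r :: real and q M :: nat
  assumes a: "a \<in> S" and a': "a' \<in> S" and neq: "a \<noteq> a'"
    and \<sigma>_meas: "\<sigma> \<in> borel_measurable borel" and Dom_meas: "Measurable.pred borel Dom"
    and \<sigma>_scale: "\<And>s x. s \<noteq> 0 ==> \<sigma> (s *\<^sub>R x) = \<sigma> x" and Dom_scale: "\<And>s x. s \<noteq> 0 ==> Dom (s *\<^sub>R x) = Dom x"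
    and Dom_eq: "\<And>z. Dom (tstep E a z) \<longleftrightarrow> Dom (tstep E a' z)"
    and shift: "\<And>z. Dom (tstep E a z) ==> \<sigma> (tstep E a z) = \<sigma> (tstep E a' z) + c"
    and cover: "\<And>x. x \<noteq> 0 ==> \<exists>i<q. Dom ((tstep_inv E a ^^ i) x) \<and> \<bar>\<sigma> ((tstep_inv E a ^^ i) x)\<bar> < r"
    and c: "c > 0" and rM: "2 * r = real M * c" and M: "M > 0" and q: "q > 0"
begin

text \<open>Contraction factor of the squared L^2 norm per block of q letters. The maximum with 0
  secures the sign that iterating the bound requires.\<close>

definition rate :: real where
  "rate = max 0 (1 - min (p a) (p a') ^ q / 2 * (1 / (6 * real (q\<^sup>2 * M * (q + 1))))\<^sup>2)"

lemma rate_nonneg: "0 <= rate" by (simp add: rate_def)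

lemma rate_less_1: "rate < 1"
proof -
  have "0 < q\<^sup>2 * M * (q + 1)" using M q by simp
  then have "0 < real (q\<^sup>2 * M * (q + 1))" by (simp only: of_nat_0_less_iff)
  then have "0 < min (p a) (p a') ^ q / 2 * (1 / (6 * real (q\<^sup>2 * M * (q + 1))))\<^sup>2"
    using p_pos[OF a] p_pos[OF a'] by (intro mult_pos_pos divide_pos_pos zero_less_power) auto
  then show ?thesis by (simp add: rate_def)
qed

lemma plane_contraction:
  assumes "f \<in> borel_measurable lborel" "integrable lborel (\<lambda>x. (f x)\<^sup>2)"
  shows "integrable lborel (\<lambda>x. (mean q (\<lambda>u. f (fold (tstep E) u x)))\<^sup>2)" (is ?A)
    and "(\<integral>x. (mean q (\<lambda>u. f (fold (tstep E) u x)))\<^sup>2 \<partial>lborel) <= rate * (\<integral>x. (f x)\<^sup>2 \<partial>lborel)" (is ?B)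
proof -
  let ?D = "min (p a) (p a') ^ q / 2 * (1 / (6 * real (q\<^sup>2 * M * (q + 1))))\<^sup>2"
  have "AE x in lborel. x \<noteq> (0 :: real \<times> real)" by (rule AE_lborel_singleton)
  then have cov: "AE x in lborel. \<exists>i<q. Dom ((tstep_inv E a ^^ i) x) \<and> \<bar>\<sigma> ((tstep_inv E a ^^ i) x)\<bar> < r"
    by eventually_elim (rule cover)
  have m: "tstep E b \<in> lborel \<rightarrow>\<^sub>M lborel" "tstep_inv E b \<in> lborel \<rightarrow>\<^sub>M lborel" for b by simp_all
  have s: "\<sigma> \<in> borel_measurable lborel" "Measurable.pred lborel Dom" using \<sigma>_meas Dom_meas by simp_all
  have pos: "0 <= min (p a) (p a')" using p_pos[OF a] p_pos[OF a'] by simp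
  note * = mean_operator_contraction[OF m(1) distr_lborel_tstep[OF snd_nz] assms a a' neq m(2)
      tstep_inv_tstep[OF snd_nz[OF a]] s Dom_eq shift cov c rM M q pos min.cobounded1 min.cobounded2 refl]
  show ?A by (rule *(1))
  have "(\<integral>x. (mean q (\<lambda>u. f (fold (tstep E) u x)))\<^sup>2 \<partial>lborel) <= (1 - ?D) * (\<integral>x. (f x)\<^sup>2 \<partial>lborel)" by (rule *(2))
  also have "\<dots> <= rate * (\<integral>x. (f x)\<^sup>2 \<partial>lborel)" unfolding rate_def by (intro mult_right_mono) auto
  finally show ?B .
qed

text \<open>Counting measure on the projective line is invariant under every bijection, so no
  stationary measure has to be constructed. Its L^2 contains the indicator of a single direction,
  which is what controls concentration.\<close>

lemma projective_contraction:
  assumes "integrable (count_space UNIV) (\<lambda>x. (f x)\<^sup>2)"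
  shows "integrable (count_space UNIV) (\<lambda>x. (mean q (\<lambda>u. f (fold (pstep E) u x)))\<^sup>2)" (is ?A)
    and "(\<integral>x. (mean q (\<lambda>u. f (fold (pstep E) u x)))\<^sup>2 \<partial>count_space UNIV)
      <= rate * (\<integral>x. (f x)\<^sup>2 \<partial>count_space UNIV)" (is ?B)
proof -
  let ?D = "min (p a) (p a') ^ q / 2 * (1 / (6 * real (q\<^sup>2 * M * (q + 1))))\<^sup>2"
  \<comment> \<open>The projective steps renormalise their representatives at each stage; since
    \<sigma> and Dom are homogeneous of degree 0, only proportionality to the linear orbit
    matters.\<close>
  have inv_pow: "\<exists>s. s \<noteq> 0 \<and> slope_vec ((pstep_inv E a ^^ i) d) = s *\<^sub>R (tstep_inv E a ^^ i) (slope_vec d)" for i d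
  proof (induction i)
    case 0
    show ?case by (rule exI[of _ 1]) simp
  next
    case (Suc i)
    then obtain s where s: "s \<noteq> 0" "slope_vec ((pstep_inv E a ^^ i) d) = s *\<^sub>R (tstep_inv E a ^^ i) (slope_vec d)"
      by blast
    define y where "y = tstep_inv E a (slope_vec ((pstep_inv E a ^^ i) d))"
    have "y \<noteq> 0" by (simp add: y_def tstep_inv_eq_0_iff snd_nz[OF a] slope_vec_nz)
    then obtain t where t: "t \<noteq> 0" "slope_vec (slope y) = t *\<^sub>R y" by (rule slope_vec_slope)
    have "slope_vec ((pstep_inv E a ^^ Suc i) d) = t *\<^sub>R y" using t by (simp add: pstep_inv_def y_def)
    also have "\<dots> = (t * s) *\<^sub>R (tstep_inv E a ^^ Suc i) (slope_vec d)" by (simp add: y_def s tstep_inv_scale)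
    finally show ?case using s t by (intro exI[of _ "t * s"]) simp
  qed
  have cov: "AE d in count_space UNIV. \<exists>i<q. Dom (slope_vec ((pstep_inv E a ^^ i) d)) \<and>
      \<bar>\<sigma> (slope_vec ((pstep_inv E a ^^ i) d))\<bar> < r"
  proof (rule AE_I2)
    fix d
    obtain i where i: "i < q" "Dom ((tstep_inv E a ^^ i) (slope_vec d))"
        "\<bar>\<sigma> ((tstep_inv E a ^^ i) (slope_vec d))\<bar> < r" using cover[OF slope_vec_nz] by blast
    obtain s where "s \<noteq> 0" "slope_vec ((pstep_inv E a ^^ i) d) = s *\<^sub>R (tstep_inv E a ^^ i) (slope_vec d)"
      using inv_pow by blast
    then show "\<exists>i<q. Dom (slope_vec ((pstep_inv E a ^^ i) d)) \<and> \<bar>\<sigma> (slope_vec ((pstep_inv E a ^^ i) d))\<bar> < r"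
      using i by (intro exI[of _ i]) (simp add: Dom_scale \<sigma>_scale)
  qed
  have pv: "\<exists>s. s \<noteq> 0 \<and> slope_vec (pstep E b d) = s *\<^sub>R tstep E b (slope_vec d)" if "b \<in> S" for b d
  proof -
    have "tstep E b (slope_vec d) \<noteq> 0" using snd_nz[OF that] by (simp add: tstep_eq_0_iff slope_vec_nz)
    then show ?thesis unfolding pstep_def by (rule slope_vec_slope) blast
  qed
  have De: "Dom (slope_vec (pstep E a z)) \<longleftrightarrow> Dom (slope_vec (pstep E a' z))"
    and sh: "Dom (slope_vec (pstep E a z)) ==> \<sigma> (slope_vec (pstep E a z)) = \<sigma> (slope_vec (pstep E a' z)) + c" for z
    using pv[OF a, of z] pv[OF a', of z] Dom_eq[of "slope_vec z"] shift[of "slope_vec z"]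
    by (auto simp: Dom_scale \<sigma>_scale)
  have distr: "distr (count_space UNIV) (count_space UNIV) (pstep E b) = count_space UNIV" if "b \<in> S" for b
    by (rule distr_bij_count_space)
       (rule bij_betw_byWitness[where f' = "pstep_inv E b"],
         auto simp: pstep_inv_pstep pstep_pstep_inv snd_nz[OF that])
  have pos: "0 <= min (p a) (p a')" using p_pos[OF a] p_pos[OF a'] by simp
  have m: "g \<in> count_space UNIV \<rightarrow>\<^sub>M count_space UNIV" "h \<in> borel_measurable (count_space UNIV)"
     "Measurable.pred (count_space UNIV) P"
    for g :: "real option => real option" and h :: "real option => real" and P by simp_all
  note * = mean_operator_contraction[OF m(1) distr m(2) assms a a' neq m(1)
      pstep_inv_pstep[OF snd_nz[OF a]] m(2) m(3) De sh cov c rM M q pos min.cobounded1 min.cobounded2 refl]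
  show ?A by (rule *(1))
  have "(\<integral>x. (mean q (\<lambda>u. f (fold (pstep E) u x)))\<^sup>2 \<partial>count_space UNIV) <= (1 - ?D) * (\<integral>x. (f x)\<^sup>2 \<partial>count_space UNIV)"
    by (rule *(2))
  also have "\<dots> <= rate * (\<integral>x. (f x)\<^sup>2 \<partial>count_space UNIV)" unfolding rate_def by (intro mult_right_mono) auto
  finally show ?B .
qed

lemma mean_fold_Suc:
  "mean (q * Suc n) (\<lambda>u. f (fold g u x)) = mean q (\<lambda>u. mean (q * n) (\<lambda>w. f (fold g w (fold g u x))))"
  by (simp add: mean_append fold_append comp_def)

lemma plane_iterate:
  assumes [measurable]: "f \<in> borel_measurable lborel" and "integrable lborel (\<lambda>x. (f x)\<^sup>2)"
  shows "(\<lambda>x. mean (q * n) (\<lambda>u. f (fold (tstep E) u x))) \<in> borel_measurable lborel \<and>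
    integrable lborel (\<lambda>x. (mean (q * n) (\<lambda>u. f (fold (tstep E) u x)))\<^sup>2) \<and>
    (\<integral>x. (mean (q * n) (\<lambda>u. f (fold (tstep E) u x)))\<^sup>2 \<partial>lborel) <= rate ^ n * (\<integral>x. (f x)\<^sup>2 \<partial>lborel)"
proof (induction n)
  case 0
  then show ?case using assms by simp
next
  case (Suc n)
  have fold_meas: "fold (tstep E) u \<in> borel_measurable borel" for u
    by (induction u) (auto intro: measurable_comp tstep_measurable)
  have "(\<lambda>x. mean (q * Suc n) (\<lambda>u. f (fold (tstep E) u x))) \<in> borel_measurable lborel"
    unfolding mean_eq_sum using assms(1) fold_meas
    by (auto intro!: borel_measurable_sum borel_measurable_times intro: measurable_compose)
  moreover note plane_contraction[of "\<lambda>x. mean (q * n) (\<lambda>u. f (fold (tstep E) u x))"] Suc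
  moreover have "rate * (\<integral>x. (mean (q * n) (\<lambda>u. f (fold (tstep E) u x)))\<^sup>2 \<partial>lborel)
      <= rate * (rate ^ n * (\<integral>x. (f x)\<^sup>2 \<partial>lborel))" using Suc by (intro mult_left_mono rate_nonneg) auto
  ultimately show ?case unfolding mean_fold_Suc by (auto simp: mult.assoc)
qed

lemma projective_iterate:
  assumes "integrable (count_space UNIV) (\<lambda>x. (f x)\<^sup>2)"
  shows "integrable (count_space UNIV) (\<lambda>x. (mean (q * n) (\<lambda>u. f (fold (pstep E) u x)))\<^sup>2) \<and>
    (\<integral>x. (mean (q * n) (\<lambda>u. f (fold (pstep E) u x)))\<^sup>2 \<partial>count_space UNIV)
      <= rate ^ n * (\<integral>x. (f x)\<^sup>2 \<partial>count_space UNIV)"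
proof (induction n)
  case 0
  then show ?case using assms by simp
next
  case (Suc n)
  note projective_contraction[of "\<lambda>x. mean (q * n) (\<lambda>u. f (fold (pstep E) u x))"] Suc
  moreover have "rate * (\<integral>x. (mean (q * n) (\<lambda>u. f (fold (pstep E) u x)))\<^sup>2 \<partial>count_space UNIV)
      <= rate * (rate ^ n * (\<integral>x. (f x)\<^sup>2 \<partial>count_space UNIV))"
    using Suc by (intro mult_left_mono rate_nonneg) auto
  ultimately show ?case unfolding mean_fold_Suc by (auto simp: mult.assoc)
qed

lemma rate_power_small: "\<epsilon> > 0 ==> \<exists>n. rate ^ n < \<epsilon>" using real_arch_pow_inv[OF _ rate_less_1] by blast

text \<open>Average the indicator of the direction of y. Its value at the direction of x is the
  probability in question, and on a counting measure a single value is bounded by the L^2 norm,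
  which decays.\<close>

lemma directions_spread:
  assumes "\<epsilon> > 0"
  shows "\<exists>k. \<forall>x y. x \<noteq> 0 \<longrightarrow> y \<noteq> 0 \<longrightarrow> prob k (\<lambda>u. wedge (tact E u x) y = 0) <= \<epsilon>"
proof -
  obtain n where n: "rate ^ n < \<epsilon>\<^sup>2" using rate_power_small[of "\<epsilon>\<^sup>2"] assms by auto
  have "prob (q * n) (\<lambda>u. wedge (tact E u x) y = 0) <= \<epsilon>" if xy: "x \<noteq> 0" "y \<noteq> 0" for x y
  proof -
    define f where "f d = (indicator {slope y} d :: real)" for d
    define h where "h d = mean (q * n) (\<lambda>u. f (fold (pstep E) u d))" for d
    have f_sq: "(f d)\<^sup>2 = indicator {slope y} d" for d by (simp add: f_def indicator_def)
    have f_int: "integrable (count_space UNIV) (\<lambda>d. (f d)\<^sup>2)" unfolding f_sq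
      by (rule integrable_real_indicator) auto
    have f_val: "(\<integral>d. (f d)\<^sup>2 \<partial>count_space UNIV) = 1" unfolding f_sq by simp
    have h: "integrable (count_space UNIV) (\<lambda>d. (h d)\<^sup>2)" "(\<integral>d. (h d)\<^sup>2 \<partial>count_space UNIV) <= rate ^ n"
      using projective_iterate[OF f_int, of n] unfolding h_def f_val by auto
    have "prob (q * n) (\<lambda>u. wedge (tact E u x) y = 0) <= h (slope x)" unfolding prob_def h_def
    proof (rule mean_mono)
      fix u assume u: "u \<in> words (q * n)"
      then have nz: "\<forall>b\<in>set u. snd b \<noteq> 0" using snd_nz by (auto simp: words_def)
      have "slope (tact E u x) = slope y" if "wedge (tact E u x) y = 0"
        using that xy nz by (intro slope_eqI) (auto simp: tact_eq_0_iff)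
      then show "of_bool (wedge (tact E u x) y = 0) <= f (fold (pstep E) u (slope x))"
        using fold_pstep_slope[OF nz xy(1)] by (auto simp: f_def)
    qed
    moreover have "(h (slope x))\<^sup>2 <= \<epsilon>\<^sup>2"
    proof -
      have "(h (slope x))\<^sup>2 = (\<integral>d. (h (slope x))\<^sup>2 * indicator {slope x} d \<partial>count_space UNIV)" by simp
      also have "\<dots> <= (\<integral>d. (h d)\<^sup>2 \<partial>count_space UNIV)"
      proof (rule integral_mono)
        show "integrable (count_space UNIV) (\<lambda>d. (h (slope x))\<^sup>2 * indicator {slope x} d)"
          by (intro integrable_mult_right integrable_real_indicator) auto
      qed (use h(1) in \<open>auto simp: indicator_def\<close>)
      finally show ?thesis using h(2) n by linarith
    qed
    then have "h (slope x) <= \<epsilon>" by (rule power2_le_imp_le) (use assms in simp)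
    ultimately show ?thesis by linarith
  qed
  then show ?thesis by blast
qed

text \<open>If both basis vectors stay in the ball of radius R, then the ball of radius 1/(2R) stays
  in the unit ball. So the averaged indicator of the unit ball is at least this probability on a
  fixed small ball, while its L^2 norm decays.\<close>

lemma norms_spread:
  assumes "\<epsilon> > 0"
  shows "\<exists>n. prob n (\<lambda>u. norm (tact E u (1, 0)) <= R \<and> norm (tact E u (0, 1)) <= R) <= \<epsilon>"
proof -
  define R' where "R' = max R 1"
  define b where "b = 1 / (2 * R')"
  have b: "b > 0" by (simp add: b_def R'_def)
  define V where "V s = measure lborel (cball (0 :: real \<times> real) s)" for s
  have V: "V s > 0" if "s > 0" for s
    unfolding V_def using that content_cball_pos[of s "0 :: real \<times> real"] by simp
  obtain n where n: "rate ^ n < \<epsilon>\<^sup>2 * V b / V 1"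
    using rate_power_small[of "\<epsilon>\<^sup>2 * V b / V 1"] assms V[of 1] V[OF b] by auto
  define P where "P = prob (q * n) (\<lambda>u. norm (tact E u (1, 0)) <= R \<and> norm (tact E u (0, 1)) <= R)"
  define f where "f x = (indicator (cball 0 1) x :: real)" for x :: "real \<times> real"
  define h where "h x = mean (q * n) (\<lambda>u. f (fold (tstep E) u x))" for x
  have f_sq: "(f x)\<^sup>2 = indicator (cball 0 1) x" for x by (simp add: f_def indicator_def)
  have f_meas: "f \<in> borel_measurable lborel"
    unfolding f_def using borel_closed[OF closed_cball] by (simp add: borel_measurable_indicator)
  have f_int: "integrable lborel (\<lambda>x. (f x)\<^sup>2)" unfolding f_sq
    by (intro integrable_real_indicator) (use emeasure_lborel_cball_finite borel_closed[OF closed_cball] in auto)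
  have f_val: "(\<integral>x. (f x)\<^sup>2 \<partial>lborel) = V 1" unfolding f_sq V_def by simp
  have h: "integrable lborel (\<lambda>x. (h x)\<^sup>2)" "(\<integral>x. (h x)\<^sup>2 \<partial>lborel) <= rate ^ n * V 1"
    using plane_iterate[OF f_meas f_int, of n] unfolding h_def f_val by auto
  have P0: "0 <= P" unfolding P_def by (rule prob_nonneg)
  have P_le: "P <= h x" if x: "norm x <= b" for x unfolding P_def prob_def h_def
  proof (rule mean_mono)
    fix u
    have "norm (tact E u x) <= 1" if u: "norm (tact E u (1, 0)) <= R \<and> norm (tact E u (0, 1)) <= R"
    proof -
      have "tact E u x = fst x *\<^sub>R tact E u (1, 0) + snd x *\<^sub>R tact E u (0, 1)"
        unfolding tact_linear[symmetric] by simp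
      also have "norm \<dots> <= \<bar>fst x\<bar> * norm (tact E u (1, 0)) + \<bar>snd x\<bar> * norm (tact E u (0, 1))"
        by (rule norm_triangle_le) simp
      also have "\<dots> <= b * R' + b * R'"
        using u x b abs_fst_le[of x] abs_snd_le[of x] by (intro add_mono mult_mono) (auto simp: R'_def)
      also have "\<dots> = 1" by (simp add: b_def R'_def)
      finally show ?thesis .
    qed
    then show "of_bool (norm (tact E u (1, 0)) <= R \<and> norm (tact E u (0, 1)) <= R) <= f (fold (tstep E) u x)"
      by (auto simp: f_def tact_eq_fold[symmetric])
  qed
  have "P\<^sup>2 * V b = (\<integral>x. P\<^sup>2 * indicator (cball (0 :: real \<times> real) b) x \<partial>lborel)" by (simp add: V_def)
  also have "\<dots> <= (\<integral>x. (h x)\<^sup>2 \<partial>lborel)"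
  proof (rule integral_mono)
    show "integrable lborel (\<lambda>x. P\<^sup>2 * indicator (cball (0 :: real \<times> real) b) x)"
      by (intro integrable_mult_right integrable_real_indicator) (use emeasure_lborel_cball_finite borel_closed[OF closed_cball] in auto)
    show "P\<^sup>2 * indicator (cball 0 b) x <= (h x)\<^sup>2" for x
      using P_le[of x] P0 by (auto simp: indicator_def intro!: power_mono)
  qed (rule h(1))
  also have "\<dots> <= rate ^ n * V 1" by (rule h(2))
  also have "\<dots> <= \<epsilon>\<^sup>2 * V b" using n V[of 1] by (simp add: pos_less_divide_eq less_imp_le)
  finally have "P\<^sup>2 <= \<epsilon>\<^sup>2" using V[OF b] by simp
  then have "P <= \<epsilon>" by (rule power2_le_imp_le) (use assms in simp)
  then show ?thesis unfolding P_def by (rule exI)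
qed

end

section \<open>Uniform expansion of the transfer products\<close>

lemma (in alphabet) mean_swap: "mean m (\<lambda>u. mean n (\<lambda>w. f u w)) = mean n (\<lambda>w. mean m (\<lambda>u. f u w))"
  unfolding mean_eq_sum sum_distrib_left by (subst sum.swap) (simp add: mult.left_commute)

text \<open>After a step the quotient fst/snd is ((v - E)x - y)/(w^2 x), so changing v translates it
  by (v - v')/w^2. Two frames suffice: if the quotient s is at least r in modulus or infinite, the
  inverse step carries it to 1/(t - w^2 s), or to 0, which lies well inside the window.\<close>

lemma (in jacobi_letters) frames_of_diagonal_disorder:
  assumes "(v, w) \<in> S" "(v', w) \<in> S" "v' < v"
  obtains \<sigma> Dom c r M where "shifted_frames S p E (v, w) (v', w) \<sigma> Dom c r 2 M"
proof -
  have w: "w \<noteq> 0" using snd_nz[OF assms(1)] by simp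
  define c where "c = (v - v') / w\<^sup>2"
  define t where "t = v - E"
  have c: "c > 0" using w assms(3) by (simp add: c_def)
  obtain M0 :: nat where M0: "real M0 * c > 2 * (1 + (\<bar>t\<bar> + 2) / w\<^sup>2)" using c reals_Archimedean3 by blast
  \<comment> \<open>The half-width must be half a multiple of c, so it is fixed by an integer M0
    large enough to pass both thresholds.\<close>
  define r where "r = real M0 * c / 2"
  have "r > 1 + (\<bar>t\<bar> + 2) / w\<^sup>2" proof -
    have "y > 2 * (1 + x) ==> y / 2 > 1 + x" for x y :: real by simp
    then show ?thesis using M0 unfolding r_def by blast
  qed
  moreover have "(\<bar>t\<bar> + 2) / w\<^sup>2 > 0" using w by simp
  ultimately have r: "r > 1" "r > (\<bar>t\<bar> + 2) / w\<^sup>2" by linarith+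
  then have r2: "w\<^sup>2 * r > \<bar>t\<bar> + 2" using w by (simp add: divide_less_eq mult.commute)
  have M0pos: "M0 > 0" using r(1) by (cases M0) (auto simp: r_def)
  have "shifted_frames S p E (v, w) (v', w) (\<lambda>y. fst y / snd y) (\<lambda>y. snd y \<noteq> 0) c r 2 M0"
  proof (unfold_locales)
    show "(\<lambda>y. fst y / snd y) \<in> borel_measurable (borel :: (real \<times> real) measure)" by measurable
    show "Measurable.pred borel (\<lambda>y :: real \<times> real. snd y \<noteq> 0)" by measurable
    show "fst (tstep E (v, w) z) / snd (tstep E (v, w) z) = fst (tstep E (v', w) z) / snd (tstep E (v', w) z) + c"
      if "snd (tstep E (v, w) z) \<noteq> 0" for z
      using that w by (simp add: tstep_def c_def field_simps power2_eq_square)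
    show "\<exists>i<2. snd ((tstep_inv E (v, w) ^^ i) x) \<noteq> 0 \<and>
        \<bar>fst ((tstep_inv E (v, w) ^^ i) x) / snd ((tstep_inv E (v, w) ^^ i) x)\<bar> < r" if x: "x \<noteq> 0" for x
    proof (cases "snd x \<noteq> 0 \<and> \<bar>fst x / snd x\<bar> < r")
      case True
      then show ?thesis by (intro exI[of _ 0]) auto
    next
      case False
      define y where "y = tstep_inv E (v, w) x"
      have y: "fst y = snd x / w" "snd y = t * snd x / w - w * fst x" by (auto simp: y_def tstep_inv_def t_def)
      have "snd y \<noteq> 0 \<and> \<bar>fst y / snd y\<bar> < r"
      proof (cases "snd x = 0")
        case True
        then have "fst x \<noteq> 0" using x by (auto simp: prod_eq_iff)
        then show ?thesis using True w y r by simp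
      next
        case nz: False
        define s where "s = fst x / snd x"
        have s: "\<bar>s\<bar> >= r" using False nz by (simp add: s_def)
        have y': "snd y = snd x / w * (t - w\<^sup>2 * s)"
          using nz w by (simp add: y s_def field_simps power2_eq_square)
        have "w\<^sup>2 * r <= \<bar>w\<^sup>2 * s\<bar>" using s w by (simp add: abs_mult)
        then have d: "\<bar>t - w\<^sup>2 * s\<bar> > 2" using r2 by linarith
        then have "fst y / snd y = 1 / (t - w\<^sup>2 * s)" unfolding y' y(1) using nz w by simp
        then have "\<bar>fst y / snd y\<bar> < 1" using d by (simp add: abs_divide)
        moreover have "snd y \<noteq> 0" using d nz w y' by auto
        ultimately show ?thesis using r(1) by linarith
      qed
      then show ?thesis by (intro exI[of _ 1]) (simp add: y_def)
    qed
  qed (use assms w c M0pos in \<open>auto simp: tstep_def r_def\<close>)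
  then show thesis by (rule that)
qed

text \<open>After a step fst/snd carries the factor 1/w^2, so the logarithm of its modulus is
  translated when |w| changes. This coordinate is infinite on both axes. The inverse step carries a
  neighbourhood of one axis near the other, and that one, because v differs from E, into the open
  sector between them; hence three frames.\<close>

lemma (in jacobi_letters) frames_of_offdiagonal_disorder:
  assumes "(v, w) \<in> S" "(v, w') \<in> S" "\<bar>w\<bar> < \<bar>w'\<bar>" "v \<noteq> E"
  obtains \<sigma> Dom c r M where "shifted_frames S p E (v, w) (v, w') \<sigma> Dom c r 3 M"
proof -
  have w: "w \<noteq> 0" "w' \<noteq> 0" using snd_nz[OF assms(1)] snd_nz[OF assms(2)] by simp_all
  define t where "t = v - E"
  have t: "t \<noteq> 0" using assms by (simp add: t_def)
  define c where "c = 2 * (ln \<bar>w'\<bar> - ln \<bar>w\<bar>)"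
  have c: "c > 0" using w assms(3) by (simp add: c_def)
  \<comment> \<open>r0 gathers the lower bounds on r: those for the logarithms in
    \<open>core\<close>, and those for exp r when directions near an axis are compared.\<close>
  define r0 where "r0 = 1 + \<bar>ln (\<bar>t\<bar> / 2)\<bar> + \<bar>ln (3 * \<bar>t\<bar> / 2)\<bar> + 2 * w\<^sup>2 / \<bar>t\<bar> + 4 / \<bar>t\<bar> + 2 * \<bar>t\<bar> / w\<^sup>2"
  have r0_pos: "2 * w\<^sup>2 / \<bar>t\<bar> > 0" "4 / \<bar>t\<bar> > 0" "2 * \<bar>t\<bar> / w\<^sup>2 > 0" using w t by auto
  obtain M :: nat where M: "real M * c > 2 * r0" using c reals_Archimedean3 by blast
  define r where "r = real M * c / 2"
  have r_r0: "r > r0" using M by (simp add: r_def)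
  have r: "r > 1" "r > \<bar>ln (\<bar>t\<bar> / 2)\<bar>" "r > \<bar>ln (3 * \<bar>t\<bar> / 2)\<bar>"
    "r > 2 * w\<^sup>2 / \<bar>t\<bar>" "r > 4 / \<bar>t\<bar>" "r > 2 * \<bar>t\<bar> / w\<^sup>2"
    using r_r0 r0_pos abs_ge_zero[of "ln (\<bar>t\<bar> / 2)"] abs_ge_zero[of "ln (3 * \<bar>t\<bar> / 2)"]
    unfolding r0_def by linarith+
  define \<rho> where "\<rho> = exp r"
  have \<rho>r: "\<rho> > r" unfolding \<rho>_def using exp_gt_one[of r] exp_ge_add_one_self[of r] by linarith
  have \<rho>: "\<rho> > 0" "2 * w\<^sup>2 <= \<bar>t\<bar> * \<rho>" "4 <= \<bar>t\<bar> * \<rho>" "2 * \<bar>t\<bar> <= w\<^sup>2 * \<rho>"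
  proof -
    have "2 * w\<^sup>2 / \<bar>t\<bar> < \<rho>" "4 / \<bar>t\<bar> < \<rho>" "2 * \<bar>t\<bar> / w\<^sup>2 < \<rho>" using r(4-6) \<rho>r by linarith+
    then show "\<rho> > 0" "2 * w\<^sup>2 <= \<bar>t\<bar> * \<rho>" "4 <= \<bar>t\<bar> * \<rho>" "2 * \<bar>t\<bar> <= w\<^sup>2 * \<rho>"
      using t w by (auto simp: \<rho>_def field_simps)
  qed
  have Mpos: "M > 0" using r(1) by (cases M) (auto simp: r_def)
  define good where "good y \<longleftrightarrow> (fst y \<noteq> 0 \<and> snd y \<noteq> 0) \<and> \<bar>ln \<bar>fst y / snd y\<bar>\<bar> < r" for y :: "real \<times> real"
  \<comment> \<open>A direction close to the vertical axis has inverse image with quotient 1/(t -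
    w^2 s), whose modulus lies between 2/(3|t|) and 2/|t|.\<close>
  have core: "good (tstep_inv E (v, w) y)" if y: "snd y \<noteq> 0" "w\<^sup>2 * \<bar>fst y / snd y\<bar> <= \<bar>t\<bar> / 2" for y
  proof -
    define z where "z = tstep_inv E (v, w) y"
    define s where "s = fst y / snd y"
    have s: "\<bar>w\<^sup>2 * s\<bar> <= \<bar>t\<bar> / 2" using y by (simp add: s_def abs_mult)
    have z: "fst z = snd y / w" "snd z = snd y / w * (t - w\<^sup>2 * s)"
      using w y by (auto simp: z_def tstep_inv_def t_def s_def field_simps power2_eq_square)
    have lo: "\<bar>t\<bar> / 2 <= \<bar>t - w\<^sup>2 * s\<bar>" and hi: "\<bar>t - w\<^sup>2 * s\<bar> <= 3 * \<bar>t\<bar> / 2" using s by linarith+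
    have d: "t - w\<^sup>2 * s \<noteq> 0" using lo t by auto
    then have "fst z / snd z = 1 / (t - w\<^sup>2 * s)" using w y z by simp
    then have "ln \<bar>fst z / snd z\<bar> = - ln \<bar>t - w\<^sup>2 * s\<bar>" using d by (simp add: ln_div)
    moreover have "ln (\<bar>t\<bar> / 2) <= ln \<bar>t - w\<^sup>2 * s\<bar>" "ln \<bar>t - w\<^sup>2 * s\<bar> <= ln (3 * \<bar>t\<bar> / 2)"
      using lo hi t d by (auto intro!: ln_mono)
    ultimately have "\<bar>ln \<bar>fst z / snd z\<bar>\<bar> < r" using r(2,3) by linarith
    then show ?thesis using z w y d by (simp add: good_def flip: z_def)
  qed
  have "shifted_frames S p E (v, w) (v, w') (\<lambda>y. ln \<bar>fst y / snd y\<bar>) (\<lambda>y. fst y \<noteq> 0 \<and> snd y \<noteq> 0) c r 3 M"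
  proof (unfold_locales)
    show "(\<lambda>y. ln \<bar>fst y / snd y\<bar>) \<in> borel_measurable (borel :: (real \<times> real) measure)" by measurable
    show "Measurable.pred borel (\<lambda>y :: real \<times> real. fst y \<noteq> 0 \<and> snd y \<noteq> 0)" by measurable
    show "ln \<bar>fst (tstep E (v, w) z) / snd (tstep E (v, w) z)\<bar>
        = ln \<bar>fst (tstep E (v, w') z) / snd (tstep E (v, w') z)\<bar> + c"
      if "fst (tstep E (v, w) z) \<noteq> 0 \<and> snd (tstep E (v, w) z) \<noteq> 0" for z
    proof -
      define x where "x = (v - E) * fst z - snd z"
      have nz: "x \<noteq> 0" "fst z \<noteq> 0" using that w by (auto simp: tstep_def x_def)
      have "ln \<bar>x / b / (b * fst z)\<bar> = ln \<bar>x\<bar> - ln \<bar>fst z\<bar> - 2 * ln \<bar>b\<bar>" if "b \<noteq> 0" for b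
        using nz that by (simp add: abs_mult ln_div ln_mult)
      from this[OF w(1)] this[OF w(2)] show ?thesis by (simp add: tstep_def c_def flip: x_def)
    qed
    show "\<exists>i<3. (fst ((tstep_inv E (v, w) ^^ i) x) \<noteq> 0 \<and> snd ((tstep_inv E (v, w) ^^ i) x) \<noteq> 0) \<and>
        \<bar>ln \<bar>fst ((tstep_inv E (v, w) ^^ i) x) / snd ((tstep_inv E (v, w) ^^ i) x)\<bar>\<bar> < r" if x: "x \<noteq> 0" for x
    proof -
      define y where "y = tstep_inv E (v, w) x"
      have y: "fst y = snd x / w" "snd y = t * snd x / w - w * fst x" by (auto simp: y_def tstep_inv_def t_def)
      have "good x \<or> good y \<or> good (tstep_inv E (v, w) y)"
      proof (rule ccontr)
        assume bad: "\<not> ?thesis"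
        \<comment> \<open>Were x close to the vertical axis, y would be good by \<open>core\<close>.
          So a bad x is close to the horizontal axis, its inverse image y is close to the vertical
          one, and \<open>core\<close> applies to y.\<close>
        have large: "\<not> \<bar>fst x\<bar> * \<rho> <= \<bar>snd x\<bar>"
        proof
          assume A: "\<bar>fst x\<bar> * \<rho> <= \<bar>snd x\<bar>"
          then have nz: "snd x \<noteq> 0" using x \<rho>(1) by (auto simp: prod_eq_iff mult_le_0_iff)
          have "2 * w\<^sup>2 * \<bar>fst x\<bar> <= \<bar>t\<bar> * \<rho> * \<bar>fst x\<bar>" using \<rho>(2) by (intro mult_right_mono) auto
          also have "\<dots> <= \<bar>t\<bar> * \<bar>snd x\<bar>" using mult_left_mono[OF A, of "\<bar>t\<bar>"] by (simp add: mult_ac)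
          finally have "w\<^sup>2 * \<bar>fst x / snd x\<bar> <= \<bar>t\<bar> / 2" using nz by (simp add: abs_divide field_simps)
          then have "good y" unfolding y_def by (rule core[OF nz])
          then show False using bad by simp
        qed
        have B: "\<bar>snd x\<bar> * \<rho> <= \<bar>fst x\<bar>"
        proof (cases "fst x = 0 \<or> snd x = 0")
          case True
          then show ?thesis using large by auto
        next
          case False
          then have "r <= \<bar>ln \<bar>fst x / snd x\<bar>\<bar>" using bad by (auto simp: good_def)
          then consider "exp r <= \<bar>fst x / snd x\<bar>" | "\<bar>fst x / snd x\<bar> <= exp (- r)"
            using False by (smt (verit) exp_le_cancel_iff exp_ln divide_eq_0_iff)
          then show ?thesis
          proof cases
            case 1
            then show ?thesis using False by (simp add: \<rho>_def abs_divide field_simps)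
          next
            case 2
            then have "\<bar>fst x\<bar> * \<rho> <= \<bar>snd x\<bar>" using False by (simp add: \<rho>_def abs_divide exp_minus field_simps)
            with large show ?thesis by simp
          qed
        qed
        have x1: "fst x \<noteq> 0" using large B x \<rho>(1) by (auto simp: prod_eq_iff mult_le_0_iff)
        have "2 * \<bar>t\<bar> * \<bar>snd x\<bar> <= w\<^sup>2 * \<rho> * \<bar>snd x\<bar>" using \<rho>(4) by (intro mult_right_mono) auto
        also have "\<dots> <= w\<^sup>2 * \<bar>fst x\<bar>" using mult_left_mono[OF B, of "w\<^sup>2"] by (simp add: mult_ac)
        finally have 1: "\<bar>t * snd x\<bar> <= w\<^sup>2 * \<bar>fst x\<bar> / 2" by (simp add: abs_mult)
        have y2w: "snd y * w = t * snd x - w\<^sup>2 * fst x" using w by (simp add: y field_simps power2_eq_square)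
        have 2: "\<bar>snd y * w\<bar> >= w\<^sup>2 * \<bar>fst x\<bar> / 2"
        proof -
          have "\<bar>w\<^sup>2 * fst x\<bar> = w\<^sup>2 * \<bar>fst x\<bar>" by (simp add: abs_mult)
          then show ?thesis unfolding y2w using 1 by linarith
        qed
        have pos: "w\<^sup>2 * \<bar>fst x\<bar> > 0" using w x1 by simp
        then have nz: "snd y \<noteq> 0" using 2 by auto
        have "\<bar>fst y / snd y\<bar> = \<bar>snd x\<bar> / \<bar>snd y * w\<bar>" using w by (simp add: y(1) abs_mult abs_divide mult.commute)
        also have "\<dots> <= \<bar>snd x\<bar> / (w\<^sup>2 * \<bar>fst x\<bar> / 2)" using 2 pos by (intro divide_left_mono mult_pos_pos) linarith+
        finally have "w\<^sup>2 * \<bar>fst y / snd y\<bar> <= w\<^sup>2 * (\<bar>snd x\<bar> / (w\<^sup>2 * \<bar>fst x\<bar> / 2))"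
          by (intro mult_left_mono) auto
        also have "\<dots> = 2 * \<bar>snd x\<bar> / \<bar>fst x\<bar>" using w x1 by (simp add: field_simps)
        also have "\<dots> <= \<bar>t\<bar> / 2"
        proof -
          have "4 * \<bar>snd x\<bar> <= \<bar>t\<bar> * \<rho> * \<bar>snd x\<bar>" using \<rho>(3) by (intro mult_right_mono) auto
          also have "\<dots> <= \<bar>t\<bar> * \<bar>fst x\<bar>" using mult_left_mono[OF B, of "\<bar>t\<bar>"] by (simp add: mult_ac)
          finally show ?thesis using x1 by (simp add: field_simps)
        qed
        finally have "good (tstep_inv E (v, w) y)" by (rule core[OF nz])
        with bad show False by simp
      qed
      then obtain i :: nat where "i < 3" "good ((tstep_inv E (v, w) ^^ i) x)"
      proof (elim disjE)
        assume "good x" then show thesis using that[of 0] by simp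
      next
        assume "good y" then show thesis using that[of 1] by (simp add: y_def)
      next
        assume "good (tstep_inv E (v, w) y)" then show thesis using that[of 2] by (simp add: y_def numeral_2_eq_2)
      qed
      then show ?thesis by (auto simp: good_def)
    qed
  qed (use assms w c Mpos in \<open>auto simp: tstep_def r_def\<close>)
  then show thesis by (rule that)
qed

section \<open>From spreading to uniform exponential expansion\<close>

lemma continuous_on_tact:
  assumes "continuous_on A f" "continuous_on A g"
  shows "continuous_on A (\<lambda>z. tact (f z) u (g z))" using assms
proof (induction u arbitrary: g)
  case (Cons a u)
  have "continuous_on A (\<lambda>z. tstep (f z) a (g z))"
    unfolding tstep_def divide_inverse by (intro continuous_intros Cons.prems)
  from Cons.IH[OF Cons.prems(1) this] show ?case by simp
qed simp

text \<open>The inverse of a unimodular 2x2 matrix has the same entries up to sign and position. So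
  if one column of the product is long, a column of its inverse is long too, and this column,
  normalised, is strongly contracted.\<close>

lemma exists_contracted_vector:
  assumes "\<forall>a\<in>set u. snd a \<noteq> 0" and "b = max (norm (tact E u (1, 0))) (norm (tact E u (0, 1)))"
  obtains x where "norm x = 1" "norm (tact E u x) * b <= 2"
proof -
  define P Q where "P = tact E u (1, 0)" and "Q = tact E u (0, 1)"
  have PQ: "wedge P Q = 1" unfolding P_def Q_def wedge_tact[OF assms(1)] by (simp add: wedge_def)
  have lin: "tact E u z = fst z *\<^sub>R P + snd z *\<^sub>R Q" for z
    unfolding P_def Q_def tact_linear[symmetric] by simp
  define z1 z2 where "z1 = (snd Q, - snd P)" and "z2 = (- fst Q, fst P)"
  have z: "tact E u z1 = (1, 0)" "tact E u z2 = (0, 1)"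
    using PQ by (auto simp: lin z1_def z2_def prod_eq_iff wedge_def algebra_simps)
  have "b <= 2 * norm z1 \<or> b <= 2 * norm z2"
  proof -
    have "b = norm P \<or> b = norm Q" using assms(2) by (auto simp: P_def Q_def max_def)
    moreover have "norm P <= norm z1 + norm z2" "norm Q <= norm z1 + norm z2"
      using norm_le_abs_add[of P] norm_le_abs_add[of Q] abs_fst_le[of z1] abs_fst_le[of z2] abs_snd_le[of z1] abs_snd_le[of z2]
      by (auto simp: z1_def z2_def)
    ultimately show ?thesis by linarith
  qed
  then obtain z where z': "b <= 2 * norm z" "norm (tact E u z) = 1"
    using z by (metis norm_Pair abs_one norm_one norm_zero power_one real_sqrt_one add_0 add.right_neutral zero_power2 real_norm_def abs_zero)
  have "z \<noteq> 0" using z'(2) lin[of z] by auto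
  then have nz: "norm z > 0" by simp
  show thesis
  proof (rule that)
    show "norm ((1 / norm z) *\<^sub>R z) = 1" using nz by simp
    have "norm (tact E u ((1 / norm z) *\<^sub>R z)) = 1 / norm z" using z'(2) by (simp add: tact_scale)
    then show "norm (tact E u ((1 / norm z) *\<^sub>R z)) * b <= 2"
      unfolding \<open>norm (tact E u ((1 / norm z) *\<^sub>R z)) = 1 / norm z\<close> using z'(1) nz by (simp add: field_simps)
  qed
qed

text \<open>Area is conserved: the square of |z| is the wedge of z with its quarter turn, hence of
  their images, and the image of the quarter turn has norm at most 2b|z|.\<close>

lemma norm_tact_ge:
  assumes "\<forall>a\<in>set u. snd a \<noteq> 0" and "b = max (norm (tact E u (1, 0))) (norm (tact E u (0, 1)))"
  shows "norm z <= 2 * b * norm (tact E u z)" and "b >= 1"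
proof -
  define P Q where "P = tact E u (1, 0)" and "Q = tact E u (0, 1)"
  have PQ: "wedge P Q = 1" unfolding P_def Q_def wedge_tact[OF assms(1)] by (simp add: wedge_def)
  have b: "norm P <= b" "norm Q <= b" "b >= 0" using assms(2) by (auto simp: P_def Q_def le_max_iff_disj)
  have "1 <= norm P * norm Q" using abs_wedge_le[of P Q] PQ by simp
  also have "\<dots> <= b * b" using b by (intro mult_mono) auto
  finally show "b >= 1" using b by (metis abs_le_square_iff abs_of_nonneg power2_eq_square abs_one one_power2)
  define y where "y = (- snd z, fst z)"
  have ny: "norm y = norm z" by (cases z) (simp add: y_def norm_Pair add.commute)
  have "tact E u y = fst y *\<^sub>R P + snd y *\<^sub>R Q" unfolding P_def Q_def tact_linear[symmetric] by simp
  also have "norm \<dots> <= \<bar>fst y\<bar> * norm P + \<bar>snd y\<bar> * norm Q" by (rule norm_triangle_le) simp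
  also have "\<dots> <= norm z * b + norm z * b"
    using b abs_fst_le[of y] abs_snd_le[of y] ny by (intro add_mono mult_mono) auto
  finally have 1: "norm (tact E u y) <= 2 * b * norm z" by simp
  have "(norm z)\<^sup>2 = wedge z y" unfolding norm_prod_sq by (simp add: wedge_def y_def power2_eq_square)
  also have "\<dots> = wedge (tact E u z) (tact E u y)" by (simp add: wedge_tact[OF assms(1)])
  also have "\<dots> <= norm (tact E u z) * norm (tact E u y)" using abs_wedge_le abs_le_D1 by blast
  also have "\<dots> <= norm (tact E u z) * (2 * b * norm z)" by (intro mult_left_mono 1) auto
  finally show "norm z <= 2 * b * norm (tact E u z)"
    by (cases "norm z = 0") (auto simp: power2_eq_square mult_ac b mult_le_cancel_left_pos)
qed

text \<open>The package on which the sequel rests, uniform over an interval of energies. Decay of a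
  negative moment of the norm yields growth with exponentially small exceptional probability; K
  bounds the cost of a single step or of undoing it.\<close>

locale expanding = jacobi_letters +
  fixes lo hi K s C \<kappa> :: real
  assumes lo_hi: "lo < hi" and K: "K >= 1"
    and norm_tstep_le: "\<And>a E x. a \<in> S ==> E \<in> {lo..hi} ==> norm (tstep E a x) <= K * norm x"
    and norm_le_tstep: "\<And>a E x. a \<in> S ==> E \<in> {lo..hi} ==> norm x <= K * norm (tstep E a x)"
    and snd_le: "\<And>a. a \<in> S ==> \<bar>snd a\<bar> <= K" and inverse_snd_le: "\<And>a. a \<in> S ==> \<bar>1 / snd a\<bar> <= K"
    and s: "0 < s" "s <= 1" and \<kappa>: "0 < \<kappa>" and C: "C >= 1"
    and expansion: "\<And>E x n. E \<in> {lo..hi} ==> x \<noteq> 0 ==>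
      mean n (\<lambda>u. norm (tact E u x) powr (- s)) <= C * exp (- \<kappa> * n) * norm x powr (- s)"

context jacobi_letters
begin

lemma words_nz: "u \<in> words n ==> \<forall>a\<in>set u. snd a \<noteq> 0" using snd_nz by (auto simp: words_def)

lemma step_bounds:
  obtains K where "K >= 1" "\<And>a E x. a \<in> S ==> \<bar>E - E0\<bar> <= 1 ==> norm (tstep E a x) <= K * norm x"
    "\<And>a E x. a \<in> S ==> \<bar>E - E0\<bar> <= 1 ==> norm x <= K * norm (tstep E a x)"
    "\<And>a. a \<in> S ==> \<bar>snd a\<bar> <= K" "\<And>a. a \<in> S ==> \<bar>1 / snd a\<bar> <= K"
proof -
  define k where "k a = (\<bar>fst a\<bar> + \<bar>E0\<bar> + 3) / \<bar>snd a\<bar> + \<bar>snd a\<bar>" for a :: "real \<times> real"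
  define K where "K = 1 + (\<Sum>a\<in>S. k a)"
  have k0: "k a >= 0" for a by (auto simp: k_def)
  have kK: "k a <= K" if "a \<in> S" for a unfolding K_def using member_le_sum[OF that, of k] k0 fin_S by simp
  have b1: "norm (tstep E a x) <= k a * norm x" and b2: "norm (tstep_inv E a x) <= k a * norm x"
    if a: "a \<in> S" and E: "\<bar>E - E0\<bar> <= 1" for a E x
  proof -
    define w where "w = \<bar>snd a\<bar>"
    have w: "w > 0" using snd_nz[OF a] by (simp add: w_def)
    have t: "\<bar>fst a - E\<bar> <= \<bar>fst a\<bar> + \<bar>E0\<bar> + 1" using E by linarith
    have n: "\<bar>fst x\<bar> <= norm x" "\<bar>snd x\<bar> <= norm x" by (rule abs_fst_le abs_snd_le)+
    have tn: "\<bar>(fst a - E) * y\<bar> <= (\<bar>fst a\<bar> + \<bar>E0\<bar> + 1) * norm x" if "\<bar>y\<bar> <= norm x" for y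
      unfolding abs_mult using t that by (intro mult_mono) auto
    have "\<bar>(fst a - E) * fst x - snd x\<bar> <= (\<bar>fst a\<bar> + \<bar>E0\<bar> + 3) * norm x"
      using tn[OF n(1)] n(2) by (simp add: algebra_simps)
    then have "\<bar>((fst a - E) * fst x - snd x) / snd a\<bar> <= (\<bar>fst a\<bar> + \<bar>E0\<bar> + 3) * norm x / w"
      using w by (simp add: w_def divide_right_mono)
    moreover have "\<bar>snd a * fst x\<bar> <= w * norm x" using n w by (simp add: w_def abs_mult mult_left_mono)
    moreover have "norm (tstep E a x) <= \<bar>((fst a - E) * fst x - snd x) / snd a\<bar> + \<bar>snd a * fst x\<bar>"
      using norm_le_abs_add[of "tstep E a x"] by (simp add: tstep_def)
    ultimately show "norm (tstep E a x) <= k a * norm x" by (simp add: k_def w_def algebra_simps add_divide_distrib)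
    have "\<bar>(fst a - E) * snd x / snd a\<bar> <= (\<bar>fst a\<bar> + \<bar>E0\<bar> + 1) * norm x / w"
      using tn[OF n(2)] w by (simp add: w_def divide_right_mono)
    moreover have "\<bar>snd x / snd a\<bar> <= norm x / w" using n w by (simp add: w_def divide_right_mono)
    moreover have "\<bar>snd a * fst x\<bar> <= w * norm x" using n w by (simp add: w_def abs_mult mult_left_mono)
    moreover have "norm (tstep_inv E a x) <= \<bar>snd x / snd a\<bar> + \<bar>(fst a - E) * snd x / snd a - snd a * fst x\<bar>"
      using norm_le_abs_add[of "tstep_inv E a x"] by (simp add: tstep_inv_def)
    moreover have "norm x / w >= 0" using w by simp
    moreover have "k a * norm x = (\<bar>fst a\<bar> + \<bar>E0\<bar> + 1) * norm x / w + 2 * (norm x / w) + w * norm x"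
      using w by (simp add: k_def w_def[symmetric] field_simps)
    ultimately show "norm (tstep_inv E a x) <= k a * norm x" by linarith
  qed
  show thesis
  proof (rule that[of K])
    show "K >= 1" using sum_nonneg[of S k] k0 by (simp add: K_def)
    fix a assume a: "a \<in> S"
    have w: "\<bar>snd a\<bar> > 0" using snd_nz[OF a] by simp
    have "1 / \<bar>snd a\<bar> <= (\<bar>fst a\<bar> + \<bar>E0\<bar> + 3) / \<bar>snd a\<bar>" using w by (intro divide_right_mono) auto
    then have "1 / \<bar>snd a\<bar> <= k a" using w by (simp add: k_def)
    then show "\<bar>1 / snd a\<bar> <= K" using kK[OF a] by simp
    have "(\<bar>fst a\<bar> + \<bar>E0\<bar> + 3) / \<bar>snd a\<bar> >= 0" by simp
    then have "\<bar>snd a\<bar> <= k a" unfolding k_def by linarith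
    then show "\<bar>snd a\<bar> <= K" using kK[OF a] by simp
    fix E x assume E: "\<bar>E - E0\<bar> <= 1"
    show "norm (tstep E a x) <= K * norm x"
      using b1[OF a E, of x] mult_right_mono[OF kK[OF a] norm_ge_zero[of x]] by linarith
    show "norm x <= K * norm (tstep E a x)"
      using b2[OF a E, of "tstep E a x"] mult_right_mono[OF kK[OF a] norm_ge_zero[of "tstep E a x"]]
      by (simp add: tstep_inv_tstep[OF snd_nz[OF a]])
  qed
qed

lemma norm_tact_bounds:
  assumes "K >= 1" "set u \<subseteq> S" "\<And>a x. a \<in> S ==> norm (tstep E a x) <= K * norm x"
    "\<And>a x. a \<in> S ==> norm x <= K * norm (tstep E a x)"
  shows "norm (tact E u x) <= K ^ length u * norm x" "norm x <= K ^ length u * norm (tact E u x)" using assms(2)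
proof (induction u arbitrary: x)
  case (Cons a u)
  have K0: "K ^ length u >= 0" using assms(1) by simp
  {
    case 1
    have "norm (tact E (a # u) x) <= K ^ length u * norm (tstep E a x)" using Cons.IH(1) 1 by simp
    also have "\<dots> <= K ^ length u * (K * norm x)" using assms(3) 1 K0 by (intro mult_left_mono) auto
    finally show ?case by (simp add: mult_ac)
  next
    case 2
    have "norm x <= K * norm (tstep E a x)" using assms(4) 2 by auto
    also have "\<dots> <= K * (K ^ length u * norm (tact E u (tstep E a x)))"
      using Cons.IH(2)[of "tstep E a x"] 2 assms(1) by (intro mult_left_mono) auto
    finally show ?case by (simp add: mult_ac)
  }
qed simp_all

text \<open>Upgrades exact coincidence to closeness by compactness. Probabilities of thresholds are
  not continuous, so the argument runs over the finitely many sets of words of weight above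
  \<epsilon>: on none of them can the continuous sum of the wedges vanish.\<close>

lemma directions_separated:
  assumes "\<And>x y. x \<noteq> 0 ==> y \<noteq> 0 ==> prob k (\<lambda>u. wedge (tact E u x) y = 0) <= \<epsilon>"
  obtains \<eta> where "0 < \<eta>" "\<And>x y. norm x = 1 ==> norm y = 1 ==> prob k (\<lambda>u. \<bar>wedge (tact E u x) y\<bar> < \<eta>) <= \<epsilon>"
proof -
  define big where "big = {U. U \<subseteq> words k \<and> (\<Sum>u\<in>U. weight u) > \<epsilon>}"
  have fin: "finite big" by (rule finite_subset[of _ "Pow (words k)"]) (auto simp: big_def finite_words)
  have finU: "finite U" if "U \<in> big" for U using that finite_words finite_subset by (auto simp: big_def)
  have prob_sum: "prob k P = (\<Sum>u | u \<in> words k \<and> P u. weight u)" for P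
    unfolding prob_def mean_eq_sum of_bool_def
    by (simp add: if_distrib sum.If_cases finite_words Int_def cong: if_cong)
  define g where "g U z = (\<Sum>u\<in>U. \<bar>wedge (tact E u (fst z)) (snd z)\<bar>)" for U and z :: "(real \<times> real) \<times> (real \<times> real)"
  define X where "X = (sphere 0 1 :: (real \<times> real) set) \<times> (sphere 0 1 :: (real \<times> real) set)"
  have X: "compact X" "X \<noteq> {}"
  proof -
    show "compact X" unfolding X_def by (intro compact_Times compact_sphere)
    have "(1, 0) \<in> sphere (0 :: real \<times> real) 1" by (simp add: norm_Pair)
    then show "X \<noteq> {}" by (auto simp: X_def)
  qed
  have "\<exists>m>0. \<forall>z\<in>X. m <= g U z" if U: "U \<in> big" for U
  proof -
    have "continuous_on X (g U)" unfolding g_def wedge_def by (intro continuous_intros continuous_on_tact)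
    then obtain z where z: "z \<in> X" "\<forall>y\<in>X. g U z <= g U y" using continuous_attains_inf[OF X] by blast
    have nz: "fst z \<noteq> 0" "snd z \<noteq> 0" using z(1) by (auto simp: X_def)
    have "g U z \<noteq> 0"
    proof
      assume "g U z = 0"
      then have "\<forall>u\<in>U. wedge (tact E u (fst z)) (snd z) = 0"
        using finU[OF U] by (simp add: g_def sum_nonneg_eq_0_iff)
      then have "(\<Sum>u\<in>U. weight u) <= (\<Sum>u | u \<in> words k \<and> wedge (tact E u (fst z)) (snd z) = 0. weight u)"
        using U by (intro sum_mono2) (auto simp: big_def finite_words less_imp_le dest: weight_pos)
      also have "\<dots> <= \<epsilon>" using assms[OF nz] by (simp add: prob_sum)
      finally show False using U by (simp add: big_def)
    qed
    moreover have "g U z >= 0" unfolding g_def by (intro sum_nonneg) auto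
    ultimately show ?thesis using z by (intro exI[of _ "g U z"]) auto
  qed
  then obtain m where m: "\<And>U. U \<in> big ==> m U > 0" "\<And>U z. U \<in> big ==> z \<in> X ==> m U <= g U z" by metis
  \<comment> \<open>Division by card U + 1 makes the sum over U fall strictly below its minimum when
    all its wedges are below \<eta>; the inserted 1 covers the case of no such U.\<close>
  define \<eta> where "\<eta> = Min (insert 1 ((\<lambda>U. m U / (card U + 1)) ` big))"
  have \<eta>: "\<eta> > 0" unfolding \<eta>_def using fin m(1) by (subst Min_gr_iff) (auto intro!: divide_pos_pos)
  show thesis
  proof (rule that[OF \<eta>], rule ccontr)
    fix x y :: "real \<times> real"
    assume xy: "norm x = 1" "norm y = 1" and neg: "\<not> prob k (\<lambda>u. \<bar>wedge (tact E u x) y\<bar> < \<eta>) <= \<epsilon>"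
    define U where "U = {u \<in> words k. \<bar>wedge (tact E u x) y\<bar> < \<eta>}"
    have U: "U \<in> big" using neg by (auto simp: big_def U_def prob_sum)
    have "m U <= g U (x, y)" using xy by (intro m(2)[OF U]) (auto simp: X_def)
    also have "\<dots> <= (\<Sum>u\<in>U. \<eta>)" unfolding g_def by (intro sum_mono) (auto simp: U_def)
    also have "\<dots> = card U * \<eta>" by simp
    also have "\<dots> <= card U * (m U / (card U + 1))"
      unfolding \<eta>_def using fin U by (intro mult_left_mono Min_le) auto
    also have "\<dots> = m U * (card U / (card U + 1))" by simp
    also have "\<dots> < m U * 1" using m(1)[OF U] by (intro mult_strict_left_mono) (auto simp: field_simps)
    finally show False by simp
  qed
qed

text \<open>At most one direction is contracted by a given product.  Since the directions reached after
  \<open>k\<close> steps do not concentrate, at least three quarters of them are expanded.\<close>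
lemma log_expansion:
  assumes "\<And>x y. x \<noteq> 0 ==> y \<noteq> 0 ==> prob k (\<lambda>u. wedge (tact E u x) y = 0) <= 1 / 4"
    and "\<And>R. \<exists>n. prob n (\<lambda>u. norm (tact E u (1, 0)) <= R \<and> norm (tact E u (0, 1)) <= R) <= 1 / 2"
  obtains n where "\<And>x. norm x = 1 ==> mean n (\<lambda>u. ln (norm (tact E u x))) >= 2"
proof -
  obtain \<eta> where \<eta>: "\<eta> > 0" "\<And>x y. norm x = 1 ==> norm y = 1 ==> prob k (\<lambda>u. \<bar>wedge (tact E u x) y\<bar> < \<eta>) <= 1 / 4"
    using directions_separated[OF assms(1)] by blast
  obtain K where K: "K >= 1" "\<And>a E' x. a \<in> S ==> \<bar>E' - E\<bar> <= 1 ==> norm (tstep E' a x) <= K * norm x"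
    "\<And>a E' x. a \<in> S ==> \<bar>E' - E\<bar> <= 1 ==> norm x <= K * norm (tstep E' a x)" by (rule step_bounds[of E]) blast
  \<comment> \<open>c0 collects the losses: the separation \<eta>/2, a factor 2, and the possible
    contraction during the first k letters. R below is tuned so that half of (ln R)/2, minus c0,
    equals exactly 2.\<close>
  define c0 where "c0 = \<bar>ln (\<eta> / 2)\<bar> + ln 2 + k * ln K"
  have c0: "c0 >= 0" using K(1) by (simp add: c0_def)
  define R where "R = exp (4 * c0 + 8)"
  obtain n where n: "prob n (\<lambda>u. norm (tact E u (1, 0)) <= R \<and> norm (tact E u (0, 1)) <= R) <= 1 / 2"
    using assms(2) by blast
  define b where "b w = max (norm (tact E w (1, 0))) (norm (tact E w (0, 1)))" for w
  have "mean (k + n) (\<lambda>u. ln (norm (tact E u x))) >= 2" if x: "norm x = 1" for x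
  proof -
    have inner: "mean k (\<lambda>u. ln (norm (tact E w (tact E u x)))) >= ln (b w) / 2 - c0" if w: "w \<in> words n" for w
    proof -
      have nzw: "\<forall>a\<in>set w. snd a \<noteq> 0" using words_nz[OF w] .
      have b1: "b w >= 1" using norm_tact_ge(2)[OF nzw b_def] .
      obtain y where y: "norm y = 1" "norm (tact E w y) * b w <= 2"
        using exists_contracted_vector[OF nzw b_def] by blast
      \<comment> \<open>The block w fixes its contracted direction y; the earlier, independent
        letters u randomise the incoming direction. Missing y gains ln (b w), hitting it loses as
        much, and hits have probability at most 1/4.\<close>
      have ptw: "ln (b w) - c0 - 2 * ln (b w) * of_bool (\<bar>wedge (tact E u x) y\<bar> < \<eta>) <= ln (norm (tact E w (tact E u x)))"
        if u: "u \<in> words k" for u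
      proof -
        define z where "z = tact E u x"
        have "norm x <= K ^ k * norm z"
          using norm_tact_bounds(2)[OF K(1), of u E x] u K(2,3)[of _ E] by (auto simp: words_def z_def)
        then have z: "1 <= K ^ k * norm z" using x by simp
        then have znz: "norm z > 0" using K(1) by (cases "norm z = 0") auto
        have Tnz: "norm (tact E w z) > 0" using znz tact_eq_0_iff[OF nzw] by simp
        have lnz: "ln (norm z) >= - k * ln K"
        proof -
          have "0 <= ln (K ^ k * norm z)" using z by (intro ln_ge_zero) auto
          then show ?thesis using znz K(1) by (simp add: ln_mult ln_realpow)
        qed
        show ?thesis
        proof (cases "\<bar>wedge z y\<bar> < \<eta>")
          case True
          have "norm z <= 2 * b w * norm (tact E w z)" using norm_tact_ge(1)[OF nzw b_def] .
          then have "ln (norm z) <= ln (2 * b w * norm (tact E w z))" using znz by (intro ln_mono) auto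
          also have "\<dots> = ln 2 + ln (b w) + ln (norm (tact E w z))" using b1 Tnz by (simp add: ln_mult)
          finally show ?thesis using True lnz by (simp add: z_def c0_def)
        next
          case False
          have "\<eta> <= \<bar>wedge z y\<bar>" using False by simp
          also have "\<dots> = \<bar>wedge (tact E w z) (tact E w y)\<bar>" by (simp add: wedge_tact[OF nzw])
          also have "\<dots> <= norm (tact E w z) * norm (tact E w y)" by (rule abs_wedge_le)
          finally have "\<eta> * b w <= norm (tact E w z) * (norm (tact E w y) * b w)"
            using b1 by (simp add: mult.assoc[symmetric] mult_right_mono)
          also have "\<dots> <= norm (tact E w z) * 2" by (intro mult_left_mono y) auto
          finally have "(\<eta> / 2) * b w <= norm (tact E w z)" by simp
          then have "ln ((\<eta> / 2) * b w) <= ln (norm (tact E w z))" using \<eta>(1) b1 by (intro ln_mono) auto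
          moreover have "ln ((\<eta> / 2) * b w) = ln (\<eta> / 2) + ln (b w)" using \<eta>(1) b1 by (intro ln_mult_pos) auto
          moreover have "0 <= real k * ln K" "0 <= ln (2 :: real)" using K(1) by auto
          ultimately have "ln (b w) - c0 <= ln (norm (tact E w z))" unfolding c0_def by linarith
          then show ?thesis using False by (simp add: z_def)
        qed
      qed
      have "ln (b w) / 2 - c0 <= ln (b w) - c0 - 2 * ln (b w) * prob k (\<lambda>u. \<bar>wedge (tact E u x) y\<bar> < \<eta>)"
      proof -
        have "ln (b w) * prob k (\<lambda>u. \<bar>wedge (tact E u x) y\<bar> < \<eta>) <= ln (b w) * (1 / 4)"
          using \<eta>(2)[OF x y(1)] b1 by (intro mult_left_mono) auto
        then show ?thesis by simp
      qed
      also have "\<dots> = mean k (\<lambda>u. ln (b w) - c0 - 2 * ln (b w) * of_bool (\<bar>wedge (tact E u x) y\<bar> < \<eta>))"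
        unfolding prob_def by (simp only: mean_diff mean_cmult mean_const)
      also have "\<dots> <= mean k (\<lambda>u. ln (norm (tact E w (tact E u x))))" by (rule mean_mono[OF ptw])
      finally show ?thesis .
    qed
    have "2 <= mean n (\<lambda>w. of_bool (\<not> (norm (tact E w (1, 0)) <= R \<and> norm (tact E w (0, 1)) <= R)) * (ln R / 2) - c0)"
    proof -
      have "1 / 2 * (ln R / 2) <= prob n (\<lambda>w. \<not> (norm (tact E w (1, 0)) <= R \<and> norm (tact E w (0, 1)) <= R)) * (ln R / 2)"
        using n c0 unfolding prob_not by (intro mult_right_mono) (auto simp: R_def)
      then show ?thesis unfolding mean_diff mean_const mean_multc prob_def[symmetric] by (simp add: R_def)
    qed
    also have "\<dots> <= mean n (\<lambda>w. ln (b w) / 2 - c0)"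
    proof (rule mean_mono)
      fix w assume w: "w \<in> words n"
      have b1: "b w >= 1" using norm_tact_ge(2)[OF words_nz[OF w] b_def] .
      have "ln R <= ln (b w)" if "\<not> (norm (tact E w (1, 0)) <= R \<and> norm (tact E w (0, 1)) <= R)"
        using that by (intro ln_mono) (auto simp: b_def R_def)
      then show "of_bool (\<not> (norm (tact E w (1, 0)) <= R \<and> norm (tact E w (0, 1)) <= R)) * (ln R / 2) - c0 <= ln (b w) / 2 - c0"
        using b1 by (auto simp: of_bool_def)
    qed
    also have "\<dots> <= mean n (\<lambda>w. mean k (\<lambda>u. ln (norm (tact E w (tact E u x)))))" by (rule mean_mono[OF inner])
    also have "\<dots> = mean (k + n) (\<lambda>u. ln (norm (tact E u x)))"
      unfolding mean_append by (subst mean_swap) (simp add: tact_append)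
    finally show ?thesis .
  qed
  then show thesis by (rule that)
qed

text \<open>Uniform continuity keeps the mean logarithm above 1 for nearby energies. For small s a
  second order expansion then makes a negative moment contract over one block, and homogeneity in
  the vector allows blocks to be iterated.\<close>

lemma expanding_of_log_expansion:
  assumes "\<And>x. norm x = 1 ==> mean n (\<lambda>u. ln (norm (tact E0 u x))) >= 2"
  obtains \<epsilon> K s C \<kappa> where "\<epsilon> > 0" "expanding S p (E0 - \<epsilon>) (E0 + \<epsilon>) K s C \<kappa>"
proof -
  obtain K where K: "K >= 1" "\<And>a E x. a \<in> S ==> \<bar>E - E0\<bar> <= 1 ==> norm (tstep E a x) <= K * norm x"
    "\<And>a E x. a \<in> S ==> \<bar>E - E0\<bar> <= 1 ==> norm x <= K * norm (tstep E a x)"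
    "\<And>a. a \<in> S ==> \<bar>snd a\<bar> <= K" "\<And>a. a \<in> S ==> \<bar>1 / snd a\<bar> <= K" by (rule step_bounds[of E0]) blast
  have npos: "n > 0" using assms[of "(1, 0)"] by (cases n) (auto simp: norm_Pair)
  have tb: "norm (tact E u x) <= K ^ length u * norm x" "norm x <= K ^ length u * norm (tact E u x)"
    if "set u \<subseteq> S" "\<bar>E - E0\<bar> <= 1" for u E x using norm_tact_bounds[OF K(1) that(1) K(2,3)] that(2) by auto
  define G where "G E x = mean n (\<lambda>u. ln (norm (tact E u x)))" for E x
  define X where "X = {E0 - 1..E0 + 1} \<times> (sphere 0 1 :: (real \<times> real) set)"
  have "compact X" unfolding X_def by (intro compact_Times compact_sphere compact_Icc)
  moreover have "continuous_on X (\<lambda>z. G (fst z) (snd z))" unfolding G_def mean_eq_sum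
  proof (intro continuous_intros continuous_on_tact)
    show "\<forall>z\<in>X. norm (tact (fst z) u (snd z)) \<noteq> 0" if "u \<in> words n" for u
      using tact_eq_0_iff[OF words_nz[OF that]] by (auto simp: X_def)
  qed
  ultimately have "uniformly_continuous_on X (\<lambda>z. G (fst z) (snd z))"
    by (rule compact_uniformly_continuous[rotated])
  then obtain d where d: "d > 0" "\<And>z z'. z \<in> X ==> z' \<in> X ==> dist z' z < d ==> dist (G (fst z') (snd z')) (G (fst z) (snd z)) < 1"
    unfolding uniformly_continuous_on_def by (meson zero_less_one)
  define \<epsilon> where "\<epsilon> = min 1 (d / 2)"
  have \<epsilon>: "\<epsilon> > 0" "\<epsilon> <= 1" "\<epsilon> < d" using d(1) by (auto simp: \<epsilon>_def)
  have E1: "\<bar>E - E0\<bar> <= 1" if "\<bar>E - E0\<bar> <= \<epsilon>" for E using that \<epsilon> by linarith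
  have G1: "G E x >= 1" if E: "\<bar>E - E0\<bar> <= \<epsilon>" and x: "norm x = 1" for E x
  proof -
    have "dist (G E x) (G E0 x) < 1"
      using d(2)[of "(E0, x)" "(E, x)"] E x \<epsilon> E1[OF E] by (auto simp: X_def dist_Pair_Pair dist_real_def abs_le_iff)
    then show ?thesis using assms[OF x] by (simp add: G_def dist_real_def)
  qed
  define L where "L = n * ln K"
  have L: "L >= 0" using K(1) by (simp add: L_def)
  \<comment> \<open>Small enough that s L <= 1, as the quadratic bound on exp requires, and that the
    quadratic error s^2 L^2 is at most half of the gain s.\<close>
  define s where "s = 1 / (2 * (L + 1)\<^sup>2)"
  have L1: "(L + 1)\<^sup>2 >= L + 1" "(L + 1)\<^sup>2 >= L\<^sup>2" "(L + 1)\<^sup>2 > 0"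
    using L zero_less_power[of "L + 1" 2] by (auto simp: power2_eq_square algebra_simps)
  have s: "s > 0" "s <= 1" "s * L <= 1" "s * L\<^sup>2 <= 1 / 2" using L L1 by (auto simp: s_def divide_simps)
  have lnb: "\<bar>ln (norm (tact E u x))\<bar> <= L" if u: "u \<in> words n" and E: "\<bar>E - E0\<bar> <= \<epsilon>" and x: "norm x = 1" for E u x
  proof -
    have u': "set u \<subseteq> S" "length u = n" using u by (auto simp: words_def)
    have nz: "norm (tact E u x) > 0" using x tact_eq_0_iff[OF words_nz[OF u], of E x] by auto
    have le: "norm (tact E u x) <= K ^ n" "1 <= K ^ n * norm (tact E u x)"
      using tb[OF u'(1) E1[OF E], of x] x u'(2) by auto
    have "ln (norm (tact E u x)) <= ln (K ^ n)" using le(1) nz by (intro ln_mono) auto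
    moreover have "0 <= ln (K ^ n * norm (tact E u x))" using le(2) by (intro ln_ge_zero) auto
    ultimately show ?thesis using nz K(1) by (simp add: L_def ln_realpow ln_mult)
  qed
  have unit: "mean n (\<lambda>u. norm (tact E u x) powr (- s)) <= exp (- s / 2)"
    if E: "\<bar>E - E0\<bar> <= \<epsilon>" and x: "norm x = 1" for E x
  proof -
    have "mean n (\<lambda>u. norm (tact E u x) powr (- s)) <= mean n (\<lambda>u. (1 + s\<^sup>2 * L\<^sup>2) - s * ln (norm (tact E u x)))"
    proof (rule mean_mono)
      fix u assume u: "u \<in> words n"
      define Y where "Y = ln (norm (tact E u x))"
      have nz: "norm (tact E u x) \<noteq> 0" using x tact_eq_0_iff[OF words_nz[OF u], of E x] by auto
      have Y: "\<bar>Y\<bar> <= L" unfolding Y_def by (rule lnb[OF u E x])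
      have "\<bar>- s * Y\<bar> <= s * L" using Y s(1) by (simp add: abs_mult mult_left_mono)
      then have 1: "\<bar>- s * Y\<bar> <= 1" using s by linarith
      have "Y\<^sup>2 <= L\<^sup>2" using Y L by (simp add: abs_le_square_iff[symmetric])
      then have "(- s * Y)\<^sup>2 <= s\<^sup>2 * L\<^sup>2" by (simp add: power_mult_distrib mult_left_mono)
      with exp_le_quadratic[OF 1] have "exp (- s * Y) <= (1 + s\<^sup>2 * L\<^sup>2) - s * Y" by linarith
      then show "norm (tact E u x) powr (- s) <= (1 + s\<^sup>2 * L\<^sup>2) - s * ln (norm (tact E u x))"
        using nz by (simp add: powr_def Y_def)
    qed
    also have "\<dots> = (1 + s\<^sup>2 * L\<^sup>2) - s * G E x" unfolding G_def by (simp only: mean_diff mean_const mean_cmult)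
    also have "\<dots> <= (1 + s * (1 / 2)) - s * 1"
    proof -
      have "s\<^sup>2 * L\<^sup>2 = s * (s * L\<^sup>2)" by (simp add: power2_eq_square)
      also have "\<dots> <= s * (1 / 2)" using s by (intro mult_left_mono) auto
      finally have "s\<^sup>2 * L\<^sup>2 <= s * (1 / 2)" .
      moreover have "s * 1 <= s * G E x" using s by (intro mult_left_mono G1[OF E x]) auto
      ultimately show ?thesis by linarith
    qed
    also have "\<dots> = 1 + (- s / 2)" by simp
    also have "\<dots> <= exp (- s / 2)" by (rule exp_ge_add_one_self)
    finally show ?thesis .
  qed
  have hom: "mean m (\<lambda>u. norm (tact E u x) powr (- s))
      = norm x powr (- s) * mean m (\<lambda>u. norm (tact E u ((1 / norm x) *\<^sub>R x)) powr (- s))" if "x \<noteq> 0" for m E x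
    unfolding mean_cmult[symmetric]
  proof (rule mean_cong)
    fix u
    have "norm (tact E u x) = norm x * norm (tact E u ((1 / norm x) *\<^sub>R x))"
      using that by (simp add: tact_scale)
    then show "norm (tact E u x) powr (- s) = norm x powr (- s) * norm (tact E u ((1 / norm x) *\<^sub>R x)) powr (- s)"
      by (simp only: powr_mult norm_ge_zero)
  qed
  have block: "mean n (\<lambda>u. norm (tact E u x) powr (- s)) <= exp (- s / 2) * norm x powr (- s)"
    if "\<bar>E - E0\<bar> <= \<epsilon>" "x \<noteq> 0" for E x
    unfolding hom[OF that(2)] using unit[OF that(1), of "(1 / norm x) *\<^sub>R x"] that(2)
    by (simp add: mult.commute mult_left_mono)
  have blocks: "mean (j * n) (\<lambda>u. norm (tact E u x) powr (- s)) <= exp (- s / 2 * j) * norm x powr (- s)"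
    if E: "\<bar>E - E0\<bar> <= \<epsilon>" and "x \<noteq> 0" for E x j using that(2)
  proof (induction j arbitrary: x)
    case (Suc j)
    have "mean (Suc j * n) (\<lambda>u. norm (tact E u x) powr (- s))
        = mean n (\<lambda>u. mean (j * n) (\<lambda>w. norm (tact E w (tact E u x)) powr (- s)))"
      by (simp add: mean_append tact_append)
    also have "\<dots> <= mean n (\<lambda>u. exp (- s / 2 * j) * norm (tact E u x) powr (- s))"
      using Suc tact_eq_0_iff[OF words_nz] by (intro mean_mono Suc.IH) auto
    also have "\<dots> <= exp (- s / 2 * j) * (exp (- s / 2) * norm x powr (- s))"
      unfolding mean_cmult using block[OF E Suc.prems] by (intro mult_left_mono) auto
    also have "\<dots> = exp (- s / 2 * Suc j) * norm x powr (- s)" by (simp add: algebra_simps flip: exp_add)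
    finally show ?case .
  qed simp
  \<comment> \<open>The first factor pays for an incomplete last block of fewer than n letters, the
    second for rounding the length down to a multiple of n.\<close>
  define C where "C = (K ^ n) powr s * exp (s / 2)"
  define \<kappa> where "\<kappa> = s / (2 * n)"
  have "expanding S p (E0 - \<epsilon>) (E0 + \<epsilon>) K s C \<kappa>"
  proof (unfold_locales)
    show "E0 - \<epsilon> < E0 + \<epsilon>" using \<epsilon> by simp
    show "\<kappa> > 0" using s npos by (simp add: \<kappa>_def)
    have "1 <= (K ^ n) powr s" using K(1) s by (intro ge_one_powr_ge_zero) auto
    then show "C >= 1" unfolding C_def using s mult_mono[of 1 "(K ^ n) powr s" 1 "exp (s / 2)"] by simp
    fix E x m assume "E \<in> {E0 - \<epsilon>..E0 + \<epsilon>}" and x: "x \<noteq> (0 :: real \<times> real)"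
    then have E: "\<bar>E - E0\<bar> <= \<epsilon>" by auto
    define j r where "j = m div n" and "r = m mod n"
    have m: "m = j * n + r" and r: "r < n" using npos by (auto simp: j_def r_def)
    have "mean m (\<lambda>u. norm (tact E u x) powr (- s))
        = mean (j * n) (\<lambda>u. mean r (\<lambda>w. norm (tact E w (tact E u x)) powr (- s)))"
      unfolding m by (simp add: mean_append tact_append)
    also have "\<dots> <= mean (j * n) (\<lambda>u. (K ^ n) powr s * norm (tact E u x) powr (- s))"
    proof (intro mean_mono mean_le_const)
      fix u w assume u: "u \<in> words (j * n)" and w: "w \<in> words r"
      define y where "y = tact E u x"
      have y: "norm y > 0" using x tact_eq_0_iff[OF words_nz[OF u], of E x] by (simp add: y_def)
      have nz: "norm (tact E w y) > 0" using y tact_eq_0_iff[OF words_nz[OF w], of E y] by simp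
      have "norm y <= K ^ r * norm (tact E w y)" using tb(2)[OF _ E1[OF E], of w y] w by (auto simp: words_def)
      also have "\<dots> <= K ^ n * norm (tact E w y)" using K(1) r by (intro mult_right_mono power_increasing) auto
      finally have "norm (tact E w y) >= norm y / K ^ n" using K(1) by (simp add: field_simps)
      then have "norm (tact E w y) powr (- s) <= (norm y / K ^ n) powr (- s)"
        using s y K(1) by (intro powr_mono2') auto
      also have "\<dots> = (K ^ n) powr s * norm y powr (- s)"
        using K(1) y by (simp add: powr_divide powr_minus field_simps)
      finally show "norm (tact E w (tact E u x)) powr (- s) <= (K ^ n) powr s * norm (tact E u x) powr (- s)"
        by (simp add: y_def)
    qed
    also have "\<dots> <= (K ^ n) powr s * (exp (- s / 2 * j) * norm x powr (- s))"
      unfolding mean_cmult by (intro mult_left_mono blocks[OF E x]) auto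
    also have "\<dots> <= (K ^ n) powr s * (exp (s / 2 - \<kappa> * m) * norm x powr (- s))"
    proof (intro mult_left_mono mult_right_mono)
      have "real m <= real n * (real j + 1)" using m r by (simp add: algebra_simps flip: of_nat_mult of_nat_add)
      then have "\<kappa> * m <= \<kappa> * (real n * (real j + 1))" using \<open>\<kappa> > 0\<close> by (intro mult_left_mono) auto
      also have "\<dots> = s / 2 * (real j + 1)" using npos by (simp add: \<kappa>_def)
      finally show "exp (- s / 2 * j) <= exp (s / 2 - \<kappa> * m)" by (simp add: algebra_simps)
    qed auto
    also have "exp (s / 2 - \<kappa> * m) = exp (s / 2) * exp (- \<kappa> * m)" by (simp flip: exp_add)
    also have "(K ^ n) powr s * (exp (s / 2) * exp (- \<kappa> * m) * norm x powr (- s)) = C * exp (- \<kappa> * m) * norm x powr (- s)"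
      by (simp only: C_def mult_ac)
    finally show "mean m (\<lambda>u. norm (tact E u x) powr (- s)) <= C * exp (- \<kappa> * m) * norm x powr (- s)" .
  qed (use K s \<epsilon> in auto)
  with \<epsilon>(1) show thesis by (rule that)
qed

end

lemma (in shifted_frames) expanding_nearby:
  obtains \<epsilon> K s C \<kappa> where "\<epsilon> > 0" "expanding S p (E - \<epsilon>) (E + \<epsilon>) K s C \<kappa>"
proof -
  have "\<exists>k. \<forall>x y. x \<noteq> 0 \<longrightarrow> y \<noteq> 0 \<longrightarrow> prob k (\<lambda>u. wedge (tact E u x) y = 0) <= 1 / 4"
    by (rule directions_spread) simp
  then obtain k where k: "\<And>x y. x \<noteq> 0 ==> y \<noteq> 0 ==> prob k (\<lambda>u. wedge (tact E u x) y = 0) <= 1 / 4" by blast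
  obtain n where "\<And>x. norm x = 1 ==> mean n (\<lambda>u. ln (norm (tact E u x))) >= 2"
    using log_expansion[OF k norms_spread] by (metis half_gt_zero_iff zero_less_one)
  then show thesis using expanding_of_log_expansion that by blast
qed

section \<open>The Lyapunov exponent near an expanding energy\<close>

text \<open>f(mn) is within (m + 1)B of m f(n) and, by symmetry, within (n + 1)B of n f(m). Hence
  f(m)/m and f(n)/n differ by at most 2B/m + 2B/n.\<close>

lemma almost_additive_converges:
  fixes f :: "nat => real"
  assumes "\<And>m n. \<bar>f (m + n) - f m - f n\<bar> <= B"
  obtains l where "(\<lambda>n. f n / n) \<longlonglongrightarrow> l"
proof -
  have B: "B >= 0" using assms[of 0 0] by linarith
  have mult: "\<bar>f (m * n) - real m * f n\<bar> <= real (Suc m) * B" for m n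
  proof (induction m)
    case 0
    then show ?case using assms[of 0 0] by simp
  next
    case (Suc m)
    have "\<bar>f (n + m * n) - f n - f (m * n)\<bar> <= B" by (rule assms)
    with Suc show ?case by (simp add: algebra_simps abs_le_iff)
  qed
  have close: "\<bar>f m / m - f n / n\<bar> <= 2 * B / m + 2 * B / n" if mn: "m > 0" "n > 0" for m n
  proof -
    have 1: "\<bar>f (m * n) / (m * n) - f n / n\<bar> <= 2 * B / n" if "m > 0" "n > 0" for m n
    proof -
      have "\<bar>f (m * n) / (m * n) - f n / n\<bar> = \<bar>f (m * n) - real m * f n\<bar> / (m * n)"
      proof -
        have "f (m * n) / (m * n) - f n / n = (f (m * n) - real m * f n) / (m * n)"
          using that by (simp add: field_simps)
        then show ?thesis by simp
      qed
      also have "\<dots> <= (real (Suc m) * B) / (m * n)" by (intro divide_right_mono mult) simp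
      also have "\<dots> <= (2 * real m * B) / (m * n)"
        using that B by (intro divide_right_mono mult_right_mono) auto
      also have "\<dots> = 2 * B / n" using that by simp
      finally show ?thesis .
    qed
    show ?thesis using 1[OF mn] 1[OF mn(2,1)] by (simp add: mult.commute abs_le_iff)
  qed
  have "Cauchy (\<lambda>n. f n / n)"
  proof (rule CauchyI)
    fix e :: real assume e: "e > 0"
    obtain N :: nat where N: "real N * e > 4 * B" using e reals_Archimedean3 by blast
    show "\<exists>M. \<forall>m\<ge>M. \<forall>n\<ge>M. norm (f m / m - f n / n) < e"
    proof (intro exI[of _ "Suc N"] allI impI)
      fix m n assume mn: "Suc N <= m" "Suc N <= n"
      have "2 * B / k < e / 2" if "Suc N <= k" for k
      proof -
        have "4 * B < real k * e" using N that e by (smt (verit) Suc_leD mult_right_mono of_nat_mono)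
        then show ?thesis using that by (simp add: field_simps)
      qed
      from this[OF mn(1)] this[OF mn(2)] show "norm (f m / m - f n / n) < e" using close[of m n] mn by simp
    qed
  qed
  then show thesis using that by (auto simp: Cauchy_convergent_iff convergent_def)
qed

context expanding
begin

definition log_growth :: "real => nat => real \<times> real => real" where
  "log_growth E n x = mean n (\<lambda>u. ln (norm (tact E u x)))"

lemma norm_tact_le: "E \<in> {lo..hi} ==> u \<in> words n ==> norm (tact E u x) <= K ^ n * norm x"
  using norm_tact_bounds[OF K, of u E] norm_tstep_le norm_le_tstep by (auto simp: words_def)

lemma tact_nz: "u \<in> words n ==> x \<noteq> 0 ==> tact E u x \<noteq> 0" by (simp add: tact_eq_0_iff[OF words_nz])

lemma log_growth_scale:
  assumes "x \<noteq> 0" "c \<noteq> 0"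
  shows "log_growth E n (c *\<^sub>R x) = ln \<bar>c\<bar> + log_growth E n x"
proof -
  have "log_growth E n (c *\<^sub>R x) = mean n (\<lambda>u. ln \<bar>c\<bar> + ln (norm (tact E u x)))"
    unfolding log_growth_def using assms tact_nz by (intro mean_cong) (auto simp: tact_scale ln_mult)
  then show ?thesis by (simp add: mean_add mean_const log_growth_def)
qed

text \<open>One step's expansion is Lipschitz in the direction, measured by the sine of the angle.
  The lower bound on the step turns the additive error into a relative one before the logarithm is
  taken.\<close>

lemma log_tstep_le:
  assumes a: "a \<in> S" and E: "E \<in> {lo..hi}" and x: "norm x = 1" and y: "norm y = 1"
  shows "ln (norm (tstep E a y)) - ln (norm (tstep E a x)) <= K\<^sup>2 * \<bar>wedge x y\<bar>"
proof -
  obtain c where c: "\<bar>c\<bar> <= 1" "y = c *\<^sub>R x + wedge x y *\<^sub>R (- snd x, fst x)" using wedge_decomp[OF x y] by blast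
  define z where "z = (- snd x, fst x)"
  have z: "norm z = 1" using x by (cases x) (simp add: z_def norm_Pair add.commute)
  have ge: "1 <= K * norm (tstep E a x)" using norm_le_tstep[OF a E, of x] x by simp
  then have pos: "norm (tstep E a x) > 0" using K by (smt (verit) mult_nonneg_nonpos norm_ge_zero)
  have posy: "norm (tstep E a y) > 0" using norm_le_tstep[OF a E, of y] y K by (smt (verit) mult_nonneg_nonpos norm_ge_zero)
  have "tstep E a y = c *\<^sub>R tstep E a x + wedge x y *\<^sub>R tstep E a z"
    by (subst c(2)) (simp only: tstep_linear z_def)
  then have "norm (tstep E a y) <= \<bar>c\<bar> * norm (tstep E a x) + \<bar>wedge x y\<bar> * norm (tstep E a z)"
    by (metis norm_scaleR norm_triangle_ineq)
  also have "\<dots> <= 1 * norm (tstep E a x) + \<bar>wedge x y\<bar> * K"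
    using c norm_tstep_le[OF a E, of z] z by (intro add_mono mult_mono mult_left_mono) auto
  also have "\<dots> <= norm (tstep E a x) + \<bar>wedge x y\<bar> * (K * (K * norm (tstep E a x)))"
    using ge K by (intro add_mono mult_left_mono) (auto simp: mult_left_mono)
  also have "\<dots> = norm (tstep E a x) * (1 + K\<^sup>2 * \<bar>wedge x y\<bar>)" by (simp add: algebra_simps power2_eq_square)
  finally have "ln (norm (tstep E a y)) <= ln (norm (tstep E a x) * (1 + K\<^sup>2 * \<bar>wedge x y\<bar>))"
    using posy by (intro ln_mono) auto
  also have "\<dots> = ln (norm (tstep E a x)) + ln (1 + K\<^sup>2 * \<bar>wedge x y\<bar>)"
    using pos by (intro ln_mult_pos) (auto intro: add_pos_nonneg)
  also have "ln (1 + K\<^sup>2 * \<bar>wedge x y\<bar>) <= K\<^sup>2 * \<bar>wedge x y\<bar>" by (rule ln_add_one_self_le_self) simp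
  finally show ?thesis by simp
qed

lemma log_tstep_diff_le:
  assumes a: "a \<in> S" and E: "E \<in> {lo..hi}" and x: "x \<noteq> 0" and y: "y \<noteq> 0"
  shows "\<bar>(ln (norm (tstep E a x)) - ln (norm x)) - (ln (norm (tstep E a y)) - ln (norm y))\<bar>
    <= K\<^sup>2 * (\<bar>wedge x y\<bar> / (norm x * norm y))"
proof -
  define x' y' where "x' = (1 / norm x) *\<^sub>R x" and "y' = (1 / norm y) *\<^sub>R y"
  have 1: "norm x' = 1" "norm y' = 1" using x y by (auto simp: x'_def y'_def)
  have ln': "ln (norm (tstep E a ((1 / norm z) *\<^sub>R z))) = ln (norm (tstep E a z)) - ln (norm z)" if "z \<noteq> 0" for z
    using that snd_nz[OF a] by (simp add: tstep_scale ln_div tstep_eq_0_iff)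
  have w: "\<bar>wedge x' y'\<bar> = \<bar>wedge x y\<bar> / (norm x * norm y)" "\<bar>wedge y' x'\<bar> = \<bar>wedge x y\<bar> / (norm x * norm y)"
  proof -
    have "wedge x' y' = wedge x y / (norm x * norm y)" "wedge y' x' = - (wedge x y / (norm x * norm y))"
      using x y by (auto simp: wedge_def x'_def y'_def field_simps)
    then show "\<bar>wedge x' y'\<bar> = \<bar>wedge x y\<bar> / (norm x * norm y)" "\<bar>wedge y' x'\<bar> = \<bar>wedge x y\<bar> / (norm x * norm y)"
      by (auto simp: abs_divide abs_mult)
  qed
  show ?thesis using log_tstep_le[OF a E 1] log_tstep_le[OF a E 1(2,1)] ln'[OF x] ln'[OF y]
    unfolding w x'_def[symmetric] y'_def[symmetric] by (simp add: abs_le_iff)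
qed

text \<open>The dependence on the initial direction is forgotten exponentially fast, because
  \<open>sin \<angle>(Ax, Ay) = \<bar>x \<and> y\<bar> / (\<bar>Ax\<bar> \<bar>Ay\<bar>)\<close>.\<close>
lemma log_growth_oscillation_unit:
  assumes E: "E \<in> {lo..hi}" and x: "norm x = 1" and y: "norm y = 1"
  shows "\<bar>log_growth E n x - log_growth E n y\<bar> <= K\<^sup>2 * C / (1 - exp (- \<kappa>))"
proof -
  have nz: "x \<noteq> 0" "y \<noteq> 0" using x y by auto
  have inc: "\<bar>(log_growth E (Suc n) x - log_growth E (Suc n) y) - (log_growth E n x - log_growth E n y)\<bar>
      <= K\<^sup>2 * C * exp (- \<kappa>) ^ n" for n
  proof -
    define \<phi> where "\<phi> a z = ln (norm (tstep E a z)) - ln (norm z)" for a z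
    have one: "log_growth E (Suc n) z - log_growth E n z = mean n (\<lambda>u. \<Sum>a\<in>S. p a * \<phi> a (tact E u z))" for z
    proof -
      have "log_growth E (Suc n) z = mean (n + 1) (\<lambda>u. ln (norm (tact E u z)))" by (simp add: log_growth_def)
      also have "\<dots> = mean n (\<lambda>u. \<Sum>a\<in>S. p a * ln (norm (tstep E a (tact E u z))))"
        unfolding mean_append by (simp add: tact_append)
      finally have "log_growth E (Suc n) z - log_growth E n z
          = mean n (\<lambda>u. (\<Sum>a\<in>S. p a * ln (norm (tstep E a (tact E u z)))) - ln (norm (tact E u z)))"
        by (simp add: log_growth_def mean_diff)
      also have "\<dots> = mean n (\<lambda>u. \<Sum>a\<in>S. p a * \<phi> a (tact E u z))"
        by (intro mean_cong) (simp add: \<phi>_def right_diff_distrib sum_subtractf sum_p flip: sum_distrib_right)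
      finally show ?thesis .
    qed
    have "\<bar>(log_growth E (Suc n) x - log_growth E (Suc n) y) - (log_growth E n x - log_growth E n y)\<bar>
        = \<bar>mean n (\<lambda>u. \<Sum>a\<in>S. p a * (\<phi> a (tact E u x) - \<phi> a (tact E u y)))\<bar>"
      using one[of x] one[of y] by (simp add: mean_diff right_diff_distrib sum_subtractf)
    also have "\<dots> <= mean n (\<lambda>u. \<bar>\<Sum>a\<in>S. p a * (\<phi> a (tact E u x) - \<phi> a (tact E u y))\<bar>)" by (rule abs_mean_le)
    also have "\<dots> <= mean n (\<lambda>u. K\<^sup>2 * (1 / 2 * norm (tact E u x) powr (- s) + 1 / 2 * norm (tact E u y) powr (- s)))"
    proof (rule mean_mono)
      fix u assume u: "u \<in> words n"
      define X Y where "X = tact E u x" and "Y = tact E u y"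
      have XY: "X \<noteq> 0" "Y \<noteq> 0" using tact_nz[OF u] nz by (auto simp: X_def Y_def)
      define d where "d = \<bar>wedge X Y\<bar> / (norm X * norm Y)"
      have d0: "d >= 0" by (simp add: d_def)
      have d1: "d <= 1" using abs_wedge_le[of X Y] XY by (simp add: d_def)
      have "\<bar>wedge X Y\<bar> <= 1" using abs_wedge_le[of x y] x y by (simp add: X_def Y_def wedge_tact[OF words_nz[OF u]])
      then have d2: "d <= 1 / (norm X * norm Y)" unfolding d_def using XY by (intro divide_right_mono) auto
      \<comment> \<open>The sine is at most 1, so it may be raised to the small power s/2, for which
        negative moments are controlled; the arithmetic-geometric mean inequality then separates the
        two orbits.\<close>
      have "d <= d powr (s / 2)"
      proof (cases "d = 0")
        case False
        then have "d powr 1 <= d powr (s / 2)" using d0 d1 s by (intro powr_mono') auto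
        then show ?thesis using d0 by simp
      qed simp
      also have "\<dots> <= (1 / (norm X * norm Y)) powr (s / 2)" using d0 d2 s by (intro powr_mono2) auto
      also have "\<dots> = norm X powr (- s / 2) * norm Y powr (- s / 2)"
        using XY by (simp add: powr_divide powr_mult powr_minus field_simps)
      also have "\<dots> <= 1 / 2 * norm X powr (- s) + 1 / 2 * norm Y powr (- s)"
      proof -
        define e f where "e = norm X powr (- s / 2)" and "f = norm Y powr (- s / 2)"
        have "norm X powr (- s) = e\<^sup>2" "norm Y powr (- s) = f\<^sup>2"
          by (simp_all add: e_def f_def power2_eq_square flip: powr_add)
        moreover have "e * f <= 1 / 2 * e\<^sup>2 + 1 / 2 * f\<^sup>2"
          using zero_le_power2[of "e - f"] by (simp add: power2_diff)
        ultimately show ?thesis by (simp add: e_def f_def)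
      qed
      finally have d: "d <= 1 / 2 * norm X powr (- s) + 1 / 2 * norm Y powr (- s)" .
      have "\<bar>\<Sum>a\<in>S. p a * (\<phi> a X - \<phi> a Y)\<bar> <= (\<Sum>a\<in>S. \<bar>p a * (\<phi> a X - \<phi> a Y)\<bar>)" by (rule sum_abs)
      also have "\<dots> <= (\<Sum>a\<in>S. p a * (K\<^sup>2 * d))"
      proof (rule sum_mono)
        fix a assume a: "a \<in> S"
        have "\<bar>\<phi> a X - \<phi> a Y\<bar> <= K\<^sup>2 * d" unfolding \<phi>_def d_def by (rule log_tstep_diff_le[OF a E XY])
        then show "\<bar>p a * (\<phi> a X - \<phi> a Y)\<bar> <= p a * (K\<^sup>2 * d)" using p_pos[OF a] by (simp add: abs_mult)
      qed
      also have "\<dots> = K\<^sup>2 * d" by (simp add: sum_p flip: sum_distrib_right)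
      also have "\<dots> <= K\<^sup>2 * (1 / 2 * norm X powr (- s) + 1 / 2 * norm Y powr (- s))"
        using d by (intro mult_left_mono) auto
      finally show "\<bar>\<Sum>a\<in>S. p a * (\<phi> a (tact E u x) - \<phi> a (tact E u y))\<bar>
          <= K\<^sup>2 * (1 / 2 * norm (tact E u x) powr (- s) + 1 / 2 * norm (tact E u y) powr (- s))"
        by (simp add: X_def Y_def)
    qed
    also have "\<dots> = K\<^sup>2 * (1 / 2 * mean n (\<lambda>u. norm (tact E u x) powr (- s)) + 1 / 2 * mean n (\<lambda>u. norm (tact E u y) powr (- s)))"
      by (simp only: mean_cmult mean_add)
    also have "\<dots> <= K\<^sup>2 * (1 / 2 * (C * exp (- \<kappa> * n)) + 1 / 2 * (C * exp (- \<kappa> * n)))"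
      using expansion[OF E nz(1), of n] expansion[OF E nz(2), of n] x y
      by (intro mult_left_mono add_mono) auto
    also have "\<dots> = K\<^sup>2 * C * exp (- \<kappa>) ^ n" by (simp add: mult.commute flip: exp_of_nat_mult)
    finally show ?thesis .
  qed
  have e: "exp (- \<kappa>) < 1" using \<kappa> by simp
  have "\<bar>log_growth E n x - log_growth E n y\<bar> <= (\<Sum>i<n. K\<^sup>2 * C * exp (- \<kappa>) ^ i)"
  proof (induction n)
    case 0
    then show ?case using x y by (simp add: log_growth_def)
  next
    case (Suc n)
    then show ?case using inc[of n] by simp
  qed
  also have "\<dots> = K\<^sup>2 * C * (\<Sum>i<n. exp (- \<kappa>) ^ i)" by (simp add: sum_distrib_left)
  also have "\<dots> <= K\<^sup>2 * C * (1 / (1 - exp (- \<kappa>)))"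
  proof (rule mult_left_mono)
    have "(\<Sum>i<n. exp (- \<kappa>) ^ i) = (1 - exp (- \<kappa>) ^ n) / (1 - exp (- \<kappa>))" using e by (simp add: sum_gp_strict)
    also have "\<dots> <= 1 / (1 - exp (- \<kappa>))" using e by (intro divide_right_mono) auto
    finally show "(\<Sum>i<n. exp (- \<kappa>) ^ i) <= 1 / (1 - exp (- \<kappa>))" .
    show "0 <= K\<^sup>2 * C" using C by simp
  qed
  finally show ?thesis by simp
qed

definition osc :: real where "osc = K\<^sup>2 * C / (1 - exp (- \<kappa>))"

lemma log_growth_oscillation:
  assumes E: "E \<in> {lo..hi}" and x: "x \<noteq> 0" and y: "y \<noteq> 0"
  shows "\<bar>(log_growth E n x - ln (norm x)) - (log_growth E n y - ln (norm y))\<bar> <= osc"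
proof -
  have *: "log_growth E n z - ln (norm z) = log_growth E n ((1 / norm z) *\<^sub>R z)" if "z \<noteq> 0" for z
    using log_growth_scale[OF that, of "1 / norm z" E n] that by (simp add: ln_div)
  show ?thesis unfolding *[OF x] *[OF y] osc_def using x y by (intro log_growth_oscillation_unit E) auto
qed

text \<open>Two letters change the current norm by at most a factor K each way, and all later growth
  depends on the direction only up to \<open>osc\<close>. This is the bounded-increment hypothesis
  of the deviation inequality.\<close>

lemma log_growth_martingale:
  assumes E: "E \<in> {lo..hi}" and x: "x \<noteq> 0" and u: "set u \<subseteq> S" and ab: "a \<in> S" "b \<in> S"
  shows "\<bar>mean m (\<lambda>w. ln (norm (tact E (u @ a # w) x))) - mean m (\<lambda>w. ln (norm (tact E (u @ b # w) x)))\<bar>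
    <= osc + 2 * ln K"
proof -
  define X where "X = tact E u x"
  have X: "X \<noteq> 0" unfolding X_def using x u tact_nz[of u "length u"] by (simp add: words_def)
  have Xc: "tstep E c X \<noteq> 0" "\<bar>ln (norm (tstep E c X)) - ln (norm X)\<bar> <= ln K" if "c \<in> S" for c
  proof -
    show nz: "tstep E c X \<noteq> 0" using X snd_nz[OF that] by (simp add: tstep_eq_0_iff)
    have "ln (norm (tstep E c X)) <= ln (K * norm X)" "ln (norm X) <= ln (K * norm (tstep E c X))"
      using nz X norm_tstep_le[OF that E, of X] norm_le_tstep[OF that E, of X] by (auto intro!: ln_mono)
    then show "\<bar>ln (norm (tstep E c X)) - ln (norm X)\<bar> <= ln K" using K X nz by (simp add: ln_mult abs_le_iff)
  qed
  have *: "mean m (\<lambda>w. ln (norm (tact E (u @ c # w) x))) = log_growth E m (tstep E c X)" for c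
    by (simp add: log_growth_def tact_append X_def)
  show ?thesis unfolding *
    using log_growth_oscillation[OF E Xc(1)[OF ab(1)] Xc(1)[OF ab(2)], of m] Xc(2)[OF ab(1)] Xc(2)[OF ab(2)]
    by linarith
qed

lemma log_growth_limit:
  assumes E: "E \<in> {lo..hi}"
  obtains l where "l > 0" "\<And>x. x \<noteq> 0 ==> (\<lambda>n. log_growth E n x / n) \<longlonglongrightarrow> l"
proof -
  define e1 where "e1 = (1 :: real, 0 :: real)"
  have e1: "e1 \<noteq> 0" "norm e1 = 1" by (auto simp: e1_def prod_eq_iff norm_Pair)
  have add: "\<bar>log_growth E (m + n) e1 - log_growth E m e1 - log_growth E n e1\<bar> <= osc" for m n
  proof -
    have "log_growth E (m + n) e1 = mean m (\<lambda>u. log_growth E n (tact E u e1))"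
      by (simp add: log_growth_def mean_append tact_append)
    then have "log_growth E (m + n) e1 - log_growth E m e1 - log_growth E n e1
        = mean m (\<lambda>u. log_growth E n (tact E u e1) - ln (norm (tact E u e1)) - log_growth E n e1)"
      by (simp only: mean_diff mean_const) (simp add: log_growth_def)
    also have "\<bar>\<dots>\<bar> <= mean m (\<lambda>u. \<bar>log_growth E n (tact E u e1) - ln (norm (tact E u e1)) - log_growth E n e1\<bar>)"
      by (rule abs_mean_le)
    also have "\<dots> <= osc"
    proof (rule mean_le_const)
      fix u assume "u \<in> words m"
      then show "\<bar>log_growth E n (tact E u e1) - ln (norm (tact E u e1)) - log_growth E n e1\<bar> <= osc"
        using log_growth_oscillation[OF E tact_nz[OF _ e1(1)] e1(1)] e1(2) by fastforce
    qed
    finally show ?thesis .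
  qed
  obtain l where l: "(\<lambda>n. log_growth E n e1 / n) \<longlonglongrightarrow> l" using almost_additive_converges[OF add] by blast
  \<comment> \<open>Jensen's inequality in the form 1 + y <= exp y turns decay of the negative
    moment into linear growth of the mean logarithm, with slope at least \<kappa>/s.\<close>
  have lower: "(\<kappa> * n - C) / s <= log_growth E n e1" for n
  proof -
    have "1 + \<kappa> * n - s * log_growth E n e1 = mean n (\<lambda>u. 1 + \<kappa> * n - s * ln (norm (tact E u e1)))"
      unfolding log_growth_def by (simp only: mean_diff mean_const mean_cmult)
    also have "\<dots> <= mean n (\<lambda>u. exp (\<kappa> * n) * norm (tact E u e1) powr (- s))"
    proof (rule mean_mono)
      fix u assume u: "u \<in> words n"
      have "1 + (\<kappa> * n - s * ln (norm (tact E u e1))) <= exp (\<kappa> * n - s * ln (norm (tact E u e1)))"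
        by (rule exp_ge_add_one_self)
      also have "\<dots> = exp (\<kappa> * n) * norm (tact E u e1) powr (- s)"
        using tact_nz[OF u e1(1)] by (simp add: powr_def flip: exp_add)
      finally show "1 + \<kappa> * n - s * ln (norm (tact E u e1)) <= exp (\<kappa> * n) * norm (tact E u e1) powr (- s)" by simp
    qed
    also have "\<dots> <= exp (\<kappa> * n) * (C * exp (- \<kappa> * n))"
      unfolding mean_cmult using expansion[OF E e1(1), of n] e1(2) by (intro mult_left_mono) auto
    also have "\<dots> = C * (exp (\<kappa> * n) * exp (- \<kappa> * n))" by simp
    also have "\<dots> = C" by (simp flip: exp_add)
    finally show ?thesis using s by (simp add: field_simps)
  qed
  have "l >= \<kappa> / s"
  proof (rule LIMSEQ_le[OF _ l])
    have "(\<lambda>n. \<kappa> / s - C / s / real n) \<longlonglongrightarrow> \<kappa> / s - 0" by (intro tendsto_intros lim_const_over_n)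
    then show "(\<lambda>n. \<kappa> / s - C / s / real n) \<longlonglongrightarrow> \<kappa> / s" by simp
    show "\<exists>N. \<forall>n\<ge>N. \<kappa> / s - C / s / real n <= log_growth E n e1 / real n"
    proof (intro exI[of _ 1] allI impI)
      fix n :: nat assume n: "n >= 1"
      have "(\<kappa> * n - C) / s / n <= log_growth E n e1 / n" by (intro divide_right_mono lower) simp
      moreover have "(\<kappa> * n - C) / s / n = \<kappa> / s - C / s / real n" using n s by (simp add: field_simps)
      ultimately show "\<kappa> / s - C / s / real n <= log_growth E n e1 / real n" by simp
    qed
  qed
  then have "l > 0" using s \<kappa> by (smt (verit) divide_pos_pos)
  moreover have "(\<lambda>n. log_growth E n x / n) \<longlonglongrightarrow> l" if x: "x \<noteq> 0" for x
  proof -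
    have "(\<lambda>n. log_growth E n x / n - log_growth E n e1 / n) \<longlonglongrightarrow> 0"
    proof (rule Lim_null_comparison)
      show "\<forall>\<^sub>F n in sequentially. norm (log_growth E n x / n - log_growth E n e1 / n) <= (osc + \<bar>ln (norm x)\<bar>) / real n"
      proof (rule always_eventually, rule allI)
        fix n
        have "\<bar>log_growth E n x - log_growth E n e1\<bar> <= osc + \<bar>ln (norm x)\<bar>"
          using log_growth_oscillation[OF E x e1(1), of n] e1(2) by simp
        then show "norm (log_growth E n x / n - log_growth E n e1 / n) <= (osc + \<bar>ln (norm x)\<bar>) / real n"
          by (simp add: divide_right_mono flip: diff_divide_distrib)
      qed
      show "(\<lambda>n. (osc + \<bar>ln (norm x)\<bar>) / real n) \<longlonglongrightarrow> 0" by (rule lim_const_over_n)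
    qed
    from tendsto_add[OF this l] show ?thesis by simp
  qed
  ultimately show thesis by (rule that)
qed

end

section \<open>Trapped sites\<close>

definition flip :: "real => real \<times> real => real \<times> real" where
  "flip w x = (snd x / w, w * fst x)"

text \<open>With \<open>\<psi>\<close> an eigenfunction and \<open>x = (\<psi>\<^sub>j, w\<^sub>j \<psi>\<^sub>j\<^sub>-\<^sub>1)\<close>, the vector \<open>flip w\<^sub>j x = (\<psi>\<^sub>j\<^sub>-\<^sub>1, w\<^sub>j \<psi>\<^sub>j)\<close> is
  propagated to the left by the same transfer steps.  The first letter of the word provides \<open>w\<^sub>j\<close>.\<close>
definition trapped :: "nat => real => real => (real \<times> real) list => bool" where
  "trapped m T E u \<longleftrightarrow> (\<exists>x. norm x = 1 \<and> norm (tact E (take m (tl u)) x) <= T \<and>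
      norm (tact E (drop m (tl u)) (flip (snd (hd u)) x)) <= T)"

lemma flip_linear: "flip w (c *\<^sub>R x + d *\<^sub>R y) = c *\<^sub>R flip w x + d *\<^sub>R flip w y"
  by (simp add: flip_def prod_eq_iff add_divide_distrib algebra_simps)

lemma flip_flip: "w \<noteq> 0 ==> flip w (flip w x) = x" by (simp add: flip_def prod_eq_iff)

context expanding
begin

lemma norm_flip_le:
  assumes "a \<in> S"
  shows "norm (flip (snd a) x) <= K * norm x" "norm x <= K * norm (flip (snd a) x)"
proof -
  have le: "norm (flip (snd a) x) <= K * norm x" for x
  proof (rule power2_le_imp_le)
    have 1: "(1 / snd a)\<^sup>2 <= K\<^sup>2" "(snd a)\<^sup>2 <= K\<^sup>2"
      using snd_le[OF assms] inverse_snd_le[OF assms] K by (simp_all only: abs_le_square_iff[symmetric] abs_of_nonneg)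
    have "(norm (flip (snd a) x))\<^sup>2 = (1 / snd a)\<^sup>2 * (snd x)\<^sup>2 + (snd a)\<^sup>2 * (fst x)\<^sup>2"
      unfolding norm_prod_sq by (simp add: flip_def power_mult_distrib power_divide)
    also have "\<dots> <= K\<^sup>2 * (snd x)\<^sup>2 + K\<^sup>2 * (fst x)\<^sup>2" by (intro add_mono mult_right_mono 1) auto
    also have "\<dots> = (K * norm x)\<^sup>2" unfolding power_mult_distrib norm_prod_sq by (simp add: algebra_simps)
    finally show "(norm (flip (snd a) x))\<^sup>2 <= (K * norm x)\<^sup>2" .
  qed (use K in simp)
  show "norm (flip (snd a) x) <= K * norm x" by (rule le)
  show "norm x <= K * norm (flip (snd a) x)" using le[of "flip (snd a) x"] by (simp add: flip_flip snd_nz[OF assms])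
qed

lemma prob_norm_tact_le:
  assumes E: "E \<in> {lo..hi}" and x: "x \<noteq> 0" and R: "R > 0"
  shows "prob n (\<lambda>u. norm (tact E u x) <= R) <= C * exp (- \<kappa> * n) * norm x powr (- s) * R powr s"
proof -
  have "prob n (\<lambda>u. norm (tact E u x) <= R) <= mean n (\<lambda>u. norm (tact E u x) powr (- s)) / R powr (- s)"
  proof (rule markov)
    fix u assume "u \<in> words n" "norm (tact E u x) <= R"
    then show "R powr (- s) <= norm (tact E u x) powr (- s)"
      using tact_nz[of u n x E] x s by (intro powr_mono2') auto
  qed (use R in auto)
  also have "\<dots> <= (C * exp (- \<kappa> * n) * norm x powr (- s)) / R powr (- s)"
    by (intro divide_right_mono expansion E x) simp
  finally show ?thesis using R by (simp add: powr_minus field_simps)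
qed

text \<open>The initial directions that stay bounded to the right form a small neighbourhood of a direction
  determined by the letters on the right, which is independent of the letters on the left.\<close>
lemma prob_trapped_le:
  assumes E: "E \<in> {lo..hi}" and T: "T > 0" and R: "R > 0"
  shows "prob (Suc (m + m')) (trapped m T E) <= C * exp (- \<kappa> * m) * R powr s
     + C * exp (- \<kappa> * m') * K powr s * (T + 2 * T / R * K ^ Suc m') powr s"
proof -
  \<comment> \<open>What the left product satisfies once the trapped vector is replaced by the
    contracted direction: the replacement error 2T/R is amplified at most by K^(m' + 1), one factor
    K coming from \<open>flip\<close>.\<close>
  define T' where "T' = T + 2 * T / R * K ^ Suc m'"
  have T': "T' > 0" using T R K by (auto simp: T'_def intro!: add_pos_nonneg)
  define P1 where "P1 r = (norm (tact E r (1, 0)) <= R)" for r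
  \<comment> \<open>A contracted direction selected from the right word alone; its independence of
    the left letters is what permits the fixed-vector estimate there.\<close>
  define xs where "xs r = (SOME x. norm x = 1 \<and> norm (tact E r x) * R <= 2)" for r
  have xs: "norm (xs r) = 1 \<and> norm (tact E r (xs r)) * R <= 2" if r: "r \<in> words m" "\<not> P1 r" for r
  proof -
    obtain x where x: "norm x = 1" "norm (tact E r x) * max (norm (tact E r (1, 0))) (norm (tact E r (0, 1))) <= 2"
      using exists_contracted_vector[OF words_nz[OF r(1)] refl] by blast
    have "norm (tact E r x) * R <= norm (tact E r x) * max (norm (tact E r (1, 0))) (norm (tact E r (0, 1)))"
      using r(2) by (intro mult_left_mono) (auto simp: P1_def)
    with x have "norm x = 1 \<and> norm (tact E r x) * R <= 2" by linarith
    then show ?thesis unfolding xs_def by (rule someI)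
  qed
  have imp: "P1 r \<or> norm (tact E l (flip (snd a) (xs r))) <= T'"
    if a: "a \<in> S" and r: "r \<in> words m" and l: "l \<in> words m'" and tr: "trapped m T E (a # r @ l)" for a r l
  proof (cases "P1 r")
    case False
    have lr: "length r = m" using r by (simp add: words_def)
    obtain x where x: "norm x = 1" "norm (tact E r x) <= T" "norm (tact E l (flip (snd a) x)) <= T"
      using tr lr by (auto simp: trapped_def)
    define y where "y = xs r"
    have y: "norm y = 1" "norm (tact E r y) * R <= 2" using xs[OF r False] by (auto simp: y_def)
    obtain c where c: "\<bar>c\<bar> <= 1" "y = c *\<^sub>R x + wedge x y *\<^sub>R (- snd x, fst x)" using wedge_decomp[OF x(1) y(1)] by blast
    define z where "z = (- snd x, fst x)"
    have z: "norm z = 1" using x(1) by (cases x) (simp add: z_def norm_Pair add.commute)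
    \<comment> \<open>Both x and the contracted direction y become short under the right product,
      and area is conserved, so they are close.\<close>
    have "\<bar>wedge x y\<bar> = \<bar>wedge (tact E r x) (tact E r y)\<bar>" by (simp add: wedge_tact[OF words_nz[OF r]])
    also have "\<dots> <= norm (tact E r x) * norm (tact E r y)" by (rule abs_wedge_le)
    also have "\<dots> <= T * (2 / R)" using x(2) y(2) T R by (intro mult_mono) (auto simp: field_simps)
    finally have w: "\<bar>wedge x y\<bar> <= 2 * T / R" by (simp add: mult.commute)
    have "norm (tact E l (flip (snd a) z)) <= K ^ m' * norm (flip (snd a) z)" by (rule norm_tact_le[OF E l])
    also have "\<dots> <= K ^ m' * (K * norm z)" using K by (intro mult_left_mono norm_flip_le a) auto
    finally have nz: "norm (tact E l (flip (snd a) z)) <= K ^ Suc m'" using z by (simp add: mult.commute)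
    have "tact E l (flip (snd a) y) = c *\<^sub>R tact E l (flip (snd a) x) + wedge x y *\<^sub>R tact E l (flip (snd a) z)"
      by (subst c(2)) (simp only: flip_linear tact_linear z_def)
    then have "norm (tact E l (flip (snd a) y)) <= \<bar>c\<bar> * norm (tact E l (flip (snd a) x)) + \<bar>wedge x y\<bar> * norm (tact E l (flip (snd a) z))"
      by (metis norm_scaleR norm_triangle_ineq)
    also have "\<dots> <= 1 * T + 2 * T / R * K ^ Suc m'" using c(1) x(3) w nz T R by (intro add_mono mult_mono) auto
    finally show ?thesis by (simp add: T'_def y_def)
  qed simp
  have "prob (Suc (m + m')) (trapped m T E)
      <= (\<Sum>a\<in>S. p a * mean m (\<lambda>r. mean m' (\<lambda>l. of_bool (P1 r) + of_bool (\<not> P1 r \<and> norm (tact E l (flip (snd a) (xs r))) <= T'))))"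
    unfolding prob_def mean.simps mean_append
  proof (intro sum_mono mult_left_mono mean_mono)
    fix a r l assume "a \<in> S" "r \<in> words m" "l \<in> words m'"
    from imp[OF this] show "of_bool (trapped m T E (a # r @ l))
        <= (of_bool (P1 r) + of_bool (\<not> P1 r \<and> norm (tact E l (flip (snd a) (xs r))) <= T') :: real)"
      by (auto simp: of_bool_def)
  qed (use p_pos in \<open>auto intro: less_imp_le\<close>)
  also have "\<dots> <= (\<Sum>a\<in>S. p a * mean m (\<lambda>r. of_bool (P1 r) + C * exp (- \<kappa> * m') * K powr s * T' powr s))"
  proof (intro sum_mono mult_left_mono mean_mono)
    fix a r assume a: "a \<in> S" and r: "r \<in> words m"
    show "mean m' (\<lambda>l. of_bool (P1 r) + of_bool (\<not> P1 r \<and> norm (tact E l (flip (snd a) (xs r))) <= T'))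
      <= of_bool (P1 r) + C * exp (- \<kappa> * m') * K powr s * T' powr s"
    proof (cases "P1 r")
      case True
      then show ?thesis using C by (simp add: mean_const)
    next
      case False
      define y where "y = flip (snd a) (xs r)"
      have y1: "1 <= K * norm y" using norm_flip_le(2)[OF a, of "xs r"] xs[OF r False] by (simp add: y_def)
      then have ynz: "y \<noteq> 0" by auto
      have "norm y powr (- s) <= (1 / K) powr (- s)" using y1 K s by (intro powr_mono2') (auto simp: field_simps)
      also have "\<dots> = K powr s" using K by (simp add: powr_divide powr_minus)
      finally have ys: "norm y powr (- s) <= K powr s" .
      have "mean m' (\<lambda>l. of_bool (P1 r) + of_bool (\<not> P1 r \<and> norm (tact E l (flip (snd a) (xs r))) <= T'))
          = prob m' (\<lambda>l. norm (tact E l y) <= T')" using False by (simp add: prob_def y_def)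
      also have "\<dots> <= C * exp (- \<kappa> * m') * norm y powr (- s) * T' powr s"
        by (rule prob_norm_tact_le[OF E ynz T'])
      also have "\<dots> <= C * exp (- \<kappa> * m') * K powr s * T' powr s"
        using ys C by (intro mult_right_mono mult_left_mono) auto
      finally show ?thesis using False by simp
    qed
  qed (use p_pos in \<open>auto intro: less_imp_le\<close>)
  also have "\<dots> = prob m P1 + C * exp (- \<kappa> * m') * K powr s * T' powr s"
    by (simp add: mean_add mean_const prob_def sum_p flip: sum_distrib_right)
  also have "prob m P1 <= C * exp (- \<kappa> * m) * norm (1 :: real, 0 :: real) powr (- s) * R powr s"
    unfolding P1_def by (rule prob_norm_tact_le[OF E _ R]) (simp add: prod_eq_iff)
  finally show ?thesis by (simp add: T'_def norm_Pair)
qed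

text \<open>The left window is shorter by this factor, so that K to the power of its length is at
  most exp (\<kappa>m/(2s)). A priori growth to the left then cannot spoil the precision with which
  the right side fixes the direction.\<close>

definition ratio :: real where "ratio = min 1 (\<kappa> / (2 * s) / (1 + ln K))"

text \<open>With the threshold T = exp (trap_exp m), the factor T^s costs half of the decay earned
  on the left; \<open>trap_rate\<close> is the remaining half.\<close>

definition trap_exp :: real where "trap_exp = \<kappa> * ratio / (2 * s)"

definition trap_rate :: real where "trap_rate = \<kappa> * ratio / 2"

definition left_len :: "nat => nat" where "left_len m = nat \<lfloor>ratio * m\<rfloor>"

lemma ratio: "0 < ratio" "ratio <= 1" "ratio * ln K <= \<kappa> / (2 * s)"
proof -
  have l: "1 + ln K > 0" using K by (intro add_pos_nonneg) auto
  then show "0 < ratio" using \<kappa> s by (simp add: ratio_def)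
  show "ratio <= 1" by (simp add: ratio_def)
  have "ratio * ln K <= (\<kappa> / (2 * s) / (1 + ln K)) * (1 + ln K)"
    using K l \<kappa> s by (intro mult_mono) (auto simp: ratio_def)
  then show "ratio * ln K <= \<kappa> / (2 * s)" using l by simp
qed

lemma trap_exp_pos: "trap_exp > 0" and trap_rate_pos: "trap_rate > 0"
  using ratio \<kappa> s by (auto simp: trap_exp_def trap_rate_def)

lemma left_len_le: "left_len m <= m" and left_len_bounds: "left_len m <= ratio * m" "ratio * m <= left_len m + 1"
proof -
  show 1: "left_len m <= ratio * m" "ratio * m <= left_len m + 1"
    using ratio(1) unfolding left_len_def by (auto simp: of_nat_nat) linarith+
  have "ratio * m <= 1 * real m" using ratio(2) by (intro mult_right_mono) auto
  with 1 show "left_len m <= m" by simp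
qed

lemma prob_trapped_exp:
  assumes "A >= 1"
  obtains D where "D > 0" "\<And>E m. E \<in> {lo..hi} ==>
     prob (Suc (m + left_len m)) (trapped m (A * exp (trap_exp * m)) E) <= D * exp (- trap_rate * m)"
proof -
  define D where "D = C + C * K powr s * (3 * K * A) powr s * exp \<kappa>"
  have D: "D > 0" using C by (auto simp: D_def intro!: add_pos_nonneg)
  have "prob (Suc (m + left_len m)) (trapped m (A * exp (trap_exp * m)) E) <= D * exp (- trap_rate * m)"
    if E: "E \<in> {lo..hi}" for E m
  proof -
    \<comment> \<open>R^s costs half of the decay on the right, and R still dominates K to the power
      \<open>left_len m\<close>.\<close>
    define R where "R = exp (\<kappa> / (2 * s) * m)"
    define T where "T = A * exp (trap_exp * m)"
    have R: "R > 0" and T: "T > 0" using assms by (auto simp: R_def T_def)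
    have 1: "exp (- \<kappa> * m) * R powr s <= exp (- trap_rate * m)"
    proof -
      have "exp (- \<kappa> * m) * R powr s = exp (- (\<kappa> / 2 * m))"
        using s by (simp add: R_def powr_def flip: exp_add)
      also have "trap_rate * m <= \<kappa> / 2 * m"
        unfolding trap_rate_def using ratio \<kappa> by (intro mult_right_mono) (auto simp: mult_left_le)
      then have "exp (- (\<kappa> / 2 * m)) <= exp (- trap_rate * m)" by simp
      finally show ?thesis .
    qed
    have "K ^ left_len m = exp (left_len m * ln K)" using K by (simp add: exp_of_nat_mult)
    also have "\<dots> <= R"
    proof -
      have "left_len m * ln K <= ratio * m * ln K" using left_len_bounds K by (intro mult_right_mono) auto
      also have "\<dots> <= \<kappa> / (2 * s) * m" using mult_right_mono[OF ratio(3), of m] by (simp add: mult_ac)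
      finally show ?thesis by (simp add: R_def)
    qed
    finally have KR: "K ^ left_len m <= R" .
    have "T + 2 * T / R * K ^ Suc (left_len m) = T + 2 * T * K * (K ^ left_len m / R)" by simp
    also have "\<dots> <= T + 2 * T * K * 1" using KR R T K by (intro add_left_mono mult_left_mono) auto
    also have "\<dots> <= 3 * K * T" using mult_right_mono[OF K, of T] T by simp
    finally have T2: "T + 2 * T / R * K ^ Suc (left_len m) <= 3 * K * T" .
    have T2pos: "0 <= T + 2 * T / R * K ^ Suc (left_len m)" using T R K by simp
    have "exp (- \<kappa> * left_len m) * (T + 2 * T / R * K ^ Suc (left_len m)) powr s
        <= exp (\<kappa> - \<kappa> * ratio * m) * (3 * K * T) powr s"
    proof (intro mult_mono powr_mono2 T2 T2pos)
      have "\<kappa> * (ratio * m) <= \<kappa> * (left_len m + 1)" using left_len_bounds \<kappa> by (intro mult_left_mono) auto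
      then show "exp (- \<kappa> * left_len m) <= exp (\<kappa> - \<kappa> * ratio * m)" by (simp add: algebra_simps)
    qed (use s in auto)
    also have "(3 * K * T) powr s = (3 * K * A) powr s * exp (\<kappa> * ratio / 2 * m)"
    proof -
      have "(3 * K * T) powr s = (3 * K * A) powr s * exp (trap_exp * m) powr s"
        using K assms by (simp add: T_def powr_mult mult_ac)
      also have "exp (trap_exp * m) powr s = exp (\<kappa> * ratio / 2 * m)"
        using s by (simp add: powr_def trap_exp_def field_simps)
      finally show ?thesis .
    qed
    also have "exp (\<kappa> - \<kappa> * ratio * m) * ((3 * K * A) powr s * exp (\<kappa> * ratio / 2 * m))
        = (3 * K * A) powr s * exp \<kappa> * exp (- trap_rate * m)"
    proof -
      have "exp (\<kappa> - \<kappa> * ratio * m) * exp (\<kappa> * ratio / 2 * m) = exp \<kappa> * exp (- trap_rate * m)"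
        unfolding exp_add[symmetric] by (simp add: trap_rate_def)
      then show ?thesis by (metis mult.assoc mult.commute)
    qed
    finally have 2: "exp (- \<kappa> * left_len m) * (T + 2 * T / R * K ^ Suc (left_len m)) powr s
        <= (3 * K * A) powr s * exp \<kappa> * exp (- trap_rate * m)" .
    have "prob (Suc (m + left_len m)) (trapped m T E) <= C * exp (- \<kappa> * m) * R powr s
     + C * exp (- \<kappa> * left_len m) * K powr s * (T + 2 * T / R * K ^ Suc (left_len m)) powr s"
      by (rule prob_trapped_le[OF E T R])
    also have "\<dots> = C * (exp (- \<kappa> * m) * R powr s)
     + C * K powr s * (exp (- \<kappa> * left_len m) * (T + 2 * T / R * K ^ Suc (left_len m)) powr s)" by (simp add: mult_ac)
    also have "\<dots> <= C * exp (- trap_rate * m) + C * K powr s * ((3 * K * A) powr s * exp \<kappa> * exp (- trap_rate * m))"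
      using 1 2 C by (intro add_mono mult_left_mono) auto
    also have "\<dots> = D * exp (- trap_rate * m)" by (simp add: D_def algebra_simps)
    finally show ?thesis by (simp add: T_def)
  qed
  with D show thesis by (rule that)
qed

end

section \<open>Elimination of energies\<close>

lemma tact_poly:
  fixes P Q :: "real poly"
  assumes "degree P <= d" "degree Q <= d"
  shows "\<exists>P' Q'. degree P' <= d + length u \<and> degree Q' <= d + length u \<and>
    (\<forall>en. tact en u (poly P en, poly Q en) = (poly P' en, poly Q' en))" using assms
proof (induction u arbitrary: P Q d)
  case (Cons a u)
  define P1 Q1 where "P1 = smult (1 / snd a) ([:fst a, -1:] * P - Q)" and "Q1 = smult (snd a) P"
  have "degree ([:fst a, -1:] * P) <= 1 + d" using degree_mult_le[of "[:fst a, -1:]" P] Cons.prems by simp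
  then have "degree ([:fst a, -1:] * P - Q) <= Suc d" using Cons.prems by (intro degree_diff_le) auto
  then have d: "degree P1 <= Suc d" "degree Q1 <= Suc d"
    using Cons.prems degree_smult_le[of "snd a" P] degree_smult_le[of "1 / snd a" "[:fst a, -1:] * P - Q"]
    unfolding P1_def Q1_def by linarith+
  have "tstep en a (poly P en, poly Q en) = (poly P1 en, poly Q1 en)" for en
    by (simp add: tstep_def P1_def Q1_def algebra_simps add_divide_distrib diff_divide_distrib)
  with Cons.IH[OF d] show ?case by simp
qed auto

definition quad_form :: "real => real => real => real \<times> real => real" where
  "quad_form \<alpha> \<beta> \<gamma> x = \<alpha> * (fst x)\<^sup>2 + 2 * \<beta> * fst x * snd x + \<gamma> * (snd x)\<^sup>2"

text \<open>If the smaller eigenvalue is at most \<tau>, their product is at most \<tau> times their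
  sum. Evaluating the form at x and at its quarter turn avoids diagonalising it.\<close>

lemma quad_form_det_le:
  assumes nonneg: "\<And>x. 0 <= quad_form \<alpha> \<beta> \<gamma> x" and x: "norm x = 1" "quad_form \<alpha> \<beta> \<gamma> x <= \<tau>"
  shows "\<alpha> * \<gamma> - \<beta>\<^sup>2 <= \<tau> * (\<alpha> + \<gamma>)"
proof -
  define a b where "a = fst x" and "b = snd x"
  define y where "y = (- b, a)"
  have ab: "a\<^sup>2 + b\<^sup>2 = 1" using x(1) norm_prod_sq[of x] by (simp add: a_def b_def)
  define B where "B = \<gamma> * a * b - \<alpha> * a * b + \<beta> * (a\<^sup>2 - b\<^sup>2)"
  have Qx: "quad_form \<alpha> \<beta> \<gamma> x = \<alpha> * a\<^sup>2 + 2 * \<beta> * a * b + \<gamma> * b\<^sup>2"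
    and Qy: "quad_form \<alpha> \<beta> \<gamma> y = \<alpha> * b\<^sup>2 - 2 * \<beta> * a * b + \<gamma> * a\<^sup>2"
    by (simp_all add: quad_form_def y_def a_def b_def)
  have "quad_form \<alpha> \<beta> \<gamma> x * quad_form \<alpha> \<beta> \<gamma> y - B\<^sup>2 = (\<alpha> * \<gamma> - \<beta>\<^sup>2) * (a\<^sup>2 + b\<^sup>2)\<^sup>2"
    unfolding Qx Qy B_def by (simp add: power2_eq_square algebra_simps)
  then have det: "\<alpha> * \<gamma> - \<beta>\<^sup>2 = quad_form \<alpha> \<beta> \<gamma> x * quad_form \<alpha> \<beta> \<gamma> y - B\<^sup>2" using ab by simp
  have "quad_form \<alpha> \<beta> \<gamma> x + quad_form \<alpha> \<beta> \<gamma> y = (\<alpha> + \<gamma>) * (a\<^sup>2 + b\<^sup>2)"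
    unfolding Qx Qy by (simp add: algebra_simps)
  then have tr: "quad_form \<alpha> \<beta> \<gamma> x + quad_form \<alpha> \<beta> \<gamma> y = \<alpha> + \<gamma>" using ab by simp
  have \<tau>: "0 <= \<tau>" using nonneg[of x] x(2) by linarith
  have "\<alpha> * \<gamma> - \<beta>\<^sup>2 <= quad_form \<alpha> \<beta> \<gamma> x * quad_form \<alpha> \<beta> \<gamma> y" unfolding det by simp
  also have "\<dots> <= \<tau> * quad_form \<alpha> \<beta> \<gamma> y" using x(2) nonneg by (intro mult_right_mono) auto
  also have "\<dots> <= \<tau> * (\<alpha> + \<gamma>)" using \<tau> tr nonneg[of x] by (intro mult_left_mono) auto
  finally show ?thesis .
qed

text \<open>Converse up to a factor 2, because the larger eigenvalue is at least half the trace. If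
  the form exceeded 2\<tau> on the unit circle, subtracting 2\<tau> would keep it nonnegative, and
  the test vector (\<beta>, -A) extracts the resulting determinant inequality.\<close>

lemma quad_form_small:
  assumes "\<tau> > 0" and det: "\<alpha> * \<gamma> - \<beta>\<^sup>2 <= \<tau> * (\<alpha> + \<gamma>)"
  obtains x where "norm x = 1" "quad_form \<alpha> \<beta> \<gamma> x <= 2 * \<tau>"
proof (rule ccontr)
  assume "\<not> thesis"
  with that have big: "norm x = 1 ==> quad_form \<alpha> \<beta> \<gamma> x > 2 * \<tau>" for x by (meson not_le)
  have a: "\<alpha> > 2 * \<tau>" using big[of "(1, 0)"] by (simp add: quad_form_def norm_Pair)
  have c: "\<gamma> > 2 * \<tau>" using big[of "(0, 1)"] by (simp add: quad_form_def norm_Pair)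
  have gen: "quad_form \<alpha> \<beta> \<gamma> y >= 2 * \<tau> * (norm y)\<^sup>2" for y
  proof (cases "y = 0")
    case False
    have "quad_form \<alpha> \<beta> \<gamma> y = (norm y)\<^sup>2 * quad_form \<alpha> \<beta> \<gamma> ((1 / norm y) *\<^sub>R y)"
      using False by (simp add: quad_form_def field_simps power2_eq_square)
    also have "\<dots> >= (norm y)\<^sup>2 * (2 * \<tau>)"
      using big[of "(1 / norm y) *\<^sub>R y"] False by (intro mult_left_mono) auto
    finally show ?thesis by (simp add: mult.commute)
  qed (simp add: quad_form_def)
  define A G where "A = \<alpha> - 2 * \<tau>" and "G = \<gamma> - 2 * \<tau>"
  have AG: "A > 0" "G > 0" using a c by (auto simp: A_def G_def)
  have "0 <= A * \<beta>\<^sup>2 - 2 * \<beta> * \<beta> * A + G * A\<^sup>2" using gen[of "(\<beta>, - A)"] unfolding norm_prod_sq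
    by (simp add: quad_form_def A_def G_def algebra_simps power2_eq_square)
  then have "0 <= A * (A * G - \<beta>\<^sup>2)" by (simp add: algebra_simps power2_eq_square)
  then have "\<beta>\<^sup>2 <= A * G" using AG by (simp add: zero_le_mult_iff)
  then have "\<tau> * (\<alpha> + \<gamma>) >= 2 * \<tau> * (\<alpha> + \<gamma>) - 4 * \<tau> * \<tau>" using det by (simp add: A_def G_def algebra_simps)
  then have "\<tau> * (\<alpha> + \<gamma>) <= \<tau> * (4 * \<tau>)" by (simp add: algebra_simps)
  then show False using a c \<open>\<tau> > 0\<close> by simp
qed

text \<open>Trapping says that the sum of the two squared norms, a quadratic form in x, is small
  somewhere on the unit circle; comparing determinant and trace makes this a polynomial inequality
  in the energy, exact up to a factor 2 in T. Entries have degree at most m, coefficients of the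
  form at most 2m.\<close>

lemma trapped_poly:
  assumes T: "T > 0" and len: "length u = Suc (m + m')" "m' <= m"
  shows "\<exists>P :: real poly. degree P <= 4 * m \<and> (\<forall>en. trapped m T en u \<longrightarrow> poly P en <= 0) \<and>
    (\<forall>en. poly P en <= 0 \<longrightarrow> trapped m (2 * T) en u)"
proof -
  define r l w where "r = take m (tl u)" and "l = drop m (tl u)" and "w = snd (hd u)"
  have lr: "length r = m" "length l = m'" using len by (auto simp: r_def l_def)
  have ex: "\<exists>P Q. degree P <= m \<and> degree Q <= m \<and> (\<forall>en. tact en z x = (poly P en, poly Q en))"
    if "length z <= m" for z x
  proof -
    obtain P Q where "degree P <= 0 + length z" "degree Q <= 0 + length z"
      "\<forall>en. tact en z (poly [:fst x:] en, poly [:snd x:] en) = (poly P en, poly Q en)"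
      using tact_poly[of "[:fst x:]" 0 "[:snd x:]" z] by auto
    with that show ?thesis by (intro exI[of _ P] exI[of _ Q]) auto
  qed
  obtain P1 Q1 where 1: "degree P1 <= m" "degree Q1 <= m" "\<And>en. tact en r (1, 0) = (poly P1 en, poly Q1 en)"
    using ex[of r "(1, 0)"] lr by auto
  obtain P2 Q2 where 2: "degree P2 <= m" "degree Q2 <= m" "\<And>en. tact en r (0, 1) = (poly P2 en, poly Q2 en)"
    using ex[of r "(0, 1)"] lr by auto
  obtain P3 Q3 where 3: "degree P3 <= m" "degree Q3 <= m" "\<And>en. tact en l (flip w (1, 0)) = (poly P3 en, poly Q3 en)"
    using ex[of l "flip w (1, 0)"] lr len by auto
  obtain P4 Q4 where 4: "degree P4 <= m" "degree Q4 <= m" "\<And>en. tact en l (flip w (0, 1)) = (poly P4 en, poly Q4 en)"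
    using ex[of l "flip w (0, 1)"] lr len by auto
  define \<alpha> \<beta> \<gamma> where "\<alpha> = P1 * P1 + Q1 * Q1 + P3 * P3 + Q3 * Q3"
    and "\<beta> = P1 * P2 + Q1 * Q2 + P3 * P4 + Q3 * Q4" and "\<gamma> = P2 * P2 + Q2 * Q2 + P4 * P4 + Q4 * Q4"
  \<comment> \<open>Two squared norms of at most T^2 each give \<tau>; conversely 2\<tau> is the
    square of 2T.\<close>
  define \<tau> where "\<tau> = 2 * T\<^sup>2"
  define P where "P = \<alpha> * \<gamma> - \<beta> * \<beta> - smult \<tau> (\<alpha> + \<gamma>)"
  have mul: "degree (X * Y) <= a + b" if "degree X <= a" "degree Y <= b" for X Y :: "real poly" and a b
    using degree_mult_le[of X Y] that by linarith
  have d: "degree \<alpha> <= m + m" "degree \<beta> <= m + m" "degree \<gamma> <= m + m"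
    unfolding \<alpha>_def \<beta>_def \<gamma>_def by (intro degree_add_le mul 1 2 3 4)+
  have "degree (smult \<tau> (\<alpha> + \<gamma>)) <= (m + m) + (m + m)"
    using d degree_smult_le[of \<tau> "\<alpha> + \<gamma>"] degree_add_le[of \<alpha> "m + m" \<gamma>] by linarith
  then have "degree P <= (m + m) + (m + m)" unfolding P_def by (intro degree_diff_le mul d)
  moreover have Q: "(norm (tact en r x))\<^sup>2 + (norm (tact en l (flip w x)))\<^sup>2
      = quad_form (poly \<alpha> en) (poly \<beta> en) (poly \<gamma> en) x" for en x
  proof -
    have "tact en r x = fst x *\<^sub>R tact en r (1, 0) + snd x *\<^sub>R tact en r (0, 1)"
      unfolding tact_linear[symmetric] by simp
    moreover have "tact en l (flip w x) = fst x *\<^sub>R tact en l (flip w (1, 0)) + snd x *\<^sub>R tact en l (flip w (0, 1))"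
      unfolding tact_linear[symmetric] flip_linear[symmetric] by simp
    ultimately show ?thesis
      unfolding norm_prod_sq by (simp add: 1(3) 2(3) 3(3) 4(3) quad_form_def \<alpha>_def \<beta>_def \<gamma>_def power2_eq_square algebra_simps)
  qed
  have nonneg: "0 <= quad_form (poly \<alpha> en) (poly \<beta> en) (poly \<gamma> en) x" for en x unfolding Q[symmetric] by simp
  have polyP: "poly P en <= 0 \<longleftrightarrow> poly \<alpha> en * poly \<gamma> en - (poly \<beta> en)\<^sup>2 <= \<tau> * (poly \<alpha> en + poly \<gamma> en)" for en
    by (simp add: P_def power2_eq_square)
  have "poly P en <= 0" if tr: "trapped m T en u" for en
  proof -
    obtain x where x: "norm x = 1" "norm (tact en r x) <= T" "norm (tact en l (flip w x)) <= T"
      using tr by (auto simp: trapped_def r_def l_def w_def)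
    have "quad_form (poly \<alpha> en) (poly \<beta> en) (poly \<gamma> en) x <= T\<^sup>2 + T\<^sup>2"
      unfolding Q[symmetric] using x by (intro add_mono power_mono) auto
    then show ?thesis unfolding polyP using x(1) by (intro quad_form_det_le[OF nonneg]) (auto simp: \<tau>_def)
  qed
  moreover have "trapped m (2 * T) en u" if "poly P en <= 0" for en
  proof -
    have "\<tau> > 0" using T by (simp add: \<tau>_def)
    then obtain x where x: "norm x = 1" "quad_form (poly \<alpha> en) (poly \<beta> en) (poly \<gamma> en) x <= 2 * \<tau>"
      using quad_form_small \<open>poly P en <= 0\<close>[unfolded polyP] by metis
    have T4: "(2 * T)\<^sup>2 = 4 * T\<^sup>2" by (simp add: power_mult_distrib)
    have "(norm (tact en r x))\<^sup>2 <= (2 * T)\<^sup>2" "(norm (tact en l (flip w x)))\<^sup>2 <= (2 * T)\<^sup>2"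
      using x(2) Q[of en x] zero_le_power2[of "norm (tact en r x)"] zero_le_power2[of "norm (tact en l (flip w x))"]
      unfolding \<tau>_def T4 by linarith+
    then have "norm (tact en r x) <= 2 * T" "norm (tact en l (flip w x)) <= 2 * T"
      using T by (auto intro: power2_le_imp_le)
    then show ?thesis using x(1) unfolding trapped_def r_def l_def w_def by blast
  qed
  ultimately show ?thesis by (intro exI[of _ P]) auto
qed

context expanding
begin

lemma tact_energy_diff:
  assumes "E \<in> {lo..hi}" "E' \<in> {lo..hi}" "u \<in> words n"
  shows "norm (tact E u x - tact E' u x) <= \<bar>E - E'\<bar> * (n * K ^ n * norm x)" using assms(3)
proof (induction u arbitrary: n x)
  case (Cons a u)
  then obtain k where n: "n = Suc k" and u: "u \<in> words k" and a: "a \<in> S" by (cases n) (auto simp: words_def)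
  define y y' where "y = tstep E a x" and "y' = tstep E' a x"
  have "norm (y - y') <= \<bar>E - E'\<bar> * (K * norm x)"
  proof -
    have "y - y' = ((E' - E) * (1 / snd a) * fst x, 0)"
      by (simp add: y_def y'_def tstep_def prod_eq_iff diff_divide_distrib[symmetric] algebra_simps)
    then have "norm (y - y') = \<bar>E - E'\<bar> * (\<bar>1 / snd a\<bar> * \<bar>fst x\<bar>)"
      by (simp add: norm_Pair abs_mult abs_minus_commute)
    also have "\<dots> <= \<bar>E - E'\<bar> * (K * norm x)"
      using inverse_snd_le[OF a] abs_fst_le[of x] K by (intro mult_left_mono mult_mono) auto
    finally show ?thesis .
  qed
  have "norm (tact E (a # u) x - tact E' (a # u) x) = norm ((tact E u y - tact E' u y) + tact E' u (y - y'))"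
    using tact_linear[of E' u 1 y "-1" y'] by (simp add: y_def y'_def)
  also have "\<dots> <= norm (tact E u y - tact E' u y) + norm (tact E' u (y - y'))" by (rule norm_triangle_ineq)
  also have "\<dots> <= \<bar>E - E'\<bar> * (k * K ^ k * norm y) + K ^ k * norm (y - y')"
    by (intro add_mono Cons.IH u norm_tact_le[OF assms(2) u])
  also have "\<dots> <= \<bar>E - E'\<bar> * (k * K ^ k * (K * norm x)) + K ^ k * (\<bar>E - E'\<bar> * (K * norm x))"
    using K norm_tstep_le[OF a assms(1), of x] \<open>norm (y - y') <= _\<close>
    by (intro add_mono mult_left_mono) (auto simp: y_def)
  also have "\<dots> = \<bar>E - E'\<bar> * (n * K ^ n * norm x)" by (simp add: n algebra_simps)
  finally show ?case .
qed (use K in auto)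

lemma trapped_energy_close:
  assumes E: "E \<in> {lo..hi}" "E' \<in> {lo..hi}" and u: "u \<in> words (Suc (n + n'))" and "n' <= n" "T >= 1"
    and close: "\<bar>E - E'\<bar> * (n * K ^ Suc n) <= 1" and tr: "trapped n T E u"
  shows "trapped n (2 * T) E' u"
proof -
  define a r l where "a = hd u" and "r = take n (tl u)" and "l = drop n (tl u)"
  obtain a0 u0 where "u = a0 # u0" using u by (cases u) (auto simp: words_def)
  then have a: "a \<in> S" and r: "r \<in> words n" and l: "l \<in> words n'"
    using u by (auto simp: a_def r_def l_def words_def dest: in_set_takeD in_set_dropD)
  obtain x where x: "norm x = 1" "norm (tact E r x) <= T" "norm (tact E l (flip (snd a) x)) <= T"
    using tr by (auto simp: trapped_def a_def r_def l_def)
  have "norm (tact E' r x) <= norm (tact E r x) + norm (tact E' r x - tact E r x)" by (rule norm_triangle_sub)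
  also have "\<dots> <= T + \<bar>E' - E\<bar> * (n * K ^ n * norm x)" by (intro add_mono x tact_energy_diff E r)
  also have "\<dots> <= T + \<bar>E - E'\<bar> * (n * K ^ Suc n)"
    using K x(1) by (auto simp: abs_minus_commute intro!: mult_left_mono)
  also have "\<dots> <= 2 * T" using close assms(5) by simp
  finally have 1: "norm (tact E' r x) <= 2 * T" .
  have "norm (tact E' l (flip (snd a) x)) <= norm (tact E l (flip (snd a) x)) + norm (tact E' l (flip (snd a) x) - tact E l (flip (snd a) x))"
    by (rule norm_triangle_sub)
  also have "\<dots> <= T + \<bar>E' - E\<bar> * (n' * K ^ n' * norm (flip (snd a) x))"
    by (intro add_mono x tact_energy_diff E l)
  also have "\<dots> <= T + \<bar>E - E'\<bar> * (n * K ^ n * K)"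
    using K x(1) norm_flip_le(1)[OF a, of x] assms(4) unfolding abs_minus_commute[of E' E]
    by (intro add_left_mono mult_left_mono mult_mono power_increasing) auto
  also have "\<dots> <= 2 * T" using close assms(5) by (simp add: mult_ac)
  finally have 2: "norm (tact E' l (flip (snd a) x)) <= 2 * T" .
  show ?thesis using x(1) 1 2 unfolding trapped_def a_def r_def l_def by blast
qed

text \<open>Without a root nearby the polynomial would, by the intermediate value theorem, stay
  nonpositive on an interval of length 2\<eta>, too long for the measure bound.\<close>

lemma poly_root_near:
  fixes P :: "real poly"
  assumes "poly P x <= 0" "\<eta> > 0" "{x - \<eta>..x + \<eta>} \<subseteq> {lo..hi}"
    and meas: "measure lborel {y \<in> {lo..hi}. poly P y <= 0} < \<eta>"
  shows "\<exists>r. \<bar>x - r\<bar> <= \<eta> \<and> poly P r = 0"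
proof (rule ccontr)
  assume no: "\<not> ?thesis"
  have neg: "poly P y <= 0" if y: "y \<in> {x - \<eta>..x + \<eta>}" for y
  proof (rule ccontr)
    assume "\<not> poly P y <= 0"
    then have py: "poly P y > 0" by simp
    have px: "poly P x < 0" using assms(1) no \<open>\<eta> > 0\<close> by (metis abs_zero cancel_comm_monoid_add_class.diff_cancel less_eq_real_def)
    consider "x < y" | "y < x" using px py by force
    then show False
    proof cases
      case 1
      obtain r where "r > x" "r < y" "poly P r = 0" using poly_IVT_pos[OF 1 px py] by blast
      then show False using no y by (auto simp: abs_le_iff)
    next
      case 2
      obtain r where "r > y" "r < x" "poly P r = 0" using poly_IVT_neg[OF 2 py px] by blast
      then show False using no y by (auto simp: abs_le_iff)
    qed
  qed
  have cl: "closed {y \<in> {lo..hi}. poly P y <= 0}"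
    by (simp add: Collect_conj_eq closed_Int closed_Collect_le continuous_intros)
  have "2 * \<eta> = measure lborel {x - \<eta>..x + \<eta>}" using \<open>\<eta> > 0\<close> by simp
  also have "\<dots> <= measure lborel {y \<in> {lo..hi}. poly P y <= 0}"
  proof (rule measure_mono_fmeasurable)
    show "{x - \<eta>..x + \<eta>} \<subseteq> {y \<in> {lo..hi}. poly P y <= 0}" using neg assms(3) by auto
    show "{y \<in> {lo..hi}. poly P y <= 0} \<in> fmeasurable lborel"
      by (rule fmeasurableI2[of "{lo..hi}"]) (use cl lo_hi in \<open>auto intro!: fmeasurableI\<close>)
  qed auto
  finally show False using meas \<open>\<eta> > 0\<close> by simp
qed

text \<open>Outside an event of small probability the first word's bad energies have total length
  below \<eta>, so a common bad energy can be moved to a root that only the first word determines.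
  The hypothesis is stated with 2A because passing to the polynomial, and moving the energy of the
  second word, each double the threshold.\<close>

lemma prob_both_trapped_le:
  assumes D: "\<And>E m. E \<in> {lo..hi} ==>
      prob (Suc (m + left_len m)) (trapped m (2 * A * exp (trap_exp * m)) E) <= D * exp (- trap_rate * m)"
    and A: "A >= 1" and \<eta>: "\<eta> > 0" "lo <= lo' - \<eta>" "hi' + \<eta> <= hi" "\<eta> * (n * K ^ Suc n) <= 1"
  shows "mean (Suc (m + left_len m)) (\<lambda>u. prob (Suc (n + left_len n)) (\<lambda>w.
      \<exists>en\<in>{lo'..hi'}. trapped m (A * exp (trap_exp * m)) en u \<and> trapped n (A * exp (trap_exp * n)) en w))
    <= (hi - lo) * D * exp (- trap_rate * m) / \<eta> + 4 * m * D * exp (- trap_rate * n)"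
proof -
  define Lm Ln where "Lm = Suc (m + left_len m)" and "Ln = Suc (n + left_len n)"
  define Tm Tn where "Tm = A * exp (trap_exp * m)" and "Tn = A * exp (trap_exp * n)"
  have T: "Tm > 0" "Tn >= 1"
  proof -
    show "Tm > 0" using A by (simp add: Tm_def)
    have "1 * 1 <= A * exp (trap_exp * n)" using A trap_exp_pos by (intro mult_mono) auto
    then show "Tn >= 1" by (simp add: Tn_def)
  qed
  have D0: "D >= 0"
  proof -
    have "0 <= prob (Suc (0 + left_len 0)) (trapped 0 (2 * A * exp (trap_exp * real 0)) lo)" by (rule prob_nonneg)
    also have "\<dots> <= D * exp (- trap_rate * real 0)" using lo_hi by (intro D) auto
    finally show ?thesis by simp
  qed
  have "\<forall>u\<in>words Lm. \<exists>P :: real poly. degree P <= 4 * m \<and> (\<forall>en. trapped m Tm en u \<longrightarrow> poly P en <= 0) \<and>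
    (\<forall>en. poly P en <= 0 \<longrightarrow> trapped m (2 * Tm) en u)"
  proof
    fix u assume "u \<in> words Lm"
    then have "length u = Suc (m + left_len m)" by (simp add: words_def Lm_def)
    from trapped_poly[OF T(1) this left_len_le]
    show "\<exists>P :: real poly. degree P <= 4 * m \<and> (\<forall>en. trapped m Tm en u \<longrightarrow> poly P en <= 0) \<and>
      (\<forall>en. poly P en <= 0 \<longrightarrow> trapped m (2 * Tm) en u)" .
  qed
  from bchoice[OF this] obtain P where "\<forall>u\<in>words Lm. degree (P u :: real poly) <= 4 * m \<and>
    (\<forall>en. trapped m Tm en u \<longrightarrow> poly (P u) en <= 0) \<and> (\<forall>en. poly (P u) en <= 0 \<longrightarrow> trapped m (2 * Tm) en u)" by blast
  then have P: "\<And>u. u \<in> words Lm ==> degree (P u :: real poly) <= 4 * m"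
    "\<And>u en. u \<in> words Lm ==> trapped m Tm en u ==> poly (P u) en <= 0"
    "\<And>u en. u \<in> words Lm ==> poly (P u) en <= 0 ==> trapped m (2 * Tm) en u" by blast+
  define Z where "Z u = {y \<in> {lo..hi}. poly (P u) y <= 0}" for u
  have cl: "closed (Z u)" for u
    unfolding Z_def by (simp add: Collect_conj_eq closed_Int closed_Collect_le continuous_intros)
  have Zint: "integrable lborel (indicator (Z u) :: real => real)" for u
  proof (rule integrable_real_indicator)
    show "Z u \<in> sets lborel" using cl by auto
    have "emeasure lborel (Z u) <= emeasure lborel {lo..hi}" by (rule emeasure_mono) (auto simp: Z_def)
    also have "\<dots> < \<infinity>" using lo_hi by simp
    finally show "emeasure lborel (Z u) < \<infinity>" .
  qed
  \<comment> \<open>Fubini: the expected length of the set of bad energies is the integral of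
    fixed-energy probabilities.\<close>
  have mean_meas: "mean Lm (\<lambda>u. measure lborel (Z u)) <= (hi - lo) * D * exp (- trap_rate * m)"
  proof -
    have "mean Lm (\<lambda>u. measure lborel (Z u)) = (\<Sum>u\<in>words Lm. weight u * (\<integral>en. indicator (Z u) en \<partial>lborel))"
      unfolding mean_eq_sum using cl by simp
    also have "\<dots> = (\<Sum>u\<in>words Lm. (\<integral>en. weight u * indicator (Z u) en \<partial>lborel))" by simp
    also have "\<dots> = (\<integral>en. (\<Sum>u\<in>words Lm. weight u * indicator (Z u) en) \<partial>lborel)"
      by (rule Bochner_Integration.integral_sum[symmetric]) (rule integrable_mult_right[OF Zint])
    also have "\<dots> <= (\<integral>en. D * exp (- trap_rate * m) * indicator {lo..hi} en \<partial>lborel)"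
    proof (rule integral_mono)
      show "integrable lborel (\<lambda>en. \<Sum>u\<in>words Lm. weight u * indicator (Z u) en :: real)"
        by (intro Bochner_Integration.integrable_sum integrable_mult_right Zint)
      show "integrable lborel (\<lambda>en. D * exp (- trap_rate * m) * indicator {lo..hi} en)"
        using lo_hi by (intro integrable_mult_right integrable_real_indicator) auto
      fix en
      show "(\<Sum>u\<in>words Lm. weight u * indicator (Z u) en) <= D * exp (- trap_rate * m) * indicator {lo..hi} en"
      proof (cases "en \<in> {lo..hi}")
        case True
        have "(\<Sum>u\<in>words Lm. weight u * indicator (Z u) en) = mean Lm (\<lambda>u. indicator (Z u) en)"
          by (simp add: mean_eq_sum)
        also have "\<dots> <= prob Lm (trapped m (2 * A * exp (trap_exp * m)) en)"
          unfolding prob_def using P(3) by (intro mean_mono) (auto simp: Z_def Tm_def mult.assoc indicator_def)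
        also have "\<dots> <= D * exp (- trap_rate * m)" unfolding Lm_def by (rule D[OF True])
        finally show ?thesis using True by simp
      next
        case False
        then have "en \<notin> Z u" for u by (auto simp: Z_def)
        then show ?thesis using False by simp
      qed
    qed
    also have "\<dots> = (hi - lo) * D * exp (- trap_rate * m)" using lo_hi by simp
    finally show ?thesis .
  qed
  \<comment> \<open>The second word is independent of the roots, so the fixed-energy bound applies
    at each of the at most 4m roots.\<close>
  have good: "prob Ln (\<lambda>w. \<exists>en\<in>{lo'..hi'}. trapped m Tm en u \<and> trapped n Tn en w) <= 4 * m * D * exp (- trap_rate * n)"
    if u: "u \<in> words Lm" and small: "measure lborel (Z u) < \<eta>" for u
  proof (cases "P u = 0")
    case True
    have "{y \<in> {lo..hi}. poly (P u) y <= 0} = {lo..hi}" using True by auto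
    \<comment> \<open>A vanishing polynomial makes every energy bad; then \<eta> exceeds the whole
      interval, and shrinking by \<eta> on both sides leaves no energies to consider.\<close>
    then have "hi - lo < \<eta>" using small lo_hi by (simp add: Z_def)
    then have "{lo'..hi'} = {}" using \<eta> by auto
    then show ?thesis using D0 by (simp add: prob_def mean_const)
  next
    case False
    define R where "R = {r. poly (P u) r = 0} \<inter> {lo..hi}"
    have fin: "finite {r. poly (P u) r = 0}" using poly_roots_finite[OF False] .
    have "prob Ln (\<lambda>w. \<exists>en\<in>{lo'..hi'}. trapped m Tm en u \<and> trapped n Tn en w)
        <= prob Ln (\<lambda>w. \<exists>r\<in>R. trapped n (2 * Tn) r w)"
    proof (rule prob_mono)
      fix w assume w: "w \<in> words Ln" and "\<exists>en\<in>{lo'..hi'}. trapped m Tm en u \<and> trapped n Tn en w"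
      then obtain en where en: "en \<in> {lo'..hi'}" "trapped m Tm en u" "trapped n Tn en w" by blast
      have sub: "{en - \<eta>..en + \<eta>} \<subseteq> {lo..hi}" using en(1) \<eta> by auto
      obtain r where r: "\<bar>en - r\<bar> <= \<eta>" "poly (P u) r = 0"
        using poly_root_near[OF P(2)[OF u en(2)] \<eta>(1) sub] small by (auto simp: Z_def)
      have r': "r \<in> {lo..hi}" using r(1) sub by (auto simp: abs_le_iff subset_iff)
      have "\<bar>en - r\<bar> * (n * K ^ Suc n) <= \<eta> * (n * K ^ Suc n)" using r(1) K by (intro mult_right_mono) auto
      then have "\<bar>en - r\<bar> * (n * K ^ Suc n) <= 1" using \<eta>(4) by linarith
      moreover have "en \<in> {lo..hi}" using en(1) \<eta> by auto
      ultimately have "trapped n (2 * Tn) r w"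
        using w r' T(2) en(3) left_len_le unfolding Ln_def by (intro trapped_energy_close) auto
      then show "\<exists>r\<in>R. trapped n (2 * Tn) r w" using r(2) r' by (auto simp: R_def)
    qed
    also have "\<dots> <= (\<Sum>r\<in>R. prob Ln (trapped n (2 * Tn) r))"
      by (rule prob_Bex_le) (use fin in \<open>auto simp: R_def\<close>)
    also have "\<dots> <= (\<Sum>r\<in>R. D * exp (- trap_rate * n))"
      using D[of _ n] by (intro sum_mono) (auto simp: R_def Ln_def Tn_def mult.assoc)
    also have "\<dots> = card R * (D * exp (- trap_rate * n))" by simp
    also have "\<dots> <= real (4 * m) * (D * exp (- trap_rate * n))"
    proof (rule mult_right_mono)
      have "card R <= card {r. poly (P u) r = 0}" using fin by (intro card_mono) (auto simp: R_def)
      also have "\<dots> <= degree (P u)" by (rule card_poly_roots_bound[OF False])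
      also have "\<dots> <= 4 * m" by (rule P(1)[OF u])
      finally show "real (card R) <= real (4 * m)" by simp
    qed (use D0 in simp)
    finally show ?thesis by (simp add: mult_ac)
  qed
  have "mean Lm (\<lambda>u. prob Ln (\<lambda>w. \<exists>en\<in>{lo'..hi'}. trapped m Tm en u \<and> trapped n Tn en w))
      <= mean Lm (\<lambda>u. of_bool (\<eta> <= measure lborel (Z u)) + 4 * m * D * exp (- trap_rate * n))"
  proof (rule mean_mono)
    fix u assume u: "u \<in> words Lm"
    show "prob Ln (\<lambda>w. \<exists>en\<in>{lo'..hi'}. trapped m Tm en u \<and> trapped n Tn en w)
        <= of_bool (\<eta> <= measure lborel (Z u)) + 4 * m * D * exp (- trap_rate * n)"
    proof (cases "\<eta> <= measure lborel (Z u)")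
      case True
      then show ?thesis using prob_le_1[of Ln] D0 by (simp add: add_increasing2)
    next
      case False
      then show ?thesis using good[OF u] by simp
    qed
  qed
  also have "\<dots> = prob Lm (\<lambda>u. \<eta> <= measure lborel (Z u)) + 4 * m * D * exp (- trap_rate * n)"
    by (simp add: mean_add mean_const prob_def)
  also have "prob Lm (\<lambda>u. \<eta> <= measure lborel (Z u)) <= mean Lm (\<lambda>u. measure lborel (Z u)) / \<eta>"
    using \<eta>(1) by (intro markov) auto
  also have "\<dots> <= ((hi - lo) * D * exp (- trap_rate * m)) / \<eta>"
    using \<eta>(1) by (intro divide_right_mono mean_meas) auto
  finally show ?thesis by (simp add: Lm_def Ln_def Tm_def Tn_def)
qed

end

section \<open>Finite Jacobi matrices\<close>

text \<open>Induction on the equations, eliminating one unknown. It supplies the dimension counts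
  behind completeness of the eigenvectors and the comparison of eigenvalue counts.\<close>

lemma underdetermined_system:
  fixes M :: "'i => 'j => real"
  assumes "finite I" "finite J" "card I < card J"
  shows "\<exists>c. (\<exists>j\<in>J. c j \<noteq> 0) \<and> (\<forall>i\<in>I. (\<Sum>j\<in>J. M i j * c j) = 0)" using assms
proof (induction I arbitrary: J M rule: finite_induct)
  case empty
  then obtain j where "j \<in> J" by (metis card.empty card_gt_0_iff ex_in_conv)
  then show ?case by (intro exI[of _ "\<lambda>_. 1"]) auto
next
  case (insert i I)
  show ?case
  proof (cases "\<forall>j\<in>J. M i j = 0")
    case True
    obtain c where "\<exists>j\<in>J. c j \<noteq> 0" "\<forall>k\<in>I. (\<Sum>j\<in>J. M k j * c j) = 0"
      using insert.IH[of J M] insert.prems insert.hyps by auto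
    with True show ?thesis by (intro exI[of _ c]) auto
  next
    case False
    then obtain j0 where j0: "j0 \<in> J" "M i j0 \<noteq> 0" by blast
    define J' where "J' = J - {j0}"
    have "finite J'" "card I < card J'" using insert.prems insert.hyps j0 by (auto simp: J'_def)
    from insert.IH[OF this, of "\<lambda>k j. M k j - M k j0 / M i j0 * M i j"]
    obtain c where c: "\<exists>j\<in>J'. c j \<noteq> 0" "\<forall>k\<in>I. (\<Sum>j\<in>J'. (M k j - M k j0 / M i j0 * M i j) * c j) = 0" by blast
    define s where "s = (\<Sum>j\<in>J'. M i j * c j)"
    define c' where "c' j = (if j = j0 then - s / M i j0 else c j)" for j
    have sum_J: "(\<Sum>j\<in>J. M k j * c' j) = (\<Sum>j\<in>J'. M k j * c j) - M k j0 / M i j0 * s" for k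
    proof -
      have "(\<Sum>j\<in>J. M k j * c' j) = M k j0 * c' j0 + (\<Sum>j\<in>J'. M k j * c' j)"
        using insert.prems(1) j0(1) by (simp add: J'_def sum.remove)
      also have "(\<Sum>j\<in>J'. M k j * c' j) = (\<Sum>j\<in>J'. M k j * c j)" by (rule sum.cong) (auto simp: J'_def c'_def)
      finally show ?thesis by (simp add: c'_def)
    qed
    have "(\<Sum>j\<in>J. M k j * c' j) = 0" if "k \<in> insert i I" for k
    proof (cases "k = i")
      case True
      then show ?thesis using j0 by (simp add: sum_J s_def)
    next
      case False
      then have "(\<Sum>j\<in>J'. (M k j - M k j0 / M i j0 * M i j) * c j) = 0" using c(2) that by auto
      then show ?thesis by (simp add: sum_J s_def left_diff_distrib sum_subtractf sum_distrib_left mult.assoc)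
    qed
    moreover have "\<exists>j\<in>J. c' j \<noteq> 0" using c(1) by (auto simp: c'_def J'_def)
    ultimately show ?thesis by blast
  qed
qed

text \<open>The solution of the eigenvalue recursion that vanishes left of site 0 and equals 1
  there, as a polynomial in the energy. Its n-th value vanishing is the Dirichlet condition at the
  right end, so its zeros are the eigenvalues of the box of n sites; the entry \<open>W n\<close>
  outside the box only rescales it.\<close>

fun jpoly :: "(nat => real) => (nat => real) => nat => real poly" where
  "jpoly V W 0 = 1"
| "jpoly V W (Suc 0) = smult (1 / W 1) [:V 0, -1:]"
| "jpoly V W (Suc (Suc k)) =
    smult (1 / W (Suc (Suc k))) ([:V (Suc k), -1:] * jpoly V W (Suc k) - smult (W (Suc k)) (jpoly V W k))"

definition jeigs :: "(nat => real) => (nat => real) => nat => real set" where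
  "jeigs V W n = {e. poly (jpoly V W n) e = 0}"

definition jvec :: "(nat => real) => (nat => real) => nat => real => nat => real" where
  "jvec V W n e k = poly (jpoly V W k) e / sqrt (\<Sum>i<n. (poly (jpoly V W i) e)\<^sup>2)"

definition jop :: "(nat => real) => (nat => real) => nat => (nat => real) => nat => real" where
  "jop V W n \<psi> k = V k * \<psi> k - (if Suc k < n then W (Suc k) * \<psi> (Suc k) else 0) - (if k > 0 then W k * \<psi> (k - 1) else 0)"

definition jform :: "(nat => real) => (nat => real) => nat => (nat => real) => (nat => real) => real" where
  "jform V W n \<psi> \<phi> = (\<Sum>k<n. V k * \<psi> k * \<phi> k) - (\<Sum>k<n - 1. W (Suc k) * (\<psi> k * \<phi> (Suc k) + \<psi> (Suc k) * \<phi> k))"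

definition jcount :: "(nat => real) => (nat => real) => nat => real => nat" where
  "jcount V W n e = card {x \<in> jeigs V W n. x <= e}"

text \<open>Summation of the Wronskian of two solutions. Stated over a field to be used twice: with
  z and its conjugate to show that roots are real, and with two eigenvalues to show
  orthogonality.\<close>

lemma christoffel_darboux:
  fixes u v :: "nat => 'a :: field" and V W :: "nat => 'a"
  assumes "\<And>k. W (Suc k) * u (Suc k) = (V k - a) * u k - (if k > 0 then W k * u (k - 1) else 0)"
    and "\<And>k. W (Suc k) * v (Suc k) = (V k - b) * v k - (if k > 0 then W k * v (k - 1) else 0)"
  shows "(a - b) * (\<Sum>k<n. u k * v k) = (if n > 0 then - (W n * (u n * v (n - 1) - u (n - 1) * v n)) else 0)"
proof (induction n)
  case (Suc n)
  define R where "R = (if n > 0 then W n * (u n * v (n - 1) - u (n - 1) * v n) else 0)"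
  have "W (Suc n) * (u (Suc n) * v n - u n * v (Suc n)) = (W (Suc n) * u (Suc n)) * v n - u n * (W (Suc n) * v (Suc n))"
    by (simp add: algebra_simps)
  also have "\<dots> = (b - a) * (u n * v n) + R" unfolding assms R_def by (simp add: algebra_simps)
  finally have step: "W (Suc n) * (u (Suc n) * v n - u n * v (Suc n)) = (b - a) * (u n * v n) + R" .
  have IH: "(a - b) * (\<Sum>k<n. u k * v k) = - R" using Suc by (simp add: R_def)
  have "(a - b) * (\<Sum>k<Suc n. u k * v k) = (a - b) * (\<Sum>k<n. u k * v k) + (a - b) * (u n * v n)"
    by (simp add: distrib_left)
  also have "\<dots> = - ((b - a) * (u n * v n) + R)" unfolding IH by (simp add: algebra_simps)
  finally show ?case using step by simp
qed simp

lemma jform_sym: "jform V W n \<psi> \<phi> = jform V W n \<phi> \<psi>" by (simp add: jform_def mult_ac add.commute)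

lemma sum_mult_jop: "(\<Sum>k<n. \<psi> k * jop V W n \<phi> k) = jform V W n \<psi> \<phi>"
proof (cases n)
  case (Suc m)
  have 1: "(\<Sum>k<n. \<psi> k * (if Suc k < n then W (Suc k) * \<phi> (Suc k) else 0)) = (\<Sum>k<m. \<psi> k * (W (Suc k) * \<phi> (Suc k)))"
    unfolding Suc by simp
  have 2: "(\<Sum>k<n. \<psi> k * (if k > 0 then W k * \<phi> (k - 1) else 0)) = (\<Sum>k<m. \<psi> (Suc k) * (W (Suc k) * \<phi> k))"
    unfolding Suc by (subst sum.lessThan_Suc_shift) simp
  have "(\<Sum>k<n. \<psi> k * jop V W n \<phi> k) = (\<Sum>k<n. V k * \<psi> k * \<phi> k)
      - (\<Sum>k<n. \<psi> k * (if Suc k < n then W (Suc k) * \<phi> (Suc k) else 0))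
      - (\<Sum>k<n. \<psi> k * (if k > 0 then W k * \<phi> (k - 1) else 0))"
    unfolding sum_subtractf[symmetric] by (rule sum.cong) (auto simp: jop_def algebra_simps)
  then show ?thesis unfolding 1 2 jform_def by (simp add: Suc sum.distrib algebra_simps)
qed (simp add: jform_def)

lemma jform_Suc:
  "jform V W (Suc n) \<psi> \<phi> = jform V W n \<psi> \<phi> + V n * \<psi> n * \<phi> n
    - (if n > 0 then W n * (\<psi> (n - 1) * \<phi> n + \<psi> n * \<phi> (n - 1)) else 0)" by (cases n) (auto simp: jform_def)

lemma jform_append:
  "jform V W (n + m) \<psi> \<psi> = jform V W n \<psi> \<psi> + jform (\<lambda>k. V (n + k)) (\<lambda>k. W (n + k)) m (\<lambda>k. \<psi> (n + k)) (\<lambda>k. \<psi> (n + k))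
    - (if n > 0 \<and> m > 0 then 2 * W n * \<psi> (n - 1) * \<psi> n else 0)"
proof (induction m)
  case 0
  then show ?case by (simp add: jform_def)
next
  case (Suc m)
  then show ?case by (cases m) (auto simp: jform_Suc algebra_simps)
qed

section \<open>Spectral theorem for a finite Jacobi matrix\<close>

locale jacobi_box =
  fixes V W :: "nat => real"
  assumes W_nz: "\<And>k. W k \<noteq> 0"
begin

lemma jpoly_rec:
  "W (Suc k) * poly (jpoly V W (Suc k)) e = (V k - e) * poly (jpoly V W k) e - (if k > 0 then W k * poly (jpoly V W (k - 1)) e else 0)"
  using W_nz by (cases k) (auto simp: algebra_simps)

lemma jpoly_rec_poly:
  "smult (W (Suc k)) (jpoly V W (Suc k)) = [:V k, -1:] * jpoly V W k - (if k > 0 then smult (W k) (jpoly V W (k - 1)) else 0)"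
  using W_nz by (cases k) auto

lemma jpoly_degree: "degree (jpoly V W n) = n \<and> jpoly V W n \<noteq> 0"
proof (induction n rule: less_induct)
  case (less n)
  show ?case
  proof (cases n)
    case (Suc k)
    have k: "degree (jpoly V W k) = k" "jpoly V W k \<noteq> 0" using less[of k] Suc by auto
    have d: "degree ([:V k, -1:] * jpoly V W k) = Suc k" using k by (subst degree_mult_eq) auto
    have "degree (if k > 0 then smult (W k) (jpoly V W (k - 1)) else 0) < Suc k"
      using less[of "k - 1"] Suc degree_smult_le[of "W k" "jpoly V W (k - 1)"] by (cases k) auto
    then have "degree (smult (W (Suc k)) (jpoly V W (Suc k))) = Suc k"
      unfolding jpoly_rec_poly using d by (subst diff_conv_add_uminus, subst degree_add_eq_left) auto
    then have dn: "degree (jpoly V W n) = n" using W_nz Suc by simp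
    then show ?thesis using Suc by (metis degree_0 nat.distinct(1))
  qed simp
qed

lemma sum_sq_pos: "n > 0 ==> (\<Sum>i<n. (poly (jpoly V W i) e)\<^sup>2) > 0" by (rule sum_pos2[of _ 0]) auto

text \<open>Confluent Christoffel-Darboux identity: the Wronskian of the solution and its energy
  derivative is minus a sum of squares, and it would vanish at a double root.\<close>

lemma jpoly_simple_root:
  assumes "poly (jpoly V W n) e = 0"
  shows "poly (pderiv (jpoly V W n)) e \<noteq> 0"
proof
  assume d0: "poly (pderiv (jpoly V W n)) e = 0"
  define u where "u k = poly (jpoly V W k) e" for k
  define d where "d k = poly (pderiv (jpoly V W k)) e" for k
  have n: "n > 0" using assms by (cases n) auto
  have ru: "W (Suc k) * u (Suc k) = (V k - e) * u k - (if k > 0 then W k * u (k - 1) else 0)" for k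
    unfolding u_def by (rule jpoly_rec)
  have rd: "W (Suc k) * d (Suc k) = (V k - e) * d k - u k - (if k > 0 then W k * d (k - 1) else 0)" for k
  proof -
    have "pderiv (smult (W (Suc k)) (jpoly V W (Suc k)))
        = pderiv ([:V k, -1:] * jpoly V W k - (if k > 0 then smult (W k) (jpoly V W (k - 1)) else 0))"
      by (simp only: jpoly_rec_poly)
    then have "W (Suc k) * d (Suc k) = poly (pderiv ([:V k, -1:] * jpoly V W k - (if k > 0 then smult (W k) (jpoly V W (k - 1)) else 0))) e"
      by (simp add: d_def pderiv_smult flip: poly_smult)
    also have "\<dots> = (V k - e) * d k - u k - (if k > 0 then W k * d (k - 1) else 0)"
      unfolding pderiv_diff pderiv_mult by (simp add: pderiv_smult pderiv_pCons d_def u_def algebra_simps)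
    finally show ?thesis .
  qed
  have "(if m > 0 then W m * (d m * u (m - 1) - d (m - 1) * u m) else 0) = - (\<Sum>k<m. (u k)\<^sup>2)" for m
  proof (induction m)
    case (Suc m)
    have "W (Suc m) * (d (Suc m) * u m - d m * u (Suc m)) = (W (Suc m) * d (Suc m)) * u m - d m * (W (Suc m) * u (Suc m))"
      by (simp add: algebra_simps)
    also have "\<dots> = - (u m)\<^sup>2 + (if m > 0 then W m * (d m * u (m - 1) - d (m - 1) * u m) else 0)"
      unfolding ru rd by (simp add: algebra_simps power2_eq_square)
    finally show ?case using Suc by simp
  qed simp
  from this[of n] have "(\<Sum>k<n. (u k)\<^sup>2) = 0" using n assms d0 by (simp add: u_def d_def)
  with sum_sq_pos[OF n, of e] show False by (simp add: u_def)
qed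

text \<open>At a root the boundary term disappears, leaving z minus its conjugate times a positive
  sum of squares.\<close>

lemma complex_root_real:
  assumes "poly (map_poly complex_of_real (jpoly V W n)) z = 0"
  shows "z \<in> \<real>"
proof -
  define u where "u k = poly (map_poly complex_of_real (jpoly V W k)) z" for k
  define v where "v k = cnj (u k)" for k
  have n: "n > 0" using assms by (cases n) auto
  have ru: "of_real (W (Suc k)) * u (Suc k) = (of_real (V k) - z) * u k - (if k > 0 then of_real (W k) * u (k - 1) else 0)" for k
  proof -
    have "poly (map_poly complex_of_real (smult (W (Suc k)) (jpoly V W (Suc k)))) z
        = poly (map_poly complex_of_real ([:V k, -1:] * jpoly V W k - (if k > 0 then smult (W k) (jpoly V W (k - 1)) else 0))) z"
      by (simp only: jpoly_rec_poly)
    moreover have hom: "poly (map_poly complex_of_real (p - q)) z = poly (map_poly complex_of_real p) z - poly (map_poly complex_of_real q) z"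
       "poly (map_poly complex_of_real (smult c p)) z = of_real c * poly (map_poly complex_of_real p) z" for p q c
    proof -
      have "map_poly complex_of_real (p - q) = map_poly complex_of_real p - map_poly complex_of_real q"
        by (rule poly_eqI) (simp add: coeff_map_poly)
      then show "poly (map_poly complex_of_real (p - q)) z = poly (map_poly complex_of_real p) z - poly (map_poly complex_of_real q) z"
        by simp
      have "map_poly complex_of_real (smult c p) = smult (of_real c) (map_poly complex_of_real p)"
        by (rule poly_eqI) (simp add: coeff_map_poly)
      then show "poly (map_poly complex_of_real (smult c p)) z = of_real c * poly (map_poly complex_of_real p) z"
        by simp
    qed
    moreover have lin: "poly (map_poly complex_of_real ([:v, -1:] * p)) z = (of_real v - z) * poly (map_poly complex_of_real p) z" for v p
    proof -
      have "[:v, -1:] * p = smult v p - pCons 0 p" by simp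
      then have "poly (map_poly complex_of_real ([:v, -1:] * p)) z
          = poly (map_poly complex_of_real (smult v p)) z - poly (map_poly complex_of_real (pCons 0 p)) z"
        by (simp only: hom)
      then show ?thesis by (simp only: hom) (simp add: map_poly_pCons left_diff_distrib)
    qed
    ultimately show ?thesis by (cases "k > 0") (simp_all only: u_def if_True if_False diff_0_right hom lin)
  qed
  have rv: "of_real (W (Suc k)) * v (Suc k) = (of_real (V k) - cnj z) * v k - (if k > 0 then of_real (W k) * v (k - 1) else 0)" for k
    using arg_cong[OF ru[of k], of cnj] by (simp add: v_def split: if_splits)
  have un: "u n = 0" "v n = 0" using assms by (auto simp: u_def v_def)
  have "(z - cnj z) * (\<Sum>k<n. u k * v k) = 0"
    using christoffel_darboux[of "\<lambda>k. of_real (W k)" u "\<lambda>k. of_real (V k)" z v "cnj z" n, OF ru rv] un by simp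
  moreover have "(\<Sum>k<n. u k * v k) = of_real (\<Sum>k<n. (cmod (u k))\<^sup>2)"
    by (simp add: v_def complex_norm_square flip: of_real_power)
  moreover have "(\<Sum>k<n. (cmod (u k))\<^sup>2) > 0" by (rule sum_pos2[of _ 0]) (use n in \<open>auto simp: u_def\<close>)
  ultimately have "(z - cnj z) * of_real (\<Sum>k<n. (cmod (u k))\<^sup>2) = 0" "complex_of_real (\<Sum>k<n. (cmod (u k))\<^sup>2) \<noteq> 0"
    by (metis, metis less_irrefl of_real_eq_0_iff)
  then have "z = cnj z" by (metis mult_eq_0_iff right_minus_eq)
  then show ?thesis by (simp add: Reals_cnj_iff)
qed

lemma finite_jeigs: "finite (jeigs V W n)"
  unfolding jeigs_def using jpoly_degree by (simp add: poly_roots_finite)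

lemma poly_map_of_real: "poly (map_poly complex_of_real P) (of_real x) = of_real (poly P x)"
  by (induction P) (auto simp: map_poly_pCons)

lemma card_jeigs: "card (jeigs V W n) = n"
proof -
  define Q where "Q = map_poly complex_of_real (jpoly V W n)"
  have dQ: "degree Q = n" using jpoly_degree[of n] by (simp add: Q_def degree_map_poly)
  have Q0: "Q \<noteq> 0" using jpoly_degree[of n] by (auto simp: Q_def map_poly_eq_0_iff)
  have roots: "{z. poly Q z = 0} = complex_of_real ` jeigs V W n"
  proof (intro equalityI subsetI)
    fix z assume "z \<in> {z. poly Q z = 0}"
    then have z: "poly Q z = 0" by simp
    then obtain x where x: "z = of_real x" using complex_root_real by (auto simp: Q_def Reals_def)
    then have "poly (jpoly V W n) x = 0" using z by (simp add: Q_def poly_map_of_real)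
    then show "z \<in> complex_of_real ` jeigs V W n" using x by (simp add: jeigs_def)
  qed (auto simp: Q_def jeigs_def poly_map_of_real)
  have "rsquarefree Q" unfolding rsquarefree_roots
  proof (intro allI notI)
    fix z assume A: "poly Q z = 0 \<and> poly (pderiv Q) z = 0"
    then obtain x where x: "z = of_real x" "poly (jpoly V W n) x = 0" using roots by (auto simp: jeigs_def)
    have "pderiv Q = map_poly complex_of_real (pderiv (jpoly V W n))"
      unfolding Q_def by (rule poly_eqI) (simp add: coeff_pderiv coeff_map_poly)
    then have "poly (pderiv (jpoly V W n)) x = 0" using A x by (simp add: poly_map_of_real)
    then show False using jpoly_simple_root[OF x(2)] by simp
  qed
  then have "smult (lead_coeff Q) (\<Prod>z|poly Q z = 0. [:-z, 1:]) = Q" by (rule complex_poly_decompose_rsquarefree)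
  then have "degree Q = degree (\<Prod>z|poly Q z = 0. [:-z, 1:])" by (metis Q0 degree_smult_eq leading_coeff_0_iff)
  also have "\<dots> = card {z. poly Q z = 0}" by (subst degree_prod_eq_sum_degree) auto
  also have "\<dots> = card (jeigs V W n)" unfolding roots by (rule card_image) (auto simp: inj_on_def)
  finally show ?thesis using dQ by simp
qed

lemma jvec_rec:
  "W (Suc k) * jvec V W n e (Suc k) = (V k - e) * jvec V W n e k - (if k > 0 then W k * jvec V W n e (k - 1) else 0)"
  using arg_cong[OF jpoly_rec[of k e], of "\<lambda>x. x / sqrt (\<Sum>i<n. (poly (jpoly V W i) e)\<^sup>2)"]
  by (simp add: jvec_def diff_divide_distrib split: if_splits)

lemma jvec_end: "e \<in> jeigs V W n ==> jvec V W n e n = 0" by (simp add: jvec_def jeigs_def)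

lemma jop_jvec:
  assumes "e \<in> jeigs V W n" "k < n"
  shows "jop V W n (jvec V W n e) k = e * jvec V W n e k"
  using jvec_rec[of k n e] jvec_end[OF assms(1)] assms(2)
  by (cases "Suc k = n") (auto simp: jop_def algebra_simps)

lemma jvec_orthonormal:
  assumes "e \<in> jeigs V W n" "e' \<in> jeigs V W n"
  shows "(\<Sum>k<n. jvec V W n e k * jvec V W n e' k) = (if e = e' then 1 else 0)"
proof (cases "e = e'")
  case True
  have n: "n > 0" using assms(1) by (cases n) (auto simp: jeigs_def)
  define N where "N = (\<Sum>i<n. (poly (jpoly V W i) e)\<^sup>2)"
  have "N > 0" unfolding N_def by (rule sum_sq_pos[OF n])
  then have "(\<Sum>k<n. jvec V W n e k * jvec V W n e k) = (\<Sum>k<n. (poly (jpoly V W k) e)\<^sup>2 / N)"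
    proof (intro sum.cong refl)
    fix k
    have "jvec V W n e k = poly (jpoly V W k) e / sqrt N" by (simp add: jvec_def N_def)
    then show "jvec V W n e k * jvec V W n e k = (poly (jpoly V W k) e)\<^sup>2 / N"
      using \<open>N > 0\<close> by (simp add: power2_eq_square)
  qed
  also have "\<dots> = 1" using \<open>N > 0\<close> by (simp add: N_def flip: sum_divide_distrib)
  finally show ?thesis using True by simp
next
  case False
  have "(e - e') * (\<Sum>k<n. jvec V W n e k * jvec V W n e' k) = 0"
    using christoffel_darboux[of W "jvec V W n e" V e "jvec V W n e'" e' n, OF jvec_rec jvec_rec]
      jvec_end[OF assms(1)] jvec_end[OF assms(2)] by simp
  with False show ?thesis by simp
qed

text \<open>There are n orthonormal eigenvectors in dimension n. The residual r of a basis vector is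
  orthogonal to all of them; together they are n + 1 dependent vectors, orthogonality kills the
  coefficients of the eigenvectors, so r itself vanishes.\<close>

lemma jvec_complete:
  assumes "i < n" "j < n"
  shows "(\<Sum>e\<in>jeigs V W n. jvec V W n e i * jvec V W n e j) = (if i = j then 1 else 0)"
proof -
  define L where "L = jeigs V W n"
  have fin: "finite L" unfolding L_def by (rule finite_jeigs)
  define r where "r k = (if i = k then 1 else 0) - (\<Sum>e\<in>L. jvec V W n e i * jvec V W n e k)" for k
  define J where "J = insert None (Some ` L)"
  define M where "M k x = (case x of None => r k | Some e => jvec V W n e k)" for k x
  have "card J = Suc n" using fin card_jeigs[of n] by (simp add: J_def card_image L_def)
  then obtain c where c: "\<exists>x\<in>J. c x \<noteq> 0" "\<forall>k\<in>{..<n}. (\<Sum>x\<in>J. M k x * c x) = 0"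
    using underdetermined_system[of "{..<n}" J M] fin by (auto simp: J_def)
  have sumJ: "(\<Sum>x\<in>J. f x) = f None + (\<Sum>e\<in>L. f (Some e))" for f :: "real option => real"
    using fin by (simp add: J_def sum.reindex)
  have orth: "(\<Sum>k<n. r k * jvec V W n e k) = 0" if e: "e \<in> L" for e
  proof -
    have "(\<Sum>k<n. r k * jvec V W n e k)
        = (\<Sum>k<n. (if i = k then jvec V W n e k else 0)) - (\<Sum>k<n. \<Sum>e'\<in>L. jvec V W n e' i * (jvec V W n e' k * jvec V W n e k))"
      unfolding sum_subtractf[symmetric] by (rule sum.cong) (auto simp: r_def left_diff_distrib sum_distrib_right mult.assoc)
    also have "(\<Sum>k<n. \<Sum>e'\<in>L. jvec V W n e' i * (jvec V W n e' k * jvec V W n e k))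
        = (\<Sum>e'\<in>L. jvec V W n e' i * (\<Sum>k<n. jvec V W n e' k * jvec V W n e k))"
      by (subst sum.swap) (simp add: sum_distrib_left)
    also have "\<dots> = (\<Sum>e'\<in>L. if e' = e then jvec V W n e' i else 0)"
      using e by (intro sum.cong) (auto simp: L_def jvec_orthonormal)
    also have "\<dots> = jvec V W n e i" using fin e by simp
    finally show ?thesis using assms(1) by simp
  qed
  have cS: "c (Some e) = 0" if e: "e \<in> L" for e
  proof -
    have "0 = (\<Sum>k<n. jvec V W n e k * (\<Sum>x\<in>J. M k x * c x))" using c(2) by simp
    also have "\<dots> = (\<Sum>k<n. c None * (r k * jvec V W n e k)) + (\<Sum>k<n. \<Sum>e'\<in>L. c (Some e') * (jvec V W n e' k * jvec V W n e k))"
      unfolding sum.distrib[symmetric] by (rule sum.cong) (auto simp: sumJ M_def algebra_simps sum_distrib_left)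
    also have "(\<Sum>k<n. \<Sum>e'\<in>L. c (Some e') * (jvec V W n e' k * jvec V W n e k))
        = (\<Sum>e'\<in>L. c (Some e') * (\<Sum>k<n. jvec V W n e' k * jvec V W n e k))"
      by (subst sum.swap) (simp add: sum_distrib_left)
    also have "\<dots> = (\<Sum>e'\<in>L. if e' = e then c (Some e') else 0)"
      using e by (intro sum.cong) (auto simp: L_def jvec_orthonormal)
    also have "\<dots> = c (Some e)" using fin e by simp
    also have "(\<Sum>k<n. c None * (r k * jvec V W n e k)) = 0" using orth[OF e] by (simp flip: sum_distrib_left)
    finally show ?thesis by simp
  qed
  then have cN: "c None \<noteq> 0" using c(1) by (auto simp: J_def)
  have "(\<Sum>x\<in>J. M j x * c x) = 0" using c(2) assms(2) by simp
  then have "r j * c None = 0" using cS by (simp add: sumJ M_def)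
  then show ?thesis using cN by (simp add: r_def L_def)
qed

definition jcoeff :: "nat => (nat => real) => real => real" where
  "jcoeff n \<psi> e = (\<Sum>k<n. jvec V W n e k * \<psi> k)"

lemma jexpansion:
  assumes "k < n"
  shows "\<psi> k = (\<Sum>e\<in>jeigs V W n. jcoeff n \<psi> e * jvec V W n e k)"
proof -
  have "(\<Sum>e\<in>jeigs V W n. jcoeff n \<psi> e * jvec V W n e k)
      = (\<Sum>e\<in>jeigs V W n. \<Sum>i<n. \<psi> i * (jvec V W n e i * jvec V W n e k))"
    unfolding jcoeff_def sum_distrib_right by (intro sum.cong refl) (simp add: mult_ac)
  also have "\<dots> = (\<Sum>i<n. \<psi> i * (\<Sum>e\<in>jeigs V W n. jvec V W n e i * jvec V W n e k))"
    by (subst sum.swap) (simp add: sum_distrib_left)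
  also have "\<dots> = (\<Sum>i<n. if i = k then \<psi> i else 0)" using assms by (intro sum.cong) (auto simp: jvec_complete)
  also have "\<dots> = \<psi> k" using assms by simp
  finally show ?thesis by simp
qed

lemma jparseval: "(\<Sum>k<n. \<psi> k * \<phi> k) = (\<Sum>e\<in>jeigs V W n. jcoeff n \<psi> e * jcoeff n \<phi> e)"
proof -
  have "(\<Sum>k<n. \<psi> k * \<phi> k) = (\<Sum>k<n. \<Sum>e\<in>jeigs V W n. jcoeff n \<psi> e * (jvec V W n e k * \<phi> k))"
    by (intro sum.cong) (auto simp: jexpansion[of _ n \<psi>] sum_distrib_right mult.assoc)
  also have "\<dots> = (\<Sum>e\<in>jeigs V W n. jcoeff n \<psi> e * jcoeff n \<phi> e)"
    by (subst sum.swap) (simp add: jcoeff_def sum_distrib_left)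
  finally show ?thesis .
qed

lemma jcoeff_jop:
  assumes "e \<in> jeigs V W n"
  shows "jcoeff n (jop V W n \<psi>) e = e * jcoeff n \<psi> e"
proof -
  have "jcoeff n (jop V W n \<psi>) e = jform V W n (jvec V W n e) \<psi>" unfolding jcoeff_def by (rule sum_mult_jop)
  also have "\<dots> = (\<Sum>k<n. \<psi> k * jop V W n (jvec V W n e) k)" by (simp only: sum_mult_jop jform_sym)
  also have "\<dots> = (\<Sum>k<n. e * (jvec V W n e k * \<psi> k))" using assms by (intro sum.cong) (auto simp: jop_jvec)
  finally show ?thesis by (simp add: jcoeff_def sum_distrib_left)
qed

lemma jform_diag: "jform V W n \<psi> \<psi> = (\<Sum>e\<in>jeigs V W n. e * (jcoeff n \<psi> e)\<^sup>2)"
proof -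
  have "jform V W n \<psi> \<psi> = (\<Sum>e\<in>jeigs V W n. jcoeff n \<psi> e * jcoeff n (jop V W n \<psi>) e)"
    unfolding sum_mult_jop[symmetric] by (rule jparseval)
  also have "\<dots> = (\<Sum>e\<in>jeigs V W n. e * (jcoeff n \<psi> e)\<^sup>2)"
    by (intro sum.cong) (auto simp: jcoeff_jop power2_eq_square)
  finally show ?thesis .
qed

end

section \<open>Comparison of eigenvalue counting functions\<close>

definition eigensystem :: "nat => ((nat => real) => real) => 'x set => ('x => nat => real) => ('x => real) => bool" where
  "eigensystem n q X b evl \<longleftrightarrow> finite X \<and>
    (\<forall>x\<in>X. \<forall>y\<in>X. (\<Sum>k<n. b x k * b y k) = (if x = y then 1 else 0)) \<and>
    (\<forall>\<psi>. (\<Sum>k<n. (\<psi> k)\<^sup>2) = (\<Sum>x\<in>X. (\<Sum>k<n. b x k * \<psi> k)\<^sup>2)) \<and>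
    (\<forall>\<psi>. q \<psi> = (\<Sum>x\<in>X. evl x * (\<Sum>k<n. b x k * \<psi> k)\<^sup>2))"

text \<open>Min-max argument: forms agreeing on the hyperplane \<psi> i = 0 have counts differing by
  at most one. Otherwise some nonzero combination of the low eigenvectors of q lies in the
  hyperplane and is orthogonal to all low eigenvectors of q', so the common value would be both at
  most and above e times the squared norm.\<close>

lemma eigensystem_count_le:
  assumes A: "eigensystem n q X b evl" and B: "eigensystem n q' X' b' evl'"
    and q: "\<And>\<psi>. \<psi> i = 0 ==> q \<psi> = q' \<psi>"
  shows "card {x\<in>X. evl x <= e} <= Suc (card {x\<in>X'. evl' x <= e})"
proof (rule ccontr)
  assume neg: "\<not> ?thesis"
  define J J' where "J = {x\<in>X. evl x <= e}" and "J' = {x\<in>X'. evl' x <= e}"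
  have fin: "finite X" "finite X'" "finite J" "finite J'" using A B by (auto simp: eigensystem_def J_def J'_def)
  \<comment> \<open>One constraint per low eigenvector of q', and \<open>None\<close> for the
    constraint \<psi> i = 0.\<close>
  define I where "I = insert None (Some ` J')"
  define M where "M y x = (case y of None => b x i | Some y => (\<Sum>k<n. b' y k * b x k))" for y x
  have "card I < card J" using neg fin by (simp add: I_def card_image J_def[symmetric] J'_def[symmetric])
  then obtain c where c: "\<exists>x\<in>J. c x \<noteq> 0" "\<forall>y\<in>I. (\<Sum>x\<in>J. M y x * c x) = 0"
    using underdetermined_system[of I J M] fin by (auto simp: I_def)
  define \<psi> where "\<psi> k = (\<Sum>x\<in>J. c x * b x k)" for k
  have \<psi>i: "\<psi> i = 0" using c(2) by (auto simp: I_def M_def \<psi>_def mult.commute)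
  have co: "(\<Sum>k<n. b x k * \<psi> k) = (if x \<in> J then c x else 0)" if "x \<in> X" for x
  proof -
    have "(\<Sum>k<n. b x k * \<psi> k) = (\<Sum>k<n. \<Sum>y\<in>J. c y * (b x k * b y k))"
      by (simp add: \<psi>_def sum_distrib_left mult_ac)
    also have "\<dots> = (\<Sum>y\<in>J. c y * (\<Sum>k<n. b x k * b y k))" by (subst sum.swap) (simp add: sum_distrib_left)
    also have "\<dots> = (\<Sum>y\<in>J. if x = y then c y else 0)"
      using A that by (intro sum.cong) (auto simp: eigensystem_def J_def)
    finally show ?thesis using fin by simp
  qed
  have co': "(\<Sum>k<n. b' y k * \<psi> k) = 0" if y: "y \<in> J'" for y
  proof -
    have "(\<Sum>k<n. b' y k * \<psi> k) = (\<Sum>k<n. \<Sum>x\<in>J. c x * (b' y k * b x k))"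
      by (simp add: \<psi>_def sum_distrib_left mult_ac)
    also have "\<dots> = (\<Sum>x\<in>J. M (Some y) x * c x)" by (subst sum.swap) (simp add: sum_distrib_left M_def mult.commute)
    also have "\<dots> = 0" using c(2) y by (simp add: I_def)
    finally show ?thesis .
  qed
  define N where "N = (\<Sum>k<n. (\<psi> k)\<^sup>2)"
  have NX: "N = (\<Sum>x\<in>X. (if x \<in> J then c x else 0)\<^sup>2)"
    unfolding N_def using A co by (auto simp: eigensystem_def intro!: sum.cong)
  have Npos: "N > 0"
  proof -
    obtain x where x: "x \<in> J" "c x \<noteq> 0" using c(1) by blast
    then show ?thesis unfolding NX using fin by (intro sum_pos2[of _ x]) (auto simp: J_def)
  qed
  have "q \<psi> = (\<Sum>x\<in>X. evl x * (if x \<in> J then c x else 0)\<^sup>2)"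
    using A co by (auto simp: eigensystem_def intro!: sum.cong)
  also have "\<dots> <= (\<Sum>x\<in>X. e * (if x \<in> J then c x else 0)\<^sup>2)"
    by (intro sum_mono) (auto simp: J_def mult_right_mono)
  also have "\<dots> = e * N" by (simp add: NX sum_distrib_left)
  finally have le: "q \<psi> <= e * N" .
  have NX': "N = (\<Sum>x\<in>X'. (\<Sum>k<n. b' x k * \<psi> k)\<^sup>2)" unfolding N_def using B by (simp add: eigensystem_def)
  have "0 < (\<Sum>x\<in>X'. (evl' x - e) * (\<Sum>k<n. b' x k * \<psi> k)\<^sup>2)"
  proof -
    obtain y where y: "y \<in> X'" "(\<Sum>k<n. b' y k * \<psi> k)\<^sup>2 \<noteq> 0"
      using Npos unfolding NX' by (metis (no_types, lifting) less_irrefl sum.neutral)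
    have ge: "0 <= (evl' x - e) * (\<Sum>k<n. b' x k * \<psi> k)\<^sup>2" if "x \<in> X'" for x
      using co'[of x] that by (cases "evl' x <= e") (auto simp: J'_def)
    have "y \<notin> J'" using co'[of y] y by auto
    then have "0 < (evl' y - e) * (\<Sum>k<n. b' y k * \<psi> k)\<^sup>2" using y by (auto simp: J'_def)
    then show ?thesis using fin(2) y(1) ge by (intro sum_pos2[of _ y]) auto
  qed
  also have "\<dots> = q' \<psi> - e * N"
    using B by (simp add: eigensystem_def NX' left_diff_distrib sum_subtractf sum_distrib_left)
  also have "q' \<psi> = q \<psi>" using q[of \<psi>] \<psi>i by simp
  finally show False using le by simp
qed

lemma (in jacobi_box) eigensystem_box:
  "eigensystem n (\<lambda>\<psi>. jform V W n \<psi> \<psi>) (jeigs V W n) (jvec V W n) (\<lambda>e. e)" unfolding eigensystem_def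
proof (intro conjI ballI allI)
  show "(\<Sum>k<n. (\<psi> k)\<^sup>2) = (\<Sum>x\<in>jeigs V W n. (\<Sum>k<n. jvec V W n x k * \<psi> k)\<^sup>2)" for \<psi>
    using jparseval[of \<psi> \<psi> n] by (simp only: jcoeff_def power2_eq_square)
  show "jform V W n \<psi> \<psi> = (\<Sum>x\<in>jeigs V W n. x * (\<Sum>k<n. jvec V W n x k * \<psi> k)\<^sup>2)" for \<psi>
    using jform_diag[of n \<psi>] by (simp only: jcoeff_def)
qed (auto intro: finite_jeigs simp: jvec_orthonormal)

text \<open>The diagonal entry at i and the hopping from i to i + 1 occur only in terms containing
  \<psi> i. This is the effect of changing a single letter.\<close>

lemma jcount_change_le:
  assumes "jacobi_box W" "jacobi_box W'" and eq: "\<And>k. k \<noteq> i ==> V k = V' k" "\<And>k. k \<noteq> Suc i ==> W k = W' k"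
  shows "jcount V W n e <= Suc (jcount V' W' n e)" unfolding jcount_def
proof (rule eigensystem_count_le[OF jacobi_box.eigensystem_box[OF assms(1)] jacobi_box.eigensystem_box[OF assms(2)]])
  fix \<psi> :: "nat => real" assume i: "\<psi> i = 0"
  have "V k * \<psi> k * \<psi> k = V' k * \<psi> k * \<psi> k" for k using eq(1)[of k] i by (cases "k = i") auto
  moreover have "W (Suc k) * (\<psi> k * \<psi> (Suc k) + \<psi> (Suc k) * \<psi> k) = W' (Suc k) * (\<psi> k * \<psi> (Suc k) + \<psi> (Suc k) * \<psi> k)" for k
    using eq(2)[of "Suc k"] i by (cases "k = i") auto
  ultimately show "jform V W n \<psi> \<psi> = jform V' W' n \<psi> \<psi>" unfolding jform_def by (intro arg_cong2[where f="(-)"] sum.cong) auto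
qed

text \<open>Setting \<psi> n = 0 removes the only coupling between the two boxes, so the large box
  and the direct sum agree on a hyperplane.\<close>

lemma jcount_append_le:
  assumes "jacobi_box W"
  shows "\<bar>real (jcount V W (n + m) e) - real (jcount V W n e) - real (jcount (\<lambda>k. V (n + k)) (\<lambda>k. W (n + k)) m e)\<bar> <= 1"
proof -
  define V2 W2 where "V2 = (\<lambda>k. V (n + k))" and "W2 = (\<lambda>k. W (n + k))"
  have B2: "jacobi_box W2" using assms by (simp add: jacobi_box_def W2_def)
  interpret A: jacobi_box V W by fact
  interpret B: jacobi_box V2 W2 by fact
  \<comment> \<open>The tags count an eigenvalue shared by both boxes twice, as the direct sum
    does.\<close>
  define X where "X = Inl ` jeigs V W n \<union> Inr ` jeigs V2 W2 m"
  define b where "b x k = (case x of Inl a => if k < n then jvec V W n a k else 0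
      | Inr a => if k < n then 0 else jvec V2 W2 m a (k - n))" for x :: "real + real" and k
  define evl where "evl x = (case x of Inl a => a | Inr a => a)" for x :: "real + real"
  define q' where "q' \<psi> = jform V W n \<psi> \<psi> + jform V2 W2 m (\<lambda>k. \<psi> (n + k)) (\<lambda>k. \<psi> (n + k))" for \<psi>
  have split: "(\<Sum>k<n + m. f k) = (\<Sum>k<n. f k) + (\<Sum>k<m. f (n + k))" for f :: "nat => real" by (induction m) auto
  have sumX: "(\<Sum>x\<in>X. f x) = (\<Sum>a\<in>jeigs V W n. f (Inl a)) + (\<Sum>a\<in>jeigs V2 W2 m. f (Inr a))" for f :: "real + real => real"
    unfolding X_def using A.finite_jeigs B.finite_jeigs by (subst sum.union_disjoint) (auto simp: sum.reindex)
  have bL: "(\<Sum>k<n + m. b (Inl a) k * \<psi> k) = A.jcoeff n \<psi> a" and bR: "(\<Sum>k<n + m. b (Inr a) k * \<psi> k) = B.jcoeff m (\<lambda>k. \<psi> (n + k)) a" for a \<psi>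
    unfolding split by (simp_all add: b_def A.jcoeff_def B.jcoeff_def)
  have "eigensystem (n + m) q' X b evl" unfolding eigensystem_def
  proof (intro conjI ballI allI)
    show "finite X" using A.finite_jeigs B.finite_jeigs by (simp add: X_def)
    show "(\<Sum>k<n + m. b x k * b y k) = (if x = y then 1 else 0)" if "x \<in> X" "y \<in> X" for x y
      using that unfolding split by (auto simp: X_def b_def A.jvec_orthonormal B.jvec_orthonormal split: if_splits)
    show "(\<Sum>k<n + m. (\<psi> k)\<^sup>2) = (\<Sum>x\<in>X. (\<Sum>k<n + m. b x k * \<psi> k)\<^sup>2)" for \<psi>
      unfolding sumX bL bR using A.jparseval[of \<psi> \<psi> n] B.jparseval[of "\<lambda>k. \<psi> (n + k)" "\<lambda>k. \<psi> (n + k)" m]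
      by (simp add: split power2_eq_square)
    show "q' \<psi> = (\<Sum>x\<in>X. evl x * (\<Sum>k<n + m. b x k * \<psi> k)\<^sup>2)" for \<psi>
      unfolding sumX bL bR q'_def by (simp add: evl_def A.jform_diag B.jform_diag)
  qed
  note E1 = A.eigensystem_box[of "n + m"] and E2 = this
  have eq: "jform V W (n + m) \<psi> \<psi> = q' \<psi>" if "\<psi> n = 0" for \<psi>
    unfolding jform_append q'_def using that by (simp add: V2_def W2_def)
  have cX: "card {x\<in>X. evl x <= e} = jcount V W n e + jcount V2 W2 m e"
  proof -
    have "{x\<in>X. evl x <= e} = Inl ` {a\<in>jeigs V W n. a <= e} \<union> Inr ` {a\<in>jeigs V2 W2 m. a <= e}"
      by (auto simp: X_def evl_def)
    moreover have "card (Inl ` {a\<in>jeigs V W n. a <= e} \<union> Inr ` {a\<in>jeigs V2 W2 m. a <= e})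
        = card (Inl ` {a\<in>jeigs V W n. a <= e} :: (real + real) set) + card (Inr ` {a\<in>jeigs V2 W2 m. a <= e} :: (real + real) set)"
      by (rule card_Un_disjoint) (use A.finite_jeigs B.finite_jeigs in auto)
    ultimately show ?thesis unfolding jcount_def by (simp add: card_image)
  qed
  have "jcount V W (n + m) e <= Suc (card {x\<in>X. evl x <= e})"
    unfolding jcount_def by (rule eigensystem_count_le[OF E1 E2 eq])
  moreover have "card {x\<in>X. evl x <= e} <= Suc (jcount V W (n + m) e)"
    unfolding jcount_def by (rule eigensystem_count_le[OF E2 E1 eq[symmetric]])
  ultimately show ?thesis unfolding cX V2_def W2_def by simp
qed

lemma (in jacobi_box) jcount_le: "jcount V W n e <= n"
  using card_mono[OF finite_jeigs, of "{x \<in> jeigs V W n. x <= e}" n] by (simp add: jcount_def card_jeigs)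

text \<open>A positive fraction of the mass of each eigenvector sits at sites where it is not much smaller than
  at the sites within distance \<open>l\<close>; summing over the eigenvectors at each site counts them.\<close>
lemma (in jacobi_box) card_eigs_le:
  assumes F: "F \<subseteq> jeigs V W n" and t: "t > 0" "4 * real l + 2 <= t\<^sup>2"
    and B: "\<And>e k. e \<in> F ==> k < n ==> k \<notin> B ==> \<exists>i<n. \<bar>int i - int k\<bar> <= int l \<and> t * \<bar>jvec V W n e k\<bar> <= \<bar>jvec V W n e i\<bar>"
  shows "card F <= 2 * card (B \<inter> {..<n})"
proof -
  have finF: "finite F" using F finite_jeigs finite_subset by blast
  have half: "1 / 2 <= (\<Sum>k\<in>B \<inter> {..<n}. (jvec V W n e k)\<^sup>2)" if e: "e \<in> F" for e
  proof -
    define f where "f k = (jvec V W n e k)\<^sup>2" for k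
    have one: "(\<Sum>k<n. f k) = 1" using jvec_orthonormal[of e n e] e F by (auto simp: f_def power2_eq_square)
    \<comment> \<open>Each site k outside B is charged to a site i with f k <= f i / t^2, and a site
      i is charged by at most 2l + 1 sites.\<close>
    have "(\<Sum>k\<in>{..<n} - B. f k) <= (\<Sum>k\<in>{..<n} - B. 1 / t\<^sup>2 * (\<Sum>i<n. if \<bar>int i - int k\<bar> <= int l then f i else 0))"
    proof (rule sum_mono)
      fix k assume k: "k \<in> {..<n} - B"
      then obtain i where i: "i < n" "\<bar>int i - int k\<bar> <= int l" "t * \<bar>jvec V W n e k\<bar> <= \<bar>jvec V W n e i\<bar>"
        using B[OF e] by auto
      have "(t * \<bar>jvec V W n e k\<bar>)\<^sup>2 <= \<bar>jvec V W n e i\<bar>\<^sup>2" using i t by (intro power_mono) auto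
      then have "t\<^sup>2 * f k <= f i" by (simp add: f_def power_mult_distrib)
      also have "f i <= (\<Sum>i<n. if \<bar>int i - int k\<bar> <= int l then f i else 0)"
        using member_le_sum[of i "{..<n}" "\<lambda>i. if \<bar>int i - int k\<bar> <= int l then f i else 0"] i by (auto simp: f_def)
      finally show "f k <= 1 / t\<^sup>2 * (\<Sum>i<n. if \<bar>int i - int k\<bar> <= int l then f i else 0)"
        using t by (simp add: field_simps)
    qed
    also have "\<dots> <= (\<Sum>k<n. 1 / t\<^sup>2 * (\<Sum>i<n. if \<bar>int i - int k\<bar> <= int l then f i else 0))"
      by (rule sum_mono2) (auto simp: f_def intro!: sum_nonneg divide_nonneg_nonneg)
    also have "\<dots> = 1 / t\<^sup>2 * (\<Sum>i<n. \<Sum>k<n. if \<bar>int i - int k\<bar> <= int l then f i else 0)"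
      by (subst sum.swap) (simp add: sum_distrib_left)
    also have "\<dots> <= 1 / t\<^sup>2 * (\<Sum>i<n. (2 * real l + 1) * f i)"
    proof (intro mult_left_mono sum_mono)
      fix i
      have "(\<Sum>k<n. if \<bar>int i - int k\<bar> <= int l then f i else 0) = card {k\<in>{..<n}. \<bar>int i - int k\<bar> <= int l} * f i"
        by (simp add: sum.If_cases Int_def)
      also have "card {k\<in>{..<n}. \<bar>int i - int k\<bar> <= int l} <= card {i - l..i + l}" by (rule card_mono) auto
      then have "real (card {k\<in>{..<n}. \<bar>int i - int k\<bar> <= int l}) * f i <= (2 * real l + 1) * f i"
        by (intro mult_right_mono) (auto simp: f_def)
      finally show "(\<Sum>k<n. if \<bar>int i - int k\<bar> <= int l then f i else 0) <= (2 * real l + 1) * f i" .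
    qed simp
    also have "\<dots> = (2 * real l + 1) / t\<^sup>2" by (simp add: one flip: sum_distrib_left)
    also have "\<dots> <= 1 / 2" using t by (simp add: field_simps)
    finally have "(\<Sum>k\<in>{..<n} - B. f k) <= 1 / 2" .
    moreover have "(\<Sum>k<n. f k) = (\<Sum>k\<in>{..<n} - B. f k) + (\<Sum>k\<in>B \<inter> {..<n}. f k)"
      using sum.Int_Diff[of "{..<n}" f B] by (simp add: Int_commute add.commute)
    ultimately show ?thesis using one by (simp add: f_def)
  qed
  have "real (card F) * (1 / 2) = (\<Sum>e\<in>F. 1 / 2)" by simp
  also have "\<dots> <= (\<Sum>e\<in>F. \<Sum>k\<in>B \<inter> {..<n}. (jvec V W n e k)\<^sup>2)" by (intro sum_mono half)
  also have "\<dots> = (\<Sum>k\<in>B \<inter> {..<n}. \<Sum>e\<in>F. (jvec V W n e k)\<^sup>2)" by (rule sum.swap)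
  also have "\<dots> <= (\<Sum>k\<in>B \<inter> {..<n}. 1)"
  proof (rule sum_mono)
    fix k assume k: "k \<in> B \<inter> {..<n}"
    have "(\<Sum>e\<in>F. (jvec V W n e k)\<^sup>2) <= (\<Sum>e\<in>jeigs V W n. (jvec V W n e k)\<^sup>2)"
      using F finite_jeigs by (intro sum_mono2) auto
    also have "\<dots> = 1" using jvec_complete[of k n k] k by (simp add: power2_eq_square)
    finally show "(\<Sum>e\<in>F. (jvec V W n e k)\<^sup>2) <= 1" .
  qed
  finally have "real (card F) <= real (2 * card (B \<inter> {..<n}))" by simp
  then show ?thesis by simp
qed

section \<open>Random words\<close>

locale random_letters = prob_space M for M :: "'a measure" +
  fixes v w :: "int => 'a => real" and Sv Sw :: "real set" and pv pw :: "real => real"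
  assumes v_meas[measurable]: "\<And>n. v n \<in> borel_measurable M" and w_meas[measurable]: "\<And>n. w n \<in> borel_measurable M"
    and indep: "indep_vars (\<lambda>_. borel) (\<lambda>i. case i of Inl n => v n | Inr n => w n) UNIV"
    and fin_Sv: "finite Sv" and fin_Sw: "finite Sw" and zero_notin: "0 \<notin> Sw"
    and pv: "\<And>n a. measure M {\<omega>\<in>space M. v n \<omega> = a} = pv a" and pw: "\<And>n b. measure M {\<omega>\<in>space M. w n \<omega> = b} = pw b"
    and pv_pos: "\<And>a. a \<in> Sv ==> pv a > 0" and pw_pos: "\<And>b. b \<in> Sw ==> pw b > 0"
    and sum_pv: "sum pv Sv = 1" and sum_pw: "sum pw Sw = 1"
begin

sublocale A: jacobi_letters "Sv \<times> Sw" "\<lambda>a. pv (fst a) * pw (snd a)"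
proof
  show "finite (Sv \<times> Sw)" using fin_Sv fin_Sw by simp
  show "0 < pv (fst a) * pw (snd a)" if "a \<in> Sv \<times> Sw" for a using that pv_pos pw_pos by auto
  have "(\<Sum>a\<in>Sv \<times> Sw. pv (fst a) * pw (snd a)) = (\<Sum>x\<in>Sv. \<Sum>y\<in>Sw. pv x * pw y)"
    by (simp add: sum.cartesian_product case_prod_unfold)
  also have "\<dots> = 1" by (simp add: sum_pv sum_pw flip: sum_distrib_left)
  finally show "(\<Sum>a\<in>Sv \<times> Sw. pv (fst a) * pw (snd a)) = 1" .
  show "snd a \<noteq> 0" if "a \<in> Sv \<times> Sw" for a using that zero_notin by auto
qed

text \<open>Right propagation pairs v_i with w_(i+1), left propagation pairs it with w_i. Both kinds
  of word are i.i.d. as long as no diagonal and no off-diagonal index is repeated, hence arbitrary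
  lists of index pairs.\<close>

definition word :: "(int \<times> int) list => 'a => (real \<times> real) list" where
  "word ix \<omega> = map (\<lambda>(n, k). (v n \<omega>, w k \<omega>)) ix"

text \<open>The event of full measure on which all pathwise statements are proved: every coefficient
  is an atom of its law, so no hopping term vanishes.\<close>

definition regular :: "'a => bool" where
  "regular \<omega> \<longleftrightarrow> (\<forall>n. v n \<omega> \<in> Sv \<and> w n \<omega> \<in> Sw)"

lemma AE_value:
  assumes X: "X \<in> borel_measurable M" and "finite T" "sum q T = 1" "\<And>a. measure M {\<omega>\<in>space M. X \<omega> = a} = q a"
  shows "AE \<omega> in M. X \<omega> \<in> (T :: real set)"
proof -
  have meas: "{\<omega>\<in>space M. X \<omega> = a} \<in> sets M" for a using X by measurable
  have eq: "{\<omega>\<in>space M. X \<omega> \<in> T} = (\<Union>a\<in>T. {\<omega>\<in>space M. X \<omega> = a})" by auto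
  have "measure M (\<Union>a\<in>T. {\<omega>\<in>space M. X \<omega> = a}) = (\<Sum>a\<in>T. measure M {\<omega>\<in>space M. X \<omega> = a})"
    by (rule finite_measure_finite_Union) (use assms(2) meas in \<open>auto simp: disjoint_family_on_def\<close>)
  then have "measure M {\<omega>\<in>space M. X \<omega> \<in> T} = 1" using assms(3,4) eq by simp
  moreover have "{\<omega>\<in>space M. X \<omega> \<in> T} \<in> sets M" unfolding eq using meas assms(2) by auto
  ultimately show ?thesis by (subst (asm) prob_Collect_eq_1) auto
qed

lemma AE_regular: "AE \<omega> in M. regular \<omega>" unfolding regular_def
  using AE_value[OF v_meas fin_Sv sum_pv pv] AE_value[OF w_meas fin_Sw sum_pw pw]
  by (simp add: AE_all_countable)

lemma regular_nz: "regular \<omega> ==> w n \<omega> \<noteq> 0" using zero_notin unfolding regular_def by metis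

lemma word_in_words: "regular \<omega> ==> word ix \<omega> \<in> A.words (length ix)"
  by (auto simp: A.words_def word_def regular_def)

lemma length_word: "length (word ix \<omega>) = length ix" by (simp add: word_def)

lemma word_append: "word (ix @ jx) \<omega> = word ix \<omega> @ word jx \<omega>" by (simp add: word_def)

lemma measurable_word_eq: "{\<omega>\<in>space M. word ix \<omega> = u} \<in> sets M"
proof (cases "length u = length ix")
  case True
  have "{\<omega>\<in>space M. word ix \<omega> = u} = {\<omega>\<in>space M. \<forall>i\<in>{..<length ix}. v (fst (ix ! i)) \<omega> = fst (u ! i) \<and> w (snd (ix ! i)) \<omega> = snd (u ! i)}"
    using True by (auto simp: word_def list_eq_iff_nth_eq case_prod_unfold prod_eq_iff)
  also have "\<dots> \<in> sets M" by measurable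
  finally show ?thesis .
next
  case False
  then have "{\<omega>\<in>space M. word ix \<omega> = u} = {}" using length_word[of ix] by auto
  then show ?thesis by (simp only: sets.empty_sets)
qed

lemma measure_word_eq:
  assumes dist: "distinct (map fst ix)" "distinct (map snd ix)" and len: "length u = length ix"
  shows "measure M {\<omega>\<in>space M. word ix \<omega> = u} = A.weight u"
proof (cases "ix = []")
  case True
  then show ?thesis using len by (simp add: word_def A.weight_def prob_space)
next
  case False
  \<comment> \<open>The value the word prescribes for each variable it involves; distinctness of the
    indices makes the lookup unambiguous, and the event becomes an intersection over independent
    variables.\<close>
  define val where "val j = (case j of Inl n => the (map_of (zip (map fst ix) (map fst u)) n)
      | Inr k => the (map_of (zip (map snd ix) (map snd u)) k))" for j :: "int + int"
  define X where "X j = (case j of Inl n => v n | Inr n => w n)" for j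
  define J where "J = Inl ` set (map fst ix) \<union> Inr ` set (map snd ix)"
  have valL: "val (Inl (fst (ix ! i))) = fst (u ! i)" and valR: "val (Inr (snd (ix ! i))) = snd (u ! i)" if "i < length ix" for i
    using map_of_zip_nth[of "map fst ix" "map fst u" i] map_of_zip_nth[of "map snd ix" "map snd u" i] dist len that
    by (auto simp: val_def)
  have "{\<omega>\<in>space M. word ix \<omega> = u} = (\<Inter>j\<in>J. X j -` {val j} \<inter> space M)"
  proof (intro equalityI subsetI)
    fix \<omega> assume "\<omega> \<in> {\<omega>\<in>space M. word ix \<omega> = u}"
    then have \<omega>: "\<omega> \<in> space M" and "word ix \<omega> = u" by auto
    then have eq: "v (fst (ix ! i)) \<omega> = fst (u ! i)" "w (snd (ix ! i)) \<omega> = snd (u ! i)" if "i < length ix" for i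
      using that by (auto simp: word_def list_eq_iff_nth_eq case_prod_unfold prod_eq_iff)
    have "X j \<omega> = val j" if j: "j \<in> J" for j
    proof -
      have "\<exists>i<length ix. j = Inl (fst (ix ! i)) \<or> j = Inr (snd (ix ! i))"
        using j unfolding J_def set_conv_nth by auto
      then obtain i where i: "i < length ix" "j = Inl (fst (ix ! i)) \<or> j = Inr (snd (ix ! i))" by blast
      then show ?thesis using eq[OF i(1)] valL[OF i(1)] valR[OF i(1)] by (elim disjE) (simp_all add: X_def)
    qed
    then show "\<omega> \<in> (\<Inter>j\<in>J. X j -` {val j} \<inter> space M)" using \<omega> by simp
  next
    fix \<omega> assume \<omega>: "\<omega> \<in> (\<Inter>j\<in>J. X j -` {val j} \<inter> space M)"
    have "J \<noteq> {}" using False by (auto simp: J_def)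
    then obtain j0 where "j0 \<in> J" by blast
    then have "\<omega> \<in> X j0 -` {val j0} \<inter> space M" by (rule INT_D[OF \<omega>])
    then have sp: "\<omega> \<in> space M" by simp
    have "v (fst (ix ! i)) \<omega> = fst (u ! i) \<and> w (snd (ix ! i)) \<omega> = snd (u ! i)" if i: "i < length ix" for i
    proof -
      have "Inl (fst (ix ! i)) \<in> J" "Inr (snd (ix ! i)) \<in> J" using i by (auto simp: J_def)
      then have "X (Inl (fst (ix ! i))) \<omega> = val (Inl (fst (ix ! i)))" "X (Inr (snd (ix ! i))) \<omega> = val (Inr (snd (ix ! i)))"
        using INT_D[OF \<omega>] by simp_all
      then show ?thesis using valL[OF i] valR[OF i] by (simp add: X_def)
    qed
    then show "\<omega> \<in> {\<omega>\<in>space M. word ix \<omega> = u}"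
      using sp len by (auto simp: word_def list_eq_iff_nth_eq case_prod_unfold prod_eq_iff)
  qed
  also have "measure M \<dots> = (\<Prod>j\<in>J. measure M (X j -` {val j} \<inter> space M))"
  proof -
    have X: "indep_vars (\<lambda>_. borel) X UNIV" using indep by (simp add: X_def[abs_def])
    have "J \<noteq> {}" "finite J" using False by (auto simp: J_def)
    then show ?thesis using indep_varsD[OF X, of J "\<lambda>j. {val j}"] by simp
  qed
  also have "\<dots> = (\<Prod>n\<in>set (map fst ix). measure M (X (Inl n) -` {val (Inl n)} \<inter> space M)) *
      (\<Prod>n\<in>set (map snd ix). measure M (X (Inr n) -` {val (Inr n)} \<inter> space M))" unfolding J_def
    by (subst prod.union_disjoint[of "Inl ` set (map fst ix)" "Inr ` set (map snd ix)"]) (auto simp: prod.reindex)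
  also have "(\<Prod>n\<in>set (map fst ix). measure M (X (Inl n) -` {val (Inl n)} \<inter> space M)) = (\<Prod>n\<in>set (map fst ix). pv (val (Inl n)))"
  proof (rule prod.cong[OF refl])
    fix n
    have "X (Inl n) -` {val (Inl n)} \<inter> space M = {\<omega>\<in>space M. v n \<omega> = val (Inl n)}" by (auto simp: X_def)
    then show "measure M (X (Inl n) -` {val (Inl n)} \<inter> space M) = pv (val (Inl n))" by (simp only: pv)
  qed
  also have "(\<Prod>n\<in>set (map snd ix). measure M (X (Inr n) -` {val (Inr n)} \<inter> space M)) = (\<Prod>n\<in>set (map snd ix). pw (val (Inr n)))"
  proof (rule prod.cong[OF refl])
    fix n
    have "X (Inr n) -` {val (Inr n)} \<inter> space M = {\<omega>\<in>space M. w n \<omega> = val (Inr n)}" by (auto simp: X_def)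
    then show "measure M (X (Inr n) -` {val (Inr n)} \<inter> space M) = pw (val (Inr n))" by (simp only: pw)
  qed
  also have "(\<Prod>n\<in>set (map fst ix). pv (val (Inl n))) = prod_list (map (\<lambda>n. pv (val (Inl n))) (map fst ix))"
    by (rule prod.distinct_set_conv_list[OF dist(1)])
  also have "map (\<lambda>n. pv (val (Inl n))) (map fst ix) = map pv (map fst u)"
    using valL len by (auto simp: list_eq_iff_nth_eq)
  also have "(\<Prod>n\<in>set (map snd ix). pw (val (Inr n))) = prod_list (map (\<lambda>n. pw (val (Inr n))) (map snd ix))"
    by (rule prod.distinct_set_conv_list[OF dist(2)])
  also have "map (\<lambda>n. pw (val (Inr n))) (map snd ix) = map pw (map snd u)"
    using valR len by (auto simp: list_eq_iff_nth_eq)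
  also have "prod_list (map pv (map fst u)) * prod_list (map pw (map snd u)) = A.weight u"
    unfolding A.weight_def by (induction u) (auto simp: mult_ac)
  finally show ?thesis .
qed

text \<open>The observable is written as a finite sum of indicators of words, which is integrable
  for arbitrary f; on regular samples it is f of the word (\<open>word_sum_eq\<close>).\<close>

lemma mean_word:
  assumes dist: "distinct (map fst ix)" "distinct (map snd ix)"
  shows "integrable M (\<lambda>\<omega>. \<Sum>u\<in>A.words (length ix). f u * indicator {\<omega>\<in>space M. word ix \<omega> = u} \<omega>)"
    and "(\<integral>\<omega>. (\<Sum>u\<in>A.words (length ix). f u * indicator {\<omega>\<in>space M. word ix \<omega> = u} \<omega>) \<partial>M) = A.mean (length ix) f"
proof -
  have int: "integrable M (\<lambda>\<omega>. f u * indicator {\<omega>\<in>space M. word ix \<omega> = u} \<omega>)" for u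
    by (intro integrable_mult_right integrable_real_indicator measurable_word_eq) (simp add: emeasure_eq_measure)
  then show "integrable M (\<lambda>\<omega>. \<Sum>u\<in>A.words (length ix). f u * indicator {\<omega>\<in>space M. word ix \<omega> = u} \<omega>)"
    by (intro Bochner_Integration.integrable_sum)
  have val: "(\<integral>\<omega>. f u * indicator {\<omega>\<in>space M. word ix \<omega> = u} \<omega> \<partial>M) = f u * measure M {\<omega>\<in>space M. word ix \<omega> = u}" for u
    using sets.Int_space_eq2[OF measurable_word_eq[of ix u]] by simp
  have "(\<integral>\<omega>. (\<Sum>u\<in>A.words (length ix). f u * indicator {\<omega>\<in>space M. word ix \<omega> = u} \<omega>) \<partial>M)
      = (\<Sum>u\<in>A.words (length ix). f u * measure M {\<omega>\<in>space M. word ix \<omega> = u})"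
    by (subst Bochner_Integration.integral_sum) (simp_all only: int val)
  also have "\<dots> = A.mean (length ix) f"
    unfolding A.mean_eq_sum by (intro sum.cong) (auto simp: measure_word_eq[OF dist] A.words_def)
  finally show "(\<integral>\<omega>. (\<Sum>u\<in>A.words (length ix). f u * indicator {\<omega>\<in>space M. word ix \<omega> = u} \<omega>) \<partial>M) = A.mean (length ix) f" .
qed

lemma word_sum_eq:
  assumes "regular \<omega>" "\<omega> \<in> space M"
  shows "(\<Sum>u\<in>A.words (length ix). f u * indicator {\<omega>\<in>space M. word ix \<omega> = u} \<omega>) = (f (word ix \<omega>) :: real)"
proof -
  have "(\<Sum>u\<in>A.words (length ix). f u * indicator {\<omega>\<in>space M. word ix \<omega> = u} \<omega>)
      = (\<Sum>u\<in>A.words (length ix). if u = word ix \<omega> then f u else 0)" using assms(2) by (intro sum.cong) auto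
  then show ?thesis using word_in_words[OF assms(1), of ix] A.finite_words by simp
qed

text \<open>Requiring the word to consist of letters makes the event a finite union, hence
  measurable for an arbitrary predicate B.\<close>

definition word_event :: "(int \<times> int) list => ((real \<times> real) list => bool) => 'a set" where
  "word_event ix B = {\<omega>\<in>space M. word ix \<omega> \<in> A.words (length ix) \<and> B (word ix \<omega>)}"

lemma word_event_sets: "word_event ix B \<in> sets M"
proof -
  have "word_event ix B = (\<Union>u\<in>{u\<in>A.words (length ix). B u}. {\<omega>\<in>space M. word ix \<omega> = u})"
    by (auto simp: word_event_def)
  also have "\<dots> \<in> sets M" using A.finite_words by (intro sets.finite_UN measurable_word_eq) auto
  finally show ?thesis .
qed

lemma measure_word_event:
  assumes dist: "distinct (map fst ix)" "distinct (map snd ix)"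
  shows "measure M (word_event ix B) = A.prob (length ix) B"
proof -
  have "word_event ix B = (\<Union>u\<in>{u\<in>A.words (length ix). B u}. {\<omega>\<in>space M. word ix \<omega> = u})"
    by (auto simp: word_event_def)
  also have "measure M \<dots> = (\<Sum>u\<in>{u\<in>A.words (length ix). B u}. measure M {\<omega>\<in>space M. word ix \<omega> = u})"
    by (rule finite_measure_finite_Union) (auto simp: A.finite_words measurable_word_eq disjoint_family_on_def)
  also have "\<dots> = (\<Sum>u\<in>{u\<in>A.words (length ix). B u}. A.weight u)"
    by (intro sum.cong) (auto simp: measure_word_eq[OF dist] A.words_def)
  also have "\<dots> = (\<Sum>u\<in>A.words (length ix). A.weight u * of_bool (B u))"
    by (intro sum.mono_neutral_cong_left) (auto simp: A.finite_words)
  finally show ?thesis by (simp add: A.prob_def A.mean_eq_sum)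
qed

definition path_ix :: "nat => (int \<times> int) list" where
  "path_ix n = map (\<lambda>i. (int i, int i + 1)) [0..<n]"

lemma length_path_ix: "length (path_ix n) = n" by (simp add: path_ix_def)

lemma distinct_path_ix: "distinct (map fst (path_ix n))" "distinct (map snd (path_ix n))"
  by (auto simp: path_ix_def distinct_map inj_on_def comp_def)

lemma word_path_Suc: "word (path_ix (Suc n)) \<omega> = word (path_ix n) \<omega> @ [(v (int n) \<omega>, w (int n + 1) \<omega>)]"
  by (simp add: path_ix_def word_def)

text \<open>The deviation probabilities are summable in n, so Borel-Cantelli applies at each of
  countably many thresholds. The observable may vary with n, and only its averages over the
  remaining letters need to be insensitive to a single letter.\<close>

lemma law_of_large_numbers:
  fixes f :: "nat => (real \<times> real) list => real"
  assumes "C > 0" and diff: "\<And>n u a b. set u \<subseteq> Sv \<times> Sw ==> length u < n ==> a \<in> Sv \<times> Sw ==> b \<in> Sv \<times> Sw ==>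
      \<bar>A.mean (n - Suc (length u)) (\<lambda>x. f n (u @ a # x)) - A.mean (n - Suc (length u)) (\<lambda>x. f n (u @ b # x))\<bar> <= C"
  shows "AE \<omega> in M. (\<lambda>n. (f n (word (path_ix n) \<omega>) - A.mean n (f n)) / n) \<longlonglongrightarrow> 0"
proof -
  have ev: "AE \<omega> in M. eventually (\<lambda>n. \<bar>f n (word (path_ix n) \<omega>) - A.mean n (f n)\<bar> < min C (1 / Suc k) * n) sequentially" for k
  proof -
    \<comment> \<open>The deviation inequality is available for \<epsilon> up to C only.\<close>
    define \<epsilon> where "\<epsilon> = min C (1 / Suc k)"
    have \<epsilon>: "\<epsilon> > 0" "\<epsilon> <= C" using assms(1) by (auto simp: \<epsilon>_def)
    define B where "B n u \<longleftrightarrow> \<epsilon> * n <= \<bar>f n u - A.mean n (f n)\<bar>" for n :: nat and u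
    define c where "c = exp (- (\<epsilon>\<^sup>2 / (4 * C\<^sup>2)))"
    have c: "0 < c" "c < 1" using \<epsilon> assms(1) by (auto simp: c_def)
    have P: "measure M (word_event (path_ix n) (B n)) <= 2 * c ^ n" for n
    proof -
      have "A.prob n (B n) <= 2 * exp (- (\<epsilon>\<^sup>2 / (4 * C\<^sup>2)) * n)"
        unfolding B_def by (rule A.prob_deviation_le[OF diff assms(1) \<epsilon>])
      also have "exp (- (\<epsilon>\<^sup>2 / (4 * C\<^sup>2)) * n) = c ^ n" unfolding c_def by (simp add: mult.commute flip: exp_of_nat_mult)
      finally show ?thesis by (simp add: measure_word_event[OF distinct_path_ix] length_path_ix)
    qed
    have "AE \<omega> in M. eventually (\<lambda>n. \<omega> \<in> space M - word_event (path_ix n) (B n)) sequentially"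
    proof (rule borel_cantelli_AE1)
      show "summable (\<lambda>n. measure M (word_event (path_ix n) (B n)))"
        by (rule summable_comparison_test'[of "\<lambda>n. 2 * c ^ n" 0]) (use c P in \<open>auto intro!: summable_mult summable_geometric\<close>)
    qed (auto simp: word_event_sets emeasure_eq_measure)
    with AE_regular show ?thesis
    proof eventually_elim
      case (elim \<omega>)
      from elim(2) show ?case
      proof (rule eventually_mono)
        fix n assume "\<omega> \<in> space M - word_event (path_ix n) (B n)"
        then have "\<not> B n (word (path_ix n) \<omega>)" using word_in_words[OF elim(1), of "path_ix n"] by (auto simp: word_event_def)
        then show "\<bar>f n (word (path_ix n) \<omega>) - A.mean n (f n)\<bar> < min C (1 / Suc k) * n" by (simp add: B_def \<epsilon>_def)
      qed
    qed
  qed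
  have "AE \<omega> in M. \<forall>k. eventually (\<lambda>n. \<bar>f n (word (path_ix n) \<omega>) - A.mean n (f n)\<bar> < min C (1 / Suc k) * n) sequentially"
    unfolding AE_all_countable using ev by blast
  then show ?thesis
  proof eventually_elim
    case (elim \<omega>)
    show ?case
    proof (rule LIMSEQ_I)
      fix r :: real assume r: "0 < r"
      obtain k where k: "1 / Suc k < r" using r nat_approx_posE by blast
      have "eventually (\<lambda>n. norm ((f n (word (path_ix n) \<omega>) - A.mean n (f n)) / n - 0) < r) sequentially"
        using elim[rule_format, of k] eventually_gt_at_top[of 0]
      proof eventually_elim
        case (elim n)
        have "min C (1 / Suc k) * n <= 1 / Suc k * n" by (intro mult_right_mono) auto
        also have "\<dots> < r * n" using k elim(2) by (intro mult_strict_right_mono) auto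
        finally have "\<bar>f n (word (path_ix n) \<omega>) - A.mean n (f n)\<bar> < r * n" using elim(1) by linarith
        then show ?case using elim(2) by (simp add: abs_divide divide_less_eq)
      qed
      then show "\<exists>no. \<forall>n\<ge>no. norm ((f n (word (path_ix n) \<omega>) - A.mean n (f n)) / n - 0) < r"
        by (simp add: eventually_sequentially)
    qed
  qed
qed

section \<open>Identification of the almost sure limits\<close>

lemma AE_limit_unique:
  assumes "AE \<omega> in M. X \<omega> \<longlonglongrightarrow> (a :: real)" "AE \<omega> in M. X \<omega> \<longlonglongrightarrow> b"
  shows "a = b"
proof -
  have "AE \<omega> in M. a = b" using assms by eventually_elim (rule LIMSEQ_unique)
  then show ?thesis by simp
qed

lemma lyapunov_exp_eq:
  assumes "AE \<omega> in M. (\<lambda>n. ln (onorm (\<lambda>x. transfer_prod v w E \<omega> n *v x)) / real n) \<longlonglongrightarrow> l"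
  shows "lyapunov_exp M v w E = l"
  unfolding lyapunov_exp_def using assms AE_limit_unique by (intro the_equality) blast+

lemma ids_eq:
  assumes "AE \<omega> in M. (\<lambda>n. real (card ({..E} \<inter> restr_spectrum v w \<omega> n)) / real n) \<longlonglongrightarrow> l"
  shows "ids M v w E = l" unfolding ids_def using assms AE_limit_unique by (intro the_equality) blast+

text \<open>The unimodular steps are the transfer matrices conjugated by the diagonal matrices
  diag(1, w_n).\<close>

lemma transfer_prod_tact:
  assumes "regular \<omega>"
  shows "transfer_prod v w E \<omega> n *v x
    = vector [fst (tact E (word (path_ix n) \<omega>) (x $ 1, w 0 \<omega> * x $ 2)),
       snd (tact E (word (path_ix n) \<omega>) (x $ 1, w 0 \<omega> * x $ 2)) / w (int n) \<omega>]"
proof (induction n)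
  case 0
  then show ?case using regular_nz[OF assms] by (simp add: vec_eq_iff forall_2 path_ix_def word_def)
next
  case (Suc n)
  have n: "int (Suc n) = int n + 1" by simp
  define X where "X = tact E (word (path_ix n) \<omega>) (x $ 1, w 0 \<omega> * x $ 2)"
  have "transfer_prod v w E \<omega> (Suc n) *v x = transfer_mat v w E \<omega> (int n) *v (transfer_prod v w E \<omega> n *v x)"
    by (simp add: matrix_vector_mul_assoc)
  also have "\<dots> = transfer_mat v w E \<omega> (int n) *v vector [fst X, snd X / w (int n) \<omega>]" by (simp only: Suc X_def)
  also have "\<dots> = vector [((v (int n) \<omega> - E) * fst X - snd X) / w (int n + 1) \<omega>, fst X]"
    using regular_nz[OF assms, of "int n"] regular_nz[OF assms, of "int n + 1"]
    by (simp add: transfer_mat_def vec_eq_iff forall_2 matrix_vector_mult_def sum_2) (simp add: field_simps)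
  also have "\<dots> = vector [fst (tact E (word (path_ix (Suc n)) \<omega>) (x $ 1, w 0 \<omega> * x $ 2)),
       snd (tact E (word (path_ix (Suc n)) \<omega>) (x $ 1, w 0 \<omega> * x $ 2)) / w (int (Suc n)) \<omega>]"
    unfolding n using regular_nz[OF assms, of "int n + 1"]
    by (simp add: word_path_Suc tact_append tstep_def vec_eq_iff forall_2 flip: X_def)
  finally show ?case .
qed

lemma Sw_bound:
  obtains K where "K >= 1" "\<And>b. b \<in> Sw ==> \<bar>b\<bar> <= K" "\<And>b. b \<in> Sw ==> \<bar>1 / b\<bar> <= K"
proof
  define K where "K = 1 + (\<Sum>b\<in>Sw. \<bar>b\<bar> + \<bar>1 / b\<bar>)"
  have le: "\<bar>b\<bar> + \<bar>1 / b\<bar> <= K - 1" if "b \<in> Sw" for b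
    using member_le_sum[OF that, of "\<lambda>b. \<bar>b\<bar> + \<bar>1 / b\<bar>"] fin_Sw by (simp add: K_def)
  show "K >= 1" unfolding K_def by (simp add: sum_nonneg)
  show "\<bar>b\<bar> <= K" "\<bar>1 / b\<bar> <= K" if "b \<in> Sw" for b using le[OF that] abs_ge_zero[of b] abs_ge_zero[of "1 / b"] by linarith+
qed

lemma norm_vec2: "(norm (x :: real ^ 2))\<^sup>2 = (x $ 1)\<^sup>2 + (x $ 2)\<^sup>2"
  by (simp add: norm_vec_def L2_set_def sum_2)

text \<open>The conjugating diagonal matrices are bounded together with their inverses, so up to
  constants the operator norm lies between the image of one basis vector and the larger of both
  images; constants vanish after division by n.\<close>

lemma lyapunov_exp_eqI:
  assumes 1: "AE \<omega> in M. (\<lambda>n. ln (norm (tact E (word (path_ix n) \<omega>) (1, 0))) / real n) \<longlonglongrightarrow> l"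
    and 2: "AE \<omega> in M. (\<lambda>n. ln (norm (tact E (word (path_ix n) \<omega>) (0, 1))) / real n) \<longlonglongrightarrow> l"
  shows "lyapunov_exp M v w E = l"
proof -
  obtain K where K: "K >= 1" "\<And>b. b \<in> Sw ==> \<bar>b\<bar> <= K" "\<And>b. b \<in> Sw ==> \<bar>1 / b\<bar> <= K" by (rule Sw_bound) blast
  show ?thesis
  proof (rule lyapunov_exp_eq)
    from AE_regular 1 2 show "AE \<omega> in M. (\<lambda>n. ln (onorm (\<lambda>x. transfer_prod v w E \<omega> n *v x)) / real n) \<longlonglongrightarrow> l"
    proof eventually_elim
      case (elim \<omega>)
      define P Q where "P n = tact E (word (path_ix n) \<omega>) (1, 0)" and "Q n = tact E (word (path_ix n) \<omega>) (0, 1)" for n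
      define G where "G n = onorm (\<lambda>x. transfer_prod v w E \<omega> n *v x)" for n
      have nz: "\<forall>a\<in>set (word (path_ix n) \<omega>). snd a \<noteq> 0" for n
        using A.words_nz[OF word_in_words[OF elim(1)]] by simp
      have PQ: "norm (P n) > 0" "norm (Q n) > 0" for n
        unfolding P_def Q_def using tact_eq_0_iff[OF nz] by (auto simp: prod_eq_iff)
      have bl: "bounded_linear (\<lambda>x. transfer_prod v w E \<omega> n *v x)" for n by (rule matrix_vector_mul_bounded_linear)
      have w: "\<bar>w k \<omega>\<bar> <= K" "\<bar>1 / w k \<omega>\<bar> <= K" "w k \<omega> \<noteq> 0" for k
        using K elim(1) regular_nz[OF elim(1)] by (auto simp: regular_def)
      have lower: "norm (P n) <= K * G n" for n
      proof -
        define y where "y = transfer_prod v w E \<omega> n *v vector [1, 0]"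
        have y: "y $ 1 = fst (P n)" "y $ 2 = snd (P n) / w (int n) \<omega>"
          unfolding y_def transfer_prod_tact[OF elim(1)] by (simp_all add: P_def)
        have "(norm (P n))\<^sup>2 <= (K * norm y)\<^sup>2"
        proof -
          have "1 * (y $ 1)\<^sup>2 <= K\<^sup>2 * (y $ 1)\<^sup>2" using K(1) by (intro mult_right_mono) auto
          moreover have "(w (int n) \<omega>)\<^sup>2 * (y $ 2)\<^sup>2 <= K\<^sup>2 * (y $ 2)\<^sup>2"
            using w(1)[of "int n"] K(1) by (intro mult_right_mono) (auto simp: abs_le_square_iff[symmetric])
          moreover have "(w (int n) \<omega>)\<^sup>2 * (y $ 2)\<^sup>2 = (snd (P n))\<^sup>2" using w(3) by (simp add: y power_divide)
          ultimately show ?thesis unfolding norm_prod_sq power_mult_distrib norm_vec2 by (simp add: y(1) algebra_simps)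
        qed
        then have "norm (P n) <= K * norm y" by (rule power2_le_imp_le) (use K(1) in auto)
        also have "norm y <= G n * norm (vector [1, 0] :: real ^ 2)" unfolding G_def y_def by (rule onorm[OF bl])
        also have "norm (vector [1, 0] :: real ^ 2) = 1" by (rule power2_eq_imp_eq) (simp_all add: norm_vec2)
        finally show ?thesis using K(1) by (simp add: mult_left_mono)
      qed
      have upper: "G n <= K * (norm (P n) + K * norm (Q n))" for n unfolding G_def
      proof (rule onorm_le)
        fix x :: "real ^ 2"
        define X where "X = tact E (word (path_ix n) \<omega>) (x $ 1, w 0 \<omega> * x $ 2)"
        have X: "X = (x $ 1) *\<^sub>R P n + (w 0 \<omega> * x $ 2) *\<^sub>R Q n"
          unfolding X_def P_def Q_def tact_linear[symmetric] by simp
        have xc: "\<bar>x $ 1\<bar> <= norm x" "\<bar>x $ 2\<bar> <= norm x" by (rule component_le_norm_cart)+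
        have "norm X <= \<bar>x $ 1\<bar> * norm (P n) + \<bar>w 0 \<omega> * x $ 2\<bar> * norm (Q n)"
          unfolding X by (rule norm_triangle_le) simp
        also have "\<dots> <= norm x * norm (P n) + (K * norm x) * norm (Q n)"
          unfolding abs_mult using xc w(1)[of 0] K(1) by (intro add_mono mult_right_mono mult_mono) auto
        finally have nX: "norm X <= (norm (P n) + K * norm (Q n)) * norm x" by (simp add: algebra_simps)
        have "(norm (transfer_prod v w E \<omega> n *v x))\<^sup>2 = (fst X)\<^sup>2 + (1 / w (int n) \<omega>)\<^sup>2 * (snd X)\<^sup>2"
          unfolding norm_vec2 transfer_prod_tact[OF elim(1)] X_def[symmetric] by (simp add: power_divide)
        also have "\<dots> <= K\<^sup>2 * (fst X)\<^sup>2 + K\<^sup>2 * (snd X)\<^sup>2"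
        proof (rule add_mono)
          have "1 * (fst X)\<^sup>2 <= K\<^sup>2 * (fst X)\<^sup>2" using K(1) by (intro mult_right_mono) auto
          then show "(fst X)\<^sup>2 <= K\<^sup>2 * (fst X)\<^sup>2" by simp
          have "(1 / w (int n) \<omega>)\<^sup>2 <= K\<^sup>2" using w(2)[of "int n"] K(1) by (simp only: abs_le_square_iff[symmetric] abs_of_nonneg)
          then show "(1 / w (int n) \<omega>)\<^sup>2 * (snd X)\<^sup>2 <= K\<^sup>2 * (snd X)\<^sup>2" by (intro mult_right_mono) auto
        qed
        also have "\<dots> = (K * norm X)\<^sup>2" unfolding power_mult_distrib norm_prod_sq by (simp add: algebra_simps)
        finally have "norm (transfer_prod v w E \<omega> n *v x) <= K * norm X" by (rule power2_le_imp_le) (use K(1) in auto)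
        also have "\<dots> <= K * ((norm (P n) + K * norm (Q n)) * norm x)" using nX K(1) by (intro mult_left_mono) auto
        finally show "norm (transfer_prod v w E \<omega> n *v x) <= K * (norm (P n) + K * norm (Q n)) * norm x" by (simp add: mult.assoc)
      qed
      have G: "G n > 0" for n proof -
        have "0 < K * G n" using lower[of n] PQ(1)[of n] by linarith
        then show ?thesis using K(1) by (simp add: zero_less_mult_iff)
      qed
      define c where "c = ln K + ln K + ln 2"
      have c: "c >= 0" using K(1) by (simp add: c_def)
      have lo: "ln (norm (P n)) - c <= ln (G n)" for n
      proof -
        have "ln (norm (P n)) <= ln (K * G n)" using lower PQ by (intro ln_mono) auto
        moreover have "ln (K * G n) = ln K + ln (G n)" using K(1) G[of n] by (intro ln_mult_pos) auto
        moreover have "ln K >= 0" "ln (2 :: real) >= 0" using K(1) by auto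
        ultimately show ?thesis unfolding c_def by linarith
      qed
      have up: "ln (G n) <= max (ln (norm (P n))) (ln (norm (Q n))) + c" for n
      proof -
        define m where "m = max (norm (P n)) (norm (Q n))"
        have m: "m > 0" "norm (P n) <= m" "norm (Q n) <= m" using PQ[of n] by (auto simp: m_def less_max_iff_disj)
        have "G n <= K * (norm (P n) + K * norm (Q n))" by (rule upper)
        also have "\<dots> <= K * (K * m + K * m)"
          using m K(1) mult_mono[OF K(1) m(2)] by (intro mult_left_mono add_mono) auto
        finally have "ln (G n) <= ln (K * (K * m + K * m))" using G by (intro ln_mono) auto
        also have "K * (K * m + K * m) = K * K * 2 * m" by simp
        also have "ln (K * K * 2 * m) = c + ln m" using K(1) m(1) by (simp add: ln_mult c_def)
        also have "ln m = max (ln (norm (P n))) (ln (norm (Q n)))" using PQ[of n] by (auto simp: m_def max_def)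
        finally show ?thesis by simp
      qed
      have l1: "(\<lambda>n. ln (norm (P n)) / n) \<longlonglongrightarrow> l" and l2: "(\<lambda>n. ln (norm (Q n)) / n) \<longlonglongrightarrow> l"
        using elim by (simp_all add: P_def Q_def)
      have "(\<lambda>n. ln (G n) / n) \<longlonglongrightarrow> l"
      proof (rule tendsto_sandwich)
        show "(\<lambda>n. ln (norm (P n)) / n - c / n) \<longlonglongrightarrow> l" using tendsto_diff[OF l1 lim_const_over_n[of c]] by simp
        show "(\<lambda>n. max (ln (norm (P n)) / n) (ln (norm (Q n)) / n) + c / n) \<longlonglongrightarrow> l"
          using tendsto_add[OF tendsto_max[OF l1 l2] lim_const_over_n[of c]] by simp
        show "\<forall>\<^sub>F n in sequentially. ln (norm (P n)) / n - c / n <= ln (G n) / n"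
        proof (rule always_eventually, rule allI)
          fix n show "ln (norm (P n)) / n - c / n <= ln (G n) / n"
            unfolding diff_divide_distrib[symmetric] by (intro divide_right_mono lo) simp
        qed
        show "\<forall>\<^sub>F n in sequentially. ln (G n) / n <= max (ln (norm (P n)) / n) (ln (norm (Q n)) / n) + c / n"
        proof (rule always_eventually, rule allI)
          fix n :: nat
          have "ln (G n) / n <= (max (ln (norm (P n))) (ln (norm (Q n))) + c) / n" by (intro divide_right_mono up) simp
          also have "\<dots> = max (ln (norm (P n)) / n) (ln (norm (Q n)) / n) + c / n"
            by (cases "n = 0") (auto simp: add_divide_distrib max_def divide_le_cancel)
          finally show "ln (G n) / n <= max (ln (norm (P n)) / n) (ln (norm (Q n)) / n) + c / n" .
        qed
      qed
      then show ?case by (simp add: G_def)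
    qed
  qed
qed

end

locale random_expanding = random_letters + A: expanding "Sv \<times> Sw" "\<lambda>a. pv (fst a) * pw (snd a)" lo hi K s C \<kappa>
  for lo hi K s C \<kappa>
begin

lemma lyapunov_exp_pos:
  assumes E: "E \<in> {lo..hi}"
  shows "lyapunov_exp M v w E > 0"
proof -
  obtain l where l: "l > 0" "\<And>x. x \<noteq> 0 ==> (\<lambda>n. A.log_growth E n x / n) \<longlonglongrightarrow> l"
  proof (rule A.log_growth_limit[OF E])
    fix l assume "l > 0" "\<And>x. x \<noteq> 0 ==> (\<lambda>n. A.log_growth E n x / n) \<longlonglongrightarrow> l"
    then show thesis by (rule that)
  qed
  have C: "A.osc + 2 * ln K + 1 > 0"
  proof -
    have "(1, 0) \<noteq> (0 :: real \<times> real)" by (simp add: prod_eq_iff)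
    from A.log_growth_oscillation[OF E this this, of 0] have "0 <= A.osc" by simp
    moreover have "0 <= ln K" using A.K by simp
    ultimately show ?thesis by linarith
  qed
  have "AE \<omega> in M. (\<lambda>n. ln (norm (tact E (word (path_ix n) \<omega>) x)) / n) \<longlonglongrightarrow> l" if x: "x \<noteq> 0" for x
  proof -
    have "AE \<omega> in M. (\<lambda>n. (ln (norm (tact E (word (path_ix n) \<omega>) x)) - A.mean n (\<lambda>u. ln (norm (tact E u x)))) / n) \<longlonglongrightarrow> 0"
    proof (rule law_of_large_numbers[OF C])
      fix n u a b assume "set u \<subseteq> Sv \<times> Sw" "a \<in> Sv \<times> Sw" "b \<in> Sv \<times> Sw"
      then show "\<bar>A.mean (n - Suc (length u)) (\<lambda>y. ln (norm (tact E (u @ a # y) x))) -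
          A.mean (n - Suc (length u)) (\<lambda>y. ln (norm (tact E (u @ b # y) x)))\<bar> <= A.osc + 2 * ln K + 1"
        using A.log_growth_martingale[OF E x, of u a b "n - Suc (length u)"] by linarith
    qed
    then show ?thesis
    proof eventually_elim
      case (elim \<omega>)
      have "(\<lambda>n. (ln (norm (tact E (word (path_ix n) \<omega>) x)) - A.mean n (\<lambda>u. ln (norm (tact E u x)))) / n
          + A.log_growth E n x / n) \<longlonglongrightarrow> 0 + l" by (rule tendsto_add[OF elim l(2)[OF x]])
      then show ?case by (simp add: A.log_growth_def flip: add_divide_distrib)
    qed
  qed
  then have "lyapunov_exp M v w E = l" by (intro lyapunov_exp_eqI) (simp_all add: prod_eq_iff)
  with l(1) show ?thesis by simp
qed

end

section \<open>The integrated density of states\<close>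

lemma jpoly_cong:
  "(\<And>k. k < n ==> V k = V' k) ==> (\<And>k. 0 < k ==> k <= n ==> W k = W' k) ==> jpoly V W n = jpoly V' W' n"
proof (induction n rule: less_induct)
  case (less n)
  consider "n = 0" | "n = Suc 0" | k where "n = Suc (Suc k)" by (metis nat.exhaust)
  then show ?case
  proof cases
    case 2
    then show ?thesis using less.prems(1)[of 0] less.prems(2)[of 1] by simp
  next
    case 3
    have "jpoly V W (Suc k) = jpoly V' W' (Suc k)" by (rule less.IH) (use 3 less.prems in auto)
    moreover have "jpoly V W k = jpoly V' W' k" by (rule less.IH) (use 3 less.prems in auto)
    ultimately show ?thesis using 3 less.prems(1)[of "Suc k"] less.prems(2)[of "Suc k"] less.prems(2)[of n] by simp
  qed simp
qed

lemma jcount_cong: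
  assumes "\<And>k. k < n ==> V k = V' k" "\<And>k. 0 < k ==> k <= n ==> W k = W' k"
  shows "jcount V W n = jcount V' W' n"
proof -
  have "jpoly V W n = jpoly V' W' n" by (rule jpoly_cong[OF assms])
  then show ?thesis by (simp add: jcount_def jeigs_def fun_eq_iff)
qed

definition word_diag :: "(real \<times> real) list => nat => real" where
  "word_diag u k = (if k < length u then fst (u ! k) else 0)"

text \<open>Letter k carries the diagonal entry at k and the hopping from k to k + 1, hence the
  shift by one. The default 1 keeps all entries nonzero, as \<open>jacobi_box\<close>
  demands.\<close>

definition word_offdiag :: "(real \<times> real) list => nat => real" where
  "word_offdiag u k = (if 0 < k \<and> k <= length u then snd (u ! (k - 1)) else 1)"

definition wcount :: "real => (real \<times> real) list => real" where
  "wcount e u = jcount (word_diag u) (word_offdiag u) (length u) e"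

lemma jacobi_box_word: "\<forall>a\<in>set u. snd a \<noteq> 0 ==> jacobi_box (word_offdiag u)"
  by (auto simp: jacobi_box_def word_offdiag_def)

lemma wcount_append:
  assumes "\<forall>a\<in>set (u @ u'). snd a \<noteq> 0"
  shows "\<bar>wcount e (u @ u') - wcount e u - wcount e u'\<bar> <= 1"
proof -
  define V W where "V = word_diag (u @ u')" and "W = word_offdiag (u @ u')"
  have "jcount V W (length u) = jcount (word_diag u) (word_offdiag u) (length u)"
    by (rule jcount_cong) (auto simp: V_def W_def word_diag_def word_offdiag_def nth_append)
  moreover have "jcount (\<lambda>k. V (length u + k)) (\<lambda>k. W (length u + k)) (length u') = jcount (word_diag u') (word_offdiag u') (length u')"
    by (rule jcount_cong) (auto simp: V_def W_def word_diag_def word_offdiag_def nth_append)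
  ultimately show ?thesis
    using jcount_append_le[OF jacobi_box_word[OF assms], of "word_diag (u @ u')" "length u" "length u'" e]
    by (simp add: wcount_def V_def W_def)
qed

lemma wcount_change:
  assumes "\<forall>c\<in>set (u @ a # x). snd c \<noteq> 0" "\<forall>c\<in>set (u @ b # x). snd c \<noteq> 0"
  shows "\<bar>wcount e (u @ a # x) - wcount e (u @ b # x)\<bar> <= 1"
proof -
  have "wcount e (u @ a # x) <= wcount e (u @ b # x) + 1"
    if nz: "\<forall>c\<in>set (u @ a # x). snd c \<noteq> 0" "\<forall>c\<in>set (u @ b # x). snd c \<noteq> 0" for a b
  proof -
    have "jcount (word_diag (u @ a # x)) (word_offdiag (u @ a # x)) (length (u @ a # x)) e
        <= Suc (jcount (word_diag (u @ b # x)) (word_offdiag (u @ b # x)) (length (u @ a # x)) e)"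
    proof (rule jcount_change_le[OF jacobi_box_word[OF nz(1)] jacobi_box_word[OF nz(2)]])
      fix k :: nat
      show "k \<noteq> length u ==> word_diag (u @ a # x) k = word_diag (u @ b # x) k"
        by (auto simp: word_diag_def nth_append nth_Cons split: nat.splits)
      show "k \<noteq> Suc (length u) ==> word_offdiag (u @ a # x) k = word_offdiag (u @ b # x) k"
        by (auto simp: word_offdiag_def nth_append nth_Cons split: nat.splits)
    qed
    then show ?thesis by (simp add: wcount_def)
  qed
  from this[OF assms] this[OF assms(2,1)] show ?thesis by linarith
qed

context random_letters
begin

lemma box_word:
  assumes "regular \<omega>"
  shows "jcount (\<lambda>k. v (int k) \<omega>) (\<lambda>k. w (int k) \<omega>) n e = wcount e (word (path_ix n) \<omega>)"
proof -
  have "jcount (\<lambda>k. v (int k) \<omega>) (\<lambda>k. w (int k) \<omega>) n = jcount (word_diag (word (path_ix n) \<omega>)) (word_offdiag (word (path_ix n) \<omega>)) n"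
  proof (rule jcount_cong)
    fix k assume "k < n"
    then show "v (int k) \<omega> = word_diag (word (path_ix n) \<omega>) k" by (simp add: word_diag_def word_def path_ix_def)
  next
    fix k assume "0 < k" "k <= n"
    then show "w (int k) \<omega> = word_offdiag (word (path_ix n) \<omega>) k"
      by (simp add: word_offdiag_def word_def path_ix_def of_nat_diff)
  qed
  then show ?thesis by (simp add: wcount_def length_word length_path_ix)
qed

lemma sum_restr_entry:
  assumes "i < n"
  shows "(\<Sum>j<n. restr_entry v w \<omega> i j * \<psi> j) = jop (\<lambda>k. v (int k) \<omega>) (\<lambda>k. w (int k) \<omega>) n \<psi> i"
proof -
  have "(\<Sum>j<n. restr_entry v w \<omega> i j * \<psi> j) = (\<Sum>j<n. (if j = i then v (int i) \<omega> * \<psi> i else 0)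
      + ((if j = Suc i then - (w (int (Suc i)) \<omega> * \<psi> (Suc i)) else 0)
      + (if j = i - 1 then (if i > 0 then - (w (int i) \<omega> * \<psi> (i - 1)) else 0) else 0)))"
    by (rule sum.cong) (auto simp: restr_entry_def)
  also have "\<dots> = jop (\<lambda>k. v (int k) \<omega>) (\<lambda>k. w (int k) \<omega>) n \<psi> i"
    using assms by (auto simp: sum.distrib jop_def)
  finally show ?thesis .
qed

lemma restr_spectrum_eq:
  assumes "regular \<omega>"
  shows "restr_spectrum v w \<omega> n = jeigs (\<lambda>k. v (int k) \<omega>) (\<lambda>k. w (int k) \<omega>) n"
proof -
  define V W where "V k = v (int k) \<omega>" and "W k = w (int k) \<omega>" for k
  interpret jacobi_box V W by unfold_locales (simp add: W_def regular_nz[OF assms])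
  have eq: "restr_spectrum v w \<omega> n = {e. \<exists>\<psi>. (\<exists>i<n. \<psi> i \<noteq> 0) \<and> (\<forall>i<n. jop V W n \<psi> i = e * \<psi> i)}"
    unfolding restr_spectrum_def using sum_restr_entry by (simp add: V_def[abs_def] W_def[abs_def] cong: conj_cong)
  have "\<exists>\<psi>. (\<exists>i<n. \<psi> i \<noteq> 0) \<and> (\<forall>i<n. jop V W n \<psi> i = e * \<psi> i)" if e: "e \<in> jeigs V W n" for e
  proof (intro exI[of _ "jvec V W n e"] conjI)
    show "\<exists>i<n. jvec V W n e i \<noteq> 0"
    proof (rule ccontr)
      assume "\<not> ?thesis"
      then have "(\<Sum>k<n. jvec V W n e k * jvec V W n e k) = 0" by simp
      then show False using jvec_orthonormal[OF e e] by simp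
    qed
    show "\<forall>i<n. jop V W n (jvec V W n e) i = e * jvec V W n e i" using jop_jvec[OF e] by blast
  qed
  moreover have "e \<in> jeigs V W n" if ne: "\<exists>i<n. \<psi> i \<noteq> 0" and op: "\<forall>i<n. jop V W n \<psi> i = e * \<psi> i" for e \<psi>
  proof -
    have "(\<Sum>k<n. \<psi> k * \<psi> k) \<noteq> 0"
    proof -
      obtain i where "i < n" "\<psi> i \<noteq> 0" using ne by blast
      then have "(\<Sum>k<n. \<psi> k * \<psi> k) > 0" by (intro sum_pos2[of _ i]) (auto simp flip: power2_eq_square)
      then show ?thesis by simp
    qed
    then obtain x where x: "x \<in> jeigs V W n" "jcoeff n \<psi> x \<noteq> 0"
      unfolding jparseval by (metis (no_types, lifting) mult_zero_left sum.neutral)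
    have "jcoeff n (jop V W n \<psi>) x = e * jcoeff n \<psi> x"
      using op by (simp add: jcoeff_def sum_distrib_left mult_ac)
    then have "x = e" using jcoeff_jop[OF x(1), of \<psi>] x(2) by simp
    then show ?thesis using x(1) by simp
  qed
  ultimately show ?thesis unfolding eq V_def[symmetric, abs_def] W_def[symmetric, abs_def] by blast
qed

text \<open>Eigenvalue counts are almost additive under concatenation, so their means have a
  density; changing one letter moves a count by at most 1, so the law of large numbers carries this
  density over to almost every sample.\<close>

lemma ids_tendsto: "(\<lambda>n. A.mean n (wcount e) / n) \<longlonglongrightarrow> ids M v w e"
proof -
  have add: "\<bar>A.mean (m + n) (wcount e) - A.mean m (wcount e) - A.mean n (wcount e)\<bar> <= 1" for m n
  proof -
    have "A.mean (m + n) (wcount e) - A.mean m (wcount e) - A.mean n (wcount e)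
       = A.mean m (\<lambda>u. A.mean n (\<lambda>u'. wcount e (u @ u') - wcount e u - wcount e u'))" (is "?l = ?r")
      by (simp only: A.mean_append A.mean_diff A.mean_const)
    then have "\<bar>?l\<bar> = \<bar>?r\<bar>" by (rule arg_cong)
    also have "\<bar>?r\<bar> <= A.mean m (\<lambda>u. \<bar>A.mean n (\<lambda>u'. wcount e (u @ u') - wcount e u - wcount e u')\<bar>)"
      by (rule A.abs_mean_le)
    also have "\<dots> <= 1"
    proof (rule A.mean_le_const)
      fix u assume u: "u \<in> A.words m"
      have "\<bar>A.mean n (\<lambda>u'. wcount e (u @ u') - wcount e u - wcount e u')\<bar>
          <= A.mean n (\<lambda>u'. \<bar>wcount e (u @ u') - wcount e u - wcount e u'\<bar>)" by (rule A.abs_mean_le)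
      also have "\<dots> <= 1"
        by (intro A.mean_le_const wcount_append) (use A.words_nz[OF A.append_in_words[OF u]] in auto)
      finally show "\<bar>A.mean n (\<lambda>u'. wcount e (u @ u') - wcount e u - wcount e u')\<bar> <= 1" .
    qed
    finally show ?thesis .
  qed
  obtain l where l: "(\<lambda>n. A.mean n (wcount e) / n) \<longlonglongrightarrow> l"
  proof (rule almost_additive_converges[OF add])
    fix l assume "(\<lambda>n. A.mean n (wcount e) / n) \<longlonglongrightarrow> l"
    then show thesis by (rule that)
  qed
  have "AE \<omega> in M. (\<lambda>n. (wcount e (word (path_ix n) \<omega>) - A.mean n (wcount e)) / n) \<longlonglongrightarrow> 0"
  proof (rule law_of_large_numbers[where C = 1])
    fix n u a b
    assume u: "set u \<subseteq> Sv \<times> Sw" "a \<in> Sv \<times> Sw" "b \<in> Sv \<times> Sw"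
    define k where "k = n - Suc (length u)"
    have "\<bar>A.mean k (\<lambda>x. wcount e (u @ a # x)) - A.mean k (\<lambda>x. wcount e (u @ b # x))\<bar>
        <= A.mean k (\<lambda>x. \<bar>wcount e (u @ a # x) - wcount e (u @ b # x)\<bar>)"
      unfolding A.mean_diff[symmetric] by (rule A.abs_mean_le)
    also have "\<dots> <= 1"
    proof (intro A.mean_le_const wcount_change)
      fix x assume "x \<in> A.words k"
      then show "\<forall>c\<in>set (u @ a # x). snd c \<noteq> 0" "\<forall>c\<in>set (u @ b # x). snd c \<noteq> 0"
        using u A.snd_nz by (auto simp: A.words_def)
    qed
    finally show "\<bar>A.mean (n - Suc (length u)) (\<lambda>x. wcount e (u @ a # x)) - A.mean (n - Suc (length u)) (\<lambda>x. wcount e (u @ b # x))\<bar> <= 1"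
      by (simp add: k_def)
  qed simp
  with AE_regular have "AE \<omega> in M. (\<lambda>n. real (card ({..e} \<inter> restr_spectrum v w \<omega> n)) / real n) \<longlonglongrightarrow> l"
  proof eventually_elim
    case (elim \<omega>)
    have "real (card ({..e} \<inter> restr_spectrum v w \<omega> n)) = wcount e (word (path_ix n) \<omega>)" for n
    proof -
      have "{..e} \<inter> restr_spectrum v w \<omega> n = {x \<in> jeigs (\<lambda>k. v (int k) \<omega>) (\<lambda>k. w (int k) \<omega>) n. x <= e}"
        by (auto simp: restr_spectrum_eq[OF elim(1)])
      then show ?thesis using box_word[OF elim(1), of n e] by (simp add: jcount_def)
    qed
    then show ?case using tendsto_add[OF elim(2) l] by (simp flip: add_divide_distrib)
  qed
  then have "ids M v w e = l" by (rule ids_eq)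
  with l show ?thesis by simp
qed

section \<open>Eigenfunctions and trapped sites\<close>

definition right_ix :: "int => nat => (int \<times> int) list" where
  "right_ix j m = map (\<lambda>i. (j + int i, j + int i + 1)) [0..<m]"

definition left_ix :: "int => nat => (int \<times> int) list" where
  "left_ix j m = map (\<lambda>i. (j - 1 - int i, j - 1 - int i)) [0..<m]"

text \<open>The head supplies w_j, which \<open>trapped\<close> reads from the first letter. Its
  diagonal index j + m is filler: the first site beyond the window, so that no index is
  repeated.\<close>

definition site_ix :: "int => nat => nat => (int \<times> int) list" where
  "site_ix j m m' = (j + int m, j) # right_ix j m @ left_ix j m'"

lemma length_site_ix: "length (site_ix j m m') = Suc (m + m')"
  by (simp add: site_ix_def right_ix_def left_ix_def)

lemma set_site_ix: "set (map fst (site_ix j m m')) \<subseteq> {j - int m'..j + int m}"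
    "set (map snd (site_ix j m m')) \<subseteq> {j - int m'..j + int m}"
  by (auto simp: site_ix_def right_ix_def left_ix_def)

lemma distinct_site_ix: "distinct (map fst (site_ix j m m'))" "distinct (map snd (site_ix j m m'))"
  by (auto simp: site_ix_def right_ix_def left_ix_def distinct_map inj_on_def comp_def)

lemma tact_right:
  assumes "regular \<omega>" and rec: "\<And>i. j <= i ==> i < j + int m ==>
      w (i + 1) \<omega> * \<psi> (i + 1) = (v i \<omega> - e) * \<psi> i - w i \<omega> * \<psi> (i - 1)"
  shows "tact e (word (right_ix j m) \<omega>) (\<psi> j, w j \<omega> * \<psi> (j - 1)) = (\<psi> (j + int m), w (j + int m) \<omega> * \<psi> (j + int m - 1))"
  using rec
proof (induction m)
  case 0
  then show ?case by (simp add: right_ix_def word_def)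
next
  case (Suc m)
  define i where "i = j + int m"
  have "word (right_ix j (Suc m)) \<omega> = word (right_ix j m) \<omega> @ [(v i \<omega>, w (i + 1) \<omega>)]"
    by (simp add: right_ix_def word_def i_def)
  then have "tact e (word (right_ix j (Suc m)) \<omega>) (\<psi> j, w j \<omega> * \<psi> (j - 1)) = tstep e (v i \<omega>, w (i + 1) \<omega>) (\<psi> i, w i \<omega> * \<psi> (i - 1))"
    using Suc by (simp add: tact_append i_def)
  also have "\<dots> = (\<psi> (i + 1), w (i + 1) \<omega> * \<psi> i)" using Suc.prems[of i] regular_nz[OF assms(1), of "i + 1"]
    by (simp add: tstep_def i_def field_simps)
  finally show ?case by (simp add: i_def algebra_simps)
qed

lemma tact_left:
  assumes "regular \<omega>" and rec: "\<And>i. j - int m <= i ==> i < j ==>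
      w (i + 1) \<omega> * \<psi> (i + 1) = (v i \<omega> - e) * \<psi> i - w i \<omega> * \<psi> (i - 1)"
  shows "tact e (word (left_ix j m) \<omega>) (\<psi> (j - 1), w j \<omega> * \<psi> j) = (\<psi> (j - 1 - int m), w (j - int m) \<omega> * \<psi> (j - int m))"
  using rec
proof (induction m)
  case 0
  then show ?case by (simp add: left_ix_def word_def)
next
  case (Suc m)
  define i where "i = j - 1 - int m"
  have "word (left_ix j (Suc m)) \<omega> = word (left_ix j m) \<omega> @ [(v i \<omega>, w i \<omega>)]"
    by (simp add: left_ix_def word_def i_def)
  then have "tact e (word (left_ix j (Suc m)) \<omega>) (\<psi> (j - 1), w j \<omega> * \<psi> j) = tstep e (v i \<omega>, w i \<omega>) (\<psi> i, w (i + 1) \<omega> * \<psi> (i + 1))"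
    using Suc by (simp add: tact_append i_def algebra_simps)
  also have "\<dots> = (\<psi> (i - 1), w i \<omega> * \<psi> i)" using Suc.prems[of i] regular_nz[OF assms(1), of i]
    by (simp add: tstep_def i_def field_simps)
  finally show ?case by (simp add: i_def algebra_simps)
qed

definition box_vec :: "'a => int => nat => real => int => real" where
  "box_vec \<omega> b n e i = (if b <= i \<and> i < b + int n then
     jvec (\<lambda>k. v (b + int k) \<omega>) (\<lambda>k. w (b + int k) \<omega>) n e (nat (i - b)) else 0)"

definition box_eigs :: "'a => int => nat => real set" where
  "box_eigs \<omega> b n = jeigs (\<lambda>k. v (b + int k) \<omega>) (\<lambda>k. w (b + int k) \<omega>) n"

text \<open>Extension by zero remains a solution at the two end sites: the solution starts from zero
  on the left, and the eigenvalue condition says that it vanishes just beyond the right end.\<close>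

lemma box_vec_rec:
  assumes "regular \<omega>" "e \<in> box_eigs \<omega> b n" "b <= i" "i < b + int n"
  shows "w (i + 1) \<omega> * box_vec \<omega> b n e (i + 1) = (v i \<omega> - e) * box_vec \<omega> b n e i - w i \<omega> * box_vec \<omega> b n e (i - 1)"
proof -
  define V W where "V = (\<lambda>k. v (b + int k) \<omega>)" and "W = (\<lambda>k. w (b + int k) \<omega>)"
  interpret jacobi_box V W by unfold_locales (simp add: W_def regular_nz[OF assms(1)])
  define k where "k = nat (i - b)"
  have k: "i = b + int k" "k < n" using assms by (auto simp: k_def)
  have e: "e \<in> jeigs V W n" using assms(2) by (simp add: box_eigs_def V_def W_def)
  have bv: "box_vec \<omega> b n e (b + int l) = jvec V W n e l" if "l <= n" for l
    using that jvec_end[OF e] by (auto simp: box_vec_def V_def W_def)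
  have 1: "i + 1 = b + int (Suc k)" using k by simp
  have 2: "box_vec \<omega> b n e (i - 1) = (if k > 0 then jvec V W n e (k - 1) else 0)"
  proof (cases "k > 0")
    case True
    then have "i - 1 = b + int (k - 1)" using k by (simp add: of_nat_diff)
    then have "box_vec \<omega> b n e (i - 1) = box_vec \<omega> b n e (b + int (k - 1))" by (rule arg_cong)
    also have "\<dots> = jvec V W n e (k - 1)" using k by (intro bv) simp
    finally show ?thesis using True by simp
  next
    case False
    then show ?thesis using k by (simp add: box_vec_def)
  qed
  have "w (i + 1) \<omega> = W (Suc k)" "v i \<omega> = V k" "w i \<omega> = W k" using k by (auto simp: W_def V_def algebra_simps)
  then show ?thesis unfolding 1 2 using jvec_rec[of k n e] bv[of "Suc k"] bv[of k] k by simp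
qed

end

context random_expanding
begin

text \<open>The vector formed at j has norm at least |\<psi> j|, so after normalisation its
  propagated images are bounded by 2Kt, with K for the hopping factor and 2 for the two coordinates.
  The window extends one site further left than the letters because the last left vector contains
  the value at j - 1 - m'.\<close>

lemma trapped_of_eigenfunction:
  assumes reg: "regular \<omega>" and rec: "\<And>i. j - int m' <= i ==> i < j + int m ==>
      w (i + 1) \<omega> * \<psi> (i + 1) = (v i \<omega> - e) * \<psi> i - w i \<omega> * \<psi> (i - 1)"
    and bound: "\<And>i. j - int m' - 1 <= i ==> i <= j + int m ==> \<bar>\<psi> i\<bar> <= t * \<bar>\<psi> j\<bar>" and nz: "\<psi> j \<noteq> 0"
  shows "trapped m (2 * K * t) e (word (site_ix j m m') \<omega>)"
proof -
  define X where "X = (\<psi> j, w j \<omega> * \<psi> (j - 1))"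
  have wK: "\<bar>w i \<omega>\<bar> <= K" for i using A.snd_le[of "(v 0 \<omega>, w i \<omega>)"] reg by (simp add: regular_def)
  have X: "\<bar>\<psi> j\<bar> <= norm X" using abs_fst_le[of X] by (simp add: X_def)
  have Xpos: "norm X > 0" using X nz by linarith
  have t: "t >= 1" using bound[of j] nz by simp
  have pair: "norm (\<psi> i, w i' \<omega> * \<psi> i'') <= 2 * K * t * norm X"
    if "\<bar>\<psi> i\<bar> <= t * \<bar>\<psi> j\<bar>" "\<bar>\<psi> i''\<bar> <= t * \<bar>\<psi> j\<bar>" for i i' i''
  proof -
    have "norm (\<psi> i, w i' \<omega> * \<psi> i'') <= \<bar>\<psi> i\<bar> + \<bar>w i' \<omega>\<bar> * \<bar>\<psi> i''\<bar>"
      using norm_le_abs_add[of "(\<psi> i, w i' \<omega> * \<psi> i'')"] by (simp add: abs_mult)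
    also have "\<dots> <= K * (t * \<bar>\<psi> j\<bar>) + K * (t * \<bar>\<psi> j\<bar>)"
    proof (rule add_mono)
      have "1 * (t * \<bar>\<psi> j\<bar>) <= K * (t * \<bar>\<psi> j\<bar>)" using A.K t by (intro mult_right_mono) auto
      then show "\<bar>\<psi> i\<bar> <= K * (t * \<bar>\<psi> j\<bar>)" using that(1) by linarith
      show "\<bar>w i' \<omega>\<bar> * \<bar>\<psi> i''\<bar> <= K * (t * \<bar>\<psi> j\<bar>)" using wK that(2) A.K by (intro mult_mono) auto
    qed
    also have "\<dots> = 2 * K * t * \<bar>\<psi> j\<bar>" by simp
    also have "\<dots> <= 2 * K * t * norm X" using X A.K t by (intro mult_left_mono) auto
    finally show ?thesis .
  qed
  define Y where "Y = (1 / norm X) *\<^sub>R X"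
  have split: "hd (word (site_ix j m m') \<omega>) = (v (j + int m) \<omega>, w j \<omega>)"
    "take m (tl (word (site_ix j m m') \<omega>)) = word (right_ix j m) \<omega>"
    "drop m (tl (word (site_ix j m m') \<omega>)) = word (left_ix j m') \<omega>"
    by (simp_all add: site_ix_def word_def right_ix_def)
  have "tact e (word (right_ix j m) \<omega>) X = (\<psi> (j + int m), w (j + int m) \<omega> * \<psi> (j + int m - 1))"
    unfolding X_def
  proof (rule tact_right[OF reg, where \<psi> = \<psi> and e = e and j = j and m = m])
    fix i assume "j <= i" "i < j + int m"
    then show "w (i + 1) \<omega> * \<psi> (i + 1) = (v i \<omega> - e) * \<psi> i - w i \<omega> * \<psi> (i - 1)" by (intro rec) auto
  qed
  then have R: "norm (tact e (word (right_ix j m) \<omega>) X) <= 2 * K * t * norm X"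
    using pair[of "j + int m" "j + int m - 1" "j + int m"] bound by simp
  have "flip (w j \<omega>) X = (\<psi> (j - 1), w j \<omega> * \<psi> j)" using regular_nz[OF reg] by (simp add: flip_def X_def)
  moreover have "tact e (word (left_ix j m') \<omega>) (\<psi> (j - 1), w j \<omega> * \<psi> j) = (\<psi> (j - 1 - int m'), w (j - int m') \<omega> * \<psi> (j - int m'))"
  proof (rule tact_left[OF reg, where \<psi> = \<psi> and e = e and j = j and m = m'])
    fix i assume "j - int m' <= i" "i < j"
    then show "w (i + 1) \<omega> * \<psi> (i + 1) = (v i \<omega> - e) * \<psi> i - w i \<omega> * \<psi> (i - 1)" by (intro rec) auto
  qed
  ultimately have L: "norm (tact e (word (left_ix j m') \<omega>) (flip (w j \<omega>) X)) <= 2 * K * t * norm X"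
    using pair[of "j - 1 - int m'" "j - int m'" "j - int m'"] bound by simp
  have flipY: "flip (w j \<omega>) Y = (1 / norm X) *\<^sub>R flip (w j \<omega>) X"
    using flip_linear[of "w j \<omega>" "1 / norm X" X 0 0] by (simp add: Y_def)
  show ?thesis unfolding trapped_def split
  proof (intro exI conjI)
    show "norm Y = 1" using Xpos by (simp add: Y_def)
    show "norm (tact e (word (right_ix j m) \<omega>) Y) <= 2 * K * t"
      using R Xpos by (simp add: Y_def tact_scale field_simps)
    show "norm (tact e (word (left_ix j m') \<omega>) (flip (snd (v (j + int m) \<omega>, w j \<omega>)) Y)) <= 2 * K * t"
      using L Xpos by (simp add: flipY tact_scale field_simps)
  qed
qed

lemma box_vec_small:
  assumes reg: "regular \<omega>" and e: "e \<in> box_eigs \<omega> b n" and box: "b + int m' < j" "j + int m < b + int n"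
    and nt: "\<not> trapped m (2 * K * t) e (word (site_ix j m m') \<omega>)"
  shows "\<exists>i. j - int m' - 1 <= i \<and> i <= j + int m \<and> t * \<bar>box_vec \<omega> b n e j\<bar> <= \<bar>box_vec \<omega> b n e i\<bar>"
proof (rule ccontr)
  assume "\<not> ?thesis"
  then have small: "\<bar>box_vec \<omega> b n e i\<bar> < t * \<bar>box_vec \<omega> b n e j\<bar>" if "j - int m' - 1 <= i" "i <= j + int m" for i
    using that by (meson not_le)
  have "box_vec \<omega> b n e j \<noteq> 0" using small[of j] by auto
  have "trapped m (2 * K * t) e (word (site_ix j m m') \<omega>)"
  proof (rule trapped_of_eigenfunction[OF reg, where \<psi> = "box_vec \<omega> b n e"])
    fix i assume i: "j - int m' <= i" "i < j + int m"
    show "w (i + 1) \<omega> * box_vec \<omega> b n e (i + 1) = (v i \<omega> - e) * box_vec \<omega> b n e i - w i \<omega> * box_vec \<omega> b n e (i - 1)"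
      by (rule box_vec_rec[OF reg e]) (use i box in linarith)+
  next
    fix i assume i: "j - int m' - 1 <= i" "i <= j + int m"
    show "\<bar>box_vec \<omega> b n e i\<bar> <= t * \<bar>box_vec \<omega> b n e j\<bar>" using small[OF i] by simp
  qed fact
  with nt show False by simp
qed

text \<open>Eigenvectors with eigenvalue in (e, e'] concentrate half of their mass on trapped or
  boundary sites, so twice the number of such sites bounds their number; taking means and dividing
  by the box size leaves twice the trapping probability at e.\<close>

lemma ids_increment_le:
  assumes D: "\<And>E. E \<in> {lo..hi} ==>
      A.prob (Suc (m + A.left_len m)) (trapped m (4 * K * exp (A.trap_exp * m)) E) <= D * exp (- A.trap_rate * m)"
    and ee: "e \<in> {lo..hi}" "e' \<in> {lo..hi}" "e <= e'" and close: "(e' - e) * (m * K ^ Suc m) <= 1"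
    and large: "4 * real (Suc m) + 2 <= (exp (A.trap_exp * m))\<^sup>2"
  shows "ids M v w e' - ids M v w e <= 2 * D * exp (- A.trap_rate * m)"
proof -
  define t where "t = exp (A.trap_exp * m)"
  define m' where "m' = A.left_len m"
  have m': "m' <= m" unfolding m'_def by (rule A.left_len_le)
  have t: "t >= 1" using A.trap_exp_pos by (simp add: t_def)
  have T1: "2 * K * t >= 1" using mult_mono[of 1 K 1 t] A.K t by simp
  define Ev where "Ev k = word_event (site_ix (int k) m m') (trapped m (4 * K * t) e)" for k :: nat
  have count: "wcount e' (word (path_ix n) \<omega>) - wcount e (word (path_ix n) \<omega>)
      <= 2 * (2 * real m + 4) + 2 * (\<Sum>k<n. indicator (Ev k) \<omega>)"
    if reg: "regular \<omega>" and sp: "\<omega> \<in> space M" for \<omega> n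
  proof -
    define V W where "V = (\<lambda>k. v (0 + int k) \<omega>)" and "W = (\<lambda>k. w (0 + int k) \<omega>)"
    interpret J: jacobi_box V W by unfold_locales (simp add: W_def regular_nz[OF reg])
    define F where "F = {x \<in> jeigs V W n. e < x \<and> x <= e'}"
    \<comment> \<open>Sites too close to the ends for a full window count as bad. Their number does
      not depend on n, so it disappears in the density.\<close>
    define B where "B = {k. k < Suc m \<or> n <= k + m \<or> \<omega> \<in> Ev k}"
    have cF: "card F <= 2 * card (B \<inter> {..<n})"
    proof (rule J.card_eigs_le[where t = t and l = "Suc m"])
      show "F \<subseteq> jeigs V W n" by (auto simp: F_def)
      show "0 < t" using t by simp
      show "4 * real (Suc m) + 2 <= t\<^sup>2" using large by (simp add: t_def)
      fix x k assume x: "x \<in> F" and k: "k < n" "k \<notin> B"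
      have xe: "x \<in> box_eigs \<omega> 0 n" using x by (simp add: F_def box_eigs_def V_def W_def)
      \<comment> \<open>Trapping at the eigenvalue x, which depends on the sample, would pass with
        doubled threshold to the fixed energy e, where its probability is known.\<close>
      have nt: "\<not> trapped m (2 * K * t) x (word (site_ix (int k) m m') \<omega>)"
      proof
        assume tr: "trapped m (2 * K * t) x (word (site_ix (int k) m m') \<omega>)"
        have wd: "word (site_ix (int k) m m') \<omega> \<in> A.words (Suc (m + m'))"
          using word_in_words[OF reg, of "site_ix (int k) m m'"] by (simp add: length_site_ix)
        have "\<bar>x - e\<bar> * (m * K ^ Suc m) <= (e' - e) * (m * K ^ Suc m)"
          using x A.K by (intro mult_right_mono) (auto simp: F_def)
        then have c: "\<bar>x - e\<bar> * (m * K ^ Suc m) <= 1" using close by linarith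
        have xI: "x \<in> {lo..hi}" using x ee by (auto simp: F_def)
        have "trapped m (2 * (2 * K * t)) e (word (site_ix (int k) m m') \<omega>)"
          by (rule A.trapped_energy_close[OF xI ee(1) wd m' T1 c tr])
        then have "\<omega> \<in> Ev k" using sp wd by (simp add: Ev_def word_event_def length_site_ix mult.assoc)
        then show False using k by (simp add: B_def)
      qed
      have "0 + int m' < int k" "int k + int m < 0 + int n" using k m' by (auto simp: B_def)
      from box_vec_small[OF reg xe this nt] obtain i where i: "int k - int m' - 1 <= i" "i <= int k + int m"
        "t * \<bar>box_vec \<omega> 0 n x (int k)\<bar> <= \<bar>box_vec \<omega> 0 n x i\<bar>" by blast
      have i0: "0 <= i" "i < int n" using i k m' by (auto simp: B_def)
      have bv: "box_vec \<omega> 0 n x (int l) = jvec V W n x l" if "l < n" for l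
        using that by (simp add: box_vec_def V_def W_def)
      show "\<exists>i<n. \<bar>int i - int k\<bar> <= int (Suc m) \<and> t * \<bar>jvec V W n x k\<bar> <= \<bar>jvec V W n x i\<bar>"
      proof (intro exI[of _ "nat i"] conjI)
        show "nat i < n" using i0 by simp
        show "\<bar>int (nat i) - int k\<bar> <= int (Suc m)" using i i0 m' by simp
        show "t * \<bar>jvec V W n x k\<bar> <= \<bar>jvec V W n x (nat i)\<bar>" using i(3) bv[of k] bv[of "nat i"] k i0 by simp
      qed
    qed
    have f1: "real (card F) <= 2 * real (card (B \<inter> {..<n}))" using of_nat_mono[OF cF, where 'a = real] by simp
    have f2: "real (card (B \<inter> {..<n})) <= (2 * real m + 4) + (\<Sum>k<n. indicator (Ev k) \<omega>)"
    proof -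
      have "B \<inter> {..<n} \<subseteq> ({..<Suc m} \<union> {n - m..<n}) \<union> {k\<in>{..<n}. \<omega> \<in> Ev k}" by (auto simp: B_def)
      then have "card (B \<inter> {..<n}) <= card (({..<Suc m} \<union> {n - m..<n}) \<union> {k\<in>{..<n}. \<omega> \<in> Ev k})"
        by (intro card_mono) auto
      also have "\<dots> <= card ({..<Suc m} \<union> {n - m..<n}) + card {k\<in>{..<n}. \<omega> \<in> Ev k}" by (rule card_Un_le)
      also have "card ({..<Suc m} \<union> {n - m..<n}) <= card {..<Suc m} + card {n - m..<n}" by (rule card_Un_le)
      finally have "card (B \<inter> {..<n}) <= 2 * m + 1 + card {k\<in>{..<n}. \<omega> \<in> Ev k}" by simp
      moreover have "real (card {k\<in>{..<n}. \<omega> \<in> Ev k}) = (\<Sum>k<n. indicator (Ev k) \<omega>)"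
        by (simp add: indicator_def sum.If_cases Int_def)
      ultimately show ?thesis by linarith
    qed
    have f3: "real (card F) = wcount e' (word (path_ix n) \<omega>) - wcount e (word (path_ix n) \<omega>)"
    proof -
      have "{x \<in> jeigs V W n. x <= e'} = {x \<in> jeigs V W n. x <= e} \<union> F" using ee by (auto simp: F_def)
      moreover have "card ({x \<in> jeigs V W n. x <= e} \<union> F) = card {x \<in> jeigs V W n. x <= e} + card F"
        using J.finite_jeigs by (intro card_Un_disjoint) (auto simp: F_def)
      ultimately have "jcount V W n e' = jcount V W n e + card F" by (simp add: jcount_def)
      then show ?thesis using box_word[OF reg, of n e] box_word[OF reg, of n e'] by (simp add: V_def W_def)
    qed
    have "2 * real (card (B \<inter> {..<n})) <= 2 * ((2 * real m + 4) + (\<Sum>k<n. indicator (Ev k) \<omega>))"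
      by (intro mult_left_mono f2) simp
    with f1 have "real (card F) <= 2 * ((2 * real m + 4) + (\<Sum>k<n. indicator (Ev k) \<omega>))" by (rule order_trans)
    then show ?thesis unfolding f3 by (simp only: distrib_left)
  qed
  have mean_le: "A.mean n (wcount e') - A.mean n (wcount e) <= 2 * (2 * real m + 4) + 2 * (n * (D * exp (- A.trap_rate * m)))" for n
  proof -
    define g where "g y \<omega> = (\<Sum>u\<in>A.words (length (path_ix n)). wcount y u * indicator {\<omega>\<in>space M. word (path_ix n) \<omega> = u} \<omega>)" for y \<omega>
    have g: "integrable M (g y)" "(\<integral>\<omega>. g y \<omega> \<partial>M) = A.mean n (wcount y)" for y
      using mean_word[OF distinct_path_ix(1)[of n] distinct_path_ix(2)[of n], of "wcount y"] unfolding g_def length_path_ix by simp_all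
    have Ei: "integrable M (indicator (Ev k) :: 'a => real)" for k
      by (intro integrable_real_indicator) (auto simp: Ev_def word_event_sets emeasure_eq_measure)
    have "A.mean n (wcount e') - A.mean n (wcount e) = (\<integral>\<omega>. g e' \<omega> - g e \<omega> \<partial>M)" using g by simp
    also have "\<dots> <= (\<integral>\<omega>. 2 * (2 * real m + 4) + 2 * (\<Sum>k<n. indicator (Ev k) \<omega>) \<partial>M)"
    proof (rule integral_mono_AE)
      show "integrable M (\<lambda>\<omega>. g e' \<omega> - g e \<omega>)" using g by simp
      show "integrable M (\<lambda>\<omega>. 2 * (2 * real m + 4) + 2 * (\<Sum>k<n. indicator (Ev k) \<omega> :: real))"
        by (intro Bochner_Integration.integrable_add integrable_const integrable_mult_right Bochner_Integration.integrable_sum Ei)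
      show "AE \<omega> in M. g e' \<omega> - g e \<omega> <= 2 * (2 * real m + 4) + 2 * (\<Sum>k<n. indicator (Ev k) \<omega>)"
        using AE_regular AE_space
      proof eventually_elim
        case (elim \<omega>)
        show ?case unfolding g_def word_sum_eq[OF elim] by (rule count[OF elim])
      qed
    qed
    also have "\<dots> = 2 * (2 * real m + 4) + 2 * (\<Sum>k<n. measure M (Ev k))"
      using Ei by (simp add: prob_space Ev_def word_event_sets sets.Int_space_eq2)
    also have "\<dots> <= 2 * (2 * real m + 4) + 2 * (\<Sum>k<n. D * exp (- A.trap_rate * m))"
    proof (intro add_left_mono mult_left_mono sum_mono)
      fix k
      show "measure M (Ev k) <= D * exp (- A.trap_rate * m)"
        using D[OF ee(1)] by (simp add: Ev_def measure_word_event[OF distinct_site_ix] length_site_ix m'_def t_def mult.assoc)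
    qed simp
    finally show ?thesis by simp
  qed
  show ?thesis
  proof (rule LIMSEQ_le)
    show "(\<lambda>n. A.mean n (wcount e') / n - A.mean n (wcount e) / n) \<longlonglongrightarrow> ids M v w e' - ids M v w e"
      by (intro tendsto_diff ids_tendsto)
    have "(\<lambda>n. (2 * (2 * real m + 4)) / real n + 2 * D * exp (- A.trap_rate * m)) \<longlonglongrightarrow> 0 + 2 * D * exp (- A.trap_rate * m)"
      by (rule tendsto_add[OF lim_const_over_n tendsto_const])
    then show "(\<lambda>n. (2 * (2 * real m + 4)) / real n + 2 * D * exp (- A.trap_rate * m)) \<longlonglongrightarrow> 2 * D * exp (- A.trap_rate * m)"
      by simp
    show "\<exists>N. \<forall>n\<ge>N. A.mean n (wcount e') / n - A.mean n (wcount e) / n <= (2 * (2 * real m + 4)) / real n + 2 * D * exp (- A.trap_rate * m)"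
    proof (intro exI[of _ 1] allI impI)
      fix n :: nat assume n: "1 <= n"
      have "A.mean n (wcount e') / n - A.mean n (wcount e) / n <= (2 * (2 * real m + 4) + 2 * (n * (D * exp (- A.trap_rate * m)))) / n"
        unfolding diff_divide_distrib[symmetric] by (intro divide_right_mono mean_le) simp
      also have "\<dots> = (2 * (2 * real m + 4)) / real n + 2 * D * exp (- A.trap_rate * m)"
        using n by (simp add: add_divide_distrib)
      finally show "A.mean n (wcount e') / n - A.mean n (wcount e) / n <= (2 * (2 * real m + 4)) / real n + 2 * D * exp (- A.trap_rate * m)" .
    qed
  qed
qed

lemma ids_mono_bounds:
  assumes "e <= e'"
  shows "0 <= ids M v w e' - ids M v w e" "ids M v w e' - ids M v w e <= 1"
proof -
  have le: "0 <= wcount e' u - wcount e u" "wcount e' u - wcount e u <= n" if u: "u \<in> A.words n" for u n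
  proof -
    interpret J: jacobi_box "word_diag u" "word_offdiag u" using jacobi_box_word[OF A.words_nz[OF u]] .
    have "jcount (word_diag u) (word_offdiag u) (length u) e <= jcount (word_diag u) (word_offdiag u) (length u) e'"
      unfolding jcount_def using assms J.finite_jeigs by (intro card_mono) auto
    moreover have "jcount (word_diag u) (word_offdiag u) (length u) e' <= n"
      using J.jcount_le[of "length u" e'] u by (simp add: A.words_def)
    ultimately show "0 <= wcount e' u - wcount e u" "wcount e' u - wcount e u <= n" by (auto simp: wcount_def)
  qed
  have lim: "(\<lambda>n. A.mean n (wcount e') / n - A.mean n (wcount e) / n) \<longlonglongrightarrow> ids M v w e' - ids M v w e"
    by (intro tendsto_diff ids_tendsto)
  have b: "0 <= A.mean n (wcount e') / n - A.mean n (wcount e) / n" "A.mean n (wcount e') / n - A.mean n (wcount e) / n <= 1" for n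
  proof -
    have "0 <= A.mean n (wcount e') - A.mean n (wcount e)"
      unfolding A.mean_diff[symmetric] by (rule A.mean_nonneg) (rule le(1))
    moreover have "A.mean n (wcount e') - A.mean n (wcount e) <= n"
      unfolding A.mean_diff[symmetric] by (rule A.mean_le_const) (rule le(2))
    ultimately show "0 <= A.mean n (wcount e') / n - A.mean n (wcount e) / n" "A.mean n (wcount e') / n - A.mean n (wcount e) / n <= 1"
      unfolding diff_divide_distrib[symmetric] by (auto simp: divide_le_eq)
  qed
  show "0 <= ids M v w e' - ids M v w e" by (rule LIMSEQ_le_const[OF lim]) (use b in blast)
  show "ids M v w e' - ids M v w e <= 1" by (rule LIMSEQ_le_const2[OF lim]) (use b in blast)
qed

text \<open>A window length proportional to the logarithm of 1/|E - E'| turns the exponential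
  trapping bound into a power of |E - E'|, which is the exponent 1 in the definition.\<close>

lemma ids_weak_hoelder:
  assumes "lo <= c" "d <= hi" "d - c <= 1"
  shows "weak_hoelder_on (ids M v w) {c<..<d}"
proof -
  have "4 * K >= 1" using A.K by simp
  then obtain D where D: "D > 0" "\<And>E m. E \<in> {lo..hi} ==>
     A.prob (Suc (m + A.left_len m)) (trapped m (4 * K * exp (A.trap_exp * m)) E) <= D * exp (- A.trap_rate * m)"
    by (rule A.prob_trapped_exp) blast
  obtain m0 :: nat where m0: "\<And>m. m >= m0 ==> 4 * real (Suc m) + 2 <= (exp (A.trap_exp * m))\<^sup>2"
  proof -
    define a where "a = A.trap_exp"
    have a: "a > 0" unfolding a_def by (rule A.trap_exp_pos)
    show thesis
    proof (rule that[of "Suc (nat \<lceil>5 / a\<^sup>2\<rceil>)"])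
      fix m assume "Suc (nat \<lceil>5 / a\<^sup>2\<rceil>) <= m"
      then have m: "5 / a\<^sup>2 <= m" "1 <= m" by linarith+
      define x where "x = a * m"
      have x: "0 <= x" "(2 * x)\<^sup>2 / 2 = 2 * (a\<^sup>2 * m) * m" using a by (auto simp: x_def power2_eq_square)
      have "5 <= a\<^sup>2 * m" using m(1) a by (simp add: field_simps)
      then have "2 * 5 * real m <= 2 * (a\<^sup>2 * m) * m" by (intro mult_right_mono) linarith+
      moreover have "1 + 2 * x + (2 * x)\<^sup>2 / 2 <= exp (2 * x)"
        using x by (intro exp_lower_Taylor_quadratic) auto
      moreover have "(exp (a * m))\<^sup>2 = exp (2 * x)" by (simp add: x_def power2_eq_square flip: exp_add)
      ultimately have "1 + 10 * real m <= (exp (a * m))\<^sup>2" using x by linarith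
      then show "4 * real (Suc m) + 2 <= (exp (A.trap_exp * m))\<^sup>2" unfolding a_def[symmetric] using m(2) by simp
    qed
  qed
  \<comment> \<open>For m >= 1 this gives m K^(m + 1) <= exp (bm), so windows of length up to L/b
    tolerate an energy shift of exp (-L).\<close>
  define b where "b = 1 + 2 * ln K"
  have b: "b >= 1" using A.K by (simp add: b_def)
  define \<alpha> where "\<alpha> = A.trap_rate / b"
  have \<alpha>: "\<alpha> > 0" using A.trap_rate_pos b by (simp add: \<alpha>_def)
  \<comment> \<open>The first entry absorbs rounding L/b down to an integer; the second covers
    windows shorter than m0, where only the trivial bound 1 on the increment is used.\<close>
  define C0 where "C0 = max (2 * D * exp A.trap_rate) (exp (\<alpha> * b * (real m0 + 1)))"
  have main: "ids M v w y - ids M v w x <= C0 * exp (- \<alpha> * ln (1 / (y - x)))"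
    if xy: "x \<in> {c<..<d}" "y \<in> {c<..<d}" "x < y" for x y
  proof -
    define \<delta> where "\<delta> = y - x"
    have \<delta>: "0 < \<delta>" "\<delta> < 1" using xy assms(3) by (auto simp: \<delta>_def)
    define L where "L = ln (1 / \<delta>)"
    have L: "L > 0" using \<delta> by (simp add: L_def)
    have eL: "exp (- L) = \<delta>" using \<delta> by (simp add: L_def ln_div)
    define m where "m = nat \<lfloor>L / b\<rfloor>"
    have m: "real m <= L / b" "L / b < real m + 1" using L b unfolding m_def by (auto simp: of_nat_nat)
    show ?thesis
    proof (cases "m >= m0")
      case True
      have "\<delta> * (m * K ^ Suc m) <= 1"
      proof (cases "m = 0")
        case False
        have "real m <= exp (real m)" using exp_ge_add_one_self[of "real m"] by linarith
        moreover have "K ^ Suc m <= exp (2 * ln K * real m)"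
        proof -
          have "K ^ Suc m <= K ^ (2 * m)" using False A.K by (intro power_increasing) auto
          also have "\<dots> = exp (2 * ln K * real m)" using A.K by (simp add: powr_realpow[symmetric] powr_def mult_ac)
          finally show ?thesis .
        qed
        ultimately have "m * K ^ Suc m <= exp (real m) * exp (2 * ln K * real m)" using A.K by (intro mult_mono) auto
        also have "\<dots> = exp (b * m)" by (simp add: b_def algebra_simps flip: exp_add)
        also have "\<dots> <= exp L" using m(1) b by (simp add: field_simps)
        finally have "\<delta> * (m * K ^ Suc m) <= exp (- L) * exp L" unfolding eL using \<delta> by (intro mult_left_mono) auto
        then show ?thesis by (simp flip: exp_add)
      qed simp
      then have "ids M v w y - ids M v w x <= 2 * D * exp (- A.trap_rate * m)"
        using xy assms by (intro ids_increment_le D m0[OF True]) (auto simp: \<delta>_def)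
      also have "\<dots> <= 2 * D * exp (A.trap_rate - \<alpha> * L)"
      proof (intro mult_left_mono)
        have "\<alpha> * L = A.trap_rate * (L / b)" by (simp add: \<alpha>_def)
        also have "\<dots> <= A.trap_rate * (m + 1)" using m A.trap_rate_pos by (intro mult_left_mono) auto
        finally show "exp (- A.trap_rate * m) <= exp (A.trap_rate - \<alpha> * L)" by (simp add: algebra_simps)
      qed (use D in simp)
      also have "\<dots> = (2 * D * exp A.trap_rate) * exp (- \<alpha> * L)" by (simp add: exp_diff exp_minus field_simps)
      also have "\<dots> <= C0 * exp (- \<alpha> * L)" by (intro mult_right_mono) (auto simp: C0_def)
      finally show ?thesis by (simp add: L_def \<delta>_def)
    next
      case False
      have "real m + 1 <= real m0 + 1" using False by simp
      then have "L / b <= real m0 + 1" using m(2) by linarith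
      then have "L <= b * (real m0 + 1)" using b by (simp add: field_simps)
      then have "\<alpha> * L <= \<alpha> * b * (real m0 + 1)" using \<alpha> by (simp add: mult.assoc)
      then have "1 <= exp (\<alpha> * b * (real m0 + 1)) * exp (- \<alpha> * L)" by (simp flip: exp_add)
      also have "\<dots> <= C0 * exp (- \<alpha> * L)" by (intro mult_right_mono) (auto simp: C0_def)
      finally show ?thesis using ids_mono_bounds(2)[of x y] xy by (simp add: L_def \<delta>_def)
    qed
  qed
  show ?thesis unfolding weak_hoelder_on_def
  proof (rule exI[of _ C0], rule exI[of _ \<alpha>], rule exI[of _ "1 :: real"], intro conjI ballI impI)
    fix x y assume xy: "x \<in> {c<..<d}" "y \<in> {c<..<d}" "x \<noteq> y"
    have p: "ln (1 / \<bar>x - y\<bar>) powr 1 = ln (1 / \<bar>x - y\<bar>)"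
      using xy assms(3) by (intro powr_one ln_ge_zero) (auto simp: field_simps abs_le_iff)
    show "\<bar>ids M v w x - ids M v w y\<bar> <= C0 * exp (- \<alpha> * ln (1 / \<bar>x - y\<bar>) powr 1)" unfolding p
    proof (cases "x < y")
      case True
      then show "\<bar>ids M v w x - ids M v w y\<bar> <= C0 * exp (- \<alpha> * ln (1 / \<bar>x - y\<bar>))"
        using main[OF xy(1,2)] ids_mono_bounds(1)[of x y] by simp
    next
      case False
      then have "y < x" using xy by simp
      then show "\<bar>ids M v w x - ids M v w y\<bar> <= C0 * exp (- \<alpha> * ln (1 / \<bar>x - y\<bar>))"
        using main[OF xy(2,1)] ids_mono_bounds(1)[of y x] by simp
    qed
  qed (use \<alpha> in auto)
qed

end

section \<open>Spectral measures\<close>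

text \<open>The property by which \<open>spectral_measure\<close> is selected, with the radius of
  the support made explicit.\<close>

definition moment_measure :: "real measure => (nat => real) => real => bool" where
  "moment_measure \<mu> c R \<longleftrightarrow> finite_measure \<mu> \<and> sets \<mu> = sets borel \<and> emeasure \<mu> (- {-R..R}) = 0 \<and>
     (\<forall>m. (\<integral>x. x ^ m \<partial>\<mu>) = c m)"

lemma moment_measure_mono:
  assumes "moment_measure \<mu> c R" "R <= R'"
  shows "moment_measure \<mu> c R'"
proof -
  have "emeasure \<mu> (- {-R'..R'}) <= emeasure \<mu> (- {-R..R})"
    using assms by (intro emeasure_mono) (auto simp: moment_measure_def)
  then show ?thesis using assms by (simp add: moment_measure_def)
qed

lemma moment_measure_AE:
  assumes "moment_measure \<mu> c R"
  shows "AE x in \<mu>. x \<in> {-R..R}"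
proof (rule AE_I)
  show "{x \<in> space \<mu>. x \<notin> {-R..R}} \<subseteq> - {-R..R}" by auto
qed (use assms in \<open>auto simp: moment_measure_def\<close>)

lemma moment_measure_integrable:
  fixes f :: "real => 'b::{banach, second_countable_topology}"
  assumes \<mu>: "moment_measure \<mu> c R" and f: "f \<in> borel_measurable borel" and B: "\<And>x. x \<in> {-R..R} ==> norm (f x) <= B"
  shows "integrable \<mu> f"
proof -
  interpret finite_measure \<mu> using \<mu> by (simp add: moment_measure_def)
  have [measurable_cong]: "sets \<mu> = sets borel" using \<mu> by (simp add: moment_measure_def)
  show ?thesis
  proof (rule integrable_const_bound[of _ B])
    show "AE x in \<mu>. norm (f x) <= B" using moment_measure_AE[OF \<mu>] by eventually_elim (rule B)
    show "f \<in> borel_measurable \<mu>" using f by measurable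
  qed
qed

lemma moment_measure_integrable_continuous:
  fixes f :: "real => real"
  assumes \<mu>: "moment_measure \<mu> c R" and f: "continuous_on UNIV f"
  shows "integrable \<mu> f"
proof -
  have "bounded (f ` {-R..R})"
    by (intro compact_imp_bounded compact_continuous_image continuous_on_subset[OF f]) auto
  then obtain B where "\<forall>y\<in>f ` {-R..R}. norm y <= B" unfolding bounded_iff by blast
  then have "\<And>x. x \<in> {-R..R} ==> norm (f x) <= B" by blast
  then show ?thesis by (rule moment_measure_integrable[OF \<mu> borel_measurable_continuous_onI[OF f]])
qed

lemma moment_measure_mass: "moment_measure \<mu> c R ==> measure \<mu> UNIV = c 0"
proof -
  assume \<mu>: "moment_measure \<mu> c R"
  then have "space \<mu> = UNIV" using sets_eq_imp_space_eq[of \<mu> borel] by (simp add: moment_measure_def)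
  moreover have "(\<integral>x. x ^ 0 \<partial>\<mu>) = c 0" using \<mu> unfolding moment_measure_def by blast
  ultimately show ?thesis by simp
qed

lemma moment_measure_approx:
  assumes \<mu>: "moment_measure \<mu> c R" and f: "continuous_on UNIV f"
    and q: "\<And>x. x \<in> {-R..R} ==> \<bar>f x - (\<Sum>i\<le>n. a i * x ^ i)\<bar> <= e"
  shows "\<bar>(\<integral>x. f x \<partial>\<mu>) - (\<Sum>i\<le>n. a i * c i)\<bar> <= e * c 0"
proof -
  interpret finite_measure \<mu> using \<mu> by (simp add: moment_measure_def)
  have sp: "space \<mu> = UNIV" using \<mu> sets_eq_imp_space_eq[of \<mu> borel] by (simp add: moment_measure_def)
  have int: "integrable \<mu> (\<lambda>x. x ^ i)" for i
    by (rule moment_measure_integrable_continuous[OF \<mu>]) (intro continuous_intros)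
  have "(\<integral>x. (\<Sum>i\<le>n. a i * x ^ i) \<partial>\<mu>) = (\<Sum>i\<le>n. a i * (\<integral>x. x ^ i \<partial>\<mu>))"
    by (subst Bochner_Integration.integral_sum) (auto simp: int)
  also have "\<dots> = (\<Sum>i\<le>n. a i * c i)" using \<mu> by (simp add: moment_measure_def)
  finally have "(\<integral>x. f x \<partial>\<mu>) - (\<Sum>i\<le>n. a i * c i) = (\<integral>x. f x - (\<Sum>i\<le>n. a i * x ^ i) \<partial>\<mu>)"
    by (simp add: moment_measure_integrable_continuous[OF \<mu> f] int)
  then have "\<bar>(\<integral>x. f x \<partial>\<mu>) - (\<Sum>i\<le>n. a i * c i)\<bar> = norm (\<integral>x. f x - (\<Sum>i\<le>n. a i * x ^ i) \<partial>\<mu>)" by simp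
  also have "norm (\<integral>x. f x - (\<Sum>i\<le>n. a i * x ^ i) \<partial>\<mu>) <= (\<integral>x. norm (f x - (\<Sum>i\<le>n. a i * x ^ i)) \<partial>\<mu>)"
    by (rule integral_norm_bound)
  also have "\<dots> <= (\<integral>x. e \<partial>\<mu>)"
  proof (rule integral_mono_AE)
    show "integrable \<mu> (\<lambda>x. norm (f x - (\<Sum>i\<le>n. a i * x ^ i)))"
      by (rule moment_measure_integrable_continuous[OF \<mu>]) (intro continuous_intros f)
    have "AE x in \<mu>. norm (f x - (\<Sum>i\<le>n. a i * x ^ i)) <= e"
      using moment_measure_AE[OF \<mu>] by eventually_elim (simp only: real_norm_def q)
    then show "AE x in \<mu>. norm (f x - (\<Sum>i\<le>n. a i * x ^ i)) <= e" .
  qed simp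
  also have "\<dots> = e * c 0" using moment_measure_mass[OF \<mu>] by (simp add: sp)
  finally show ?thesis .
qed

lemma polynomial_approximation:
  fixes f :: "real => real"
  assumes "continuous_on UNIV f" "e > 0"
  obtains a n where "\<And>x. x \<in> {-R..R} ==> \<bar>f x - (\<Sum>i\<le>n. a i * x ^ i)\<bar> <= e"
proof -
  obtain g where g: "real_polynomial_function g" "\<And>x. x \<in> {-R..R} ==> \<bar>f x - g x\<bar> < e"
    using Stone_Weierstrass_real_polynomial_function[of "{-R..R}" f e] assms continuous_on_subset
    by (metis compact_Icc subset_UNIV)
  obtain a n where "g = (\<lambda>x. \<Sum>i\<le>n. a i * x ^ i)" using g(1) real_polynomial_function_iff_sum by blast
  with g(2) have "\<And>x. x \<in> {-R..R} ==> \<bar>f x - (\<Sum>i\<le>n. a i * x ^ i)\<bar> <= e" by (simp add: less_imp_le)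
  then show thesis by (rule that)
qed

lemma moment_measure_integral_unique:
  fixes f :: "real => real"
  assumes "moment_measure \<mu> c R" "moment_measure \<nu> c R" "continuous_on UNIV f"
  shows "(\<integral>x. f x \<partial>\<mu>) = (\<integral>x. f x \<partial>\<nu>)"
proof (rule ccontr)
  assume ne: "\<not> ?thesis"
  define d where "d = \<bar>(\<integral>x. f x \<partial>\<mu>) - (\<integral>x. f x \<partial>\<nu>)\<bar>"
  have d: "d > 0" using ne by (simp add: d_def)
  have c0: "c 0 >= 0" using moment_measure_mass[OF assms(1)] measure_nonneg by metis
  define e where "e = d / (4 * (c 0 + 1))"
  have e: "e > 0" using d c0 by (simp add: e_def)
  obtain a n where q: "\<And>x. x \<in> {-R..R} ==> \<bar>f x - (\<Sum>i\<le>n. a i * x ^ i)\<bar> <= e"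
    by (rule polynomial_approximation[OF assms(3) e]) blast
  have "d <= 2 * (e * c 0)" using moment_measure_approx[OF assms(1,3) q] moment_measure_approx[OF assms(2,3) q]
    unfolding d_def by linarith
  moreover have "e * c 0 <= d / 4" using d c0 by (simp add: e_def field_simps)
  ultimately show False using d by simp
qed

text \<open>Continuous functions increasing to the indicator of the open positive half-line: the
  passage from integrals of continuous functions to measures of half-lines and to sharp spectral
  projections.\<close>

definition ramp :: "nat => real => real" where
  "ramp n x = max 0 (min 1 (real n * x))"

lemma continuous_ramp: "continuous_on A f ==> continuous_on A (\<lambda>x. ramp n (f x))"
  unfolding ramp_def by (intro continuous_intros)

lemma ramp_bounds: "0 <= ramp n x" "ramp n x <= 1" "1 <= n * x ==> ramp n x = 1" by (auto simp: ramp_def)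

lemma ramp_eq_0: "x <= 0 ==> ramp n x = 0" using mult_nonneg_nonpos[of "real n" x] by (simp add: ramp_def)

lemma ramp_tendsto: "(\<lambda>n. ramp n x) \<longlonglongrightarrow> indicator {0<..} x"
proof (cases "x > 0")
  case True
  obtain N :: nat where N: "1 / x < N" using reals_Archimedean2 by blast
  have "\<forall>\<^sub>F n in sequentially. ramp n x = 1" using eventually_ge_at_top[of N]
  proof eventually_elim
    case (elim n)
    then have "1 / x <= n" using N by linarith
    then have "1 <= n * x" using True by (simp add: divide_le_eq)
    then show ?case by (rule ramp_bounds)
  qed
  then show ?thesis using True by (simp add: tendsto_eventually)
qed (simp add: ramp_eq_0)

text \<open>Both measures live on a common compact interval, where polynomials approximate
  continuous functions; ramps then give equality on the open half-lines, which determine a finite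
  Borel measure.\<close>

lemma moment_measure_unique:
  assumes \<mu>: "moment_measure \<mu> c R" and \<nu>: "moment_measure \<nu> c R'"
  shows "\<mu> = \<nu>"
proof (rule measure_eqI_lessThan)
  show s: "sets \<mu> = sets borel" "sets \<nu> = sets borel" using assms by (auto simp: moment_measure_def)
  interpret m: finite_measure \<mu> using \<mu> by (simp add: moment_measure_def)
  interpret n: finite_measure \<nu> using \<nu> by (simp add: moment_measure_def)
  fix x :: real
  show "emeasure \<mu> {x<..} < \<infinity>" by (simp add: m.emeasure_eq_measure)
  have lim: "(\<lambda>n. \<integral>y. ramp n (y - x) \<partial>\<kappa>) \<longlonglongrightarrow> measure \<kappa> {x<..}"
    if f: "finite_measure \<kappa>" and sb: "sets \<kappa> = sets borel" for \<kappa>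
  proof -
    interpret finite_measure \<kappa> by fact
    have [measurable_cong]: "sets \<kappa> = sets borel" by fact
    have sp: "space \<kappa> = UNIV" using sets_eq_imp_space_eq[OF sb] by simp
    have "(\<lambda>n. \<integral>y. ramp n (y - x) \<partial>\<kappa>) \<longlonglongrightarrow> (\<integral>y. indicator {x<..} y \<partial>\<kappa>)"
    proof (rule integral_dominated_convergence[where w = "\<lambda>_. 1"])
      show "AE y in \<kappa>. (\<lambda>n. ramp n (y - x)) \<longlonglongrightarrow> indicator {x<..} y"
        using ramp_tendsto[of "y - x" for y] by (intro AE_I2) (simp add: indicator_def)
      show "(\<lambda>y. ramp n (y - x)) \<in> borel_measurable \<kappa>" for n unfolding ramp_def by measurable
    qed (auto simp: ramp_bounds)
    then show ?thesis using sp by simp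
  qed
  have "(\<lambda>n. \<integral>y. ramp n (y - x) \<partial>\<mu>) = (\<lambda>n. \<integral>y. ramp n (y - x) \<partial>\<nu>)"
    using moment_measure_integral_unique[OF moment_measure_mono[OF \<mu>, of "max R R'"] moment_measure_mono[OF \<nu>, of "max R R'"]]
    by (simp add: continuous_ramp continuous_on_diff)
  then have "measure \<mu> {x<..} = measure \<nu> {x<..}"
    using LIMSEQ_unique[OF lim[OF m.finite_measure_axioms s(1)]] lim[OF n.finite_measure_axioms s(2)] by simp
  then show "emeasure \<mu> {x<..} = emeasure \<nu> {x<..}" by (simp add: m.emeasure_eq_measure n.emeasure_eq_measure)
qed

section \<open>The moment problem for limits of finitely supported measures\<close>

locale atomic_moments =
  fixes X :: "nat => real set" and p :: "nat => real => real" and c :: "nat => real" and R :: real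
  assumes finX: "\<And>N. finite (X N)" and XR: "\<And>N x. x \<in> X N ==> \<bar>x\<bar> <= R"
    and p_nonneg: "\<And>N x. x \<in> X N ==> 0 <= p N x"
    and moments: "\<And>m. \<forall>\<^sub>F N in sequentially. (\<Sum>x\<in>X N. p N x * x ^ m) = c m"
begin

lemma c0_nonneg: "0 <= c 0"
proof -
  obtain N where "(\<Sum>x\<in>X N. p N x * x ^ 0) = c 0" using eventually_happens[OF moments[of 0]] by auto
  moreover have "0 <= (\<Sum>x\<in>X N. p N x * x ^ 0)" by (intro sum_nonneg) (simp add: p_nonneg)
  ultimately show ?thesis by simp
qed

text \<open>Each moment is eventually attained exactly, so polynomial sums are eventually constant;
  the common compact support lets Weierstrass approximation do the rest.\<close>

lemma atoms_tendsto:
  assumes \<mu>: "moment_measure \<mu> c R" and f: "continuous_on UNIV f"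
  shows "(\<lambda>N. \<Sum>x\<in>X N. p N x * f x) \<longlonglongrightarrow> (\<integral>x. f x \<partial>\<mu>)"
proof (rule tendstoI)
  fix d :: real assume d: "d > 0"
  define e where "e = d / (4 * (c 0 + 1))"
  have e: "e > 0" using d c0_nonneg by (simp add: e_def)
  obtain a n where q: "\<And>x. x \<in> {-R..R} ==> \<bar>f x - (\<Sum>i\<le>n. a i * x ^ i)\<bar> <= e"
    by (rule polynomial_approximation[OF f e]) blast
  have "\<forall>\<^sub>F N in sequentially. \<forall>m\<in>{..n}. (\<Sum>x\<in>X N. p N x * x ^ m) = c m"
    by (rule eventually_ball_finite) (use moments in auto)
  then have "\<forall>\<^sub>F N in sequentially. \<forall>m\<le>n. (\<Sum>x\<in>X N. p N x * x ^ m) = c m" by eventually_elim simp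
  then show "\<forall>\<^sub>F N in sequentially. dist (\<Sum>x\<in>X N. p N x * f x) (\<integral>x. f x \<partial>\<mu>) < d"
  proof eventually_elim
    case (elim N)
    have "(\<Sum>i\<le>n. a i * c i) = (\<Sum>i\<le>n. a i * (\<Sum>x\<in>X N. p N x * x ^ i))" using elim by simp
    also have "\<dots> = (\<Sum>x\<in>X N. p N x * (\<Sum>i\<le>n. a i * x ^ i))"
      unfolding sum_distrib_left by (subst sum.swap) (simp add: mult_ac)
    finally have "\<bar>(\<Sum>x\<in>X N. p N x * f x) - (\<Sum>i\<le>n. a i * c i)\<bar> = \<bar>\<Sum>x\<in>X N. p N x * (f x - (\<Sum>i\<le>n. a i * x ^ i))\<bar>"
      by (simp add: right_diff_distrib sum_subtractf)
    also have "\<bar>\<Sum>x\<in>X N. p N x * (f x - (\<Sum>i\<le>n. a i * x ^ i))\<bar> <= (\<Sum>x\<in>X N. p N x * e)"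
    proof (rule order_trans[OF sum_abs], rule sum_mono)
      fix x assume x: "x \<in> X N"
      then have "x \<in> {-R..R}" using XR[OF x] by (auto simp: abs_le_iff)
      then have "\<bar>f x - (\<Sum>i\<le>n. a i * x ^ i)\<bar> <= e" by (rule q)
      then show "\<bar>p N x * (f x - (\<Sum>i\<le>n. a i * x ^ i))\<bar> <= p N x * e"
        unfolding abs_mult using p_nonneg[OF x] by (intro mult_mono) auto
    qed
    also have "\<dots> = e * c 0" using elim[rule_format, of 0] by (simp add: mult.commute flip: sum_distrib_left)
    finally have "\<bar>(\<Sum>x\<in>X N. p N x * f x) - (\<Sum>i\<le>n. a i * c i)\<bar> <= e * c 0" .
    moreover have "\<bar>(\<integral>x. f x \<partial>\<mu>) - (\<Sum>i\<le>n. a i * c i)\<bar> <= e * c 0" by (rule moment_measure_approx[OF \<mu> f q])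
    moreover have "e * c 0 <= d / 4" using d c0_nonneg by (simp add: e_def field_simps)
    ultimately show ?case using d unfolding dist_real_def by linarith
  qed
qed

text \<open>Compactness: the atomic measures sit in a fixed interval, hence are tight, and a weak
  subsequential limit inherits support and moments. This constructs spectral measures without
  operator theory on the whole line.\<close>

lemma moment_measure_exists: "\<exists>\<mu>. moment_measure \<mu> c R"
\<comment> \<open>Zero mass cannot be normalised to a probability; all weights, hence all moments,
  are then zero. This occurs for the difference of basis vectors when j = k.\<close>
proof (cases "c 0 = 0")
  case True
  have "c m = 0" for m
  proof -
    obtain N where N: "(\<Sum>x\<in>X N. p N x * x ^ 0) = c 0" "(\<Sum>x\<in>X N. p N x * x ^ m) = c m"
      using eventually_happens[OF eventually_conj[OF moments[of 0] moments[of m]]] by auto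
    have "\<forall>x\<in>X N. p N x = 0" using N(1) True by (simp add: sum_nonneg_eq_0_iff finX p_nonneg)
    then show ?thesis using N(2) by simp
  qed
  then have "moment_measure (null_measure borel) c R"
    by (auto simp: moment_measure_def integral_null_measure intro!: finite_measureI)
  then show ?thesis ..
next
  case False
  then have c0: "c 0 > 0" using c0_nonneg by simp
  obtain N0 where N0: "\<And>N. N >= N0 ==> (\<Sum>x\<in>X N. p N x) = c 0"
    using moments[of 0] by (auto simp: eventually_sequentially)
  \<comment> \<open>Starting at N0 makes the total mass exactly c 0, so the normalised weights form
    probabilities for every index.\<close>
  define q where "q N x = p (N + N0) x / c 0" for N x
  define \<mu>s where "\<mu>s N = distr (point_measure (X (N + N0)) (\<lambda>x. ennreal (q N x))) borel (\<lambda>x. x)" for N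
  have q0: "0 <= q N x" if "x \<in> X (N + N0)" for N x using p_nonneg[OF that] c0 by (simp add: q_def)
  have meas: "(\<lambda>x. x) \<in> point_measure (X (N + N0)) (\<lambda>x. ennreal (q N x)) \<rightarrow>\<^sub>M borel" for N
    by (simp add: measurable_def space_point_measure sets_point_measure)
  have int: "(\<integral>x. f x \<partial>\<mu>s N) = (\<Sum>x\<in>X (N + N0). q N x * f x)" if [measurable]: "f \<in> borel_measurable borel" for f :: "real => real" and N
    unfolding \<mu>s_def using meas[of N]
    by (subst integral_distr) (auto simp: lebesgue_integral_point_measure_finite finX q0)
  have pr: "prob_space (\<mu>s N)" for N
  proof -
    have "emeasure (point_measure (X (N + N0)) (\<lambda>x. ennreal (q N x))) (X (N + N0)) = (\<Sum>x\<in>X (N + N0). ennreal (q N x))"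
      by (intro emeasure_point_measure_finite finX) auto
    also have "\<dots> = ennreal (\<Sum>x\<in>X (N + N0). q N x)" by (simp add: sum_ennreal q0)
    also have "(\<Sum>x\<in>X (N + N0). q N x) = 1" using N0[of "N + N0"] c0 by (simp add: q_def flip: sum_divide_distrib)
    finally have "prob_space (point_measure (X (N + N0)) (\<lambda>x. ennreal (q N x)))"
      by (intro prob_spaceI) (simp add: space_point_measure)
    then show ?thesis unfolding \<mu>s_def by (rule prob_space.prob_space_distr[OF _ meas])
  qed
  have rd: "real_distribution (\<mu>s N)" for N
    using pr[of N] by (auto simp: real_distribution_def real_distribution_axioms_def \<mu>s_def)
  have supp: "AE x in \<mu>s N. \<bar>x\<bar> <= R" for N
  proof -
    have "AE x in point_measure (X (N + N0)) (\<lambda>x. ennreal (q N x)). \<bar>x\<bar> <= R"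
      by (rule AE_I2) (simp add: space_point_measure XR)
    then show ?thesis unfolding \<mu>s_def by (subst AE_distr_iff[OF meas]) auto
  qed
  define R' where "R' = max 0 R"
  have tight: "tight \<mu>s" unfolding tight_def
  proof (intro conjI allI impI rd)
    fix e :: real assume e: "e > 0"
    have "measure (\<mu>s N) {- R' - 1<..R'} = 1" for N
    proof -
      interpret real_distribution "\<mu>s N" by (rule rd)
      have "AE x in \<mu>s N. x \<in> {- R' - 1<..R'}" using supp[of N] by eventually_elim (auto simp: R'_def)
      then show ?thesis by (intro prob_eq_1[THEN iffD2]) auto
    qed
    then show "\<exists>a b. a < b \<and> (\<forall>n. 1 - e < measure (\<mu>s n) {a<..b})"
      using e by (intro exI[of _ "- R' - 1"] exI[of _ R']) (auto simp: R'_def)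
  qed
  obtain r \<nu> where r: "strict_mono (r :: nat => nat)" and \<nu>: "real_distribution \<nu>" "weak_conv_m (\<mu>s \<circ> id \<circ> r) \<nu>"
    using tight_imp_convergent_subsubsequence[OF tight strict_mono_id] by blast
  interpret V: real_distribution \<nu> by (rule \<nu>)
  have conv: "(\<lambda>n. \<integral>x. f x \<partial>\<mu>s (r n)) \<longlonglongrightarrow> (\<integral>x. f x \<partial>\<nu>)"
    if f: "continuous_on UNIV f" "\<And>x. \<bar>f x\<bar> <= B" for f :: "real => real" and B
  proof -
    have "(\<lambda>n. integral\<^sup>L ((\<mu>s \<circ> id \<circ> r) n) f) \<longlonglongrightarrow> integral\<^sup>L \<nu> f"
      by (rule weak_conv_imp_integral_bdd_continuous_conv[OF _ \<nu>, of f B])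
         (use f rd in \<open>auto simp: continuous_on_eq_continuous_at\<close>)
    then show ?thesis by simp
  qed
  have supp\<nu>: "AE x in \<nu>. \<bar>x\<bar> <= R"
  proof -
    \<comment> \<open>A continuous function that vanishes exactly on [-R, R]; its zero integral
      passes to the limit and confines the support there.\<close>
    define h where "h x = ramp 1 (\<bar>x\<bar> - R)" for x
    have h: "continuous_on UNIV h" unfolding h_def by (intro continuous_ramp continuous_intros)
    have hm[measurable]: "h \<in> borel_measurable borel" by (rule borel_measurable_continuous_onI[OF h])
    have "(\<integral>x. h x \<partial>\<mu>s N) = 0" for N
      unfolding int[OF hm] by (intro sum.neutral) (simp add: h_def ramp_eq_0 XR)
    then have "(\<lambda>n. \<integral>x. h x \<partial>\<mu>s (r n)) \<longlonglongrightarrow> 0" by simp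
    moreover have "(\<lambda>n. \<integral>x. h x \<partial>\<mu>s (r n)) \<longlonglongrightarrow> (\<integral>x. h x \<partial>\<nu>)"
      by (rule conv[OF h, of 1]) (simp add: h_def ramp_bounds)
    ultimately have "(\<integral>x. h x \<partial>\<nu>) = 0" using LIMSEQ_unique by blast
    moreover have "integrable \<nu> h" by (rule V.integrable_const_bound[of _ 1]) (auto simp: h_def ramp_bounds hm[unfolded h_def])
    ultimately have "AE x in \<nu>. h x = 0"
      by (subst (asm) integral_nonneg_eq_0_iff_AE) (auto simp: h_def ramp_bounds)
    then show ?thesis by eventually_elim (auto simp: h_def ramp_def max_def min_def split: if_splits)
  qed
  have mom: "(\<integral>x. x ^ m \<partial>\<nu>) = c m / c 0" for m
  proof -
    \<comment> \<open>Weak convergence tests bounded functions only, so the power is truncated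
      outside the support.\<close>
    define f :: "real => real" where "f x = (max (-R') (min R' x)) ^ m" for x
    have fc: "continuous_on UNIV f" unfolding f_def by (intro continuous_intros)
    have fm[measurable]: "f \<in> borel_measurable borel" by (rule borel_measurable_continuous_onI[OF fc])
    have fb: "\<bar>f x\<bar> <= R' ^ m" for x unfolding f_def power_abs by (intro power_mono) (auto simp: R'_def)
    have fe: "f x = x ^ m" if "\<bar>x\<bar> <= R" for x
      using that by (auto simp: f_def R'_def max_def min_def abs_le_iff)
    have "\<forall>\<^sub>F n in sequentially. (\<Sum>x\<in>X (r n + N0). p (r n + N0) x * x ^ m) = c m"
    proof (rule eventually_compose_filterlim[OF moments])
      show "filterlim (\<lambda>n. r n + N0) sequentially sequentially"
        using filterlim_subseq[OF r] by (intro filterlim_compose[OF filterlim_add_const_nat_at_top])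
    qed
    then have "\<forall>\<^sub>F n in sequentially. (\<integral>x. f x \<partial>\<mu>s (r n)) = c m / c 0"
    proof eventually_elim
      case (elim n)
      have "(\<integral>x. f x \<partial>\<mu>s (r n)) = (\<Sum>x\<in>X (r n + N0). p (r n + N0) x * x ^ m / c 0)"
        unfolding int[OF fm] by (intro sum.cong) (auto simp: q_def fe XR)
      also have "\<dots> = c m / c 0" using elim by (simp flip: sum_divide_distrib)
      finally show ?case .
    qed
    then have "(\<lambda>n. \<integral>x. f x \<partial>\<mu>s (r n)) \<longlonglongrightarrow> c m / c 0" by (rule tendsto_eventually)
    with conv[OF fc fb] have "(\<integral>x. f x \<partial>\<nu>) = c m / c 0" by (rule LIMSEQ_unique)
    moreover have "(\<integral>x. f x \<partial>\<nu>) = (\<integral>x. x ^ m \<partial>\<nu>)"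
      using supp\<nu> by (intro integral_cong_AE) (auto elim!: eventually_mono simp: fe)
    ultimately show ?thesis by simp
  qed
  have "moment_measure (density \<nu> (\<lambda>_. ennreal (c 0))) c R" unfolding moment_measure_def
  proof (intro conjI allI)
    show "finite_measure (density \<nu> (\<lambda>_. ennreal (c 0)))"
      by (rule finite_measureI) (simp add: emeasure_density_const V.emeasure_eq_measure ennreal_mult_eq_top_iff)
    have "emeasure \<nu> (- {-R..R}) = 0"
    proof (rule AE_iff_measurable[THEN iffD1, OF _ _ supp\<nu>])
      show "{x \<in> space \<nu>. \<not> \<bar>x\<bar> <= R} = - {-R..R}" by (auto simp: abs_le_iff)
    qed simp
    then show "emeasure (density \<nu> (\<lambda>_. ennreal (c 0))) (- {-R..R}) = 0" by (simp add: emeasure_density_const)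
    show "(\<integral>x. x ^ m \<partial>density \<nu> (\<lambda>_. ennreal (c 0))) = c m" for m
      using c0 mom[of m] by (subst integral_density) auto
  qed simp
  then show ?thesis ..
qed

end

lemma spectral_measure_eq:
  assumes "moment_measure \<mu> (\<lambda>m. l2_inner \<phi> ((H ^^ m) \<phi>)) R"
  shows "spectral_measure H \<phi> = \<mu>" unfolding spectral_measure_def
proof (rule the_equality)
  show "finite_measure \<mu> \<and> sets \<mu> = sets borel \<and> (\<exists>R. emeasure \<mu> (- {-R..R}) = 0) \<and>
      (\<forall>m::nat. (\<integral>x. x ^ m \<partial>\<mu>) = l2_inner \<phi> ((H ^^ m) \<phi>))" using assms by (auto simp: moment_measure_def)
  fix \<nu> assume "finite_measure \<nu> \<and> sets \<nu> = sets borel \<and> (\<exists>R. emeasure \<nu> (- {-R..R}) = 0) \<and>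
      (\<forall>m::nat. (\<integral>x. x ^ m \<partial>\<nu>) = l2_inner \<phi> ((H ^^ m) \<phi>))"
  then obtain R' where "moment_measure \<nu> (\<lambda>m. l2_inner \<phi> ((H ^^ m) \<phi>)) R'"
    unfolding moment_measure_def by blast
  then show "\<nu> = \<mu>" using assms by (rule moment_measure_unique)
qed

context random_letters
begin

section \<open>Centred boxes and matrix elements on the whole line\<close>

lemma regular_bound:
  obtains K0 where "\<And>\<omega> n. regular \<omega> ==> \<bar>v n \<omega>\<bar> <= K0" "\<And>\<omega> n. regular \<omega> ==> \<bar>w n \<omega>\<bar> <= K0"
proof
  have Sv: "\<bar>a\<bar> <= (\<Sum>a\<in>Sv. \<bar>a\<bar>) + (\<Sum>b\<in>Sw. \<bar>b\<bar>)" if "a \<in> Sv" for a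
    using member_le_sum[OF that, of abs] fin_Sv sum_nonneg[of Sw abs, OF abs_ge_zero] by linarith
  have Sw: "\<bar>b\<bar> <= (\<Sum>a\<in>Sv. \<bar>a\<bar>) + (\<Sum>b\<in>Sw. \<bar>b\<bar>)" if "b \<in> Sw" for b
    using member_le_sum[OF that, of abs] fin_Sw sum_nonneg[of Sv abs, OF abs_ge_zero] by linarith
  show "\<bar>v n \<omega>\<bar> <= (\<Sum>a\<in>Sv. \<bar>a\<bar>) + (\<Sum>b\<in>Sw. \<bar>b\<bar>)" if "regular \<omega>" for \<omega> n
    using that by (intro Sv) (simp add: regular_def)
  show "\<bar>w n \<omega>\<bar> <= (\<Sum>a\<in>Sv. \<bar>a\<bar>) + (\<Sum>b\<in>Sw. \<bar>b\<bar>)" if "regular \<omega>" for \<omega> n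
    using that by (intro Sw) (simp add: regular_def)
qed

lemma box_vec_maximum:
  assumes reg: "regular \<omega>" and e: "e \<in> box_eigs \<omega> b n"
  obtains i where "b <= i" "i < b + int n" "box_vec \<omega> b n e i \<noteq> 0" "\<And>k. \<bar>box_vec \<omega> b n e k\<bar> <= \<bar>box_vec \<omega> b n e i\<bar>"
proof -
  define V W where "V = (\<lambda>k. v (b + int k) \<omega>)" and "W = (\<lambda>k. w (b + int k) \<omega>)"
  interpret jacobi_box V W by unfold_locales (simp add: W_def regular_nz[OF reg])
  have e': "e \<in> jeigs V W n" using e by (simp add: box_eigs_def V_def W_def)
  define f where "f k = \<bar>box_vec \<omega> b n e k\<bar>" for k
  have "\<exists>k<n. jvec V W n e k \<noteq> 0"
  proof (rule ccontr)
    assume "\<not> ?thesis"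
    then have "(\<Sum>k<n. jvec V W n e k * jvec V W n e k) = 0" by simp
    then show False using jvec_orthonormal[OF e' e'] by simp
  qed
  then obtain k0 where k0: "k0 < n" "jvec V W n e k0 \<noteq> 0" by blast
  then have f0: "f (b + int k0) > 0" by (simp add: f_def box_vec_def V_def W_def)
  have fin: "finite (f ` {b..<b + int n})" and ne: "f ` {b..<b + int n} \<noteq> {}" using k0 by auto
  have "Max (f ` {b..<b + int n}) \<in> f ` {b..<b + int n}" by (rule Max_in[OF fin ne])
  then obtain i where i: "i \<in> {b..<b + int n}" "f i = Max (f ` {b..<b + int n})" by auto
  have le: "f k <= f i" for k
  proof (cases "k \<in> {b..<b + int n}")
    case True
    then show ?thesis unfolding i(2) using fin by (intro Max_ge) auto
  next
    case False
    then have "f k = 0" by (auto simp: f_def box_vec_def)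
    then show ?thesis by (simp add: f_def)
  qed
  have "f i > 0" using le[of "b + int k0"] f0 by linarith
  then show thesis using i(1) le by (intro that[of i]) (auto simp: f_def)
qed

text \<open>Evaluate the eigenvalue equation at a site where the eigenvector is largest; the other
  entries are then bounded by the value there. The uniform bound supplies the common support of the
  box spectral measures.\<close>

lemma box_eigs_bound:
  assumes reg: "regular \<omega>" and e: "e \<in> box_eigs \<omega> b n"
    and K0: "\<And>n. \<bar>v n \<omega>\<bar> <= K0" "\<And>n. \<bar>w n \<omega>\<bar> <= K0"
  shows "\<bar>e\<bar> <= 3 * K0"
proof (rule box_vec_maximum[OF reg e])
  fix i assume i: "b <= i" "i < b + int n" "box_vec \<omega> b n e i \<noteq> 0" and le: "\<And>k. \<bar>box_vec \<omega> b n e k\<bar> <= \<bar>box_vec \<omega> b n e i\<bar>"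
  define y where "y = box_vec \<omega> b n e"
  have K00: "K0 >= 0" using K0(1)[of 0] by linarith
  have b: "\<bar>v i \<omega> * y i\<bar> <= K0 * \<bar>y i\<bar>" "\<bar>w (i + 1) \<omega> * y (i + 1)\<bar> <= K0 * \<bar>y i\<bar>" "\<bar>w i \<omega> * y (i - 1)\<bar> <= K0 * \<bar>y i\<bar>"
    unfolding abs_mult using K0 le K00 by (auto intro!: mult_mono simp: y_def)
  have "e * y i = v i \<omega> * y i - w (i + 1) \<omega> * y (i + 1) - w i \<omega> * y (i - 1)"
    using box_vec_rec[OF reg e i(1,2)] by (simp add: y_def algebra_simps)
  then have "\<bar>e * y i\<bar> <= 3 * K0 * \<bar>y i\<bar>" using b by linarith
  then have "\<bar>e\<bar> * \<bar>y i\<bar> <= 3 * K0 * \<bar>y i\<bar>" by (simp add: abs_mult)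
  then show ?thesis using i(3) by (simp add: y_def)
qed

lemma jacobi_power_support:
  assumes "\<And>i. int L < \<bar>i\<bar> ==> \<phi> i = 0" "int L + int m < \<bar>i\<bar>"
  shows "(jacobi_op v w \<omega> ^^ m) \<phi> i = 0" using assms(2)
proof (induction m arbitrary: i)
  case 0
  then show ?case using assms(1) by simp
next
  case (Suc m)
  have "(jacobi_op v w \<omega> ^^ m) \<phi> (i + 1) = 0" "(jacobi_op v w \<omega> ^^ m) \<phi> (i - 1) = 0" "(jacobi_op v w \<omega> ^^ m) \<phi> i = 0"
    using Suc.prems by (auto intro!: Suc.IH)
  then show ?case by (simp add: jacobi_op_def[of v w \<omega> "(jacobi_op v w \<omega> ^^ m) \<phi>"])
qed

definition cbox_eigs :: "'a => nat => real set" where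
  "cbox_eigs \<omega> N = box_eigs \<omega> (- int N) (2 * N + 1)"

definition cbox_vec :: "'a => nat => real => int => real" where
  "cbox_vec \<omega> N e = box_vec \<omega> (- int N) (2 * N + 1) e"

definition cbox_coeff :: "'a => nat => (int => real) => real => real" where
  "cbox_coeff \<omega> N \<phi> e = (\<Sum>k<2 * N + 1. cbox_vec \<omega> N e (- int N + int k) * \<phi> (- int N + int k))"

lemma sum_cbox:
  fixes f :: "int => real"
  assumes "\<And>i. int N < \<bar>i\<bar> ==> f i = 0"
  shows "(\<Sum>k<2 * N + 1. f (- int N + int k)) = (\<Sum>i\<in>{- int N..int N}. f i)"
  by (rule sum.reindex_bij_witness[where i = "\<lambda>i. nat (i + int N)" and j = "\<lambda>k. - int N + int k"]) auto

lemma cbox_coeff_basis: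
  assumes "\<bar>j\<bar> <= int N"
  shows "cbox_coeff \<omega> N (basis_vec j) e = cbox_vec \<omega> N e j"
proof -
  have "cbox_coeff \<omega> N (basis_vec j) e = (\<Sum>i\<in>{- int N..int N}. cbox_vec \<omega> N e i * basis_vec j i)"
    unfolding cbox_coeff_def using assms by (intro sum_cbox) (auto simp: basis_vec_def)
  also have "\<dots> = cbox_vec \<omega> N e j"
    using assms by (simp add: basis_vec_def if_distrib[of "(*) _"] cong: if_cong) (auto simp: abs_le_iff)
  finally show ?thesis .
qed

text \<open>Box coefficients see only the sites from -N to N. For vectors supported there, the full
  operator agrees on these sites with the Dirichlet box operator, although it may leak to the two
  outer neighbours.\<close>

lemma cbox_parseval:
  assumes reg: "regular \<omega>" and \<phi>: "\<And>i. int N < \<bar>i\<bar> ==> \<phi> i = 0"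
  shows "finite (cbox_eigs \<omega> N)" "l2_inner \<phi> \<psi> = (\<Sum>e\<in>cbox_eigs \<omega> N. cbox_coeff \<omega> N \<phi> e * cbox_coeff \<omega> N \<psi> e)"
    "(\<And>i. int N < \<bar>i\<bar> ==> \<psi> i = 0) ==> e \<in> cbox_eigs \<omega> N ==>
      cbox_coeff \<omega> N (jacobi_op v w \<omega> \<psi>) e = e * cbox_coeff \<omega> N \<psi> e"
proof -
  define V W where "V = (\<lambda>k. v (- int N + int k) \<omega>)" and "W = (\<lambda>k. w (- int N + int k) \<omega>)"
  define n where "n = 2 * N + 1"
  interpret jacobi_box V W by unfold_locales (simp add: W_def regular_nz[OF reg])
  have eigs: "cbox_eigs \<omega> N = jeigs V W n" by (simp add: cbox_eigs_def box_eigs_def V_def W_def n_def)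
  then show "finite (cbox_eigs \<omega> N)" using finite_jeigs by simp
  have vec: "cbox_vec \<omega> N e (- int N + int k) = jvec V W n e k" if "k < n" for e k
    using that by (simp add: cbox_vec_def box_vec_def V_def W_def n_def)
  have coeff: "cbox_coeff \<omega> N f e = jcoeff n (\<lambda>k. f (- int N + int k)) e" for f e
    unfolding cbox_coeff_def jcoeff_def n_def[symmetric] by (intro sum.cong refl arg_cong2[where f = "(*)"] vec) simp
  have "l2_inner \<phi> \<psi> = (\<Sum>\<^sub>\<infinity>i\<in>{- int N..int N}. \<phi> i * \<psi> i)"
    unfolding l2_inner_def by (intro infsum_cong_neutral) (auto intro!: \<phi>)
  also have "\<dots> = (\<Sum>i\<in>{- int N..int N}. \<phi> i * \<psi> i)" by simp
  also have "\<dots> = (\<Sum>k<n. \<phi> (- int N + int k) * \<psi> (- int N + int k))"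
    unfolding n_def by (subst sum_cbox[symmetric]) (simp_all add: \<phi>)
  also have "\<dots> = (\<Sum>e\<in>cbox_eigs \<omega> N. cbox_coeff \<omega> N \<phi> e * cbox_coeff \<omega> N \<psi> e)"
    unfolding coeff eigs by (rule jparseval)
  finally show "l2_inner \<phi> \<psi> = (\<Sum>e\<in>cbox_eigs \<omega> N. cbox_coeff \<omega> N \<phi> e * cbox_coeff \<omega> N \<psi> e)" .
  assume \<psi>: "\<And>i. int N < \<bar>i\<bar> ==> \<psi> i = 0" and e: "e \<in> cbox_eigs \<omega> N"
  have "jcoeff n (\<lambda>k. jacobi_op v w \<omega> \<psi> (- int N + int k)) e = jcoeff n (jop V W n (\<lambda>k. \<psi> (- int N + int k))) e"
    unfolding jcoeff_def
  proof (intro sum.cong refl arg_cong2[where f = "(*)"])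
    fix k assume "k \<in> {..<n}"
    then have k: "k < n" by simp
    have 1: "W (Suc k) * \<psi> (- int N + int (Suc k)) = 0" if "\<not> Suc k < n" using that k by (simp add: \<psi> n_def)
    have 2: "\<psi> (- int N + int k - 1) = (if k > 0 then \<psi> (- int N + int (k - 1)) else 0)"
    proof (cases k)
      case (Suc l)
      then have "- int N + int k - 1 = - int N + int (k - 1)" by simp
      then show ?thesis using Suc by (simp only: zero_less_Suc if_True)
    qed (simp add: \<psi>)
    have 3: "w (- int N + int k) \<omega> = W k" "v (- int N + int k) \<omega> = V k" for k by (simp_all add: W_def V_def)
    have 4: "- int N + int k + 1 = - int N + int (Suc k)" by simp
    show "jacobi_op v w \<omega> \<psi> (- int N + int k) = jop V W n (\<lambda>k. \<psi> (- int N + int k)) k"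
      unfolding jacobi_op_def jop_def 4 2 3 using 1 by auto
  qed
  then show "cbox_coeff \<omega> N (jacobi_op v w \<omega> \<psi>) e = e * cbox_coeff \<omega> N \<psi> e"
    unfolding coeff using jcoeff_jop[of e n "\<lambda>k. \<psi> (- int N + int k)"] e eigs by simp
qed

text \<open>Finite propagation: the first m applications of the operator to a vector supported in
  [-L, L] cannot notice the ends of a box of radius at least L + m. Hence box moments are eventually
  exact.\<close>

lemma cbox_moments:
  assumes reg: "regular \<omega>" and \<phi>: "\<And>i. int L < \<bar>i\<bar> ==> \<phi> i = 0" and N: "L + m <= N"
  shows "(\<Sum>e\<in>cbox_eigs \<omega> N. (cbox_coeff \<omega> N \<phi> e)\<^sup>2 * e ^ m) = l2_inner \<phi> ((jacobi_op v w \<omega> ^^ m) \<phi>)"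
proof -
  have supp: "\<phi> i = 0" if "int N < \<bar>i\<bar>" for i using that N by (intro \<phi>) simp
  have "cbox_coeff \<omega> N ((jacobi_op v w \<omega> ^^ k) \<phi>) e = e ^ k * cbox_coeff \<omega> N \<phi> e"
    if e: "e \<in> cbox_eigs \<omega> N" and k: "k <= m" for e k using k
  proof (induction k)
    case (Suc k)
    have "(jacobi_op v w \<omega> ^^ k) \<phi> i = 0" if "int N < \<bar>i\<bar>" for i
      using that N Suc.prems by (intro jacobi_power_support[OF \<phi>]) auto
    from cbox_parseval(3)[OF reg supp this e] Suc show ?case by simp
  qed simp
  then show ?thesis by (simp add: cbox_parseval(2)[OF reg supp] power2_eq_square mult_ac)
qed

lemma cbox_vec_complete:
  assumes reg: "regular \<omega>" and "\<bar>j\<bar> <= int N"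
  shows "(\<Sum>e\<in>cbox_eigs \<omega> N. (cbox_vec \<omega> N e j)\<^sup>2) = 1"
proof -
  have "l2_inner (basis_vec j) (basis_vec j) = (\<Sum>\<^sub>\<infinity>i\<in>{j}. 1)"
    unfolding l2_inner_def by (intro infsum_cong_neutral) (auto simp: basis_vec_def)
  then have "l2_inner (basis_vec j) (basis_vec j) = 1" by simp
  then show ?thesis using cbox_parseval(2)[OF reg, of N "basis_vec j" "basis_vec j"] assms(2)
    by (simp add: cbox_coeff_basis power2_eq_square) (auto simp: basis_vec_def)
qed

text \<open>Arithmetic-geometric mean inequality and completeness at the two sites. This trivial
  bound makes summing over all eigenfunctions of a box affordable.\<close>

lemma sum_cbox_vec_le_1:
  assumes reg: "regular \<omega>" and "\<bar>j\<bar> <= int N" "\<bar>k\<bar> <= int N" "F \<subseteq> cbox_eigs \<omega> N"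
  shows "(\<Sum>e\<in>F. \<bar>cbox_vec \<omega> N e j * cbox_vec \<omega> N e k\<bar>) <= 1"
proof -
  have fin: "finite (cbox_eigs \<omega> N)" using cbox_parseval(1)[OF reg, of N "\<lambda>_. 0"] by simp
  have "(\<Sum>e\<in>F. \<bar>cbox_vec \<omega> N e j * cbox_vec \<omega> N e k\<bar>) <= (\<Sum>e\<in>cbox_eigs \<omega> N. \<bar>cbox_vec \<omega> N e j * cbox_vec \<omega> N e k\<bar>)"
    using fin assms(4) by (intro sum_mono2) auto
  also have "\<dots> <= (\<Sum>e\<in>cbox_eigs \<omega> N. ((cbox_vec \<omega> N e j)\<^sup>2 + (cbox_vec \<omega> N e k)\<^sup>2) / 2)"
  proof (rule sum_mono)
    fix e
    have "2 * (\<bar>x\<bar> * \<bar>y\<bar>) <= x\<^sup>2 + y\<^sup>2" for x y :: real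
      using sum_squares_bound[of "\<bar>x\<bar>" "\<bar>y\<bar>"] by (simp add: mult.assoc)
    from this[of "cbox_vec \<omega> N e j" "cbox_vec \<omega> N e k"] show "\<bar>cbox_vec \<omega> N e j * cbox_vec \<omega> N e k\<bar> <= ((cbox_vec \<omega> N e j)\<^sup>2 + (cbox_vec \<omega> N e k)\<^sup>2) / 2"
      by (simp add: abs_mult field_simps)
  qed
  also have "\<dots> = 1" using cbox_vec_complete[OF reg assms(2)] cbox_vec_complete[OF reg assms(3)]
    by (simp add: sum.distrib flip: sum_divide_distrib)
  finally show ?thesis .
qed

text \<open>Spectral measures are weak limits of box spectral measures, for which the evolution has
  modulus at most 1 on each eigenvalue. The margin \<delta> is needed since weak limits require
  continuous functions, which cannot be cut off exactly at a and b; the bound is uniform in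
  t.\<close>

lemma evol_proj_elem_le:
  assumes reg: "regular \<omega>" and \<delta>: "\<delta> > 0"
    and g: "\<And>N. N >= N0 ==>
      (\<Sum>e\<in>cbox_eigs \<omega> N \<inter> {a - \<delta><..<b + \<delta>}. \<bar>cbox_vec \<omega> N e j * cbox_vec \<omega> N e k\<bar>) <= g"
  shows "cmod (evol_proj_elem (jacobi_op v w \<omega>) {a..b} t j k) <= g"
proof -
  obtain K0 where K0: "\<And>n. \<bar>v n \<omega>\<bar> <= K0" "\<And>n. \<bar>w n \<omega>\<bar> <= K0" by (rule regular_bound) (use reg in blast)
  define L where "L = nat (max \<bar>j\<bar> \<bar>k\<bar>)"
  have L: "\<bar>j\<bar> <= int L" "\<bar>k\<bar> <= int L" by (auto simp: L_def)
  have fin: "finite (cbox_eigs \<omega> N)" for N using cbox_parseval(1)[OF reg, of N "\<lambda>_. 0"] by simp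
  define H where "H = jacobi_op v w \<omega>"
  define \<phi> where "\<phi> s = (\<lambda>n. basis_vec j n + s * basis_vec k n)" for s :: real
  have mm: "atomic_moments (cbox_eigs \<omega>) (\<lambda>N e. (cbox_coeff \<omega> N (\<phi> s) e)\<^sup>2) (\<lambda>m. l2_inner (\<phi> s) ((H ^^ m) (\<phi> s))) (3 * K0)" for s
  proof
    show "\<bar>x\<bar> <= 3 * K0" if "x \<in> cbox_eigs \<omega> N" for N x
      using box_eigs_bound[OF reg that[unfolded cbox_eigs_def] K0] .
    show "\<forall>\<^sub>F N in sequentially. (\<Sum>e\<in>cbox_eigs \<omega> N. (cbox_coeff \<omega> N (\<phi> s) e)\<^sup>2 * e ^ m) = l2_inner (\<phi> s) ((H ^^ m) (\<phi> s))" for m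
      using eventually_ge_at_top[of "L + m"]
    proof eventually_elim
      case (elim N)
      show ?case unfolding H_def
        by (rule cbox_moments[OF reg _ elim]) (use L in \<open>auto simp: \<phi>_def basis_vec_def\<close>)
    qed
  qed (use fin in auto)
  define \<mu> where "\<mu> s = spectral_measure H (\<phi> s)" for s
  have \<mu>: "moment_measure (\<mu> s) (\<lambda>m. l2_inner (\<phi> s) ((H ^^ m) (\<phi> s))) (3 * K0)" for s
    using atomic_moments.moment_measure_exists[OF mm[of s]] spectral_measure_eq unfolding \<mu>_def by metis
  have coeff: "cbox_coeff \<omega> N (\<phi> s) e = cbox_vec \<omega> N e j + s * cbox_vec \<omega> N e k" if "N >= L" for N s e
  proof -
    have "cbox_coeff \<omega> N (\<phi> s) e = cbox_coeff \<omega> N (basis_vec j) e + s * cbox_coeff \<omega> N (basis_vec k) e"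
      by (simp add: cbox_coeff_def \<phi>_def sum.distrib sum_distrib_left algebra_simps)
    then show ?thesis using L that by (simp add: cbox_coeff_basis)
  qed
  define F where "F x = indicator {a..b} x * cis (- t * x)" for x :: real
  define z where "z = (\<integral>x. F x \<partial>\<mu> 1) - (\<integral>x. F x \<partial>\<mu> (- 1))"
  have ev_z: "evol_proj_elem H {a..b} t j k = z / 4"
    by (simp add: evol_proj_elem_def fcalc_elem_def z_def F_def \<mu>_def \<phi>_def)
  \<comment> \<open>Rotating the phase of z makes it equal to its modulus, so real test functions
    suffice.\<close>
  define \<theta> where "\<theta> = - Arg z"
  define q where "q x = cos (\<theta> - t * x)" for x
  define h where "h x = indicator {a..b} x * q x" for x
  \<comment> \<open>Continuous approximations that agree with q on [a, b] and vanish at distance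
    \<delta> from it as soon as n \<delta> >= 1.\<close>
  define hn where "hn n x = (1 - ramp n (a - x)) * (1 - ramp n (x - b)) * q x" for n x
  have hn_cont: "continuous_on UNIV (hn n)" for n
    unfolding hn_def q_def by (intro continuous_intros continuous_ramp)
  have hn_le: "\<bar>hn n x\<bar> <= 1" for n x
  proof -
    have "\<bar>1 - ramp n y\<bar> <= 1" for y using ramp_bounds(1,2)[of n y] by simp
    then show ?thesis unfolding hn_def abs_mult q_def by (intro mult_le_one) (auto intro!: mult_nonneg_nonneg)
  qed
  have hn_lim: "(\<lambda>n. hn n x) \<longlonglongrightarrow> h x" for x
  proof -
    have "(\<lambda>n. hn n x) \<longlonglongrightarrow> (1 - indicator {0<..} (a - x)) * (1 - indicator {0<..} (x - b)) * q x"
      unfolding hn_def by (intro tendsto_intros ramp_tendsto)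
    moreover have "(1 - indicator {0<..} (a - x)) * (1 - indicator {0<..} (x - b)) * q x = h x"
      by (auto simp: h_def indicator_def)
    ultimately show ?thesis by simp
  qed
  have int_lim: "(\<lambda>n. \<integral>x. hn n x \<partial>\<mu> s) \<longlonglongrightarrow> (\<integral>x. h x \<partial>\<mu> s)" for s
  proof (rule integral_dominated_convergence[where w = "\<lambda>_. 1"])
    interpret finite_measure "\<mu> s" using \<mu> by (simp add: moment_measure_def)
    have [measurable_cong]: "sets (\<mu> s) = sets borel" using \<mu> by (simp add: moment_measure_def)
    have [measurable]: "hn n \<in> borel_measurable borel" for n by (rule borel_measurable_continuous_onI[OF hn_cont])
    show "hn n \<in> borel_measurable (\<mu> s)" for n by measurable
    show "h \<in> borel_measurable (\<mu> s)" unfolding h_def q_def by measurable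
    show "integrable (\<mu> s) (\<lambda>_. 1)" by simp
  qed (use hn_lim hn_le in auto)
  have Re_h: "Re (cis \<theta> * (\<integral>x. F x \<partial>\<mu> s)) = (\<integral>x. h x \<partial>\<mu> s)" for s
  proof -
    have "integrable (\<mu> s) F"
    proof (rule moment_measure_integrable[OF \<mu>])
      have [measurable]: "(\<lambda>x. cis (- t * x)) \<in> borel_measurable borel"
        by (intro borel_measurable_continuous_onI continuous_intros)
      show "F \<in> borel_measurable borel" unfolding F_def by measurable
      show "norm (F x) <= 1" for x by (simp add: F_def indicator_def)
    qed
    then have "Re (\<integral>x. cis \<theta> * F x \<partial>\<mu> s) = (\<integral>x. Re (cis \<theta> * F x) \<partial>\<mu> s)" by (intro integral_Re[symmetric]) simp
    moreover have "Re (cis \<theta> * F x) = h x" for x by (auto simp: F_def h_def q_def indicator_def cos_diff)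
    ultimately show ?thesis by simp
  qed
  have "cis \<theta> * z = of_real (cmod z)"
    using rcis_cmod_Arg[of z] unfolding rcis_def \<theta>_def by (metis (no_types, opaque_lifting) cis_mult cis_zero add.left_inverse mult.left_commute mult.right_neutral)
  then have "cmod z = Re (cis \<theta> * z)" by simp
  also have "\<dots> = (\<integral>x. h x \<partial>\<mu> 1) - (\<integral>x. h x \<partial>\<mu> (- 1))"
    unfolding z_def right_diff_distrib minus_complex.sel Re_h ..
  finally have lim: "(\<lambda>n. (\<integral>x. hn n x \<partial>\<mu> 1) - (\<integral>x. hn n x \<partial>\<mu> (- 1))) \<longlonglongrightarrow> cmod z"
    using tendsto_diff[OF int_lim[of 1] int_lim[of "- 1"]] by simp
  obtain n0 :: nat where n0: "1 / \<delta> < n0" using reals_Archimedean2 by blast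
  have "(\<integral>x. hn n x \<partial>\<mu> 1) - (\<integral>x. hn n x \<partial>\<mu> (- 1)) <= 4 * g" if n: "n >= n0" for n
  proof (rule LIMSEQ_le_const2)
    show "(\<lambda>N. (\<Sum>e\<in>cbox_eigs \<omega> N. (cbox_coeff \<omega> N (\<phi> 1) e)\<^sup>2 * hn n e) - (\<Sum>e\<in>cbox_eigs \<omega> N. (cbox_coeff \<omega> N (\<phi> (- 1)) e)\<^sup>2 * hn n e))
        \<longlonglongrightarrow> (\<integral>x. hn n x \<partial>\<mu> 1) - (\<integral>x. hn n x \<partial>\<mu> (- 1))"
      by (intro tendsto_diff atomic_moments.atoms_tendsto[OF mm \<mu> hn_cont])
    have nd: "1 <= n * \<delta>"
    proof -
      have "1 / \<delta> <= n" using n0 n by linarith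
      then show ?thesis using \<delta> by (simp add: divide_le_eq)
    qed
    have out: "hn n e = 0" if "e \<notin> {a - \<delta><..<b + \<delta>}" for e
    proof -
      have "\<delta> <= a - e \<or> \<delta> <= e - b" using that by auto
      then have "1 <= n * (a - e) \<or> 1 <= n * (e - b)"
        using nd mult_left_mono[of \<delta> "a - e" "real n"] mult_left_mono[of \<delta> "e - b" "real n"] by fastforce
      then show ?thesis using ramp_bounds(3) unfolding hn_def by fastforce
    qed
    show "\<exists>N1. \<forall>N\<ge>N1. (\<Sum>e\<in>cbox_eigs \<omega> N. (cbox_coeff \<omega> N (\<phi> 1) e)\<^sup>2 * hn n e) - (\<Sum>e\<in>cbox_eigs \<omega> N. (cbox_coeff \<omega> N (\<phi> (- 1)) e)\<^sup>2 * hn n e) <= 4 * g"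
    proof (intro exI[of _ "max N0 L"] allI impI)
      fix N assume N: "max N0 L <= N"
      define X where "X = cbox_eigs \<omega> N \<inter> {a - \<delta><..<b + \<delta>}"
      \<comment> \<open>Polarisation: the squared coefficients of the sum and of the difference of
        two basis vectors differ by four times the product of the eigenvector values at j and
        k.\<close>
      have "(\<Sum>e\<in>cbox_eigs \<omega> N. (cbox_coeff \<omega> N (\<phi> 1) e)\<^sup>2 * hn n e) - (\<Sum>e\<in>cbox_eigs \<omega> N. (cbox_coeff \<omega> N (\<phi> (- 1)) e)\<^sup>2 * hn n e)
        = (\<Sum>e\<in>cbox_eigs \<omega> N. 4 * (cbox_vec \<omega> N e j * cbox_vec \<omega> N e k) * hn n e)"
        using N unfolding sum_subtractf[symmetric] by (intro sum.cong refl) (simp add: coeff power2_eq_square algebra_simps)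
      also have "\<dots> = (\<Sum>e\<in>X. 4 * (cbox_vec \<omega> N e j * cbox_vec \<omega> N e k) * hn n e)"
        using fin[of N] out by (intro sum.mono_neutral_right) (auto simp: X_def)
      also have "\<dots> <= (\<Sum>e\<in>X. 4 * \<bar>cbox_vec \<omega> N e j * cbox_vec \<omega> N e k\<bar>)"
      proof (rule sum_mono)
        fix e
        have "4 * (cbox_vec \<omega> N e j * cbox_vec \<omega> N e k) * hn n e <= \<bar>4 * (cbox_vec \<omega> N e j * cbox_vec \<omega> N e k)\<bar> * \<bar>hn n e\<bar>"
          by (metis abs_ge_self abs_mult)
        also have "\<dots> <= \<bar>4 * (cbox_vec \<omega> N e j * cbox_vec \<omega> N e k)\<bar> * 1" by (intro mult_left_mono hn_le) simp
        finally show "4 * (cbox_vec \<omega> N e j * cbox_vec \<omega> N e k) * hn n e <= 4 * \<bar>cbox_vec \<omega> N e j * cbox_vec \<omega> N e k\<bar>" by (simp add: abs_mult)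
      qed
      also have "\<dots> <= 4 * g" using g[of N] N by (simp add: X_def flip: sum_distrib_left)
      finally show "(\<Sum>e\<in>cbox_eigs \<omega> N. (cbox_coeff \<omega> N (\<phi> 1) e)\<^sup>2 * hn n e) - (\<Sum>e\<in>cbox_eigs \<omega> N. (cbox_coeff \<omega> N (\<phi> (- 1)) e)\<^sup>2 * hn n e) <= 4 * g" .
    qed
  qed
  then have "cmod z <= 4 * g" by (intro LIMSEQ_le_const2[OF lim]) blast
  then show ?thesis unfolding H_def[symmetric] ev_z by (simp add: norm_divide)
qed

lemma evol_proj_elem_le_1:
  assumes reg: "regular \<omega>"
  shows "cmod (evol_proj_elem (jacobi_op v w \<omega>) {a..b} t j k) <= 1"
proof (rule evol_proj_elem_le[OF reg zero_less_one])
  fix N assume "nat (max \<bar>j\<bar> \<bar>k\<bar>) <= N"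
  then show "(\<Sum>e\<in>cbox_eigs \<omega> N \<inter> {a - 1<..<b + 1}. \<bar>cbox_vec \<omega> N e j * cbox_vec \<omega> N e k\<bar>) <= 1"
    by (intro sum_cbox_vec_le_1[OF reg]) auto
qed

end

section \<open>Dynamical localization\<close>

abbreviation (in random_letters) transport :: "real => real => int => int => ennreal" where
  "transport a b j k \<equiv> \<integral>\<^sup>+ \<omega>. ennreal (SUP t. cmod (evol_proj_elem (jacobi_op v w \<omega>) {a..b} t j k)) \<partial>M"

context random_expanding
begin

text \<open>Disjoint windows make the two words together one i.i.d. word. The bad set quantifies
  over a continuum of energies; the covering event is a finite union over words and therefore
  measurable.\<close>

lemma measure_both_trapped:
  assumes D: "\<And>E m. E \<in> {lo..hi} ==>
      A.prob (Suc (m + A.left_len m)) (trapped m (4 * K * exp (A.trap_exp * m)) E) <= D * exp (- A.trap_rate * m)"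
    and sep: "int m + int n < \<bar>j - k\<bar>"
    and \<eta>: "\<eta> > 0" "lo <= lo' - \<eta>" "hi' + \<eta> <= hi" "\<eta> * (n * K ^ Suc n) <= 1"
  defines "Bad \<equiv> {\<omega>\<in>space M. regular \<omega> \<and> (\<exists>e\<in>{lo'..hi'}.
      trapped m (2 * K * exp (A.trap_exp * m)) e (word (site_ix j m (A.left_len m)) \<omega>) \<and>
      trapped n (2 * K * exp (A.trap_exp * n)) e (word (site_ix k n (A.left_len n)) \<omega>))}"
  obtains Ev where "Ev \<in> sets M" "Bad \<subseteq> Ev"
    "measure M Ev <= (hi - lo) * D * exp (- A.trap_rate * m) / \<eta> + 4 * real m * D * exp (- A.trap_rate * n)"
proof -
  define m' n' where "m' = A.left_len m" and "n' = A.left_len n"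
  have le: "m' <= m" "n' <= n" by (simp_all add: m'_def n'_def A.left_len_le)
  define ix where "ix = site_ix j m m' @ site_ix k n n'"
  define P where "P u w \<longleftrightarrow> (\<exists>e\<in>{lo'..hi'}. trapped m (2 * K * exp (A.trap_exp * m)) e u \<and> trapped n (2 * K * exp (A.trap_exp * n)) e w)" for u w
  define Ev where "Ev = word_event ix (\<lambda>u. P (take (Suc (m + m')) u) (drop (Suc (m + m')) u))"
  have len: "length ix = Suc (m + m') + Suc (n + n')" by (simp add: ix_def length_site_ix)
  have disj: "{j - int m'..j + int m} \<inter> {k - int n'..k + int n} = {}" using sep le by auto
  have dist: "distinct (map fst ix)" "distinct (map snd ix)"
    using disj set_site_ix[of j m m'] set_site_ix[of k n n'] distinct_site_ix[of j m m'] distinct_site_ix[of k n n']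
    unfolding ix_def map_append distinct_append by blast+
  have "Ev \<in> sets M" unfolding Ev_def by (rule word_event_sets)
  moreover have "Bad \<subseteq> Ev"
  proof
    fix \<omega> assume "\<omega> \<in> Bad"
    then have \<omega>: "\<omega> \<in> space M" "regular \<omega>" "P (word (site_ix j m m') \<omega>) (word (site_ix k n n') \<omega>)"
      unfolding Bad_def P_def m'_def n'_def by simp_all
    moreover have "word ix \<omega> = word (site_ix j m m') \<omega> @ word (site_ix k n n') \<omega>" by (simp add: ix_def word_append)
    ultimately show "\<omega> \<in> Ev"
      using word_in_words[OF \<omega>(2), of ix] by (simp add: Ev_def word_event_def length_word length_site_ix)
  qed
  moreover have "measure M Ev <= (hi - lo) * D * exp (- A.trap_rate * m) / \<eta> + 4 * real m * D * exp (- A.trap_rate * n)"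
  proof -
  have "measure M Ev = A.mean (Suc (m + m')) (\<lambda>u. A.prob (Suc (n + n')) (\<lambda>w. P (take (Suc (m + m')) (u @ w)) (drop (Suc (m + m')) (u @ w))))"
    unfolding Ev_def measure_word_event[OF dist] len A.prob_def A.mean_append ..
  also have "\<dots> = A.mean (Suc (m + m')) (\<lambda>u. A.prob (Suc (n + n')) (P u))"
    by (rule A.mean_cong) (simp add: A.words_def)
  also have "\<dots> <= (hi - lo) * D * exp (- A.trap_rate * m) / \<eta> + 4 * real m * D * exp (- A.trap_rate * n)"
    unfolding P_def m'_def n'_def
  proof (rule A.prob_both_trapped_le[OF _ _ \<eta>])
    show "A.prob (Suc (m + A.left_len m)) (trapped m (2 * (2 * K) * exp (A.trap_exp * m)) E) <= D * exp (- A.trap_rate * m)"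
      if "E \<in> {lo..hi}" for E m using D[OF that, of m] by simp
    show "1 <= 2 * K" using A.K by simp
  qed
  finally show ?thesis .
  qed
  ultimately show thesis by (rule that)
qed

lemma cbox_vec_decay:
  assumes reg: "regular \<omega>" and e: "e \<in> cbox_eigs \<omega> N" and N: "\<bar>j\<bar> + int m < int N"
    and nt: "\<not> trapped m (2 * K * t) e (word (site_ix j m (A.left_len m)) \<omega>)" and t: "t > 0"
  shows "\<bar>cbox_vec \<omega> N e j * y\<bar> <= (\<Sum>i\<in>{j - int m - 1..j + int m}. \<bar>cbox_vec \<omega> N e i * y\<bar>) / t"
proof -
  have le: "A.left_len m <= m" by (rule A.left_len_le)
  have "- int N + int (A.left_len m) < j" "j + int m < - int N + int (2 * N + 1)" using N le by auto
  from box_vec_small[OF reg e[unfolded cbox_eigs_def] this nt]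
  obtain i where i: "j - int (A.left_len m) - 1 <= i" "i <= j + int m" "t * \<bar>cbox_vec \<omega> N e j\<bar> <= \<bar>cbox_vec \<omega> N e i\<bar>"
    unfolding cbox_vec_def by blast
  have "t * \<bar>cbox_vec \<omega> N e j * y\<bar> <= \<bar>cbox_vec \<omega> N e i * y\<bar>"
    using mult_right_mono[OF i(3), of "\<bar>y\<bar>"] by (simp add: abs_mult mult.assoc)
  also have "\<dots> <= (\<Sum>i\<in>{j - int m - 1..j + int m}. \<bar>cbox_vec \<omega> N e i * y\<bar>)"
    using i le by (intro member_le_sum) auto
  finally show ?thesis using t by (simp add: le_divide_eq mult.commute)
qed

text \<open>Unless both sites are trapped at a common energy, each relevant box eigenfunction is
  exponentially smaller at j or at k than at some site of the window there. Summing over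
  eigenfunctions first costs only the window length, by completeness; on the exceptional event the
  trivial bound 1 is used.\<close>

lemma evol_mean_le:
  assumes D: "\<And>E m. E \<in> {lo..hi} ==>
      A.prob (Suc (m + A.left_len m)) (trapped m (4 * K * exp (A.trap_exp * m)) E) <= D * exp (- A.trap_rate * m)"
    and sep: "int m + int n < \<bar>j - k\<bar>" and nm: "n <= m" and \<delta>: "\<delta> > 0"
    and \<eta>: "\<eta> > 0" "lo <= a - \<delta> - \<eta>" "b + \<delta> + \<eta> <= hi" "\<eta> * (n * K ^ Suc n) <= 1"
  shows "transport a b j k
    <= ennreal ((hi - lo) * D * exp (- A.trap_rate * m) / \<eta> + 4 * real m * D * exp (- A.trap_rate * n) + (4 * real m + 4) * exp (- A.trap_exp * n))"
proof -
  define tm tn where "tm = exp (A.trap_exp * m)" and "tn = exp (A.trap_exp * n)"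
  define g where "g = (4 * real m + 4) * exp (- A.trap_exp * n)"
  have g0: "g >= 0" by (simp add: g_def)
  obtain Ev where Ev: "Ev \<in> sets M" "{\<omega>\<in>space M. regular \<omega> \<and> (\<exists>e\<in>{a - \<delta>..b + \<delta>}.
      trapped m (2 * K * exp (A.trap_exp * m)) e (word (site_ix j m (A.left_len m)) \<omega>) \<and>
      trapped n (2 * K * exp (A.trap_exp * n)) e (word (site_ix k n (A.left_len n)) \<omega>))} \<subseteq> Ev"
    "measure M Ev <= (hi - lo) * D * exp (- A.trap_rate * m) / \<eta> + 4 * real m * D * exp (- A.trap_rate * n)"
  proof (rule measure_both_trapped[OF _ sep \<eta>])
    show "A.prob (Suc (m + A.left_len m)) (trapped m (4 * K * exp (A.trap_exp * m)) E) <= D * exp (- A.trap_rate * m)"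
      if "E \<in> {lo..hi}" for E m by (rule D[OF that])
  qed (rule that)
  have good: "cmod (evol_proj_elem (jacobi_op v w \<omega>) {a..b} t j k) <= g"
    if reg: "regular \<omega>" and sp: "\<omega> \<in> space M" and nEv: "\<omega> \<notin> Ev" for \<omega> t
  proof (rule evol_proj_elem_le[OF reg \<delta>])
    fix N assume N: "nat (\<bar>j\<bar> + \<bar>k\<bar> + int m + int n + 2) <= N"
    define X where "X = cbox_eigs \<omega> N \<inter> {a - \<delta><..<b + \<delta>}"
    define y where "y = cbox_vec \<omega> N"
    define Wj Wk where "Wj = {j - int m - 1..j + int m}" and "Wk = {k - int n - 1..k + int n}"
    have one: "\<bar>y e j * y e k\<bar> <= (\<Sum>i\<in>Wj. \<bar>y e i * y e k\<bar>) / tm + (\<Sum>i\<in>Wk. \<bar>y e i * y e j\<bar>) / tn" if e: "e \<in> X" for e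
    proof -
      have p: "0 <= (\<Sum>i\<in>Wj. \<bar>y e i * y e k\<bar>) / tm" "0 <= (\<Sum>i\<in>Wk. \<bar>y e i * y e j\<bar>) / tn"
        by (simp_all add: tm_def tn_def sum_nonneg)
      have eN: "e \<in> cbox_eigs \<omega> N" and eI: "e \<in> {a - \<delta>..b + \<delta>}" using e by (auto simp: X_def)
      consider "\<not> trapped m (2 * K * tm) e (word (site_ix j m (A.left_len m)) \<omega>)" | "\<not> trapped n (2 * K * tn) e (word (site_ix k n (A.left_len n)) \<omega>)"
        using nEv Ev(2) sp reg eI unfolding tm_def tn_def by blast
      then show ?thesis
      proof cases
        case 1
        have "\<bar>y e j * y e k\<bar> <= (\<Sum>i\<in>Wj. \<bar>y e i * y e k\<bar>) / tm"
          unfolding y_def Wj_def by (rule cbox_vec_decay[OF reg eN _ 1]) (use N in \<open>auto simp: tm_def\<close>)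
        then show ?thesis using p by linarith
      next
        case 2
        have "\<bar>y e k * y e j\<bar> <= (\<Sum>i\<in>Wk. \<bar>y e i * y e j\<bar>) / tn"
          unfolding y_def Wk_def by (rule cbox_vec_decay[OF reg eN _ 2]) (use N in \<open>auto simp: tn_def\<close>)
        then show ?thesis using p by (simp add: mult.commute[of "y e k"])
      qed
    qed
    have win: "(\<Sum>e\<in>X. \<Sum>i\<in>{l - int r - 1..l + int r}. \<bar>y e i * y e l'\<bar>) <= 2 * r + 2"
      if "\<bar>l\<bar> + int r < int N" "\<bar>l'\<bar> <= int N" for l l' r
    proof -
      have "(\<Sum>e\<in>X. \<Sum>i\<in>{l - int r - 1..l + int r}. \<bar>y e i * y e l'\<bar>) = (\<Sum>i\<in>{l - int r - 1..l + int r}. \<Sum>e\<in>X. \<bar>y e i * y e l'\<bar>)"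
        by (rule sum.swap)
      also have "\<dots> <= (\<Sum>i\<in>{l - int r - 1..l + int r}. 1)"
        unfolding y_def using that by (intro sum_mono sum_cbox_vec_le_1[OF reg]) (auto simp: X_def)
      also have "\<dots> = 2 * r + 2" by simp
      finally show ?thesis .
    qed
    have "(\<Sum>e\<in>X. \<bar>y e j * y e k\<bar>) <= (\<Sum>e\<in>X. (\<Sum>i\<in>Wj. \<bar>y e i * y e k\<bar>) / tm + (\<Sum>i\<in>Wk. \<bar>y e i * y e j\<bar>) / tn)"
      by (rule sum_mono) (rule one)
    also have "\<dots> = (\<Sum>e\<in>X. \<Sum>i\<in>Wj. \<bar>y e i * y e k\<bar>) / tm + (\<Sum>e\<in>X. \<Sum>i\<in>Wk. \<bar>y e i * y e j\<bar>) / tn"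
      by (simp add: sum.distrib sum_divide_distrib)
    also have "\<dots> <= (2 * m + 2) / tm + (2 * n + 2) / tn"
      unfolding Wj_def Wk_def using N by (intro add_mono divide_right_mono win) (auto simp: tm_def tn_def)
    also have "\<dots> <= (2 * m + 2) / tn + (2 * m + 2) / tn"
      using nm A.trap_exp_pos by (intro add_mono divide_left_mono divide_right_mono) (auto simp: tm_def tn_def)
    also have "\<dots> = g" by (simp add: g_def tn_def exp_minus field_simps)
    finally show "(\<Sum>e\<in>cbox_eigs \<omega> N \<inter> {a - \<delta><..<b + \<delta>}. \<bar>cbox_vec \<omega> N e j * cbox_vec \<omega> N e k\<bar>) <= g"
      by (simp add: X_def y_def)
  qed
  have "transport a b j k
      <= (\<integral>\<^sup>+ \<omega>. indicator Ev \<omega> + ennreal g \<partial>M)"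
  \<comment> \<open>Monotonicity of the nonnegative integral requires no measurability of the
    supremum over t.\<close>
  proof (rule nn_integral_mono_AE)
    show "AE \<omega> in M. ennreal (SUP t. cmod (evol_proj_elem (jacobi_op v w \<omega>) {a..b} t j k)) <= indicator Ev \<omega> + ennreal g"
      using AE_regular AE_space
    proof eventually_elim
      case (elim \<omega>)
      have "(SUP t. cmod (evol_proj_elem (jacobi_op v w \<omega>) {a..b} t j k)) <= indicator Ev \<omega> + g"
      proof (rule cSUP_least)
        fix t show "cmod (evol_proj_elem (jacobi_op v w \<omega>) {a..b} t j k) <= indicator Ev \<omega> + g"
          using good[OF elim, of t] evol_proj_elem_le_1[OF elim(1), of a b t j k] g0 by (cases "\<omega> \<in> Ev") auto
      qed simp
      then have "ennreal (SUP t. cmod (evol_proj_elem (jacobi_op v w \<omega>) {a..b} t j k)) <= ennreal (indicator Ev \<omega> + g)"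
        by (rule ennreal_leI)
      then show ?case using g0 by (cases "\<omega> \<in> Ev") (auto simp: ennreal_plus)
    qed
  qed
  also have "\<dots> = ennreal (measure M Ev + g)"
    using Ev(1) g0 by (simp add: nn_integral_add emeasure_eq_measure prob_space ennreal_plus)
  also have "\<dots> <= ennreal ((hi - lo) * D * exp (- A.trap_rate * m) / \<eta> + 4 * real m * D * exp (- A.trap_rate * n) + (4 * real m + 4) * exp (- A.trap_exp * n))"
    using Ev(3) by (intro ennreal_leI) (simp add: g_def)
  finally show ?thesis .
qed

end

lemma (in random_letters) evol_mean_le_1:
  "transport a b j k <= ennreal 1"
proof -
  have "transport a b j k <= (\<integral>\<^sup>+ \<omega>. ennreal 1 \<partial>M)"
  proof (rule nn_integral_mono_AE)
    show "AE \<omega> in M. ennreal (SUP t. cmod (evol_proj_elem (jacobi_op v w \<omega>) {a..b} t j k)) <= ennreal 1"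
      using AE_regular
    proof eventually_elim
      case (elim \<omega>)
      show ?case by (intro ennreal_leI cSUP_least evol_proj_elem_le_1[OF elim]) simp
    qed
  qed
  then show ?thesis by (simp add: emeasure_space_1)
qed

lemma Suc_mult_exp_le:
  assumes "r > 0"
  shows "(real m + 1) * exp (- r * m) <= (1 + 2 / r) * exp (- (r / 2) * m)"
proof -
  have "real m + 1 <= (1 + 2 / r) * (1 + (r / 2) * m)" using assms by (simp add: field_simps)
  also have "\<dots> <= (1 + 2 / r) * exp ((r / 2) * m)"
    using assms exp_ge_add_one_self[of "(r / 2) * m"] by (intro mult_left_mono) auto
  finally have "(real m + 1) * exp (- r * m) <= (1 + 2 / r) * exp ((r / 2) * m) * exp (- r * m)"
    by (intro mult_right_mono) auto
  also have "\<dots> = (1 + 2 / r) * exp (- (r / 2) * m)" unfolding mult.assoc exp_add[symmetric] by (simp add: field_simps)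
  finally show ?thesis .
qed

text \<open>Balances the scales: \<eta> must be large enough that dividing by it preserves decay in
  m, yet small enough for energy shifts to be harmless in the window n. Taking n = \<beta>m with
  \<beta> small reconciles the two.\<close>

lemma (in random_expanding) evol_mean_exp_decay:
  assumes \<delta>: "\<delta> > 0" "lo <= a - 2 * \<delta>" "b + 2 * \<delta> <= hi"
  obtains C0 \<rho> m1 where "C0 >= 0" "\<rho> > 0" "m1 >= (1::nat)"
    "\<And>m j k. m1 <= m ==> 2 * int m < \<bar>j - k\<bar> ==>
      transport a b j k <= ennreal (C0 * exp (- \<rho> * m))"
proof -
  have "4 * K >= 1" using A.K by simp
  then obtain D where D: "D > 0" "\<And>E m. E \<in> {lo..hi} ==>
     A.prob (Suc (m + A.left_len m)) (trapped m (4 * K * exp (A.trap_exp * m)) E) <= D * exp (- A.trap_rate * m)"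
    by (rule A.prob_trapped_exp) blast
  define \<tau> \<theta> where "\<tau> = A.trap_rate" and "\<theta> = A.trap_exp"
  have pos: "\<tau> > 0" "\<theta> > 0" using A.trap_rate_pos A.trap_exp_pos by (simp_all add: \<tau>_def \<theta>_def)
  define L where "L = 1 + ln K"
  have L: "L >= 1" using A.K by (simp add: L_def)
  \<comment> \<open>Ensures L n <= \<tau>m/4, where exp (L n) bounds n K^n.\<close>
  define \<beta> where "\<beta> = min (1 / 2) (\<tau> / (4 * L))"
  have \<beta>: "0 < \<beta>" "\<beta> <= 1 / 2" "\<beta> * L <= \<tau> / 4"
  proof -
    show "0 < \<beta>" "\<beta> <= 1 / 2" using pos L by (auto simp: \<beta>_def)
    have "\<beta> * L <= \<tau> / (4 * L) * L" using L by (intro mult_right_mono) (auto simp: \<beta>_def)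
    then show "\<beta> * L <= \<tau> / 4" using L by simp
  qed
  define \<rho>0 where "\<rho>0 = min \<tau> \<theta> * \<beta>"
  have \<rho>0: "\<rho>0 > 0" using pos \<beta> by (simp add: \<rho>0_def)
  define C1 where "C1 = (hi - lo) * D + (4 * D + 4) * exp (min \<tau> \<theta>)"
  have C1: "C1 >= 0" using A.lo_hi D(1) by (simp add: C1_def)
  \<comment> \<open>From m1 on, ln K <= \<tau>m/4 absorbs the extra factor K, and \<eta> = exp
    (-\<tau>m/2) does not exceed \<delta>.\<close>
  define m1 where "m1 = Suc (nat \<lceil>max (4 * ln K / \<tau>) (2 * (- ln \<delta>) / \<tau>)\<rceil>)"
  have bound: "transport a b j k
      <= ennreal (C1 * (1 + 2 / \<rho>0) * exp (- (\<rho>0 / 2) * m))"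
    if m: "m1 <= m" and sep: "2 * int m < \<bar>j - k\<bar>" for m j k
  proof -
    define n where "n = nat \<lfloor>\<beta> * m\<rfloor>"
    have n: "real n <= \<beta> * m" "\<beta> * m < real n + 1" using \<beta>(1) unfolding n_def by auto
    have nm: "n <= m"
    proof -
      have "\<beta> * real m <= 1 * real m" using \<beta> by (intro mult_right_mono) auto
      then show ?thesis using n(1) by linarith
    qed
    have "max (4 * ln K / \<tau>) (2 * (- ln \<delta>) / \<tau>) <= m" using m unfolding m1_def by linarith
    then have m': "4 * ln K / \<tau> <= m" "2 * (- ln \<delta>) / \<tau> <= m" by simp_all
    have m4: "ln K <= \<tau> * m / 4" "- ln \<delta> <= \<tau> * m / 2" using m' pos by (auto simp: field_simps)
    \<comment> \<open>Dividing exp (-\<tau>m) by this \<eta> leaves half of its decay.\<close>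
    define \<eta> where "\<eta> = exp (- (\<tau> / 2) * m)"
    have \<eta>\<delta>: "\<eta> <= \<delta>"
    proof -
      have "\<eta> <= exp (ln \<delta>)" unfolding \<eta>_def using m4(2) by simp
      then show ?thesis using \<delta>(1) by simp
    qed
    have \<eta>1: "\<eta> * (n * K ^ Suc n) <= 1"
    proof -
      have "real n <= exp (real n)" using exp_ge_add_one_self[of "real n"] by linarith
      moreover have Kn: "K ^ Suc n = exp (ln K * (real n + 1))"
      proof -
        have "K ^ Suc n = exp (ln K) ^ Suc n" using A.K by simp
        also have "\<dots> = exp (real (Suc n) * ln K)" by (rule exp_of_nat_mult[symmetric])
        finally show ?thesis by (simp add: mult.commute add.commute)
      qed
      ultimately have "n * K ^ Suc n <= exp (real n) * exp (ln K * (real n + 1))" by simp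
      also have "\<dots> = exp (L * n + ln K)" by (simp add: L_def algebra_simps flip: exp_add)
      also have "\<dots> <= exp (\<tau> / 4 * m + \<tau> * m / 4)"
      proof (subst exp_le_cancel_iff, rule add_mono)
        have "L * n <= L * (\<beta> * m)" using n L by (intro mult_left_mono) auto
        also have "\<dots> = \<beta> * L * m" by simp
        also have "\<dots> <= \<tau> / 4 * m" using \<beta> by (intro mult_right_mono) auto
        finally show "L * n <= \<tau> / 4 * m" .
      qed (rule m4)
      also have "\<dots> = exp (\<tau> / 2 * m)" by simp
      finally have "\<eta> * (n * K ^ Suc n) <= \<eta> * exp (\<tau> / 2 * m)" by (intro mult_left_mono) (simp_all add: \<eta>_def)
      then show ?thesis by (simp add: \<eta>_def flip: exp_add)
    qed
    have "transport a b j k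
        <= ennreal ((hi - lo) * D * exp (- A.trap_rate * m) / \<eta> + 4 * real m * D * exp (- A.trap_rate * n) + (4 * real m + 4) * exp (- A.trap_exp * n))"
    proof (rule evol_mean_le[OF _ _ nm \<delta>(1) _ _ _ \<eta>1])
      show "A.prob (Suc (m + A.left_len m)) (trapped m (4 * K * exp (A.trap_exp * m)) E) <= D * exp (- A.trap_rate * m)"
        if "E \<in> {lo..hi}" for E m by (rule D(2)[OF that])
      show "\<eta> > 0" by (simp add: \<eta>_def)
    qed (use sep nm \<delta> \<eta>\<delta> in linarith)+
    also have "\<dots> <= ennreal (C1 * ((real m + 1) * exp (- \<rho>0 * m)))"
    proof (rule ennreal_leI)
      define X where "X = exp (- \<rho>0 * m)"
      have key: "exp (- r * n) <= exp (min \<tau> \<theta>) * X" if "min \<tau> \<theta> <= r" for r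
      proof -
        have "min \<tau> \<theta> * (\<beta> * m) <= min \<tau> \<theta> * (real n + 1)" using n pos by (intro mult_left_mono) auto
        also have "\<dots> <= r * n + min \<tau> \<theta>" using mult_right_mono[OF that, of "real n"] by (simp add: distrib_left)
        finally show ?thesis unfolding X_def exp_add[symmetric] by (simp add: \<rho>0_def)
      qed
      have "(hi - lo) * D * exp (- \<tau> * m) / \<eta> = (hi - lo) * D * exp (- (\<tau> / 2) * m)"
      proof -
        have "exp (- \<tau> * m) / \<eta> = exp (- (\<tau> / 2) * m)" unfolding \<eta>_def exp_diff[symmetric] by (simp add: field_simps)
        then show ?thesis by (metis times_divide_eq_right)
      qed
      also have "\<dots> <= (hi - lo) * D * X"
      proof (intro mult_left_mono)
        have "\<rho>0 <= \<tau> / 2" using mult_mono[of "min \<tau> \<theta>" \<tau> \<beta> "1 / 2"] \<beta> pos by (simp add: \<rho>0_def)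
        then have "\<rho>0 * m <= \<tau> / 2 * m" by (intro mult_right_mono) auto
        then show "exp (- (\<tau> / 2) * m) <= X" unfolding X_def by simp
      qed (use A.lo_hi D(1) in auto)
      also have "\<dots> <= ((hi - lo) * D) * ((real m + 1) * X)"
        using A.lo_hi D(1) by (intro mult_left_mono) (auto simp: X_def)
      finally have 1: "(hi - lo) * D * exp (- \<tau> * m) / \<eta> <= ((hi - lo) * D) * ((real m + 1) * X)" .
      have "4 * real m * D * exp (- \<tau> * n) <= (4 * (real m + 1) * D) * (exp (min \<tau> \<theta>) * X)"
        using D(1) key[of \<tau>] by (intro mult_mono) auto
      moreover have "(4 * real m + 4) * exp (- \<theta> * n) <= (4 * real m + 4) * (exp (min \<tau> \<theta>) * X)"
        using mult_left_mono[OF key[of \<theta>], of "4 * real m + 4"] by simp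
      ultimately have "(hi - lo) * D * exp (- \<tau> * m) / \<eta> + 4 * real m * D * exp (- \<tau> * n) + (4 * real m + 4) * exp (- \<theta> * n)
          <= ((hi - lo) * D) * ((real m + 1) * X) + (4 * (real m + 1) * D) * (exp (min \<tau> \<theta>) * X) + (4 * real m + 4) * (exp (min \<tau> \<theta>) * X)"
        using 1 by linarith
      also have "\<dots> = C1 * ((real m + 1) * X)" by (simp add: C1_def algebra_simps)
      finally show "(hi - lo) * D * exp (- A.trap_rate * m) / \<eta> + 4 * real m * D * exp (- A.trap_rate * n) + (4 * real m + 4) * exp (- A.trap_exp * n)
          <= C1 * ((real m + 1) * exp (- \<rho>0 * m))" unfolding X_def \<tau>_def \<theta>_def .
    qed
    also have "\<dots> <= ennreal (C1 * ((1 + 2 / \<rho>0) * exp (- (\<rho>0 / 2) * m)))"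
      using C1 by (intro ennreal_leI mult_left_mono Suc_mult_exp_le \<rho>0)
    finally show ?thesis by (simp only: mult.assoc)
  qed
  show thesis by (rule that[of "C1 * (1 + 2 / \<rho>0)" "\<rho>0 / 2" m1])
       (use bound C1 \<rho>0 in \<open>auto simp: m1_def\<close>)
qed

lemma (in random_expanding) dynamical_localization_inside:
  assumes cd: "lo < c" "d < hi"
  shows "dynamical_localization M v w {c<..<d}" unfolding dynamical_localization_def
proof (intro allI impI)
  fix a b :: real assume ab: "a <= b" "{a..b} \<subseteq> {c<..<d}"
  then have "a \<in> {c<..<d}" "b \<in> {c<..<d}" by auto
  then have "lo < a" "b < hi" using cd by auto
  define \<delta> where "\<delta> = min (a - lo) (hi - b) / 2"
  have \<delta>: "\<delta> > 0" "lo <= a - 2 * \<delta>" "b + 2 * \<delta> <= hi" using \<open>lo < a\<close> \<open>b < hi\<close> by (auto simp: \<delta>_def)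
  obtain C0 \<rho> m1 where C0: "C0 >= 0" and \<rho>: "\<rho> > 0" and m1: "m1 >= (1::nat)"
    and bound: "\<And>m j k. m1 <= m ==> 2 * int m < \<bar>j - k\<bar> ==>
      transport a b j k <= ennreal (C0 * exp (- \<rho> * m))" by (rule evol_mean_exp_decay[OF \<delta>]) blast
  define C where "C = (C0 + 1) * exp (\<rho> * (real m1 + 1))"
  have main: "transport a b j k
      <= ennreal (C * exp (- (\<rho> / 2) * real_of_int \<bar>j - k\<bar>))" for j k
  proof -
    \<comment> \<open>For distinct sites this is the largest m with 2m < |j - k|. For j = k it is 0,
      excluded below by m1 >= 1 and covered by the trivial bound.\<close>
    define m where "m = nat ((\<bar>j - k\<bar> - 1) div 2)"
    have ml: "\<bar>j - k\<bar> <= 2 * int m + 2" unfolding m_def by linarith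
    have lm: "real_of_int \<bar>j - k\<bar> <= 2 * real m + 2" using of_int_le_iff[where 'a = real, THEN iffD2, OF ml] by simp
    show ?thesis
    proof (cases "m1 <= m")
      case True
      then have "2 * int m < \<bar>j - k\<bar>" using m1 unfolding m_def by linarith
      from bound[OF True this] have "transport a b j k
          <= ennreal (C0 * exp (- \<rho> * m))" .
      also have "\<dots> <= ennreal (C * exp (- (\<rho> / 2) * real_of_int \<bar>j - k\<bar>))"
      proof (rule ennreal_leI)
        have "\<rho> * real_of_int \<bar>j - k\<bar> <= \<rho> * (2 * real m + 2)" using \<rho> lm by (intro mult_left_mono) auto
        moreover have "0 <= \<rho> * real m1" using \<rho> by simp
        ultimately have "exp (- \<rho> * m) <= exp (\<rho> * (real m1 + 1)) * exp (- (\<rho> / 2) * real_of_int \<bar>j - k\<bar>)"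
          unfolding exp_add[symmetric] exp_le_cancel_iff by (simp add: algebra_simps)
        then have "C0 * exp (- \<rho> * m) <= (C0 + 1) * (exp (\<rho> * (real m1 + 1)) * exp (- (\<rho> / 2) * real_of_int \<bar>j - k\<bar>))"
          using C0 by (intro mult_mono) auto
        then show "C0 * exp (- \<rho> * m) <= C * exp (- (\<rho> / 2) * real_of_int \<bar>j - k\<bar>)" unfolding C_def mult.assoc .
      qed
      finally show ?thesis .
    next
      case False
      note evol_mean_le_1
      also have "ennreal 1 <= ennreal (C * exp (- (\<rho> / 2) * real_of_int \<bar>j - k\<bar>))"
      proof (rule ennreal_leI)
        have "real_of_int \<bar>j - k\<bar> <= 2 * (real m1 + 1)" using lm False by simp
        then have "\<rho> * real_of_int \<bar>j - k\<bar> <= \<rho> * (2 * (real m1 + 1))" using \<rho> by (intro mult_left_mono) auto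
        then have "1 <= exp (\<rho> * (real m1 + 1)) * exp (- (\<rho> / 2) * real_of_int \<bar>j - k\<bar>)"
          unfolding exp_add[symmetric] by (simp add: algebra_simps)
        then have "1 * 1 <= (C0 + 1) * (exp (\<rho> * (real m1 + 1)) * exp (- (\<rho> / 2) * real_of_int \<bar>j - k\<bar>))"
          using C0 by (intro mult_mono) auto
        then show "1 <= C * exp (- (\<rho> / 2) * real_of_int \<bar>j - k\<bar>)" unfolding C_def by (simp add: mult.assoc)
      qed
      finally show ?thesis .
    qed
  qed
  show "\<exists>C \<gamma> \<sigma>. \<gamma> > 0 \<and> \<sigma> > 0 \<and>
          (\<forall>j k. transport a b j k
                   <= ennreal (C * exp (- \<gamma> * real_of_int \<bar>j - k\<bar> powr \<sigma>)))"
    using main \<rho> by (intro exI[of _ C] exI[of _ "\<rho> / 2"] exI[of _ 1]) simp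
qed

section \<open>Explicitly solvable cases\<close>

lemma ln_growth_rate:
  fixes f :: "nat => real"
  assumes C: "C >= 1" and R: "R > 0" and lower: "\<And>n. R ^ n / (C * (real n + 1)) <= f n" and upper: "\<And>n. f n <= C * (real n + 1) * R ^ n"
  shows "(\<lambda>n. ln (f n) / n) \<longlonglongrightarrow> ln R"
proof (rule LIM_zero_cancel, rule Lim_null_comparison)
  show "\<forall>\<^sub>F n in sequentially. norm (ln (f n) / n - ln R) <= (ln C + ln 2) / n + ln (real n) / n"
    using eventually_ge_at_top[of 1]
  proof eventually_elim
    case (elim n)
    have n: "real n >= 1" using elim by simp
    define X where "X = C * (real n + 1)"
    have "C * (real n + 1) > 0" using C by (intro mult_pos_pos) auto
    then have X: "X > 0" by (simp add: X_def)
    have Rn: "R ^ n > 0" using R by simp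
    have f: "R ^ n / X <= f n" "f n <= X * R ^ n" using lower[of n] upper[of n] by (simp_all add: X_def)
    have f0: "f n > 0" by (rule less_le_trans[OF divide_pos_pos[OF Rn X] f(1)])
    have 1: "ln (f n) <= ln X + n * ln R" using ln_mono[OF f(2) f0] unfolding ln_mult_pos[OF X Rn] ln_realpow .
    have 2: "n * ln R - ln X <= ln (f n)"
      using ln_mono[OF f(1) divide_pos_pos[OF Rn X]] unfolding ln_divide_pos[OF Rn X] ln_realpow .
    have "real n + 1 <= 2 * real n" using n by simp
    then have "X <= C * (2 * real n)" unfolding X_def using C by (intro mult_left_mono) auto
    from ln_mono[OF this X] have 3: "ln X <= ln C + ln 2 + ln (real n)" using C n by (simp add: ln_mult)
    have "\<bar>ln (f n) - n * ln R\<bar> <= ln C + ln 2 + ln (real n)" using 1 2 3 by linarith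
    then have "\<bar>ln (f n) - n * ln R\<bar> / n <= (ln C + ln 2 + ln (real n)) / n" by (intro divide_right_mono) auto
    moreover have "ln (f n) / n - ln R = (ln (f n) - n * ln R) / n" using n by (simp add: field_simps)
    ultimately show ?case by (simp add: abs_divide add_divide_distrib)
  qed
  have "(\<lambda>n. (ln C + ln 2) / real n + ln (real n) / real n) \<longlonglongrightarrow> 0 + 0"
    by (intro tendsto_add lim_ln_over_n) (rule lim_const_over_n)
  then show "(\<lambda>n. (ln C + ln 2) / real n + ln (real n) / real n) \<longlonglongrightarrow> 0" by simp
qed

text \<open>At the energy E = v each step interchanges the coordinate axes, multiplying by w one way
  and dividing by w the other, so logarithms of norms become alternating sums.\<close>

primrec alternating_log :: "(real \<times> real) list => real" where
  "alternating_log [] = 0"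
| "alternating_log (a # u) = ln \<bar>snd a\<bar> - alternating_log u"

lemma tact_centre_energy:
  assumes "\<forall>a\<in>set u. fst a = E \<and> snd a \<noteq> 0"
  shows "norm (tact E u (x, 0)) = \<bar>x\<bar> * exp (alternating_log u) \<and> norm (tact E u (0, y)) = \<bar>y\<bar> * exp (- alternating_log u)"
  using assms
proof (induction u arbitrary: x y)
  case (Cons a u)
  have a: "fst a = E" "snd a \<noteq> 0" and u: "\<forall>a\<in>set u. fst a = E \<and> snd a \<noteq> 0" using Cons.prems by auto
  have e: "exp (ln \<bar>snd a\<bar>) = \<bar>snd a\<bar>" using a by simp
  have s: "tstep E a (x, 0) = (0, snd a * x)" "tstep E a (0, y) = (- y / snd a, 0)"
    using a by (cases a; simp add: tstep_def)+
  show ?case using Cons.IH[OF u, of "- y / snd a" "snd a * x"] a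
    by (simp add: s exp_diff e abs_mult exp_minus field_simps)
qed (simp add: norm_Pair)

lemma alternating_log_change:
  "\<bar>alternating_log (u @ a # x) - alternating_log (u @ b # x)\<bar> = \<bar>ln \<bar>snd a\<bar> - ln \<bar>snd b\<bar>\<bar>"
  by (induction u) (auto simp: abs_minus_commute)

definition pure_hopping :: "real => real => (real \<times> real) list => bool" where
  "pure_hopping v0 w0 u \<longleftrightarrow> (\<forall>a\<in>set u. fst a = v0 \<and> \<bar>snd a\<bar> = w0)"

lemma pure_hopping_simps: "pure_hopping v0 w0 []" "pure_hopping v0 w0 (a # u) \<longleftrightarrow> fst a = v0 \<and> \<bar>snd a\<bar> = w0 \<and> pure_hopping v0 w0 u"
  by (simp_all add: pure_hopping_def)

text \<open>A root \<open>z\<close> of the characteristic polynomial has modulus \<open>w\<^sub>0\<close>, so \<open>\<bar>b - z a\<bar>\<close> is conserved.\<close>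
lemma tact_elliptic_le:
  assumes w0: "w0 > 0" and t: "\<bar>v0 - E\<bar> <= 2 * w0"
  obtains C where "\<And>u. pure_hopping v0 w0 u ==> norm (tact E u x) <= C * (real (length u) + 1)"
proof -
  define t where "t = v0 - E"
  define z where "z = Complex (t / 2) (sqrt (w0\<^sup>2 - (t / 2)\<^sup>2))"
  have "(t / 2)\<^sup>2 <= w0\<^sup>2" using t w0 abs_le_square_iff[of "t / 2" w0] by (simp add: t_def)
  then have z: "cmod z = w0" using w0 by (simp add: z_def cmod_def)
  have zz: "z + cnj z = of_real t" "z * cnj z = of_real (w0\<^sup>2)"
    by (simp add: z_def complex_eq_iff) (simp add: z complex_norm_square[symmetric])
  \<comment> \<open>Up to the factor w, the functional with coefficient z is multiplied by z, of
    modulus w0: d is conserved. Each step adds at most d to f, so norms grow at most linearly; this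
    covers the band edges, where z is real.\<close>
  define d f where "d y = cmod (of_real (snd y) - z * of_real (fst y))" and "f y = w0 * \<bar>fst y\<bar>" for y :: "real \<times> real"
  have step: "d (tstep E a y) = d y" "f (tstep E a y) <= f y + d y" if "fst a = v0" "\<bar>snd a\<bar> = w0" for a y
  proof -
    define w where "w = snd a"
    have a: "a = (v0, w)" using that(1) by (simp add: w_def prod_eq_iff)
    obtain p q where y: "y = (p, q)" by (cases y)
    have w: "w \<noteq> 0" "\<bar>w\<bar> = w0" using that w0 by (auto simp: a)
    have ww: "complex_of_real w * of_real w = z * cnj z" unfolding zz w(2)[symmetric] by (simp add: power2_eq_square)
    have ts: "tstep E a (p, q) = ((t * p - q) / w, w * p)" by (simp add: a tstep_def t_def)
    have tp: "complex_of_real (t * p - q) = (z + cnj z) * of_real p - of_real q" by (simp add: zz)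
    have "of_real w * (of_real (w * p) - z * of_real ((t * p - q) / w)) = (of_real w * of_real w) * of_real p - z * of_real (t * p - q)"
      using w(1) by (simp add: field_simps)
    also have "\<dots> = z * (of_real q - z * of_real p)" unfolding ww tp by (simp add: algebra_simps)
    finally have "cmod (of_real w) * d (tstep E a y) = cmod z * d y"
      unfolding d_def y ts fst_conv snd_conv norm_mult[symmetric] by (rule arg_cong)
    then show "d (tstep E a y) = d y" using w z w0 by simp
    have "complex_of_real (t * p - q) = cnj z * of_real p - (of_real q - z * of_real p)" unfolding tp by (simp add: algebra_simps)
    then have "cmod (of_real (t * p - q)) <= cmod (cnj z * of_real p) + d y"
      unfolding d_def y fst_conv snd_conv by (metis norm_triangle_ineq4)
    then show "f (tstep E a y) <= f y + d y" using w w0 unfolding norm_mult complex_mod_cnj z norm_of_real by (simp add: f_def y ts)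
  qed
  have tact: "d (tact E u y) = d y" "f (tact E u y) <= f y + length u * d y" if "pure_hopping v0 w0 u" for u y
  proof -
    show "d (tact E u y) = d y" using that by (induction u arbitrary: y) (auto simp: pure_hopping_simps step)
    show "f (tact E u y) <= f y + length u * d y" using that
    proof (induction u arbitrary: y)
      case (Cons a u)
      then have a: "fst a = v0" "\<bar>snd a\<bar> = w0" and u: "pure_hopping v0 w0 u" by (auto simp: pure_hopping_simps)
      have "f (tact E u (tstep E a y)) <= f (tstep E a y) + length u * d (tstep E a y)" by (rule Cons.IH[OF u])
      also have "\<dots> <= (f y + d y) + length u * d y" using step[OF a, of y] by simp
      finally show ?case by (simp add: algebra_simps)
    qed simp
  qed
  define C where "C = (1 / w0 + 1) * (f x + d x) + d x"
  show thesis
  proof (rule that[of C])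
    fix u assume u: "pure_hopping v0 w0 u"
    define y where "y = tact E u x"
    have d: "d y = d x" and fy: "f y <= f x + length u * d x" unfolding y_def by (rule tact[OF u])+
    have pos: "0 <= f x" "0 <= d x" using w0 by (auto simp: f_def d_def)
    have "cmod (of_real (snd y)) <= cmod (z * of_real (fst y)) + d y" unfolding d_def by (rule norm_triangle_sub)
    then have "\<bar>snd y\<bar> <= f y + d y" unfolding norm_mult z norm_of_real by (simp add: f_def)
    moreover have "\<bar>fst y\<bar> = f y / w0" using w0 by (simp add: f_def)
    ultimately have "norm y <= (1 / w0 + 1) * f y + d x" using norm_le_abs_add[of y] d by (simp add: distrib_right)
    also have "\<dots> <= (1 / w0 + 1) * ((f x + d x) * (real (length u) + 1)) + d x * (real (length u) + 1)"
    proof (intro add_mono mult_left_mono)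
      show "f y <= (f x + d x) * (real (length u) + 1)"
      proof -
        have "(f x + d x) * (real (length u) + 1) = (f x + length u * d x) + (d x + f x * length u)" by (simp add: algebra_simps)
        moreover have "0 <= d x + f x * length u" using pos by simp
        ultimately show ?thesis using fy by linarith
      qed
      show "d x <= d x * (real (length u) + 1)" using pos by (simp add: mult_le_cancel_left1)
    qed (use w0 in auto)
    also have "\<dots> = C * (real (length u) + 1)" by (simp only: C_def distrib_right mult.assoc)
    finally show "norm (tact E u x) <= C * (real (length u) + 1)" by (simp only: y_def)
  qed
qed

text \<open>The functionals with the real roots \<alpha> and \<beta> are eigenvectors of the dual
  action: in modulus they are multiplied by |\<alpha>|/w0 > 1 and |\<beta>|/w0 <= 1. The signs of w
  drop out in absolute values.\<close>

lemma tact_hyperbolic: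
  assumes w0: "w0 > 0" and t: "2 * w0 < \<bar>v0 - E\<bar>"
  obtains R where "R > 1" "\<And>x. (x = (1, 0) \<or> x = (0, 1)) ==> \<exists>C\<ge>1. \<forall>u. pure_hopping v0 w0 u \<longrightarrow>
     R ^ length u <= C * norm (tact E u x) \<and> norm (tact E u x) <= C * R ^ length u"
proof -
  define t where "t = v0 - E"
  define D where "D = sqrt (t\<^sup>2 - 4 * w0\<^sup>2)"
  have "(2 * w0)\<^sup>2 < t\<^sup>2" using t w0 abs_le_square_iff[of t "2 * w0"] by (simp add: t_def not_le[symmetric])
  then have D: "D > 0" "D\<^sup>2 = t\<^sup>2 - 4 * w0\<^sup>2" by (auto simp: D_def power_mult_distrib)
  \<comment> \<open>The sign of t selects for \<alpha> the root of larger modulus.\<close>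
  define \<alpha> \<beta> where "\<alpha> = (t + sgn t * D) / 2" and "\<beta> = (t - sgn t * D) / 2"
  have t0: "t \<noteq> 0" using t w0 by (auto simp: t_def)
  then have sg: "sgn t * sgn t = 1" by (simp add: sgn_if)
  have sum: "\<alpha> + \<beta> = t" by (simp add: \<alpha>_def \<beta>_def field_simps)
  have "\<alpha> * \<beta> = (t\<^sup>2 - (sgn t * sgn t) * D\<^sup>2) / 4" by (simp add: \<alpha>_def \<beta>_def power2_eq_square field_simps)
  then have prod: "\<alpha> * \<beta> = w0\<^sup>2" using D(2) sg by simp
  have \<alpha>: "\<bar>\<alpha>\<bar> > w0"
  proof (cases "t > 0")
    case True
    then have "\<alpha> = (t + D) / 2" by (simp add: \<alpha>_def)
    then have "w0 < \<alpha>" using True t D(1) by (simp add: t_def[symmetric])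
    then show ?thesis using abs_ge_self[of \<alpha>] by linarith
  next
    case False
    then have "\<alpha> = (t - D) / 2" using t0 by (simp add: \<alpha>_def)
    then have "w0 < - \<alpha>" using False t D(1) by (simp add: t_def[symmetric])
    then show ?thesis using abs_ge_minus_self[of \<alpha>] by linarith
  qed
  have \<beta>: "\<bar>\<beta>\<bar> <= w0"
  proof (rule ccontr)
    assume "\<not> ?thesis"
    then have "w0 * w0 < \<bar>\<alpha>\<bar> * \<bar>\<beta>\<bar>" using \<alpha> w0 by (intro mult_strict_mono) auto
    then show False using prod w0 by (simp add: power2_eq_square flip: abs_mult)
  qed
  have diff: "\<bar>\<alpha> - \<beta>\<bar> = D" using D(1) t0 by (auto simp: \<alpha>_def \<beta>_def sgn_if abs_if field_simps)
  define R where "R = \<bar>\<alpha>\<bar> / w0"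
  have R: "R > 1" using \<alpha> w0 by (simp add: R_def)
  define P Q where "P y = snd y - \<alpha> * fst y" and "Q y = snd y - \<beta> * fst y" for y :: "real \<times> real"
  have step: "\<bar>P (tstep E a y)\<bar> = R * \<bar>P y\<bar>" "\<bar>Q (tstep E a y)\<bar> <= \<bar>Q y\<bar>" if "fst a = v0" "\<bar>snd a\<bar> = w0" for a y
  proof -
    obtain v w where a: "a = (v, w)" by (cases a)
    obtain p q where y: "y = (p, q)" by (cases y)
    have w: "w \<noteq> 0" "\<bar>w\<bar> = w0" "v - E = \<alpha> + \<beta>" using that w0 sum by (auto simp: a t_def)
    have ww: "w * w = \<alpha> * \<beta>" using w(2) prod by (metis abs_mult_self_eq power2_eq_square)
    have ts: "tstep E a y = (((\<alpha> + \<beta>) * p - q) / w, w * p)" using w by (simp add: a y tstep_def)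
    have "w * P (tstep E a y) = (w * w) * p - \<alpha> * ((\<alpha> + \<beta>) * p - q)" using w(1) by (simp add: ts P_def field_simps)
    also have "\<dots> = \<alpha> * P y" unfolding ww by (simp add: P_def y algebra_simps)
    finally have "\<bar>w\<bar> * \<bar>P (tstep E a y)\<bar> = \<bar>\<alpha>\<bar> * \<bar>P y\<bar>" by (simp flip: abs_mult)
    then show "\<bar>P (tstep E a y)\<bar> = R * \<bar>P y\<bar>" using w w0 by (simp add: R_def field_simps)
    have "w * Q (tstep E a y) = (w * w) * p - \<beta> * ((\<alpha> + \<beta>) * p - q)" using w(1) by (simp add: ts Q_def field_simps)
    also have "\<dots> = \<beta> * Q y" unfolding ww by (simp add: Q_def y algebra_simps)
    finally have "\<bar>w\<bar> * \<bar>Q (tstep E a y)\<bar> = \<bar>\<beta>\<bar> * \<bar>Q y\<bar>" by (simp flip: abs_mult)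
    also have "\<dots> <= \<bar>w\<bar> * \<bar>Q y\<bar>" using \<beta> w by (intro mult_right_mono) auto
    finally show "\<bar>Q (tstep E a y)\<bar> <= \<bar>Q y\<bar>" using w w0 by simp
  qed
  have tP: "\<bar>P (tact E u y)\<bar> = R ^ length u * \<bar>P y\<bar>" if "pure_hopping v0 w0 u" for u y
    using that by (induction u arbitrary: y) (auto simp: pure_hopping_simps step(1))
  have tQ: "\<bar>Q (tact E u y)\<bar> <= \<bar>Q y\<bar>" if "pure_hopping v0 w0 u" for u y using that
  proof (induction u arbitrary: y)
    case (Cons a u)
    then have a: "fst a = v0" "\<bar>snd a\<bar> = w0" and u: "pure_hopping v0 w0 u" by (auto simp: pure_hopping_simps)
    have "\<bar>Q (tact E u (tstep E a y))\<bar> <= \<bar>Q (tstep E a y)\<bar>" by (rule Cons.IH[OF u])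
    also have "\<dots> <= \<bar>Q y\<bar>" by (rule step(2)[OF a])
    finally show ?case by simp
  qed simp
  show thesis
  proof (rule that[OF R])
    fix x :: "real \<times> real" assume "x = (1, 0) \<or> x = (0, 1)"
    then have Px: "\<bar>P x\<bar> > 0" using \<alpha> w0 by (auto simp: P_def)
    define C where "C = 1 + (1 + \<bar>\<alpha>\<bar>) / \<bar>P x\<bar> + (2 + \<bar>\<alpha>\<bar> + \<bar>\<beta>\<bar>) / D * (\<bar>P x\<bar> + \<bar>Q x\<bar>)"
    have C1: "0 <= (1 + \<bar>\<alpha>\<bar>) / \<bar>P x\<bar>" "0 <= (2 + \<bar>\<alpha>\<bar> + \<bar>\<beta>\<bar>) / D * (\<bar>P x\<bar> + \<bar>Q x\<bar>)" using D(1) by auto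
    show "\<exists>C\<ge>1. \<forall>u. pure_hopping v0 w0 u \<longrightarrow> R ^ length u <= C * norm (tact E u x) \<and> norm (tact E u x) <= C * R ^ length u"
    proof (intro exI[of _ C] conjI allI impI)
      show "1 <= C" using C1 by (simp add: C_def)
      fix u assume u: "pure_hopping v0 w0 u"
      define y where "y = tact E u x"
      have Rn: "1 <= R ^ length u" using R by (simp add: one_le_power)
      have "\<bar>P y\<bar> <= \<bar>snd y\<bar> + \<bar>\<alpha>\<bar> * \<bar>fst y\<bar>" unfolding P_def abs_mult[symmetric] by linarith
      also have "\<dots> <= 1 * norm y + \<bar>\<alpha>\<bar> * norm y"
        using abs_fst_le[of y] abs_snd_le[of y] by (intro add_mono mult_left_mono) auto
      finally have "R ^ length u * \<bar>P x\<bar> <= (1 + \<bar>\<alpha>\<bar>) * norm y" using tP[OF u, of x] by (simp add: y_def distrib_right)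
      then have "R ^ length u <= (1 + \<bar>\<alpha>\<bar>) / \<bar>P x\<bar> * norm y" using Px by (simp add: field_simps)
      also have "\<dots> <= C * norm y" using C1 by (intro mult_right_mono) (auto simp: C_def)
      finally show "R ^ length u <= C * norm (tact E u x)" by (simp add: y_def)
      have Py: "\<bar>P y\<bar> = R ^ length u * \<bar>P x\<bar>" and Qy: "\<bar>Q y\<bar> <= \<bar>Q x\<bar>" unfolding y_def by (rule tP[OF u], rule tQ[OF u])
      have "\<bar>Q x\<bar> <= R ^ length u * \<bar>Q x\<bar>" using mult_right_mono[OF Rn, of "\<bar>Q x\<bar>"] by simp
      with Py Qy have PQ: "\<bar>P y\<bar> + \<bar>Q y\<bar> <= R ^ length u * (\<bar>P x\<bar> + \<bar>Q x\<bar>)" by (simp add: distrib_left)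
      have fy: "(\<alpha> - \<beta>) * fst y = Q y - P y" and sy: "(\<alpha> - \<beta>) * snd y = \<alpha> * Q y - \<beta> * P y"
        by (simp_all add: P_def Q_def algebra_simps)
      have "D * norm y <= D * (\<bar>fst y\<bar> + \<bar>snd y\<bar>)" using D(1) norm_le_abs_add[of y] by simp
      also have "\<dots> = \<bar>Q y - P y\<bar> + \<bar>\<alpha> * Q y - \<beta> * P y\<bar>" unfolding distrib_left fy[symmetric] sy[symmetric] abs_mult diff ..
      also have "\<dots> <= (\<bar>Q y\<bar> + \<bar>P y\<bar>) + (\<bar>\<alpha>\<bar> * \<bar>Q y\<bar> + \<bar>\<beta>\<bar> * \<bar>P y\<bar>)"
        unfolding abs_mult[symmetric] by (intro add_mono abs_triangle_ineq4)
      also have "\<dots> <= (2 + \<bar>\<alpha>\<bar> + \<bar>\<beta>\<bar>) * (\<bar>P y\<bar> + \<bar>Q y\<bar>)"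
      proof -
        have "0 <= \<bar>\<alpha>\<bar> * \<bar>P y\<bar>" "0 <= \<bar>\<beta>\<bar> * \<bar>Q y\<bar>" "0 <= \<bar>P y\<bar>" "0 <= \<bar>Q y\<bar>" by auto
        then show ?thesis by (simp only: distrib_left distrib_right)
      qed
      also have "\<dots> <= (2 + \<bar>\<alpha>\<bar> + \<bar>\<beta>\<bar>) * (R ^ length u * (\<bar>P x\<bar> + \<bar>Q x\<bar>))" using PQ by (intro mult_left_mono) auto
      finally have "norm y <= (2 + \<bar>\<alpha>\<bar> + \<bar>\<beta>\<bar>) / D * (\<bar>P x\<bar> + \<bar>Q x\<bar>) * R ^ length u" using D(1) by (simp add: field_simps)
      also have "\<dots> <= C * R ^ length u" using C1 Rn by (intro mult_right_mono) (auto simp: C_def)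
      finally show "norm (tact E u x) <= C * R ^ length u" by (simp add: y_def)
    qed
  qed
qed

context random_letters
begin

abbreviation localized_near :: "real => bool" where
  "localized_near E0 \<equiv> \<exists>c d. c < E0 \<and> E0 < d \<and> (\<forall>E\<in>{c<..<d}. lyapunov_exp M v w E > 0) \<and>
    weak_hoelder_on (ids M v w) {c<..<d} \<and> dynamical_localization M v w {c<..<d}"

text \<open>The means of the alternating sums stay bounded and a single letter has bounded
  influence, so the sums are almost surely o(n); both basis vectors then have growth rate 0.\<close>

lemma lyapunov_exp_centre:
  assumes Sv: "\<And>a. a \<in> Sv ==> a = E"
  shows "lyapunov_exp M v w E = 0"
proof -
  define B where "B = 1 + (\<Sum>b\<in>Sw. \<bar>ln \<bar>b\<bar>\<bar>)"
  have Bb: "\<bar>ln \<bar>b\<bar>\<bar> <= B" if "b \<in> Sw" for b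
    using member_le_sum[OF that, of "\<lambda>b. \<bar>ln \<bar>b\<bar>\<bar>"] fin_Sw by (simp add: B_def)
  have B: "B > 0" by (simp add: B_def sum_nonneg add_pos_nonneg)
  have words: "\<forall>a\<in>set u. fst a = E \<and> snd a \<noteq> 0" if "u \<in> A.words n" for u n
    using that zero_notin by (auto simp: A.words_def dest!: subsetD intro: Sv)
  define m0 where "m0 = A.mean 1 alternating_log"
  have "A.mean n alternating_log = (if even n then 0 else m0)" for n
  proof (induction n)
    case (Suc n)
    have "A.mean (Suc n) alternating_log = A.mean (1 + n) alternating_log" by (simp only: plus_1_eq_Suc)
    also have "\<dots> = A.mean 1 (\<lambda>u. A.mean n (\<lambda>x. alternating_log u - alternating_log x))"
      unfolding A.mean_append by (intro A.mean_cong) (auto simp: A.words_def length_Suc_conv)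
    also have "\<dots> = m0 - A.mean n alternating_log" by (simp only: A.mean_diff A.mean_const m0_def)
    finally show ?case using Suc by simp
  qed simp
  then have mean: "\<bar>A.mean n alternating_log\<bar> <= \<bar>m0\<bar>" for n by simp
  have mean0: "(\<lambda>n. A.mean n alternating_log / n) \<longlonglongrightarrow> 0"
  proof (rule Lim_null_comparison[OF always_eventually])
    show "\<forall>n. norm (A.mean n alternating_log / real n) <= \<bar>m0\<bar> / n"
      using mean by (auto simp: abs_divide intro: divide_right_mono)
  qed (rule lim_const_over_n)
  have "AE \<omega> in M. (\<lambda>n. (alternating_log (word (path_ix n) \<omega>) - A.mean n alternating_log) / n) \<longlonglongrightarrow> 0"
  proof (rule law_of_large_numbers[where C = "2 * B" and f = "\<lambda>_. alternating_log"])
    fix n and u :: "(real \<times> real) list" and a b assume ab: "a \<in> Sv \<times> Sw" "b \<in> Sv \<times> Sw"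
    define k where "k = n - Suc (length u)"
    have "\<bar>A.mean k (\<lambda>x. alternating_log (u @ a # x)) - A.mean k (\<lambda>x. alternating_log (u @ b # x))\<bar>
        <= A.mean k (\<lambda>x. \<bar>alternating_log (u @ a # x) - alternating_log (u @ b # x)\<bar>)"
      unfolding A.mean_diff[symmetric] by (rule A.abs_mean_le)
    also have "\<dots> <= 2 * B"
    proof (rule A.mean_le_const)
      have "\<bar>ln \<bar>snd a\<bar>\<bar> <= B" "\<bar>ln \<bar>snd b\<bar>\<bar> <= B" using ab by (auto intro!: Bb)
      then show "\<bar>alternating_log (u @ a # x) - alternating_log (u @ b # x)\<bar> <= 2 * B" for x
        unfolding alternating_log_change by linarith
    qed
    finally show "\<bar>A.mean (n - Suc (length u)) (\<lambda>x. alternating_log (u @ a # x)) - A.mean (n - Suc (length u)) (\<lambda>x. alternating_log (u @ b # x))\<bar> <= 2 * B"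
      by (simp add: k_def)
  qed (use B in simp)
  then have lim: "AE \<omega> in M. (\<lambda>n. alternating_log (word (path_ix n) \<omega>) / n) \<longlonglongrightarrow> 0"
  proof eventually_elim
    case (elim \<omega>)
    show ?case using tendsto_add[OF elim mean0] by (simp flip: add_divide_distrib)
  qed
  have norms: "norm (tact E (word (path_ix n) \<omega>) (1, 0)) = exp (alternating_log (word (path_ix n) \<omega>))"
    "norm (tact E (word (path_ix n) \<omega>) (0, 1)) = exp (- alternating_log (word (path_ix n) \<omega>))" if "regular \<omega>" for n \<omega>
    using tact_centre_energy[OF words[OF word_in_words[OF that]]] by simp_all
  show ?thesis
  proof (rule lyapunov_exp_eqI)
    show "AE \<omega> in M. (\<lambda>n. ln (norm (tact E (word (path_ix n) \<omega>) (1, 0))) / real n) \<longlonglongrightarrow> 0" using lim AE_regular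
    proof eventually_elim
      case (elim \<omega>)
      then show ?case by (simp add: norms)
    qed
    show "AE \<omega> in M. (\<lambda>n. ln (norm (tact E (word (path_ix n) \<omega>) (0, 1))) / real n) \<longlonglongrightarrow> 0" using lim AE_regular
    proof eventually_elim
      case (elim \<omega>)
      then show ?case using tendsto_minus[OF elim(1)] by (simp add: norms)
    qed
  qed
qed

lemma pure_hopping_word:
  assumes "\<And>a. a \<in> Sv ==> a = v0" "\<And>b. b \<in> Sw ==> \<bar>b\<bar> = w0" "regular \<omega>"
  shows "pure_hopping v0 w0 (word ix \<omega>)" using assms by (auto simp: pure_hopping_def word_def regular_def)

text \<open>Norms grow at most linearly, and conservation of area turns the upper bound for one
  basis vector into a lower bound for the other.\<close>

lemma lyapunov_exp_elliptic:
  assumes Sv: "\<And>a. a \<in> Sv ==> a = v0" and Sw: "\<And>b. b \<in> Sw ==> \<bar>b\<bar> = w0" and w0: "w0 > 0" and t: "\<bar>v0 - E\<bar> <= 2 * w0"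
  shows "lyapunov_exp M v w E = 0"
proof -
  obtain C1 where C1: "\<And>u. pure_hopping v0 w0 u ==> norm (tact E u (1, 0)) <= C1 * (real (length u) + 1)"
    by (rule tact_elliptic_le[OF w0 t, of "(1, 0)"]) blast
  obtain C2 where C2: "\<And>u. pure_hopping v0 w0 u ==> norm (tact E u (0, 1)) <= C2 * (real (length u) + 1)"
    by (rule tact_elliptic_le[OF w0 t, of "(0, 1)"]) blast
  define C where "C = max 1 (max C1 C2)"
  have C: "C >= 1" "C1 <= C" "C2 <= C" by (auto simp: C_def)
  have main: "(\<lambda>n. ln (norm (tact E (word (path_ix n) \<omega>) x)) / real n) \<longlonglongrightarrow> ln 1"
    if reg: "regular \<omega>" and x: "x = (1, 0) \<and> x' = (0, 1) \<or> x = (0, 1) \<and> x' = (1, 0)" for \<omega> and x x' :: "real \<times> real"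
  proof (rule ln_growth_rate[OF C(1)])
    fix n
    define u where "u = word (path_ix n) \<omega>"
    have u: "pure_hopping v0 w0 u" unfolding u_def by (rule pure_hopping_word[OF Sv Sw reg])
    have len: "length u = n" by (simp add: u_def length_word length_path_ix)
    have le: "norm (tact E u y) <= C * (real n + 1)" if "y = (1, 0) \<or> y = (0, 1)" for y
    proof -
      have "C1 * (real n + 1) <= C * (real n + 1)" "C2 * (real n + 1) <= C * (real n + 1)"
        using C by (auto intro!: mult_right_mono)
      then have "norm (tact E u (1, 0)) <= C * (real n + 1)" "norm (tact E u (0, 1)) <= C * (real n + 1)"
        using order_trans C1[OF u, unfolded len] C2[OF u, unfolded len] by blast+
      then show ?thesis using that by blast
    qed
    then show "norm (tact E (word (path_ix n) \<omega>) x) <= C * (real n + 1) * 1 ^ n" using x by (auto simp: u_def)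
    have "\<forall>a\<in>set u. snd a \<noteq> 0" using u w0 by (auto simp: pure_hopping_def)
    then have "\<bar>wedge (tact E u x) (tact E u x')\<bar> = \<bar>wedge x x'\<bar>" by (simp add: wedge_tact)
    also have "\<dots> = 1" using x by (auto simp: wedge_def)
    finally have "1 <= norm (tact E u x) * norm (tact E u x')" using abs_wedge_le[of "tact E u x" "tact E u x'"] by simp
    also have "\<dots> <= norm (tact E u x) * (C * (real n + 1))" using x by (intro mult_left_mono le) auto
    finally show "1 ^ n / (C * (real n + 1)) <= norm (tact E (word (path_ix n) \<omega>) x)"
      using C(1) by (simp add: u_def[symmetric] divide_le_eq)
  qed simp
  have "lyapunov_exp M v w E = ln 1" by (rule lyapunov_exp_eqI; rule AE_mp[OF AE_regular])
       (use main[of _ "(1, 0)" "(0, 1)"] main[of _ "(0, 1)" "(1, 0)"] in \<open>auto intro!: AE_I2\<close>)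
  then show ?thesis by simp
qed

lemma lyapunov_exp_hyperbolic:
  assumes Sv: "\<And>a. a \<in> Sv ==> a = v0" and Sw: "\<And>b. b \<in> Sw ==> \<bar>b\<bar> = w0" and w0: "w0 > 0" and t: "2 * w0 < \<bar>v0 - E\<bar>"
  shows "lyapunov_exp M v w E > 0"
proof (rule tact_hyperbolic[OF w0 t])
  fix R :: real assume R: "R > 1" and RC: "\<And>x. (x = (1, 0) \<or> x = (0, 1)) ==> \<exists>C\<ge>1. \<forall>u. pure_hopping v0 w0 u \<longrightarrow>
     R ^ length u <= C * norm (tact E u x) \<and> norm (tact E u x) <= C * R ^ length u"
  have lim: "(\<lambda>n. ln (norm (tact E (word (path_ix n) \<omega>) x)) / real n) \<longlonglongrightarrow> ln R"
    if reg: "regular \<omega>" and x: "x = (1, 0) \<or> x = (0, 1)" for \<omega> x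
  proof -
    obtain C where C: "C >= 1" "\<And>u. pure_hopping v0 w0 u ==> R ^ length u <= C * norm (tact E u x) \<and> norm (tact E u x) <= C * R ^ length u"
      using RC[OF x] by blast
    show ?thesis
    proof (rule ln_growth_rate[OF C(1)])
      show "R > 0" using R by simp
      fix n
      define y where "y = norm (tact E (word (path_ix n) \<omega>) x)"
      have len: "length (word (path_ix n) \<omega>) = n" by (simp add: length_word length_path_ix)
      have y: "R ^ n <= C * y" "y <= C * R ^ n"
        using C(2)[OF pure_hopping_word[OF Sv Sw reg], of "path_ix n"] by (simp_all add: len y_def)
      have "C * y <= (C * y) * (real n + 1)" using mult_left_mono[of 1 "real n + 1" "C * y"] C(1) by (simp add: y_def)
      then have "R ^ n <= y * (C * (real n + 1))" using y(1) by (simp add: mult_ac)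
      then show "R ^ n / (C * (real n + 1)) <= norm (tact E (word (path_ix n) \<omega>) x)"
        using C(1) by (simp add: y_def[symmetric] divide_le_eq)
      have "C * R ^ n <= (C * R ^ n) * (real n + 1)" using mult_left_mono[of 1 "real n + 1" "C * R ^ n"] C(1) R by simp
      then show "norm (tact E (word (path_ix n) \<omega>) x) <= C * (real n + 1) * R ^ n"
        using y(2) by (simp add: y_def[symmetric] mult_ac)
    qed
  qed
  have "lyapunov_exp M v w E = ln R"
    by (rule lyapunov_exp_eqI; rule AE_mp[OF AE_regular]) (use lim in \<open>auto intro!: AE_I2\<close>)
  then show ?thesis using R by simp
qed

lemma box_eigs_hopping:
  assumes Sv: "\<And>a. a \<in> Sv ==> a = v0" and Sw: "\<And>b. b \<in> Sw ==> \<bar>b\<bar> = w0" and reg: "regular \<omega>" and e: "e \<in> box_eigs \<omega> b n"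
  shows "\<bar>v0 - e\<bar> <= 2 * w0"
proof (rule box_vec_maximum[OF reg e])
  fix i assume i: "b <= i" "i < b + int n" "box_vec \<omega> b n e i \<noteq> 0" and le: "\<And>k. \<bar>box_vec \<omega> b n e k\<bar> <= \<bar>box_vec \<omega> b n e i\<bar>"
  define y where "y = box_vec \<omega> b n e"
  have w: "\<bar>w k \<omega>\<bar> = w0" "v k \<omega> = v0" for k using reg Sv Sw by (auto simp: regular_def)
  then have w0: "w0 >= 0" using abs_ge_zero by metis
  have b: "\<bar>w (i + 1) \<omega> * y (i + 1)\<bar> <= w0 * \<bar>y i\<bar>" "\<bar>w i \<omega> * y (i - 1)\<bar> <= w0 * \<bar>y i\<bar>"
    unfolding abs_mult w using le w0 by (auto intro!: mult_left_mono simp: y_def)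
  have "(v0 - e) * y i = w (i + 1) \<omega> * y (i + 1) + w i \<omega> * y (i - 1)"
    using box_vec_rec[OF reg e i(1,2)] by (simp add: y_def w algebra_simps)
  then have "\<bar>(v0 - e) * y i\<bar> <= 2 * w0 * \<bar>y i\<bar>" using b by linarith
  then have "\<bar>v0 - e\<bar> * \<bar>y i\<bar> <= 2 * w0 * \<bar>y i\<bar>" by (simp add: abs_mult)
  then show ?thesis using i(3) by (simp add: y_def)
qed

text \<open>All box eigenvalues lie in the band |v0 - e| <= 2 w0, which E0 avoids. Near E0 the
  counting functions are therefore constant in the energy, and the sums over box eigenvalues that
  dominate the evolution are empty.\<close>

lemma localization_hopping:
  assumes Sv: "\<And>a. a \<in> Sv ==> a = v0" and Sw: "\<And>b. b \<in> Sw ==> \<bar>b\<bar> = w0" and w0: "w0 > 0" and t: "2 * w0 < \<bar>v0 - E0\<bar>"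
  shows "localized_near E0"
proof -
  \<comment> \<open>Half the distance to the band, so that the interval of radius \<delta> enlarged
    by another \<delta> still avoids it.\<close>
  define \<delta> where "\<delta> = (\<bar>v0 - E0\<bar> - 2 * w0) / 2"
  have \<delta>: "\<delta> > 0" using t by (simp add: \<delta>_def)
  define c d where "c = E0 - \<delta>" and "d = E0 + \<delta>"
  have gap: "2 * w0 < \<bar>v0 - E\<bar>" if "E \<in> {c - \<delta><..<d + \<delta>}" for E
    using that unfolding c_def d_def \<delta>_def by (auto simp: abs_if split: if_splits)
  have no_eigs: "box_eigs \<omega> b n \<inter> {c - \<delta><..<d + \<delta>} = {}" if "regular \<omega>" for \<omega> b n
    using box_eigs_hopping[OF Sv Sw that] gap by force
  have ids: "ids M v w x = ids M v w y" if "x \<in> {c<..<d}" "y \<in> {c<..<d}" for x y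
  proof -
    have "({..x} \<inter> restr_spectrum v w \<omega> n) = ({..y} \<inter> restr_spectrum v w \<omega> n)" if reg: "regular \<omega>" for \<omega> n
    proof -
      have "restr_spectrum v w \<omega> n = box_eigs \<omega> 0 n" by (simp add: restr_spectrum_eq[OF reg] box_eigs_def)
      moreover have "e <= x \<longleftrightarrow> e <= y" if "e \<in> box_eigs \<omega> 0 n" for e
      proof -
        have "e \<notin> {c - \<delta><..<d + \<delta>}" using no_eigs[OF reg] that by blast
        then show ?thesis using \<open>x \<in> {c<..<d}\<close> \<open>y \<in> {c<..<d}\<close> \<delta> by auto
      qed
      ultimately show ?thesis by auto
    qed
    then have "(AE \<omega> in M. (\<lambda>n. real (card ({..x} \<inter> restr_spectrum v w \<omega> n)) / real n) \<longlonglongrightarrow> l)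
      = (AE \<omega> in M. (\<lambda>n. real (card ({..y} \<inter> restr_spectrum v w \<omega> n)) / real n) \<longlonglongrightarrow> l)" for l
      by (intro eventually_subst eventually_mono[OF AE_regular]) simp
    then show ?thesis unfolding ids_def by simp
  qed
  have "weak_hoelder_on (ids M v w) {c<..<d}" unfolding weak_hoelder_on_def
  proof (intro exI[of _ 1] conjI ballI impI)
    fix x y assume "x \<in> {c<..<d}" "y \<in> {c<..<d}"
    then have "ids M v w x = ids M v w y" by (rule ids)
    then show "\<bar>ids M v w x - ids M v w y\<bar> <= 1 * exp (- 1 * ln (1 / \<bar>x - y\<bar>) powr 1)" by simp
  qed simp_all
  moreover have "dynamical_localization M v w {c<..<d}" unfolding dynamical_localization_def
  proof (intro allI impI, intro exI[of _ 1] conjI allI)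
    fix a b :: real and j k assume ab: "a <= b" "{a..b} \<subseteq> {c<..<d}"
    then have abm: "a \<in> {c<..<d}" "b \<in> {c<..<d}" by auto
    have zero: "cmod (evol_proj_elem (jacobi_op v w \<omega>) {a..b} t j k) <= 0" if reg: "regular \<omega>" for \<omega> t
    proof (rule evol_proj_elem_le[OF reg \<delta>])
      fix N
      have "cbox_eigs \<omega> N \<inter> {a - \<delta><..<b + \<delta>} = {}"
        using no_eigs[OF reg, of "- int N" "2 * N + 1"] abm unfolding cbox_eigs_def by fastforce
      then show "(\<Sum>e\<in>cbox_eigs \<omega> N \<inter> {a - \<delta><..<b + \<delta>}. \<bar>cbox_vec \<omega> N e j * cbox_vec \<omega> N e k\<bar>) <= 0" by simp
    qed
    have "transport a b j k <= (\<integral>\<^sup>+ \<omega>. 0 \<partial>M)"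
    proof (rule nn_integral_mono_AE)
      show "AE \<omega> in M. ennreal (SUP t. cmod (evol_proj_elem (jacobi_op v w \<omega>) {a..b} t j k)) <= 0"
        using AE_regular
      proof eventually_elim
        case (elim \<omega>)
        have "(SUP t. cmod (evol_proj_elem (jacobi_op v w \<omega>) {a..b} t j k)) <= 0"
          by (intro cSUP_least zero[OF elim]) simp
        then show ?case by (simp add: ennreal_neg)
      qed
    qed
    then show "transport a b j k
        <= ennreal (1 * exp (- 1 * real_of_int \<bar>j - k\<bar> powr 1))" by simp
  qed simp_all
  moreover have "\<forall>E\<in>{c<..<d}. lyapunov_exp M v w E > 0"
    using \<delta> by (intro ballI lyapunov_exp_hyperbolic[OF Sv Sw w0] gap) auto
  moreover have "c < E0" "E0 < d" using \<delta> by (simp_all add: c_def d_def)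
  ultimately show ?thesis by blast
qed

lemma localization_of_frames:
  assumes "shifted_frames (Sv \<times> Sw) (\<lambda>a. pv (fst a) * pw (snd a)) E0 a a' \<sigma> Dom c r q N"
  shows "localized_near E0"
proof -
  interpret F: shifted_frames "Sv \<times> Sw" "\<lambda>a. pv (fst a) * pw (snd a)" E0 a a' \<sigma> Dom c r q N by fact
  obtain \<epsilon> K s C \<kappa> where \<epsilon>: "\<epsilon> > 0" and ex: "expanding (Sv \<times> Sw) (\<lambda>a. pv (fst a) * pw (snd a)) (E0 - \<epsilon>) (E0 + \<epsilon>) K s C \<kappa>"
    by (rule F.expanding_nearby) blast
  interpret R: random_expanding M v w Sv Sw pv pw "E0 - \<epsilon>" "E0 + \<epsilon>" K s C \<kappa>
    by (intro random_expanding.intro random_letters_axioms ex)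
  \<comment> \<open>Strictly inside the expanding interval, leaving room for the energy margins of
    localization, and of total length at most 1, as the logarithm in the Hoelder bound
    demands.\<close>
  define \<delta> where "\<delta> = min \<epsilon> 1 / 2"
  have \<delta>: "0 < \<delta>" "\<delta> < \<epsilon>" "2 * \<delta> <= 1" using \<epsilon> by (auto simp: \<delta>_def)
  show ?thesis
  proof (rule exI[of _ "E0 - \<delta>"], rule exI[of _ "E0 + \<delta>"], intro conjI ballI)
    fix E assume "E \<in> {E0 - \<delta><..<E0 + \<delta>}"
    then show "lyapunov_exp M v w E > 0" using \<delta> by (intro R.lyapunov_exp_pos) auto
  next
    show "weak_hoelder_on (ids M v w) {E0 - \<delta><..<E0 + \<delta>}" using \<delta> by (intro R.ids_weak_hoelder) auto
    show "dynamical_localization M v w {E0 - \<delta><..<E0 + \<delta>}" using \<delta> by (intro R.dynamical_localization_inside) auto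
  qed (use \<delta> in auto)
qed

text \<open>Positivity rules out the explicit cases of vanishing exponent: v constantly E0, and |w|
  constant with E0 in the closed band. Excluding the first also provides v0 \<noteq> E0, which the
  logarithmic frames require.\<close>

lemma localization_near:
  assumes pos: "lyapunov_exp M v w E0 > 0"
  shows "localized_near E0"
proof -
  obtain b where b: "b \<in> Sw" using sum_pw by fastforce
  obtain v0 where v0: "v0 \<in> Sv" using sum_pv by fastforce
  show ?thesis
  proof (cases "\<exists>a\<in>Sv. \<exists>a'\<in>Sv. a' < a")
    case True
    then obtain a a' where "(a, b) \<in> Sv \<times> Sw" "(a', b) \<in> Sv \<times> Sw" "a' < a" using b by auto
    then obtain \<sigma> Dom c r N where "shifted_frames (Sv \<times> Sw) (\<lambda>a. pv (fst a) * pw (snd a)) E0 (a, b) (a', b) \<sigma> Dom c r 2 N"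
      by (rule A.frames_of_diagonal_disorder) blast
    then show ?thesis by (rule localization_of_frames)
  next
    case False
    then have Sv: "a = v0" if "a \<in> Sv" for a using that v0 by (meson linorder_neqE)
    have ne: "v0 \<noteq> E0"
    proof
      assume "v0 = E0"
      then have "lyapunov_exp M v w E0 = 0" using Sv by (intro lyapunov_exp_centre) simp
      with pos show False by simp
    qed
    show ?thesis
    proof (cases "\<exists>b\<in>Sw. \<exists>b'\<in>Sw. \<bar>b\<bar> < \<bar>b'\<bar>")
      case True
      then obtain b1 b2 where "(v0, b1) \<in> Sv \<times> Sw" "(v0, b2) \<in> Sv \<times> Sw" "\<bar>b1\<bar> < \<bar>b2\<bar>" using v0 by auto
      then obtain \<sigma> Dom c r N where "shifted_frames (Sv \<times> Sw) (\<lambda>a. pv (fst a) * pw (snd a)) E0 (v0, b1) (v0, b2) \<sigma> Dom c r 3 N"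
        by (rule A.frames_of_offdiagonal_disorder[OF _ _ _ ne]) blast
      then show ?thesis by (rule localization_of_frames)
    next
      case False
      then have Sw: "\<bar>b'\<bar> = \<bar>b\<bar>" if "b' \<in> Sw" for b' using that b by (meson linorder_neqE)
      have w0: "\<bar>b\<bar> > 0" using b zero_notin by auto
      show ?thesis
      proof (cases "2 * \<bar>b\<bar> < \<bar>v0 - E0\<bar>")
        case True
        show ?thesis by (rule localization_hopping[OF Sv Sw w0 True])
      next
        case False
        then have "lyapunov_exp M v w E0 = 0" by (intro lyapunov_exp_elliptic[OF Sv Sw w0]) auto
        with pos show ?thesis by simp
      qed
    qed
  qed
qed

end

text \<open>The alphabet consists of the atoms of positive mass rather than of the given set S, so
  that every letter has positive weight.\<close>

lemma (in prob_space) finite_support_masses: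
  assumes [measurable]: "X \<in> borel_measurable M" and S: "finite (S :: real set)" "AE \<omega> in M. X \<omega> \<in> S"
  defines "p a \<equiv> measure M {\<omega>\<in>space M. X \<omega> = a}"
  shows "finite {a. p a > 0}" "sum p {a. p a > 0} = 1"
proof -
  have out: "p a = 0" if "a \<notin> S" for a
    unfolding p_def using that S(2) by (intro prob_eq_0[THEN iffD2]) (auto elim!: eventually_mono)
  then have sub: "{a. p a > 0} \<subseteq> S" by force
  then show "finite {a. p a > 0}" using S(1) finite_subset by blast
  have "sum p {a. p a > 0} = sum p S"
  proof (rule sum.mono_neutral_left[OF S(1) sub])
    have "p a >= 0" for a by (simp add: p_def)
    then show "\<forall>i\<in>S - {a. 0 < p a}. p i = 0" by (auto simp: not_less intro: antisym)
  qed
  also have "\<dots> = measure M (\<Union>a\<in>S. {\<omega>\<in>space M. X \<omega> = a})"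
    unfolding p_def using S(1) by (intro finite_measure_finite_Union[symmetric]) (auto simp: disjoint_family_on_def)
  also have "\<dots> = 1" using S by (intro prob_eq_1[THEN iffD2]) (auto elim!: eventually_mono)
  finally show "sum p {a. p a > 0} = 1" .
qed

theorem theorem1p9:
  fixes M :: "'a measure" and v w :: "int \<Rightarrow> 'a \<Rightarrow> real" and E\<^sub>0 :: real
  assumes "prob_space M"
    and "\<And>n. v n \<in> borel_measurable M" and "\<And>n. w n \<in> borel_measurable M"
    and "prob_space.indep_vars M (\<lambda>_. borel) (\<lambda>i. case i of Inl n \<Rightarrow> v n | Inr n \<Rightarrow> w n) UNIV"
    and "\<And>n. distr M borel (v n) = distr M borel (v 0)"
    and "\<And>n. distr M borel (w n) = distr M borel (w 0)"
    and "\<exists>S. finite S \<and> (\<forall>n. AE \<omega> in M. v n \<omega> \<in> S)"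
    and "\<exists>S. finite S \<and> (\<forall>n. AE \<omega> in M. w n \<omega> \<in> S)"
    and "AE \<omega> in M. w 1 \<omega> \<noteq> 0"
    and "(\<integral>\<^sup>+ \<omega>. ennreal (max 0 (- ln \<bar>w 1 \<omega>\<bar>)) \<partial>M) < \<infinity>"
    and "lyapunov_exp M v w E\<^sub>0 > 0"
  shows "\<exists>c d. c < E\<^sub>0 \<and> E\<^sub>0 < d \<and>
           (\<forall>E\<in>{c<..<d}. lyapunov_exp M v w E > 0) \<and>
           weak_hoelder_on (ids M v w) {c<..<d} \<and>
           ({c<..<d} \<inter> as_spectrum M v w \<noteq> {} \<longrightarrow> dynamical_localization M v w {c<..<d})"
proof -
  interpret prob_space M by fact
  note [measurable] = assms(2,3)
  define pv pw where "pv a = measure M {\<omega>\<in>space M. v 0 \<omega> = a}" and "pw b = measure M {\<omega>\<in>space M. w 0 \<omega> = b}" for a b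
  have mass: "measure M {\<omega>\<in>space M. X \<omega> = a} = measure (distr M borel X) {a}" if "X \<in> borel_measurable M" for X :: "'a \<Rightarrow> real" and a
    using that by (subst measure_distr) (auto simp: vimage_def Int_def conj_commute intro!: arg_cong[where f = "measure M"])
  have pvn: "measure M {\<omega>\<in>space M. v n \<omega> = a} = pv a" for n a
    unfolding pv_def mass[OF assms(2)] assms(5)[of n] ..
  have pwn: "measure M {\<omega>\<in>space M. w n \<omega> = b} = pw b" for n b
    unfolding pw_def mass[OF assms(3)] assms(6)[of n] ..
  have fv: "finite {a. pv a > 0}" "sum pv {a. pv a > 0} = 1"
    using assms(7) finite_support_masses[OF assms(2)[of 0]] unfolding pv_def by blast+
  have fw: "finite {a. pw a > 0}" "sum pw {a. pw a > 0} = 1"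
    using assms(8) finite_support_masses[OF assms(3)[of 0]] unfolding pw_def by blast+
  \<comment> \<open>Equality of distributions transfers the nonvanishing of \<open>w 1\<close> to
    every hopping term, so 0 is not among the off-diagonal letters.\<close>
  have "pw 0 = 0"
    unfolding pwn[of 1, symmetric] using assms(9) by (intro prob_eq_0[THEN iffD2]) (auto elim!: eventually_mono)
  then interpret R: random_letters M v w "{a. pv a > 0}" "{b. pw b > 0}" pv pw
    by unfold_locales (use assms(2-4) fv fw pvn pwn in auto)
  show ?thesis using R.localization_near[OF assms(11)] by blast
qed

end
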